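(* Let $\mathbf{k}$ be an algebraically closed field, and fix integers $r,d>0$ and $n\geq 0$. Then there is an identity $$[\mathrm{ncQuot}^n_{r,d}] = \frac{\mathbb{L}^{dn^2}}{[\mathrm{GL}_n]}\left(\mathbb{L}^{rn} - \sum_{k=0}^{n-1}\, [\mathrm{ncQuot}^k_{r,d}]\,[\mathrm{GL}_k]\,[G(k,n)]\,\mathbb{L}^{-dnk} \right)$$ in $K_0(\mathrm{St}_{\mathbf{k}})$, where $\mathbb{L} = [\mathbb{A}^1_{\mathbf{k}}]$ is the Lefschetz motive. Moreover, if $\mathbf{k}=\mathbb{C}$, the generating functions $$\mathsf{Z}_{r,d}(t) = \sum_{n=0}^\infty\, \mathbb{L}^{-N_{n,r,d}/2}\, [\mathrm{ncQuot}^{n}_{r,d}]\, (\mathbb{L}^{(r-1)/2}t)^n \in K_0(\mathrm{St}_{\mathbb{C}})[\mathbb{L}^{1/2}] [[ t ]], \qquad N_{n,r,d} = (d-1)n^2+rn,$$ satisfy the functional equations $$\mathsf{Z}_{1,d}(t) = 1+\mathbb{L}^{d/2}\,t \prod_{i=0}^{d-1}\mathsf{Z}_{1,d}(\mathbb{L}^i t),$$ $$\mathsf{Z}_{r,d}(t) = \prod_{i=0}^{r-1} \mathsf{Z}_{1,d}(\mathbb{L}^{i}t).$$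
   Context: Noncommutative Quot scheme. Let $V_n$ be an $n$-dimensional $\mathbf{k}$-vector space and let $\mathbb{A}=\mathrm{End}_{\mathbf{k}}(V_n)^d \times V_n^r$, an affine space of dimension $dn^2+rn$. The group $\mathrm{GL}_n$ acts on $\mathbb{A}$ by $$g\cdot(T_1,\ldots,T_d,v_1,\ldots,v_r) = (gT_1g^{-1},\ldots,gT_dg^{-1},gv_1,\ldots,gv_r).$$ Let $U^n_{r,d}\subset\mathbb{A}$ be the open subscheme of tuples $(T_1,\ldots,T_d,v_1,\ldots,v_r)$ such that the $\mathbf{k}$-linear span of all (noncommutative) monomials in $T_1,\ldots,T_d$ (including the empty monomial $\mathrm{id}$) applied to $v_1,\ldots,v_r$ is the whole of $V_n$. The group $\mathrm{GL}_n$ acts freely on $U^n_{r,d}$, and the noncommutative Quot scheme is the geometric quotient $\mathrm{ncQuot}^n_{r,d} = U^n_{r,d}/\mathrm{GL}_n$; it is a smooth quasiprojective $\mathbf{k}$-variety of dimension $N_{n,r,d}=(d-1)n^2+rn$. For $n=0$ it is $\mathrm{Spec}\,\mathbf{k}$, with class $1$. Grothendieck rings. $K_0(\mathrm{Var}_{\mathbf{k}})$ is the free abelian group on isomorphism classes $[Y]$ of $\mathbf{k}$-varieties modulo the relations $[Y]=[Y\setminus Z]+[Z]$ for all closed subvarieties $Z\hookrightarrow Y$, with product determined by $[Y]\cdot[Y']=[Y\times_{\mathbf{k}}Y']$. The Grothendieck ring of stacks $K_0(\mathrm{St}_{\mathbf{k}})$ is taken to be the localisation of $K_0(\mathrm{Var}_{\mathbf{k}})$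 at the multiplicative system generated by $\mathbb{L}$ and $\mathbb{L}^m-1$ for all $m>0$ (equivalently, at the classes $[\mathrm{GL}_m]$ for all $m>0$). Classes of varieties are viewed in $K_0(\mathrm{St}_{\mathbf{k}})$ through the natural map $K_0(\mathrm{Var}_{\mathbf{k}})\to K_0(\mathrm{St}_{\mathbf{k}})$. $K_0(\mathrm{St}_{\mathbb{C}})[\mathbb{L}^{1/2}]$ denotes the ring obtained by formally adjoining a square root of $\mathbb{L}$, i.e. $K_0(\mathrm{St}_{\mathbb{C}})[x]/(x^2-\mathbb{L})$ with $\mathbb{L}^{1/2}$ the class of $x$ (which is invertible). $G(k,n)$ is the Grassmannian of $k$-dimensional linear subspaces of $\mathbf{k}^n$. With $[n]_x=\prod_{1\leq i\leq n}(x^i-1)$, one has $[\mathrm{GL}_n]=\prod_{i=0}^{n-1}(\mathbb{L}^n-\mathbb{L}^i)=\mathbb{L}^{\binom{n}{2}}[n]_{\mathbb{L}}$ and $[G(k,n)]=\dfrac{[n]_{\mathbb{L}}}{[k]_{\mathbb{L}}[n-k]_{\mathbb{L}}}$. *)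

theory Defs
  imports
    "HOL-Analysis.Abstract_Topology"
    "HOL-Library.Poly_Mapping"
    "HOL-Computational_Algebra.Formal_Power_Series"
    "HOL-Computational_Algebra.Fundamental_Theorem_Algebra"
    "Jordan_Normal_Form.VS_Connect"
begin

text \<open>
  Varieties over an algebraically closed field are taken in the classical sense: spaces carrying a
  sheaf of field-valued functions, with a finite cover by open subspaces isomorphic to closed subsets
  of affine space, and separated. They need not be irreducible. This category is equivalent to that of
  reduced separated schemes of finite type over the field, and passing to the reduced structure does
  not change classes in the Grothendieck ring.
\<close>

section \<open>Spaces with functions\<close>

text \<open>
  \<open>reg X U\<close> is the set of functions that are regular on the open set \<open>U\<close>. Functions are total, but
  membership only depends on the values on \<open>U\<close> (this follows from the gluing axiom below).
\<close>

datatype ('k, 'p) space =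
  Space (zar: "'p topology") (reg: "'p set \<Rightarrow> ('p \<Rightarrow> 'k) set")

abbreviation pts :: "('k, 'p) space \<Rightarrow> 'p set" where
  "pts X \<equiv> topspace (zar X)"

locale space_with_functions =
  fixes X :: "('k::field, 'p) space"
  assumes restrict: "\<lbrakk>openin (zar X) U; openin (zar X) V; V \<subseteq> U; f \<in> reg X U\<rbrakk> \<Longrightarrow> f \<in> reg X V"
    and glue: "\<lbrakk>openin (zar X) U;
        \<And>x. x \<in> U \<Longrightarrow> \<exists>V g. openin (zar X) V \<and> x \<in> V \<and> V \<subseteq> U \<and> g \<in> reg X V \<and> (\<forall>y\<in>V. f y = g y)\<rbrakk>
      \<Longrightarrow> f \<in> reg X U"
    and const: "openin (zar X) U \<Longrightarrow> (\<lambda>_. c) \<in> reg X U"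
    and add: "\<lbrakk>openin (zar X) U; f \<in> reg X U; g \<in> reg X U\<rbrakk> \<Longrightarrow> (\<lambda>x. f x + g x) \<in> reg X U"
    and mult: "\<lbrakk>openin (zar X) U; f \<in> reg X U; g \<in> reg X U\<rbrakk> \<Longrightarrow> (\<lambda>x. f x * g x) \<in> reg X U"
    and nonzero: "\<lbrakk>openin (zar X) U; f \<in> reg X U\<rbrakk> \<Longrightarrow> openin (zar X) {x\<in>U. f x \<noteq> 0}"
    and inverse: "\<lbrakk>openin (zar X) U; f \<in> reg X U\<rbrakk> \<Longrightarrow> (\<lambda>x. inverse (f x)) \<in> reg X {x\<in>U. f x \<noteq> 0}"
begin

lemma cong_reg: "openin (zar X) U \<Longrightarrow> f \<in> reg X U \<Longrightarrow> (\<And>x. x \<in> U \<Longrightarrow> f x = g x) \<Longrightarrow> g \<in> reg X U"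
  by (rule glue) (use openin_subset in force)+

lemma sum_reg: "openin (zar X) U \<Longrightarrow> (\<And>i. i \<in> A \<Longrightarrow> f i \<in> reg X U) \<Longrightarrow> (\<lambda>x. \<Sum>i\<in>A. f i x) \<in> reg X U"
  by (induction A rule: infinite_finite_induct) (auto intro: const add)

lemma divide_reg:
  assumes "openin (zar X) U" "f \<in> reg X U" "g \<in> reg X U" "\<And>x. x \<in> U \<Longrightarrow> g x \<noteq> 0"
  shows "(\<lambda>x. f x / g x) \<in> reg X U"
proof -
  have "{x\<in>U. g x \<noteq> 0} = U" using assms(4) by auto
  then have "(\<lambda>x. inverse (g x)) \<in> reg X U" using inverse[OF assms(1,3)] by simp
  from mult[OF assms(1,2) this] show ?thesis by (simp add: divide_inverse)
qed

end

definition morphism :: "('k::field, 'p) space \<Rightarrow> ('k, 'q) space \<Rightarrow> ('p \<Rightarrow> 'q) \<Rightarrow> bool" where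
  "morphism X Y f \<longleftrightarrow> continuous_map (zar X) (zar Y) f \<and>
     (\<forall>V h. openin (zar Y) V \<and> h \<in> reg Y V \<longrightarrow> (\<lambda>x. h (f x)) \<in> reg X {x\<in>pts X. f x \<in> V})"

definition iso_spaces :: "('k::field, 'p) space \<Rightarrow> ('k, 'q) space \<Rightarrow> bool" where
  "iso_spaces X Y \<longleftrightarrow> (\<exists>f g. morphism X Y f \<and> morphism Y X g \<and>
     (\<forall>x\<in>pts X. g (f x) = x) \<and> (\<forall>y\<in>pts Y. f (g y) = y))"

text \<open>
  The structure on \<open>P\<close> induced by a map \<open>\<phi>\<close> into \<open>X\<close>. For injective \<open>\<phi>\<close> this identifies \<open>P\<close> with the
  subset \<open>\<phi> ` P\<close> of \<open>X\<close>: regular functions are those which locally extend to regular functions on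
  open subsets of \<open>X\<close> (the reduced induced structure).
\<close>

definition induced_space :: "('q \<Rightarrow> 'p) \<Rightarrow> 'q set \<Rightarrow> ('k::field, 'p) space \<Rightarrow> ('k, 'q) space" where
  "induced_space \<phi> P X = Space (pullback_topology P \<phi> (zar X))
     (\<lambda>U. {f. \<forall>x\<in>U. \<exists>W g. openin (zar X) W \<and> \<phi> x \<in> W \<and> g \<in> reg X W \<and>
                (\<forall>y\<in>U. \<phi> y \<in> W \<longrightarrow> f y = g (\<phi> y))})"

abbreviation sub_space :: "('k::field, 'p) space \<Rightarrow> 'p set \<Rightarrow> ('k, 'p) space" where
  "sub_space X A \<equiv> induced_space (\<lambda>x. x) A X"

text \<open>
  The product of spaces with functions: a regular function on \<open>U \<times> V\<close> of the form
  \<open>\<Sum> f\<^sub>i \<otimes> g\<^sub>i\<close> has an open non-vanishing locus, these loci form a basis of the topology, and regular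
  functions are locally quotients of such sums. The lemmas \<open>morphism_fst\<close>, \<open>morphism_snd\<close> and
  \<open>morphism_pair\<close> below show that this is the categorical product.
\<close>

definition tensor_functions ::
    "('k::field, 'p) space \<Rightarrow> ('k, 'q) space \<Rightarrow> 'p set \<Rightarrow> 'q set \<Rightarrow> ('p \<times> 'q \<Rightarrow> 'k) set" where
  "tensor_functions X Y U V =
     {(\<lambda>z. \<Sum>i<m. f i (fst z) * g i (snd z)) | (m::nat) f g. \<forall>i<m. f i \<in> reg X U \<and> g i \<in> reg Y V}"

definition prod_space :: "('k::field, 'p) space \<Rightarrow> ('k, 'q) space \<Rightarrow> ('k, 'p \<times> 'q) space" where
  "prod_space X Y = Space
     (topology (\<lambda>W. W \<subseteq> pts X \<times> pts Y \<and>
        (\<forall>z\<in>W. \<exists>U V h. openin (zar X) U \<and> openin (zar Y) V \<and> h \<in> tensor_functions X Y U V \<and>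
           z \<in> U \<times> V \<and> h z \<noteq> 0 \<and> {w \<in> U \<times> V. h w \<noteq> 0} \<subseteq> W)))
     (\<lambda>W. {f. \<forall>z\<in>W. \<exists>U V p q. openin (zar X) U \<and> openin (zar Y) V \<and>
           p \<in> tensor_functions X Y U V \<and> q \<in> tensor_functions X Y U V \<and>
           z \<in> U \<times> V \<and> q z \<noteq> 0 \<and> (\<forall>w\<in>W \<inter> (U \<times> V). q w \<noteq> 0 \<longrightarrow> f w = p w / q w)})"

subsection \<open>Morphisms\<close>

lemma morphismD:
  assumes "morphism X Y f"
  shows "continuous_map (zar X) (zar Y) f"
    and "x \<in> pts X \<Longrightarrow> f x \<in> pts Y"
    and "openin (zar Y) V \<Longrightarrow> openin (zar X) {x\<in>pts X. f x \<in> V}"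
    and "openin (zar Y) V \<Longrightarrow> h \<in> reg Y V \<Longrightarrow> (\<lambda>x. h (f x)) \<in> reg X {x\<in>pts X. f x \<in> V}"
  using assms by (auto simp: morphism_def continuous_map_def)

lemma morphism_id: "space_with_functions X \<Longrightarrow> morphism X X (\<lambda>x. x)"
proof -
  assume X: "space_with_functions X"
  interpret space_with_functions X by fact
  have *: "{x \<in> pts X. x \<in> V} = V" if "openin (zar X) V" for V
    using openin_subset[OF that] by auto
  show ?thesis by (auto simp: morphism_def * cong: conj_cong)
qed

lemma morphism_compose:
  assumes f: "morphism X Y f" and g: "morphism Y Z g"
  shows "morphism X Z (\<lambda>x. g (f x))"
  unfolding morphism_def
proof (intro conjI allI impI)
  show "continuous_map (zar X) (zar Z) (\<lambda>x. g (f x))"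
    using continuous_map_compose[OF morphismD(1)[OF f] morphismD(1)[OF g]] by (simp add: o_def)
  fix V h assume V: "openin (zar Z) V \<and> h \<in> reg Z V"
  have "(\<lambda>x. h (g (f x))) \<in> reg X {x\<in>pts X. f x \<in> {y\<in>pts Y. g y \<in> V}}"
    using morphismD(4)[OF f] morphismD(3,4)[OF g] V by blast
  moreover have "{x\<in>pts X. f x \<in> {y\<in>pts Y. g y \<in> V}} = {x\<in>pts X. g (f x) \<in> V}"
    using morphismD(2)[OF f] by auto
  ultimately show "(\<lambda>x. h (g (f x))) \<in> reg X {x\<in>pts X. g (f x) \<in> V}" by simp
qed

lemma morphism_cong:
  assumes X: "space_with_functions X" and f: "morphism X Y f" and eq: "\<And>x. x \<in> pts X \<Longrightarrow> f x = f' x"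
  shows "morphism X Y f'"
  unfolding morphism_def
proof (intro conjI allI impI)
  interpret space_with_functions X by fact
  show "continuous_map (zar X) (zar Y) f'"
    using continuous_map_eq[OF morphismD(1)[OF f]] eq by auto
  fix V h assume V: "openin (zar Y) V \<and> h \<in> reg Y V"
  have e: "{x\<in>pts X. f x \<in> V} = {x\<in>pts X. f' x \<in> V}" using eq by auto
  show "(\<lambda>x. h (f' x)) \<in> reg X {x\<in>pts X. f' x \<in> V}"
    by (rule cong_reg[of _ "\<lambda>x. h (f x)"])
      (use V morphismD(3,4)[OF f] eq in \<open>auto simp: e[symmetric]\<close>)
qed

lemma iso_spacesI:
  assumes "morphism X Y f" "morphism Y X g" "\<And>x. x \<in> pts X \<Longrightarrow> g (f x) = x" "\<And>y. y \<in> pts Y \<Longrightarrow> f (g y) = y"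
  shows "iso_spaces X Y"
  using assms unfolding iso_spaces_def by blast

lemma iso_spacesE:
  assumes "iso_spaces X Y"
  obtains f g where "morphism X Y f" "morphism Y X g" "\<And>x. x \<in> pts X \<Longrightarrow> g (f x) = x" "\<And>y. y \<in> pts Y \<Longrightarrow> f (g y) = y"
  using assms unfolding iso_spaces_def by blast

lemma iso_spaces_refl: "space_with_functions X \<Longrightarrow> iso_spaces X X"
  by (rule iso_spacesI[of _ _ "\<lambda>x. x" "\<lambda>x. x"]) (auto intro: morphism_id)

lemma iso_spaces_sym: "iso_spaces X Y \<Longrightarrow> iso_spaces Y X"
  unfolding iso_spaces_def by blast

lemma iso_spaces_trans:
  assumes "iso_spaces X Y" "iso_spaces Y Z" shows "iso_spaces X Z"
proof -
  obtain f g where fg: "morphism X Y f" "morphism Y X g" "\<And>x. x \<in> pts X \<Longrightarrow> g (f x) = x" "\<And>y. y \<in> pts Y \<Longrightarrow> f (g y) = y"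
    using iso_spacesE[OF assms(1)] by metis
  obtain f' g' where fg': "morphism Y Z f'" "morphism Z Y g'" "\<And>x. x \<in> pts Y \<Longrightarrow> g' (f' x) = x" "\<And>y. y \<in> pts Z \<Longrightarrow> f' (g' y) = y"
    using iso_spacesE[OF assms(2)] by metis
  show ?thesis
    by (rule iso_spacesI[of X Z "\<lambda>x. f' (f x)" "\<lambda>z. g (g' z)"])
      (use fg fg' morphism_compose morphismD(2) in \<open>fastforce+\<close>)
qed

subsection \<open>Induced structures\<close>

lemma openin_induced:
  "openin (zar (induced_space \<phi> P X)) U \<longleftrightarrow> (\<exists>W. openin (zar X) W \<and> U = {x\<in>P. \<phi> x \<in> W})"
  by (auto simp: induced_space_def openin_pullback_topology)

lemma pts_induced: "pts (induced_space \<phi> P X) = {x\<in>P. \<phi> x \<in> pts X}"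
  by (auto simp: induced_space_def topspace_pullback_topology)

lemma reg_induced:
  "f \<in> reg (induced_space \<phi> P X) U \<longleftrightarrow>
   (\<forall>x\<in>U. \<exists>W g. openin (zar X) W \<and> \<phi> x \<in> W \<and> g \<in> reg X W \<and> (\<forall>y\<in>U. \<phi> y \<in> W \<longrightarrow> f y = g (\<phi> y)))"
  by (simp add: induced_space_def)

lemma induced_swf:
  assumes "space_with_functions X"
  shows "space_with_functions (induced_space \<phi> P X)" (is "space_with_functions ?I")
proof
  interpret X: space_with_functions X by fact
  fix U V :: "'c set" and f g :: "'c \<Rightarrow> 'a"
  { assume "V \<subseteq> U" "f \<in> reg ?I U"
    then show "f \<in> reg ?I V" unfolding reg_induced by (meson subset_iff) }
  { assume U: "openin (zar ?I) U"
      and g: "\<And>x. x \<in> U \<Longrightarrow> \<exists>V g. openin (zar ?I) V \<and> x \<in> V \<and> V \<subseteq> U \<and> g \<in> reg ?I V \<and> (\<forall>y\<in>V. f y = g y)"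
    show "f \<in> reg ?I U" unfolding reg_induced
    proof
      fix x assume x: "x \<in> U"
      from g[OF this] obtain V g where V: "openin (zar ?I) V" "x \<in> V" "V \<subseteq> U" "g \<in> reg ?I V" "\<forall>y\<in>V. f y = g y" by blast
      from V(1) obtain O' where O': "openin (zar X) O'" "V = {x\<in>P. \<phi> x \<in> O'}" by (auto simp: openin_induced)
      from V(2,4) obtain W h where W: "openin (zar X) W" "\<phi> x \<in> W" "h \<in> reg X W" "\<forall>y\<in>V. \<phi> y \<in> W \<longrightarrow> g y = h (\<phi> y)"
        unfolding reg_induced by blast
      have UP: "U \<subseteq> P" using U by (auto simp: openin_induced)
      show "\<exists>W g. openin (zar X) W \<and> \<phi> x \<in> W \<and> g \<in> reg X W \<and> (\<forall>y\<in>U. \<phi> y \<in> W \<longrightarrow> f y = g (\<phi> y))"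
        by (rule exI[of _ "W \<inter> O'"], rule exI[of _ h])
          (use V O' W UP X.restrict[OF W(1) openin_Int[OF W(1) O'(1)] _ W(3)] in auto)
    qed }
  { fix c assume "openin (zar ?I) U"
    then have "\<phi> x \<in> pts X" if "x \<in> U" for x using that openin_subset by (fastforce simp: openin_induced)
    then show "(\<lambda>_. c) \<in> reg ?I U" unfolding reg_induced
      by (intro ballI exI[of _ "pts X"] exI[of _ "\<lambda>_. c"]) (auto intro: X.const) }
  { assume f: "f \<in> reg ?I U" and g: "g \<in> reg ?I U"
    have *: "\<exists>W f' g'. openin (zar X) W \<and> \<phi> x \<in> W \<and> f' \<in> reg X W \<and> g' \<in> reg X W \<and> (\<forall>y\<in>U. \<phi> y \<in> W \<longrightarrow> f y = f' (\<phi> y) \<and> g y = g' (\<phi> y))"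
      if x: "x \<in> U" for x
    proof -
      from f x obtain W f' where W: "openin (zar X) W" "\<phi> x \<in> W" "f' \<in> reg X W" "\<forall>y\<in>U. \<phi> y \<in> W \<longrightarrow> f y = f' (\<phi> y)"
        unfolding reg_induced by blast
      from g x obtain W' g' where W': "openin (zar X) W'" "\<phi> x \<in> W'" "g' \<in> reg X W'" "\<forall>y\<in>U. \<phi> y \<in> W' \<longrightarrow> g y = g' (\<phi> y)"
        unfolding reg_induced by blast
      have o: "openin (zar X) (W \<inter> W')" using W W' by blast
      show ?thesis
        by (rule exI[of _ "W \<inter> W'"], rule exI[of _ f'], rule exI[of _ g'])
          (use W W' o X.restrict[OF W(1) o _ W(3)] X.restrict[OF W'(1) o _ W'(3)] in auto)
    qed
    show "(\<lambda>x. f x + g x) \<in> reg ?I U" unfolding reg_induced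
    proof
      fix x assume "x \<in> U"
      with *[OF this] obtain W f' g' where **: "openin (zar X) W" "\<phi> x \<in> W" "f' \<in> reg X W" "g' \<in> reg X W" "\<forall>y\<in>U. \<phi> y \<in> W \<longrightarrow> f y = f' (\<phi> y) \<and> g y = g' (\<phi> y)"
        by blast
      then show "\<exists>W h. openin (zar X) W \<and> \<phi> x \<in> W \<and> h \<in> reg X W \<and> (\<forall>y\<in>U. \<phi> y \<in> W \<longrightarrow> f y + g y = h (\<phi> y))"
        by (intro exI[of _ W] exI[of _ "\<lambda>x. f' x + g' x"]) (auto intro: X.add)
    qed
    show "(\<lambda>x. f x * g x) \<in> reg ?I U" unfolding reg_induced
    proof
      fix x assume "x \<in> U"
      with *[OF this] obtain W f' g' where **: "openin (zar X) W" "\<phi> x \<in> W" "f' \<in> reg X W" "g' \<in> reg X W" "\<forall>y\<in>U. \<phi> y \<in> W \<longrightarrow> f y = f' (\<phi> y) \<and> g y = g' (\<phi> y)"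
        by blast
      then show "\<exists>W h. openin (zar X) W \<and> \<phi> x \<in> W \<and> h \<in> reg X W \<and> (\<forall>y\<in>U. \<phi> y \<in> W \<longrightarrow> f y * g y = h (\<phi> y))"
        by (intro exI[of _ W] exI[of _ "\<lambda>x. f' x * g' x"]) (auto intro: X.mult)
    qed }
  { assume U: "openin (zar ?I) U" and f: "f \<in> reg ?I U"
    show "openin (zar ?I) {x\<in>U. f x \<noteq> 0}"
    proof (subst openin_subopen, safe)
      fix x assume x: "x \<in> U" "f x \<noteq> 0"
      from U obtain O' where O': "openin (zar X) O'" "U = {x\<in>P. \<phi> x \<in> O'}" by (auto simp: openin_induced)
      from f x obtain W f' where W: "openin (zar X) W" "\<phi> x \<in> W" "f' \<in> reg X W" "\<forall>y\<in>U. \<phi> y \<in> W \<longrightarrow> f y = f' (\<phi> y)"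
        unfolding reg_induced by blast
      show "\<exists>T. openin (zar ?I) T \<and> x \<in> T \<and> T \<subseteq> {x \<in> U. f x \<noteq> 0}"
        by (rule exI[of _ "{x\<in>P. \<phi> x \<in> O' \<inter> {z\<in>W. f' z \<noteq> 0}}"])
          (use W O' x X.nonzero[OF W(1,3)] in \<open>auto simp: openin_induced\<close>)
    qed
    show "(\<lambda>x. inverse (f x)) \<in> reg ?I {x\<in>U. f x \<noteq> 0}" unfolding reg_induced
    proof safe
      fix x assume x: "x \<in> U" "f x \<noteq> 0"
      from f x obtain W f' where W: "openin (zar X) W" "\<phi> x \<in> W" "f' \<in> reg X W" "\<forall>y\<in>U. \<phi> y \<in> W \<longrightarrow> f y = f' (\<phi> y)"
        unfolding reg_induced by blast
      show "\<exists>W g. openin (zar X) W \<and> \<phi> x \<in> W \<and> g \<in> reg X W \<and> (\<forall>y\<in>{x\<in>U. f x \<noteq> 0}. \<phi> y \<in> W \<longrightarrow> inverse (f y) = g (\<phi> y))"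
        by (rule exI[of _ "{z\<in>W. f' z \<noteq> 0}"], rule exI[of _ "\<lambda>x. inverse (f' x)"])
          (use W x X.nonzero[OF W(1,3)] X.inverse[OF W(1,3)] in auto)
    qed }
qed

lemma morphism_induced_map:
  assumes "space_with_functions X"
  shows "morphism (induced_space \<phi> P X) X \<phi>"
proof -
  interpret X: space_with_functions X by fact
  have e: "{x \<in> pts (induced_space \<phi> P X). \<phi> x \<in> V} = {x\<in>P. \<phi> x \<in> V}" if "openin (zar X) V" for V
    using openin_subset[OF that] by (auto simp: pts_induced)
  show ?thesis
    unfolding morphism_def continuous_map_def
    by (auto simp: e reg_induced) (auto simp: pts_induced openin_induced)
qed

lemma morphism_into_induced:
  assumes W: "space_with_functions W"
    and f: "morphism W X (\<lambda>x. \<phi> (f x))" and P: "\<And>x. x \<in> pts W \<Longrightarrow> f x \<in> P"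
  shows "morphism W (induced_space \<phi> P X) f"
  unfolding morphism_def
proof (intro conjI allI impI)
  interpret W: space_with_functions W by fact
  have pre: "openin (zar W) {x\<in>pts W. f x \<in> V}" if "openin (zar (induced_space \<phi> P X)) V" for V
  proof -
    from that obtain V' where V': "openin (zar X) V'" "V = {x\<in>P. \<phi> x \<in> V'}" by (auto simp: openin_induced)
    have "{x\<in>pts W. f x \<in> V} = {x\<in>pts W. \<phi> (f x) \<in> V'}" using P V' by auto
    then show ?thesis using morphismD(3)[OF f V'(1)] by simp
  qed
  show "continuous_map (zar W) (zar (induced_space \<phi> P X)) f"
    using P morphismD(2)[OF f] pre by (auto simp: continuous_map_def pts_induced)
  fix V h assume "openin (zar (induced_space \<phi> P X)) V \<and> h \<in> reg (induced_space \<phi> P X) V"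
  then have V: "openin (zar (induced_space \<phi> P X)) V" and h: "h \<in> reg (induced_space \<phi> P X) V" by auto
  show "(\<lambda>x. h (f x)) \<in> reg W {x \<in> pts W. f x \<in> V}"
  proof (rule W.glue[OF pre[OF V]])
    fix x assume x: "x \<in> {x \<in> pts W. f x \<in> V}"
    with h obtain O' g where O': "openin (zar X) O'" "\<phi> (f x) \<in> O'" "g \<in> reg X O'" "\<forall>y\<in>V. \<phi> y \<in> O' \<longrightarrow> h y = g (\<phi> y)"
      unfolding reg_induced by blast
    have o: "openin (zar W) {x\<in>pts W. \<phi> (f x) \<in> O'}" using morphismD(3)[OF f O'(1)] .
    have r: "(\<lambda>x. g (\<phi> (f x))) \<in> reg W {x\<in>pts W. \<phi> (f x) \<in> O'}" using morphismD(4)[OF f O'(1,3)] .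
    have o2: "openin (zar W) ({x\<in>pts W. \<phi> (f x) \<in> O'} \<inter> {x\<in>pts W. f x \<in> V})"
      using o pre[OF V] by blast
    show "\<exists>Va g. openin (zar W) Va \<and> x \<in> Va \<and> Va \<subseteq> {x \<in> pts W. f x \<in> V} \<and> g \<in> reg W Va \<and> (\<forall>y\<in>Va. h (f y) = g y)"
      by (rule exI[of _ "{x\<in>pts W. \<phi> (f x) \<in> O'} \<inter> {x\<in>pts W. f x \<in> V}"], rule exI[of _ "\<lambda>x. g (\<phi> (f x))"])
        (use x O' o2 W.restrict[OF o o2 _ r] in auto)
  qed
qed

lemma pts_sub: "pts (sub_space X A) = A \<inter> pts X"
  by (auto simp: pts_induced)

lemma morphism_sub:
  assumes X: "space_with_functions X" and f: "morphism X Y f" and AB: "\<And>x. x \<in> A \<Longrightarrow> x \<in> pts X \<Longrightarrow> f x \<in> B"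
  shows "morphism (sub_space X A) (sub_space Y B) f"
  by (rule morphism_into_induced)
     (use assms morphism_compose[OF morphism_induced_map[OF X] f] in \<open>auto intro!: induced_swf simp: pts_induced\<close>)

lemma iso_sub_iso:
  assumes X: "space_with_functions X" and Y: "space_with_functions Y"
    and "morphism X Y f" "morphism Y X g" "\<And>x. x \<in> pts X \<Longrightarrow> g (f x) = x" "\<And>y. y \<in> pts Y \<Longrightarrow> f (g y) = y"
    and A: "A \<subseteq> pts X" 
  shows "iso_spaces (sub_space X A) (sub_space Y {y\<in>pts Y. g y \<in> A})"
  by (rule iso_spacesI[of _ _ f g])
     (use assms morphismD(2)[OF assms(3)] morphismD(2)[OF assms(4)] in \<open>auto intro!: morphism_sub simp: pts_induced\<close>)

lemma iso_sub_sub: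
  assumes X: "space_with_functions X"
  shows "iso_spaces (sub_space (sub_space X A) B) (sub_space X (A \<inter> B))"
proof -
  note i = induced_swf[OF X] induced_swf[OF induced_swf[OF X]]
  have a: "morphism (sub_space (sub_space X A) B) X (\<lambda>x. x)"
    using morphism_compose[OF morphism_induced_map[OF induced_swf[OF X]] morphism_induced_map[OF X]] .
  have b: "morphism (sub_space X (A \<inter> B)) X (\<lambda>x. x)" by (rule morphism_induced_map[OF X])
  show ?thesis
    by (rule iso_spacesI[of _ _ "\<lambda>x. x" "\<lambda>x. x"])
       (auto intro!: morphism_into_induced a b i simp: pts_induced)
qed

lemma iso_sub_id:
  assumes X: "space_with_functions X" and "pts X \<subseteq> A"
  shows "iso_spaces (sub_space X A) X"
  by (rule iso_spacesI[of _ _ "\<lambda>x. x" "\<lambda>x. x"])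
     (use assms in \<open>auto intro!: morphism_into_induced morphism_induced_map morphism_id simp: pts_induced\<close>)

lemma iso_induced_inj:
  assumes X: "space_with_functions X" and e: "\<And>x. x \<in> pts X \<Longrightarrow> e x \<in> P \<and> \<phi> (e x) = x"
    and P: "\<And>y. y \<in> P \<Longrightarrow> e (\<phi> y) = y"
  shows "iso_spaces X (induced_space \<phi> P X)"
proof (rule iso_spacesI[of _ _ e \<phi>])
  show "morphism X (induced_space \<phi> P X) e"
    by (rule morphism_into_induced[OF X])
       (use e morphism_cong[OF X morphism_id[OF X]] in auto)
  show "morphism (induced_space \<phi> P X) X \<phi>" by (rule morphism_induced_map[OF X])
qed (use e P in \<open>auto simp: pts_induced\<close>)

subsection \<open>Products\<close>

lemma tensorI: "(\<And>i. i < (m::nat) \<Longrightarrow> f i \<in> reg X U) \<Longrightarrow> (\<And>i. i < m \<Longrightarrow> g i \<in> reg Y V) \<Longrightarrow>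
    (\<lambda>z. \<Sum>i<m. f i (fst z) * g i (snd z)) \<in> tensor_functions X Y U V"
  unfolding tensor_functions_def
  by (rule CollectI, rule exI[of _ m], rule exI[of _ f], rule exI[of _ g]) simp

lemma tensorE:
  assumes "h \<in> tensor_functions X Y U V"
  obtains m f g where "h = (\<lambda>z. \<Sum>i<m. f i (fst z) * g i (snd z))"
    "\<And>i. i < (m::nat) \<Longrightarrow> f i \<in> reg X U" "\<And>i. i < m \<Longrightarrow> g i \<in> reg Y V"
  using assms unfolding tensor_functions_def by blast

lemma tensorI_list:
  assumes "\<And>f g. (f,g) \<in> set fs \<Longrightarrow> f \<in> reg X U \<and> g \<in> reg Y V"
  shows "(\<lambda>z. \<Sum>(f,g)\<leftarrow>fs. f (fst z) * g (snd z)) \<in> tensor_functions X Y U V"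
proof -
  have "(\<lambda>z. \<Sum>(f,g)\<leftarrow>fs. f (fst z) * g (snd z)) = (\<lambda>z. \<Sum>i<length fs. fst (fs!i) (fst z) * snd (fs!i) (snd z))"
    by (rule ext) (simp add: sum_list_sum_nth atLeast0LessThan case_prod_beta)
  also have "\<dots> \<in> tensor_functions X Y U V"
    by (rule tensorI) (use assms in \<open>metis nth_mem prod.collapse\<close>)+
  finally show ?thesis .
qed

lemma tensorE_list:
  assumes "h \<in> tensor_functions X Y U V"
  obtains fs where "h = (\<lambda>z. \<Sum>(f,g)\<leftarrow>fs. f (fst z) * g (snd z))"
    "\<And>f g. (f,g) \<in> set fs \<Longrightarrow> f \<in> reg X U \<and> g \<in> reg Y V"
proof -
  from assms obtain m f g where h: "h = (\<lambda>z. \<Sum>i<m. f i (fst z) * g i (snd z))"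
    "\<And>i. i < (m::nat) \<Longrightarrow> f i \<in> reg X U" "\<And>i. i < m \<Longrightarrow> g i \<in> reg Y V" by (rule tensorE) blast
  show ?thesis
    by (rule that[of "map (\<lambda>i. (f i, g i)) [0..<m]"])
       (use h in \<open>auto simp: o_def sum_list_sum_nth atLeast0LessThan\<close>)
qed

locale two_spaces = X: space_with_functions X + Y: space_with_functions Y
  for X :: "('k::field, 'p) space" and Y :: "('k, 'q) space"
begin

lemma tensor_add:
  assumes "h \<in> tensor_functions X Y U V" "h' \<in> tensor_functions X Y U V"
  shows "(\<lambda>z. h z + h' z) \<in> tensor_functions X Y U V"
proof -
  from assms(1) obtain fs where fs: "h = (\<lambda>z. \<Sum>(f,g)\<leftarrow>fs. f (fst z) * g (snd z))"
    "\<And>f g. (f,g) \<in> set fs \<Longrightarrow> f \<in> reg X U \<and> g \<in> reg Y V" by (erule tensorE_list)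
  from assms(2) obtain fs' where fs': "h' = (\<lambda>z. \<Sum>(f,g)\<leftarrow>fs'. f (fst z) * g (snd z))"
    "\<And>f g. (f,g) \<in> set fs' \<Longrightarrow> f \<in> reg X U \<and> g \<in> reg Y V" by (erule tensorE_list)
  have "(\<lambda>z. \<Sum>(f,g)\<leftarrow>fs @ fs'. f (fst z) * g (snd z)) \<in> tensor_functions X Y U V"
    by (rule tensorI_list) (use fs fs' in auto)
  then show ?thesis by (simp add: fs(1) fs'(1))
qed

lemma tensor_zero: "(\<lambda>_. 0) \<in> tensor_functions X Y U V"
  using tensorI_list[of "[]"] by simp

lemma tensor_simple: "f \<in> reg X U \<Longrightarrow> g \<in> reg Y V \<Longrightarrow> (\<lambda>z. f (fst z) * g (snd z)) \<in> tensor_functions X Y U V"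
  using tensorI_list[of "[(f,g)]"] by simp

lemma tensor_sum: "(\<And>i. i \<in> A \<Longrightarrow> h i \<in> tensor_functions X Y U V) \<Longrightarrow> (\<lambda>z. \<Sum>i\<in>A. h i z) \<in> tensor_functions X Y U V"
  by (induction A rule: infinite_finite_induct) (auto intro: tensor_zero tensor_add)

lemma tensor_mult:
  assumes U: "openin (zar X) U" and V: "openin (zar Y) V"
  assumes "h \<in> tensor_functions X Y U V" "h' \<in> tensor_functions X Y U V"
  shows "(\<lambda>z. h z * h' z) \<in> tensor_functions X Y U V"
proof -
  from assms(3) obtain m f g where h: "h = (\<lambda>z. \<Sum>i<m. f i (fst z) * g i (snd z))"
    "\<And>i. i < (m::nat) \<Longrightarrow> f i \<in> reg X U" "\<And>i. i < m \<Longrightarrow> g i \<in> reg Y V" by (rule tensorE) blast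
  from assms(4) obtain m' f' g' where h': "h' = (\<lambda>z. \<Sum>i<m'. f' i (fst z) * g' i (snd z))"
    "\<And>i. i < (m'::nat) \<Longrightarrow> f' i \<in> reg X U" "\<And>i. i < m' \<Longrightarrow> g' i \<in> reg Y V" by (rule tensorE) blast
  have "(\<lambda>z. h z * h' z) = (\<lambda>z. \<Sum>i<m. \<Sum>j<m'. (f i (fst z) * f' j (fst z)) * (g i (snd z) * g' j (snd z)))"
    unfolding h(1) h'(1) sum_product by (intro ext sum.cong) (auto simp: ac_simps)
  also have "\<dots> \<in> tensor_functions X Y U V"
    by (intro tensor_sum tensor_simple[of "\<lambda>x. f _ x * f' _ x" _ "\<lambda>x. g _ x * g' _ x"] X.mult Y.mult)
       (use h h' U V in auto)
  finally show ?thesis .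
qed

lemma tensor_restrict:
  assumes "openin (zar X) U" "openin (zar Y) V" "openin (zar X) U'" "openin (zar Y) V'" "U' \<subseteq> U" "V' \<subseteq> V"
    "h \<in> tensor_functions X Y U V"
  shows "h \<in> tensor_functions X Y U' V'"
proof -
  from assms(7) obtain fs where fs: "h = (\<lambda>z. \<Sum>(f,g)\<leftarrow>fs. f (fst z) * g (snd z))"
    "\<And>f g. (f,g) \<in> set fs \<Longrightarrow> f \<in> reg X U \<and> g \<in> reg Y V" by (erule tensorE_list)
  show ?thesis unfolding fs(1)
    by (rule tensorI_list) (use fs X.restrict Y.restrict assms in blast)
qed

lemma tensor_const: "openin (zar X) U \<Longrightarrow> openin (zar Y) V \<Longrightarrow> (\<lambda>_. c) \<in> tensor_functions X Y U V"
  using tensor_simple[of "\<lambda>_. c" U "\<lambda>_. 1" V] X.const Y.const by simp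

definition basic where "basic W z U V h \<longleftrightarrow> openin (zar X) U \<and> openin (zar Y) V \<and> h \<in> tensor_functions X Y U V \<and>
           z \<in> U \<times> V \<and> h z \<noteq> 0 \<and> {w \<in> U \<times> V. h w \<noteq> 0} \<subseteq> W"

lemma istopology_prod:
  "istopology (\<lambda>W. W \<subseteq> pts X \<times> pts Y \<and> (\<forall>z\<in>W. \<exists>U V h. basic W z U V h))"
  unfolding istopology_def
proof (rule conjI; intro allI impI)
  fix S T assume S: "S \<subseteq> pts X \<times> pts Y \<and> (\<forall>z\<in>S. \<exists>U V h. basic S z U V h)"
    and T: "T \<subseteq> pts X \<times> pts Y \<and> (\<forall>z\<in>T. \<exists>U V h. basic T z U V h)"
  show "S \<inter> T \<subseteq> pts X \<times> pts Y \<and> (\<forall>z\<in>S \<inter> T. \<exists>U V h. basic (S \<inter> T) z U V h)"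
  proof (intro conjI ballI)
    show "S \<inter> T \<subseteq> pts X \<times> pts Y" using S by blast
    fix z assume z: "z \<in> S \<inter> T"
    then obtain U V h U' V' h' where "basic S z U V h" "basic T z U' V' h'" using S T by blast
    note 1 = this(1)[unfolded basic_def] and 2 = this(2)[unfolded basic_def]
    have o: "openin (zar X) (U \<inter> U')" "openin (zar Y) (V \<inter> V')" using 1 2 by blast+
    have t: "h \<in> tensor_functions X Y (U \<inter> U') (V \<inter> V')" "h' \<in> tensor_functions X Y (U \<inter> U') (V \<inter> V')"
      using 1 2 o tensor_restrict[of U V "U \<inter> U'" "V \<inter> V'" h] tensor_restrict[of U' V' "U \<inter> U'" "V \<inter> V'" h'] by auto
    have "basic (S \<inter> T) z (U \<inter> U') (V \<inter> V') (\<lambda>z. h z * h' z)"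
      unfolding basic_def using 1 2 o tensor_mult[OF o t] by auto
    then show "\<exists>U V h. basic (S \<inter> T) z U V h" by blast
  qed
next
  fix K assume K: "\<forall>S\<in>K. S \<subseteq> pts X \<times> pts Y \<and> (\<forall>z\<in>S. \<exists>U V h. basic S z U V h)"
  show "\<Union>K \<subseteq> pts X \<times> pts Y \<and> (\<forall>z\<in>\<Union>K. \<exists>U V h. basic (\<Union>K) z U V h)"
  proof (intro conjI ballI)
    show "\<Union>K \<subseteq> pts X \<times> pts Y" using K by blast
    fix z assume "z \<in> \<Union>K"
    then obtain S where S: "S \<in> K" "z \<in> S" by blast
    with K obtain U V h where "basic S z U V h" by blast
    then have "basic (\<Union>K) z U V h" using S unfolding basic_def by blast
    then show "\<exists>U V h. basic (\<Union>K) z U V h" by blast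
  qed
qed

lemma openin_prod:
  "openin (zar (prod_space X Y)) W \<longleftrightarrow> W \<subseteq> pts X \<times> pts Y \<and> (\<forall>z\<in>W. \<exists>U V h. basic W z U V h)"
  unfolding prod_space_def space.sel basic_def[symmetric] topology_inverse'[OF istopology_prod] ..

lemma openin_prod_basic:
  assumes "openin (zar X) U" "openin (zar Y) V" "h \<in> tensor_functions X Y U V"
  shows "openin (zar (prod_space X Y)) {w \<in> U \<times> V. h w \<noteq> 0}"
  unfolding openin_prod
proof (intro conjI ballI)
  show "{w \<in> U \<times> V. h w \<noteq> 0} \<subseteq> pts X \<times> pts Y"
    using openin_subset[OF assms(1)] openin_subset[OF assms(2)] by blast
  fix z assume "z \<in> {w \<in> U \<times> V. h w \<noteq> 0}"
  then have "basic {w \<in> U \<times> V. h w \<noteq> 0} z U V h" unfolding basic_def using assms by auto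
  then show "\<exists>A B f. basic {w \<in> U \<times> V. h w \<noteq> 0} z A B f" by blast
qed

lemma openin_prod_Times:
  assumes "openin (zar X) U" "openin (zar Y) V"
  shows "openin (zar (prod_space X Y)) (U \<times> V)"
  using openin_prod_basic[OF assms tensor_const[OF assms, of 1]] by simp

lemma pts_prod: "pts (prod_space X Y) = pts X \<times> pts Y"
proof
  show "pts (prod_space X Y) \<subseteq> pts X \<times> pts Y"
    using openin_prod[of "pts (prod_space X Y)"] by simp
  show "pts X \<times> pts Y \<subseteq> pts (prod_space X Y)"
    using openin_prod_Times[of "pts X" "pts Y"] openin_subset by fastforce
qed

lemma reg_prod:
  "f \<in> reg (prod_space X Y) W \<longleftrightarrow> (\<forall>z\<in>W. \<exists>U V p q. openin (zar X) U \<and> openin (zar Y) V \<and>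
           p \<in> tensor_functions X Y U V \<and> q \<in> tensor_functions X Y U V \<and>
           z \<in> U \<times> V \<and> q z \<noteq> 0 \<and> (\<forall>w\<in>W. w \<in> U \<times> V \<longrightarrow> q w \<noteq> 0 \<longrightarrow> f w = p w / q w))"
proof -
  have "(\<forall>w\<in>W \<inter> A. P w) \<longleftrightarrow> (\<forall>w\<in>W. w \<in> A \<longrightarrow> P w)" for A P by blast
  then show ?thesis by (simp add: prod_space_def)
qed

lemma reg_prodE:
  assumes "f \<in> reg (prod_space X Y) W" "z \<in> W"
  obtains U V p q where "openin (zar X) U" "openin (zar Y) V"
           "p \<in> tensor_functions X Y U V" "q \<in> tensor_functions X Y U V"
           "z \<in> U \<times> V" "q z \<noteq> 0" "\<And>w. w\<in>W \<Longrightarrow> w \<in> U \<times> V \<Longrightarrow> q w \<noteq> 0 \<Longrightarrow> f w = p w / q w"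
  using bspec[OF assms(1)[unfolded reg_prod] assms(2)]
proof (elim exE conjE)
  fix U V p q
  assume *: "openin (zar X) U" "openin (zar Y) V" "p \<in> tensor_functions X Y U V" "q \<in> tensor_functions X Y U V"
      "z \<in> U \<times> V" "q z \<noteq> 0" and **: "\<forall>w\<in>W. w \<in> U \<times> V \<longrightarrow> q w \<noteq> 0 \<longrightarrow> f w = p w / q w"
  show thesis by (rule that[OF *]) (use ** in simp)
qed

lemma reg_prodI:
  assumes "\<And>z. z \<in> W \<Longrightarrow> \<exists>U V p q. openin (zar X) U \<and> openin (zar Y) V \<and>
           p \<in> tensor_functions X Y U V \<and> q \<in> tensor_functions X Y U V \<and>
           z \<in> U \<times> V \<and> q z \<noteq> 0 \<and> (\<forall>w\<in>W. w \<in> U \<times> V \<longrightarrow> q w \<noteq> 0 \<longrightarrow> f w = p w / q w)"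
  shows "f \<in> reg (prod_space X Y) W"
  unfolding reg_prod by (rule ballI) (rule assms)

lemma prod_swf: "space_with_functions (prod_space X Y)"
proof
  let ?P = "prod_space X Y"
  fix U V :: "('p \<times> 'q) set" and f g :: "'p \<times> 'q \<Rightarrow> 'k"
  { assume VU: "V \<subseteq> U" and f: "f \<in> reg ?P U"
    show "f \<in> reg ?P V"
    proof (rule reg_prodI)
      fix z assume "z \<in> V"
      then have "z \<in> U" using VU by blast
      from reg_prodE[OF f this] obtain A B p q where "openin (zar X) A" "openin (zar Y) B"
           "p \<in> tensor_functions X Y A B" "q \<in> tensor_functions X Y A B"
           "z \<in> A \<times> B" "q z \<noteq> 0" "\<And>w. w\<in>U \<Longrightarrow> w \<in> A \<times> B \<Longrightarrow> q w \<noteq> 0 \<Longrightarrow> f w = p w / q w" by blast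
      then show "\<exists>A B p q. openin (zar X) A \<and> openin (zar Y) B \<and> p \<in> tensor_functions X Y A B \<and> q \<in> tensor_functions X Y A B \<and>
           z \<in> A \<times> B \<and> q z \<noteq> 0 \<and> (\<forall>w\<in>V. w \<in> A \<times> B \<longrightarrow> q w \<noteq> 0 \<longrightarrow> f w = p w / q w)"
        by (intro exI[of _ A] exI[of _ B] exI[of _ p] exI[of _ q]) (use VU in auto)
    qed }
  { assume U: "openin (zar ?P) U"
      and g: "\<And>x. x \<in> U \<Longrightarrow> \<exists>V g. openin (zar ?P) V \<and> x \<in> V \<and> V \<subseteq> U \<and> g \<in> reg ?P V \<and> (\<forall>y\<in>V. f y = g y)"
    show "f \<in> reg ?P U"
    proof (rule reg_prodI)
      fix x assume x: "x \<in> U"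
      from g[OF this] obtain W g where W: "openin (zar ?P) W" "x \<in> W" "W \<subseteq> U" "g \<in> reg ?P W" "\<forall>y\<in>W. f y = g y" by blast
      from W(1,2) obtain A B h where "basic W x A B h" unfolding openin_prod by blast
      note 1 = this[unfolded basic_def]
      from reg_prodE[OF W(4,2)] obtain A' B' p q where 2: "openin (zar X) A'" "openin (zar Y) B'"
           "p \<in> tensor_functions X Y A' B'" "q \<in> tensor_functions X Y A' B'"
           "x \<in> A' \<times> B'" "q x \<noteq> 0" "\<And>w. w\<in>W \<Longrightarrow> w \<in> A' \<times> B' \<Longrightarrow> q w \<noteq> 0 \<Longrightarrow> g w = p w / q w" by blast
      let ?A = "A \<inter> A'" and ?B = "B \<inter> B'"
      have o: "openin (zar X) ?A" "openin (zar Y) ?B" using 1 2 by blast+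
      have t: "h \<in> tensor_functions X Y ?A ?B" "p \<in> tensor_functions X Y ?A ?B" "q \<in> tensor_functions X Y ?A ?B"
        using 1 2 tensor_restrict[OF _ _ o, of A B h] tensor_restrict[OF 2(1,2) o _ _ 2(3)] tensor_restrict[OF 2(1,2) o _ _ 2(4)] by auto
      have w: "f w = (p w * h w) / (q w * h w)" if "w \<in> ?A \<times> ?B" "q w * h w \<noteq> 0" for w
      proof -
        have "w \<in> W" using 1 that by auto
        then show ?thesis using 2(7)[of w] that W(5) by auto
      qed
      show "\<exists>A B p q. openin (zar X) A \<and> openin (zar Y) B \<and> p \<in> tensor_functions X Y A B \<and> q \<in> tensor_functions X Y A B \<and>
           x \<in> A \<times> B \<and> q x \<noteq> 0 \<and> (\<forall>w\<in>U. w \<in> A \<times> B \<longrightarrow> q w \<noteq> 0 \<longrightarrow> f w = p w / q w)"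
        by (rule exI[of _ ?A], rule exI[of _ ?B], rule exI[of _ "\<lambda>w. p w * h w"], rule exI[of _ "\<lambda>w. q w * h w"])
           (use 1 2 o w tensor_mult[OF o] t in auto)
    qed }
  { fix c assume U: "openin (zar ?P) U"
    show "(\<lambda>_. c) \<in> reg ?P U"
    proof (rule reg_prodI)
      fix z assume "z \<in> U"
      then have "z \<in> pts X \<times> pts Y" using U unfolding openin_prod by blast
      then show "\<exists>A B p q. openin (zar X) A \<and> openin (zar Y) B \<and> p \<in> tensor_functions X Y A B \<and> q \<in> tensor_functions X Y A B \<and>
           z \<in> A \<times> B \<and> q z \<noteq> 0 \<and> (\<forall>w\<in>U. w \<in> A \<times> B \<longrightarrow> q w \<noteq> 0 \<longrightarrow> c = p w / q w)"
        by (intro exI[of _ "pts X"] exI[of _ "pts Y"] exI[of _ "\<lambda>_. c"] exI[of _ "\<lambda>_. 1"]) (auto intro: tensor_const)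
    qed }
  { assume f: "f \<in> reg ?P U" and g: "g \<in> reg ?P U"
    have *: "\<exists>A B p q p' q'. openin (zar X) A \<and> openin (zar Y) B \<and> p \<in> tensor_functions X Y A B \<and> q \<in> tensor_functions X Y A B \<and>
           p' \<in> tensor_functions X Y A B \<and> q' \<in> tensor_functions X Y A B \<and>
           z \<in> A \<times> B \<and> q z \<noteq> 0 \<and> q' z \<noteq> 0 \<and> (\<forall>w\<in>U. w \<in> A \<times> B \<longrightarrow> q w \<noteq> 0 \<longrightarrow> q' w \<noteq> 0 \<longrightarrow> f w = p w / q w \<and> g w = p' w / q' w)"
      if z: "z \<in> U" for z
    proof -
      from reg_prodE[OF f z] obtain A B p q where 1: "openin (zar X) A" "openin (zar Y) B"
           "p \<in> tensor_functions X Y A B" "q \<in> tensor_functions X Y A B"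
           "z \<in> A \<times> B" "q z \<noteq> 0" "\<And>w. w\<in>U \<Longrightarrow> w \<in> A \<times> B \<Longrightarrow> q w \<noteq> 0 \<Longrightarrow> f w = p w / q w" by blast
      from reg_prodE[OF g z] obtain A' B' p' q' where 2: "openin (zar X) A'" "openin (zar Y) B'"
           "p' \<in> tensor_functions X Y A' B'" "q' \<in> tensor_functions X Y A' B'"
           "z \<in> A' \<times> B'" "q' z \<noteq> 0" "\<And>w. w\<in>U \<Longrightarrow> w \<in> A' \<times> B' \<Longrightarrow> q' w \<noteq> 0 \<Longrightarrow> g w = p' w / q' w" by blast
      let ?A = "A \<inter> A'" and ?B = "B \<inter> B'"
      have o: "openin (zar X) ?A" "openin (zar Y) ?B" using 1 2 by blast+
      have t: "p \<in> tensor_functions X Y ?A ?B" "q \<in> tensor_functions X Y ?A ?B"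
         "p' \<in> tensor_functions X Y ?A ?B" "q' \<in> tensor_functions X Y ?A ?B"
        by (intro tensor_restrict[OF 1(1,2) o _ _ 1(3)] tensor_restrict[OF 1(1,2) o _ _ 1(4)] tensor_restrict[OF 2(1,2) o _ _ 2(3)] tensor_restrict[OF 2(1,2) o _ _ 2(4)] Int_lower1 Int_lower2)+
      show ?thesis
        by (rule exI[of _ ?A], rule exI[of _ ?B], rule exI[of _ p], rule exI[of _ q], rule exI[of _ p'], rule exI[of _ q'])
           (use 1 2 o t in auto)
    qed
    show "(\<lambda>x. f x + g x) \<in> reg ?P U"
    proof (rule reg_prodI)
      fix z assume "z \<in> U"
      from *[OF this] obtain A B p q p' q' where 1: "openin (zar X) A" "openin (zar Y) B"
           "p \<in> tensor_functions X Y A B" "q \<in> tensor_functions X Y A B" "p' \<in> tensor_functions X Y A B" "q' \<in> tensor_functions X Y A B"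
           "z \<in> A \<times> B" "q z \<noteq> 0" "q' z \<noteq> 0"
           and 2: "\<forall>w\<in>U. w \<in> A \<times> B \<longrightarrow> q w \<noteq> 0 \<longrightarrow> q' w \<noteq> 0 \<longrightarrow> f w = p w / q w \<and> g w = p' w / q' w" by blast
      show "\<exists>A B p q. openin (zar X) A \<and> openin (zar Y) B \<and> p \<in> tensor_functions X Y A B \<and> q \<in> tensor_functions X Y A B \<and>
           z \<in> A \<times> B \<and> q z \<noteq> 0 \<and> (\<forall>w\<in>U. w \<in> A \<times> B \<longrightarrow> q w \<noteq> 0 \<longrightarrow> f w + g w = p w / q w)"
        by (rule exI[of _ A], rule exI[of _ B], rule exI[of _ "\<lambda>w. p w * q' w + p' w * q w"], rule exI[of _ "\<lambda>w. q w * q' w"])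
           (use 1 2 in \<open>auto intro!: tensor_mult tensor_add simp: add_frac_eq\<close>)
    qed
    show "(\<lambda>x. f x * g x) \<in> reg ?P U"
    proof (rule reg_prodI)
      fix z assume "z \<in> U"
      from *[OF this] obtain A B p q p' q' where 1: "openin (zar X) A" "openin (zar Y) B"
           "p \<in> tensor_functions X Y A B" "q \<in> tensor_functions X Y A B" "p' \<in> tensor_functions X Y A B" "q' \<in> tensor_functions X Y A B"
           "z \<in> A \<times> B" "q z \<noteq> 0" "q' z \<noteq> 0"
           and 2: "\<forall>w\<in>U. w \<in> A \<times> B \<longrightarrow> q w \<noteq> 0 \<longrightarrow> q' w \<noteq> 0 \<longrightarrow> f w = p w / q w \<and> g w = p' w / q' w" by blast
      show "\<exists>A B p q. openin (zar X) A \<and> openin (zar Y) B \<and> p \<in> tensor_functions X Y A B \<and> q \<in> tensor_functions X Y A B \<and>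
           z \<in> A \<times> B \<and> q z \<noteq> 0 \<and> (\<forall>w\<in>U. w \<in> A \<times> B \<longrightarrow> q w \<noteq> 0 \<longrightarrow> f w * g w = p w / q w)"
        by (rule exI[of _ A], rule exI[of _ B], rule exI[of _ "\<lambda>w. p w * p' w"], rule exI[of _ "\<lambda>w. q w * q' w"])
           (use 1 2 in \<open>auto intro!: tensor_mult\<close>)
    qed }
  { assume U: "openin (zar ?P) U" and f: "f \<in> reg ?P U"
    have *: "\<exists>A B p q. openin (zar X) A \<and> openin (zar Y) B \<and> p \<in> tensor_functions X Y A B \<and> q \<in> tensor_functions X Y A B \<and>
           z \<in> A \<times> B \<and> q z \<noteq> 0 \<and> (\<forall>w\<in>A \<times> B. q w \<noteq> 0 \<longrightarrow> w \<in> U \<and> f w = p w / q w)" if z: "z \<in> U" for z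
    proof -
      from reg_prodE[OF f z] obtain A' B' p q where 2: "openin (zar X) A'" "openin (zar Y) B'"
           "p \<in> tensor_functions X Y A' B'" "q \<in> tensor_functions X Y A' B'"
           "z \<in> A' \<times> B'" "q z \<noteq> 0" "\<And>w. w\<in>U \<Longrightarrow> w \<in> A' \<times> B' \<Longrightarrow> q w \<noteq> 0 \<Longrightarrow> f w = p w / q w" by blast
      from U z obtain A B h where "basic U z A B h" unfolding openin_prod by blast
      note 1 = this[unfolded basic_def]
      let ?A = "A \<inter> A'" and ?B = "B \<inter> B'"
      have o: "openin (zar X) ?A" "openin (zar Y) ?B" using 1 2 by blast+
      have t: "h \<in> tensor_functions X Y ?A ?B" "p \<in> tensor_functions X Y ?A ?B" "q \<in> tensor_functions X Y ?A ?B"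
        using 1 2 tensor_restrict[OF _ _ o, of A B h] tensor_restrict[OF 2(1,2) o _ _ 2(3)] tensor_restrict[OF 2(1,2) o _ _ 2(4)] by auto
      have w: "w \<in> U \<and> f w = (p w * h w) / (q w * h w)" if "w \<in> ?A \<times> ?B" "q w * h w \<noteq> 0" for w
      proof -
        have "w \<in> U" using 1 that by auto
        then show ?thesis using 2(7)[of w] that by auto
      qed
      show ?thesis
        by (rule exI[of _ ?A], rule exI[of _ ?B], rule exI[of _ "\<lambda>w. p w * h w"], rule exI[of _ "\<lambda>w. q w * h w"])
           (use 1 2 o w tensor_mult[OF o] t in auto)
    qed
    show "openin (zar ?P) {x\<in>U. f x \<noteq> 0}"
    proof (subst openin_subopen, safe)
      fix a b assume x: "(a,b) \<in> U" "f (a,b) \<noteq> 0"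
      from *[OF x(1)] obtain A B p q where 1: "openin (zar X) A" "openin (zar Y) B"
           "p \<in> tensor_functions X Y A B" "q \<in> tensor_functions X Y A B"
           "(a,b) \<in> A \<times> B" "q (a,b) \<noteq> 0" "\<forall>w\<in>A \<times> B. q w \<noteq> 0 \<longrightarrow> w \<in> U \<and> f w = p w / q w" by blast
      have "p (a,b) \<noteq> 0" using 1 x by auto
      show "\<exists>T. openin (zar ?P) T \<and> (a,b) \<in> T \<and> T \<subseteq> {x \<in> U. f x \<noteq> 0}"
        by (rule exI[of _ "{w\<in>A \<times> B. p w * q w \<noteq> 0}"])
           (use 1 \<open>p (a,b) \<noteq> 0\<close> openin_prod_basic[OF 1(1,2) tensor_mult[OF 1(1,2,3,4)]] in auto)
    qed
    show "(\<lambda>x. inverse (f x)) \<in> reg ?P {x\<in>U. f x \<noteq> 0}"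
    proof (rule reg_prodI)
      fix x assume x: "x \<in> {x\<in>U. f x \<noteq> 0}"
      then have "x \<in> U" by simp
      from *[OF this] obtain A B p q where 1: "openin (zar X) A" "openin (zar Y) B"
           "p \<in> tensor_functions X Y A B" "q \<in> tensor_functions X Y A B"
           "x \<in> A \<times> B" "q x \<noteq> 0" "\<forall>w\<in>A \<times> B. q w \<noteq> 0 \<longrightarrow> w \<in> U \<and> f w = p w / q w" by blast
      have "p x \<noteq> 0" using 1 x by auto
      show "\<exists>A B r s. openin (zar X) A \<and> openin (zar Y) B \<and> r \<in> tensor_functions X Y A B \<and> s \<in> tensor_functions X Y A B \<and>
           x \<in> A \<times> B \<and> s x \<noteq> 0 \<and> (\<forall>w\<in>{x\<in>U. f x \<noteq> 0}. w \<in> A \<times> B \<longrightarrow> s w \<noteq> 0 \<longrightarrow> inverse (f w) = r w / s w)"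
        by (rule exI[of _ A], rule exI[of _ B], rule exI[of _ "\<lambda>w. q w * q w"], rule exI[of _ "\<lambda>w. p w * q w"])
           (use 1 \<open>p x \<noteq> 0\<close> in \<open>auto intro!: tensor_mult\<close>)
    qed }
qed

lemma morphism_fst: "morphism (prod_space X Y) X fst"
  unfolding morphism_def continuous_map_def
proof (intro conjI allI impI)
  show "fst \<in> pts (prod_space X Y) \<rightarrow> pts X" by (auto simp: pts_prod)
  have *: "{x \<in> pts (prod_space X Y). fst x \<in> U} = U \<times> pts Y" if "openin (zar X) U" for U
    using openin_subset[OF that] by (auto simp: pts_prod)
  fix U assume "openin (zar X) U"
  then show "openin (zar (prod_space X Y)) {x \<in> pts (prod_space X Y). fst x \<in> U}"
    by (simp add: * openin_prod_Times)
next
  fix V h assume "openin (zar X) V \<and> h \<in> reg X V"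
  then have V: "openin (zar X) V" "h \<in> reg X V" by auto
  have t: "(\<lambda>z. h (fst z)) \<in> tensor_functions X Y V (pts Y)"
    using tensor_simple[OF V(2) Y.const[of "pts Y" 1]] by simp
  show "(\<lambda>x. h (fst x)) \<in> reg (prod_space X Y) {x \<in> pts (prod_space X Y). fst x \<in> V}"
    by (rule reg_prodI, rule exI[of _ V], rule exI[of _ "pts Y"], rule exI[of _ "\<lambda>z. h (fst z)"], rule exI[of _ "\<lambda>_. 1"])
       (use V t in \<open>auto simp: pts_prod intro: tensor_const\<close>)
qed

lemma morphism_snd: "morphism (prod_space X Y) Y snd"
  unfolding morphism_def continuous_map_def
proof (intro conjI allI impI)
  show "snd \<in> pts (prod_space X Y) \<rightarrow> pts Y" by (auto simp: pts_prod)
  have *: "{x \<in> pts (prod_space X Y). snd x \<in> U} = pts X \<times> U" if "openin (zar Y) U" for U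
    using openin_subset[OF that] by (auto simp: pts_prod)
  fix U assume "openin (zar Y) U"
  then show "openin (zar (prod_space X Y)) {x \<in> pts (prod_space X Y). snd x \<in> U}"
    by (simp add: * openin_prod_Times)
next
  fix V h assume "openin (zar Y) V \<and> h \<in> reg Y V"
  then have V: "openin (zar Y) V" "h \<in> reg Y V" by auto
  have t: "(\<lambda>z. h (snd z)) \<in> tensor_functions X Y (pts X) V"
    using tensor_simple[OF X.const[of "pts X" 1] V(2)] by simp
  show "(\<lambda>x. h (snd x)) \<in> reg (prod_space X Y) {x \<in> pts (prod_space X Y). snd x \<in> V}"
    by (rule reg_prodI, rule exI[of _ "pts X"], rule exI[of _ V], rule exI[of _ "\<lambda>z. h (snd z)"], rule exI[of _ "\<lambda>_. 1"])
       (use V t in \<open>auto simp: pts_prod intro: tensor_const\<close>)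
qed

lemma morphism_pair:
  assumes Z: "space_with_functions Z" and f: "morphism Z X f" and g: "morphism Z Y g"
  shows "morphism Z (prod_space X Y) (\<lambda>z. (f z, g z))"
proof -
  interpret Z: space_with_functions Z by fact
  let ?D = "\<lambda>U V. {z\<in>pts Z. f z \<in> U} \<inter> {z\<in>pts Z. g z \<in> V}"
  have D: "openin (zar Z) (?D U V)" if "openin (zar X) U" "openin (zar Y) V" for U V
    using morphismD(3)[OF f that(1)] morphismD(3)[OF g that(2)] by blast
  have t: "(\<lambda>z. h (f z, g z)) \<in> reg Z (?D U V)"
    if "openin (zar X) U" "openin (zar Y) V" "h \<in> tensor_functions X Y U V" for h U V
  proof -
    from that(3) obtain m a b where h: "h = (\<lambda>z. \<Sum>i<m. a i (fst z) * b i (snd z))"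
      "\<And>i. i < (m::nat) \<Longrightarrow> a i \<in> reg X U" "\<And>i. i < m \<Longrightarrow> b i \<in> reg Y V" by (rule tensorE) blast
    have "(\<lambda>z. a i (f z)) \<in> reg Z (?D U V)" "(\<lambda>z. b i (g z)) \<in> reg Z (?D U V)" if "i < m" for i
      using Z.restrict[OF morphismD(3)[OF f \<open>openin (zar X) U\<close>] D[OF \<open>openin (zar X) U\<close> \<open>openin (zar Y) V\<close>] _
             morphismD(4)[OF f \<open>openin (zar X) U\<close> h(2)[OF that]]]
        Z.restrict[OF morphismD(3)[OF g \<open>openin (zar Y) V\<close>] D[OF \<open>openin (zar X) U\<close> \<open>openin (zar Y) V\<close>] _
             morphismD(4)[OF g \<open>openin (zar Y) V\<close> h(3)[OF that]]] by auto
    then show ?thesis unfolding h(1) fst_conv snd_conv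
      by (intro Z.sum_reg Z.mult D that) auto
  qed
  have pre: "openin (zar Z) {z\<in>pts Z. (f z, g z) \<in> W}" if W: "openin (zar (prod_space X Y)) W" for W
  proof (subst openin_subopen, safe)
    fix z assume z: "z \<in> pts Z" "(f z, g z) \<in> W"
    with W obtain U V h where "basic W (f z, g z) U V h" unfolding openin_prod by blast
    note 1 = this[unfolded basic_def]
    then have o: "openin (zar Z) {w \<in> ?D U V. h (f w, g w) \<noteq> 0}" using Z.nonzero[OF D t] by blast
    show "\<exists>T. openin (zar Z) T \<and> z \<in> T \<and> T \<subseteq> {z \<in> pts Z. (f z, g z) \<in> W}"
      by (rule exI[of _ "{w \<in> ?D U V. h (f w, g w) \<noteq> 0}"]) (use 1 z o in auto)
  qed
  show ?thesis unfolding morphism_def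
  proof (intro conjI allI impI)
    show "continuous_map (zar Z) (zar (prod_space X Y)) (\<lambda>z. (f z, g z))"
      unfolding continuous_map_def using pre morphismD(2)[OF f] morphismD(2)[OF g] by (auto simp: pts_prod)
    fix W h assume "openin (zar (prod_space X Y)) W \<and> h \<in> reg (prod_space X Y) W"
    then have W: "openin (zar (prod_space X Y)) W" and h: "h \<in> reg (prod_space X Y) W" by auto
    show "(\<lambda>z. h (f z, g z)) \<in> reg Z {z \<in> pts Z. (f z, g z) \<in> W}"
    proof (rule Z.glue[OF pre[OF W]])
      fix z assume z: "z \<in> {z \<in> pts Z. (f z, g z) \<in> W}"
      then have "(f z, g z) \<in> W" by simp
      from reg_prodE[OF h this] obtain A B p q where 1: "openin (zar X) A" "openin (zar Y) B"
           "p \<in> tensor_functions X Y A B" "q \<in> tensor_functions X Y A B"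
           "(f z, g z) \<in> A \<times> B" "q (f z, g z) \<noteq> 0" "\<And>w. w\<in>W \<Longrightarrow> w \<in> A \<times> B \<Longrightarrow> q w \<noteq> 0 \<Longrightarrow> h w = p w / q w" by blast
      note o1 = Z.nonzero[OF D[OF 1(1,2)] t[OF 1(1,2,4)]]
      have o: "openin (zar Z) ({w\<in>?D A B. q (f w, g w) \<noteq> 0} \<inter> {z \<in> pts Z. (f z, g z) \<in> W})" (is "openin _ ?T")
        using o1 pre[OF W] by blast
      have "(\<lambda>z. p (f z, g z)) \<in> reg Z ?T" "(\<lambda>z. q (f z, g z)) \<in> reg Z ?T"
        using Z.restrict[OF D[OF 1(1,2)] o _ t[OF 1(1,2,3)]] Z.restrict[OF D[OF 1(1,2)] o _ t[OF 1(1,2,4)]] by auto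
      then have "(\<lambda>z. p (f z, g z) / q (f z, g z)) \<in> reg Z ?T"
        using Z.divide_reg[OF o] by auto
      then show "\<exists>V ga. openin (zar Z) V \<and> z \<in> V \<and> V \<subseteq> {z \<in> pts Z. (f z, g z) \<in> W} \<and> ga \<in> reg Z V \<and> (\<forall>y\<in>V. h (f y, g y) = ga y)"
        by (intro exI[of _ ?T] exI[of _ "\<lambda>z. p (f z, g z) / q (f z, g z)"]) (use o z 1 in auto)
    qed
  qed
qed

end

section \<open>Affine spaces and varieties\<close>

text \<open>
  Points of affine \<open>n\<close>-space are lists of length \<open>n\<close>, and \<open>polyfun n\<close> is the algebra of polynomial
  functions in the first \<open>n\<close> entries. In \<open>affine_space\<close>, the condition on \<open>f\<close> says that \<open>f = p / q\<close> on the
  neighbourhood \<open>{y \<in> U. q y \<noteq> 0}\<close> of \<open>x\<close>; allowing smaller neighbourhoods gives nothing new, because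
  one may multiply \<open>p\<close> and \<open>q\<close> by a further polynomial.
\<close>

inductive_set polyfun :: "nat \<Rightarrow> ('k::field list \<Rightarrow> 'k) set" for n :: nat where
  polyfun_const: "(\<lambda>_. c) \<in> polyfun n"
| polyfun_coord: "i < n \<Longrightarrow> (\<lambda>x. x ! i) \<in> polyfun n"
| polyfun_add: "f \<in> polyfun n \<Longrightarrow> g \<in> polyfun n \<Longrightarrow> (\<lambda>x. f x + g x) \<in> polyfun n"
| polyfun_mult: "f \<in> polyfun n \<Longrightarrow> g \<in> polyfun n \<Longrightarrow> (\<lambda>x. f x * g x) \<in> polyfun n"

definition affine_space :: "nat \<Rightarrow> ('k::field, 'k list) space" where
  "affine_space n = Space
     (topology (\<lambda>U. \<exists>S\<subseteq>polyfun n. U = {x. length x = n \<and> (\<exists>f\<in>S. f x \<noteq> 0)}))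
     (\<lambda>U. {f. \<forall>x\<in>U. \<exists>p\<in>polyfun n. \<exists>q\<in>polyfun n. q x \<noteq> 0 \<and> (\<forall>y\<in>U. q y \<noteq> 0 \<longrightarrow> f y = p y / q y)})"

definition affine_variety :: "('k::field, 'p) space \<Rightarrow> bool" where
  "affine_variety X \<longleftrightarrow> (\<exists>n Z. closedin (zar (affine_space n)) Z \<and> iso_spaces X (sub_space (affine_space n) Z))"

definition finite_affine_cover :: "('k::field, 'p) space \<Rightarrow> bool" where
  "finite_affine_cover X \<longleftrightarrow>
     (\<exists>\<U>. finite \<U> \<and> \<Union>\<U> = pts X \<and> (\<forall>U\<in>\<U>. openin (zar X) U \<and> affine_variety (sub_space X U)))"

definition separated :: "('k::field, 'p) space \<Rightarrow> bool" where
  "separated X \<longleftrightarrow> closedin (zar (prod_space X X)) ((\<lambda>x. (x, x)) ` pts X)"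

definition variety :: "('k::field, 'p) space \<Rightarrow> bool" where
  "variety X \<longleftrightarrow> space_with_functions X \<and> finite_affine_cover X \<and> separated X"

lemma istopology_affine:
  "istopology (\<lambda>U. \<exists>S\<subseteq>polyfun n. U = {x::'k::field list. length x = n \<and> (\<exists>f\<in>S. f x \<noteq> 0)})"
  unfolding istopology_def
proof (rule conjI; intro allI impI)
  fix U V :: "'k list set"
  assume "\<exists>S\<subseteq>polyfun n. U = {x. length x = n \<and> (\<exists>f\<in>S. f x \<noteq> 0)}" "\<exists>S\<subseteq>polyfun n. V = {x. length x = n \<and> (\<exists>f\<in>S. f x \<noteq> 0)}"
  then obtain S T where S: "S \<subseteq> polyfun n" "U = {x. length x = n \<and> (\<exists>f\<in>S. f x \<noteq> 0)}"
    and T: "T \<subseteq> polyfun n" "V = {x. length x = n \<and> (\<exists>f\<in>T. f x \<noteq> 0)}" by blast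
  show "\<exists>S\<subseteq>polyfun n. U \<inter> V = {x. length x = n \<and> (\<exists>f\<in>S. f x \<noteq> 0)}"
  proof (intro exI conjI)
    let ?R = "{\<lambda>x. f x * g x | f g. f \<in> S \<and> g \<in> T}"
    show "?R \<subseteq> polyfun n" using S(1) T(1) by (auto intro: polyfun_mult)
    show "U \<inter> V = {x. length x = n \<and> (\<exists>f\<in>?R. f x \<noteq> 0)}"
    proof (intro Set.set_eqI iffI)
      fix x assume "x \<in> U \<inter> V"
      then obtain f g where "length x = n" "f \<in> S" "g \<in> T" "f x * g x \<noteq> 0" using S(2) T(2) by auto
      then show "x \<in> {x. length x = n \<and> (\<exists>f\<in>?R. f x \<noteq> 0)}"
        by (intro CollectI conjI bexI[of _ "\<lambda>x. f x * g x"]) blast+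
    next
      fix x assume "x \<in> {x. length x = n \<and> (\<exists>f\<in>?R. f x \<noteq> 0)}"
      then obtain f g where "length x = n" "f \<in> S" "g \<in> T" "f x * g x \<noteq> 0" by blast
      then show "x \<in> U \<inter> V" using S(2) T(2) by auto
    qed
  qed
next
  fix K :: "'k list set set" assume "\<forall>U\<in>K. \<exists>S\<subseteq>polyfun n. U = {x. length x = n \<and> (\<exists>f\<in>S. f x \<noteq> 0)}"
  then have "\<forall>U\<in>K. \<exists>S. S \<subseteq> polyfun n \<and> U = {x. length x = n \<and> (\<exists>f\<in>S. f x \<noteq> 0)}" by blast
  from bchoice[OF this] obtain S
    where S: "\<forall>U\<in>K. S U \<subseteq> polyfun n \<and> U = {x. length x = n \<and> (\<exists>f\<in>S U. f x \<noteq> 0)}" ..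
  have eq: "x \<in> \<Union>K \<longleftrightarrow> length x = n \<and> (\<exists>f\<in>(\<Union>U\<in>K. S U). f x \<noteq> 0)" for x
  proof -
    have eq: "x \<in> \<Union>K \<longleftrightarrow> (\<exists>U\<in>K. x \<in> U)" by blast
    also have "\<dots> \<longleftrightarrow> (\<exists>U\<in>K. length x = n \<and> (\<exists>f\<in>S U. f x \<noteq> 0))"
    proof (rule bex_cong[OF refl])
      fix U assume "U \<in> K"
      then have "U = {x. length x = n \<and> (\<exists>f\<in>S U. f x \<noteq> 0)}" using S by blast
      then show "x \<in> U \<longleftrightarrow> length x = n \<and> (\<exists>f\<in>S U. f x \<noteq> 0)" by blast
    qed
    finally show ?thesis by blast
  qed
  show "\<exists>S\<subseteq>polyfun n. \<Union>K = {x. length x = n \<and> (\<exists>f\<in>S. f x \<noteq> 0)}"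
  proof (intro exI conjI)
    show "(\<Union>U\<in>K. S U) \<subseteq> polyfun n" by (rule UN_least) (use S in blast)
    show "\<Union>K = {x. length x = n \<and> (\<exists>f\<in>(\<Union>U\<in>K. S U). f x \<noteq> 0)}"
      by (rule Set.set_eqI) (simp only: mem_Collect_eq eq)
  qed
qed

lemma openin_affine:
  "openin (zar (affine_space n)) U \<longleftrightarrow> (\<exists>S\<subseteq>polyfun n. U = {x. length x = n \<and> (\<exists>f\<in>S. f x \<noteq> 0)})"
  unfolding affine_space_def space.sel topology_inverse'[OF istopology_affine] ..

lemma openin_affine_basic: "f \<in> polyfun n \<Longrightarrow> openin (zar (affine_space n)) {x. length x = n \<and> f x \<noteq> 0}"
  unfolding openin_affine by (rule exI[of _ "{f}"]) auto

lemma pts_affine: "pts (affine_space n) = {x. length x = n}"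
proof
  show "pts (affine_space n) \<subseteq> {x. length x = n}"
    using openin_topspace[of "zar (affine_space n)"] unfolding openin_affine by blast
  show "{x. length x = n} \<subseteq> pts (affine_space n)"
    using openin_subset[OF openin_affine_basic[OF polyfun_const[of 1]]] by simp
qed

lemma closedin_affine:
  "closedin (zar (affine_space n)) Z \<longleftrightarrow> (\<exists>S\<subseteq>polyfun n. Z = {x. length x = n \<and> (\<forall>f\<in>S. f x = 0)})"
  unfolding closedin_def pts_affine openin_affine
proof safe
  fix S assume S: "S \<subseteq> polyfun n" "Z \<subseteq> {x. length x = n}" "{x. length x = n} - Z = {x. length x = n \<and> (\<exists>f\<in>S. f x \<noteq> 0)}"
  show "\<exists>S\<subseteq>polyfun n. Z = {x. length x = n \<and> (\<forall>f\<in>S. f x = 0)}"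
    by (rule exI[of _ S]) (use S in blast)
qed auto

lemma reg_affine:
  "f \<in> reg (affine_space n) U \<longleftrightarrow>
   (\<forall>x\<in>U. \<exists>p\<in>polyfun n. \<exists>q\<in>polyfun n. q x \<noteq> 0 \<and> (\<forall>y\<in>U. q y \<noteq> 0 \<longrightarrow> f y = p y / q y))"
  by (simp add: affine_space_def)

lemma affine_swf: "space_with_functions (affine_space n :: ('k::field, 'k list) space)"
proof
  let ?A = "affine_space n :: ('k, 'k list) space"
  fix U V :: "'k list set" and f g :: "'k list \<Rightarrow> 'k"
  { assume VU: "V \<subseteq> U" and f: "f \<in> reg ?A U"
    show "f \<in> reg ?A V" unfolding reg_affine
    proof
      fix x assume "x \<in> V"
      then obtain p q where "p\<in>polyfun n" "q\<in>polyfun n" "q x \<noteq> 0" "\<forall>y\<in>U. q y \<noteq> 0 \<longrightarrow> f y = p y / q y"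
        using VU f unfolding reg_affine by blast
      then show "\<exists>p\<in>polyfun n. \<exists>q\<in>polyfun n. q x \<noteq> 0 \<and> (\<forall>y\<in>V. q y \<noteq> 0 \<longrightarrow> f y = p y / q y)"
        by (intro bexI[of _ p] bexI[of _ q]) (use VU in auto)
    qed }
  { assume U: "openin (zar ?A) U"
      and g: "\<And>x. x \<in> U \<Longrightarrow> \<exists>V g. openin (zar ?A) V \<and> x \<in> V \<and> V \<subseteq> U \<and> g \<in> reg ?A V \<and> (\<forall>y\<in>V. f y = g y)"
    show "f \<in> reg ?A U" unfolding reg_affine
    proof
      fix x assume x: "x \<in> U"
      from g[OF this] obtain W g where W: "openin (zar ?A) W" "x \<in> W" "W \<subseteq> U" "g \<in> reg ?A W" "\<forall>y\<in>W. f y = g y" by blast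
      from W(2,4) obtain p q where pq: "p \<in> polyfun n" "q \<in> polyfun n" "q x \<noteq> 0" "\<forall>y\<in>W. q y \<noteq> 0 \<longrightarrow> g y = p y / q y"
        unfolding reg_affine by blast
      from W(1,2) obtain h where h: "h \<in> polyfun n" "h x \<noteq> 0" "\<And>y. length y = n \<Longrightarrow> h y \<noteq> 0 \<Longrightarrow> y \<in> W"
        unfolding openin_affine by blast
      have len: "length y = n" if "y \<in> U" for y using openin_subset[OF U] that by (auto simp: pts_affine)
      show "\<exists>p\<in>polyfun n. \<exists>q\<in>polyfun n. q x \<noteq> 0 \<and> (\<forall>y\<in>U. q y \<noteq> 0 \<longrightarrow> f y = p y / q y)"
        by (rule bexI[of _ "\<lambda>y. p y * h y"], rule bexI[of _ "\<lambda>y. q y * h y"])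
           (use pq h W(5) len in \<open>auto intro!: polyfun_mult\<close>)
    qed }
  { fix c show "(\<lambda>_. c) \<in> reg ?A U" unfolding reg_affine
      by (intro ballI bexI[of _ "\<lambda>_. c"] bexI[of _ "\<lambda>_. 1"]) (auto intro: polyfun_const) }
  { assume f: "f \<in> reg ?A U" and g: "g \<in> reg ?A U"
    have *: "\<exists>p\<in>polyfun n. \<exists>q\<in>polyfun n. \<exists>p'\<in>polyfun n. \<exists>q'\<in>polyfun n. q x \<noteq> 0 \<and> q' x \<noteq> 0 \<and>
        (\<forall>y\<in>U. q y \<noteq> 0 \<longrightarrow> q' y \<noteq> 0 \<longrightarrow> f y = p y / q y \<and> g y = p' y / q' y)" if "x \<in> U" for x
      using f g that unfolding reg_affine by (metis (no_types, lifting))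
    show "(\<lambda>x. f x + g x) \<in> reg ?A U" unfolding reg_affine
    proof
      fix x assume "x \<in> U"
      with *[OF this] obtain p q p' q' where "p\<in>polyfun n" "q\<in>polyfun n" "p'\<in>polyfun n" "q'\<in>polyfun n" "q x \<noteq> 0" "q' x \<noteq> 0"
        "\<forall>y\<in>U. q y \<noteq> 0 \<longrightarrow> q' y \<noteq> 0 \<longrightarrow> f y = p y / q y \<and> g y = p' y / q' y" by blast
      then show "\<exists>p\<in>polyfun n. \<exists>q\<in>polyfun n. q x \<noteq> 0 \<and> (\<forall>y\<in>U. q y \<noteq> 0 \<longrightarrow> f y + g y = p y / q y)"
        by (intro bexI[of _ "\<lambda>w. p w * q' w + p' w * q w"] bexI[of _ "\<lambda>y. q y * q' y"])
           (auto intro!: polyfun_mult polyfun_add simp: add_frac_eq)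
    qed
    show "(\<lambda>x. f x * g x) \<in> reg ?A U" unfolding reg_affine
    proof
      fix x assume "x \<in> U"
      with *[OF this] obtain p q p' q' where "p\<in>polyfun n" "q\<in>polyfun n" "p'\<in>polyfun n" "q'\<in>polyfun n" "q x \<noteq> 0" "q' x \<noteq> 0"
        "\<forall>y\<in>U. q y \<noteq> 0 \<longrightarrow> q' y \<noteq> 0 \<longrightarrow> f y = p y / q y \<and> g y = p' y / q' y" by blast
      then show "\<exists>p\<in>polyfun n. \<exists>q\<in>polyfun n. q x \<noteq> 0 \<and> (\<forall>y\<in>U. q y \<noteq> 0 \<longrightarrow> f y * g y = p y / q y)"
        by (intro bexI[of _ "\<lambda>w. p w * p' w"] bexI[of _ "\<lambda>y. q y * q' y"])
           (auto intro!: polyfun_mult)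
    qed }
  { assume U: "openin (zar ?A) U" and f: "f \<in> reg ?A U"
    show "openin (zar ?A) {x\<in>U. f x \<noteq> 0}"
    proof (subst openin_subopen, safe)
      fix x assume x: "x \<in> U" "f x \<noteq> 0"
      then obtain p q where pq: "p \<in> polyfun n" "q \<in> polyfun n" "q x \<noteq> 0" "\<forall>y\<in>U. q y \<noteq> 0 \<longrightarrow> f y = p y / q y"
        using f unfolding reg_affine by blast
      have len: "length x = n" using openin_subset[OF U] x by (auto simp: pts_affine)
      show "\<exists>T. openin (zar ?A) T \<and> x \<in> T \<and> T \<subseteq> {x \<in> U. f x \<noteq> 0}"
        by (rule exI[of _ "{x. length x = n \<and> p x * q x \<noteq> 0} \<inter> U"])
           (use pq len x openin_affine_basic[OF polyfun_mult[OF pq(1,2)]] U in auto)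
    qed
    show "(\<lambda>x. inverse (f x)) \<in> reg ?A {x\<in>U. f x \<noteq> 0}" unfolding reg_affine
    proof
      fix x assume x: "x \<in> {x\<in>U. f x \<noteq> 0}"
      then obtain p q where pq: "p \<in> polyfun n" "q \<in> polyfun n" "q x \<noteq> 0" "\<forall>y\<in>U. q y \<noteq> 0 \<longrightarrow> f y = p y / q y"
        using f unfolding reg_affine by blast
      show "\<exists>p\<in>polyfun n. \<exists>q\<in>polyfun n. q x \<noteq> 0 \<and> (\<forall>y\<in>{x\<in>U. f x \<noteq> 0}. q y \<noteq> 0 \<longrightarrow> inverse (f y) = p y / q y)"
        by (rule bexI[of _ "\<lambda>y. q y * q y"], rule bexI[of _ "\<lambda>y. p y * q y"])
           (use pq x in \<open>auto intro!: polyfun_mult\<close>)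
    qed }
qed

lemma coord_reg: "i < n \<Longrightarrow> (\<lambda>x. x ! i) \<in> reg (affine_space n) U"
  unfolding reg_affine
  by (intro ballI bexI[of _ "\<lambda>x. x ! i"] bexI[of _ "\<lambda>_. 1"]) (auto intro: polyfun_const polyfun_coord)

lemma polyfun_reg: "f \<in> polyfun n \<Longrightarrow> f \<in> reg (affine_space n) U"
  unfolding reg_affine
  by (intro ballI bexI[of _ f] bexI[of _ "\<lambda>_. 1"]) (auto intro: polyfun_const)

lemma morphism_affine:
  fixes f :: "'p \<Rightarrow> 'k::field list" and X :: "('k, 'p) space"
  assumes X: "space_with_functions X"
    and len: "\<And>x. x \<in> pts X \<Longrightarrow> length (f x) = n"
    and coord: "\<And>i. i < n \<Longrightarrow> (\<lambda>x. f x ! i) \<in> reg X (pts X)"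
  shows "morphism X (affine_space n) f"
proof -
  interpret X: space_with_functions X by fact
  have p: "(\<lambda>x. p (f x)) \<in> reg X (pts X)" if "p \<in> polyfun n" for p
    using that by induction (auto intro: X.const X.add X.mult coord)
  have pre: "openin (zar X) {x\<in>pts X. f x \<in> V}" if "openin (zar (affine_space n)) V" for V
  proof (subst openin_subopen, safe)
    fix x assume x: "x \<in> pts X" "f x \<in> V"
    from that this obtain h where h: "h \<in> polyfun n" "h (f x) \<noteq> 0" "\<And>y. length y = n \<Longrightarrow> h y \<noteq> 0 \<Longrightarrow> y \<in> V"
      unfolding openin_affine by blast
    show "\<exists>T. openin (zar X) T \<and> x \<in> T \<and> T \<subseteq> {x \<in> pts X. f x \<in> V}"
      by (rule exI[of _ "{x\<in>pts X. h (f x) \<noteq> 0}"]) (use h x len X.nonzero[OF _ p[OF h(1)]] in auto)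
  qed
  show ?thesis unfolding morphism_def
  proof (intro conjI allI impI)
    show "continuous_map (zar X) (zar (affine_space n)) f"
      unfolding continuous_map_def using pre len by (auto simp: pts_affine)
    fix V :: "'k list set" and h assume "openin (zar (affine_space n)) V \<and> h \<in> reg (affine_space n) V"
    then have V: "openin (zar (affine_space n)) V" and h: "h \<in> reg (affine_space n) V" by auto
    show "(\<lambda>x. h (f x)) \<in> reg X {x \<in> pts X. f x \<in> V}"
    proof (rule X.glue[OF pre[OF V]])
      fix x assume x: "x \<in> {x \<in> pts X. f x \<in> V}"
      with h obtain r s where rs: "r\<in>polyfun n" "s\<in>polyfun n" "s (f x) \<noteq> 0" "\<forall>y\<in>V. s y \<noteq> 0 \<longrightarrow> h y = r y / s y"
        unfolding reg_affine by blast
      let ?T = "{x\<in>pts X. s (f x) \<noteq> 0} \<inter> {x \<in> pts X. f x \<in> V}"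
      have o: "openin (zar X) ?T" using X.nonzero[OF _ p[OF rs(2)]] pre[OF V] by auto
      have "(\<lambda>x. r (f x)) \<in> reg X ?T" "(\<lambda>x. s (f x)) \<in> reg X ?T"
        using X.restrict[OF openin_topspace o _ p[OF rs(1)]] X.restrict[OF openin_topspace o _ p[OF rs(2)]] by auto
      then have "(\<lambda>x. r (f x) / s (f x)) \<in> reg X ?T" using X.divide_reg[OF o] by auto
      then show "\<exists>V' g. openin (zar X) V' \<and> x \<in> V' \<and> V' \<subseteq> {x \<in> pts X. f x \<in> V} \<and> g \<in> reg X V' \<and> (\<forall>y\<in>V'. h (f y) = g y)"
        by (intro exI[of _ ?T] exI[of _ "\<lambda>x. r (f x) / s (f x)"]) (use o x rs in auto)
    qed
  qed
qed

lemma morphism_reg: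
  assumes "morphism X Y f" "h \<in> reg Y (pts Y)"
  shows "(\<lambda>x. h (f x)) \<in> reg X (pts X)"
proof -
  have "{x\<in>pts X. f x \<in> pts Y} = pts X" using morphismD(2)[OF assms(1)] by auto
  then show ?thesis using morphismD(4)[OF assms(1) openin_topspace assms(2)] by simp
qed

section \<open>The Hilbert basis theorem\<close>

inductive_set pideal :: "nat \<Rightarrow> ('k::field list \<Rightarrow> 'k) set \<Rightarrow> ('k list \<Rightarrow> 'k) set" for n T where
  pideal_zero: "(\<lambda>_. 0) \<in> pideal n T"
| pideal_step: "t \<in> T \<Longrightarrow> c \<in> polyfun n \<Longrightarrow> h \<in> pideal n T \<Longrightarrow> (\<lambda>x. c x * t x + h x) \<in> pideal n T"

lemma pideal_add: "f \<in> pideal n T \<Longrightarrow> g \<in> pideal n T \<Longrightarrow> (\<lambda>x. f x + g x) \<in> pideal n T"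
  by (induction rule: pideal.induct) (auto simp: add.assoc intro: pideal_step)

lemma pideal_mult: "f \<in> pideal n T \<Longrightarrow> c \<in> polyfun n \<Longrightarrow> (\<lambda>x. c x * f x) \<in> pideal n T"
proof (induction rule: pideal.induct)
  case (pideal_step t d h)
  then show ?case using pideal.pideal_step[of t T "\<lambda>x. c x * d x" n "\<lambda>x. c x * h x"]
    by (auto simp: algebra_simps intro: polyfun_mult)
qed (simp add: pideal_zero)

lemma pideal_base: "t \<in> T \<Longrightarrow> t \<in> pideal n T"
  using pideal_step[of t T "\<lambda>_. 1" n "\<lambda>_. 0"] by (simp add: polyfun_const pideal_zero)

lemma pideal_sub: "f \<in> pideal n T \<Longrightarrow> g \<in> pideal n T \<Longrightarrow> (\<lambda>x. f x - g x) \<in> pideal n T"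
  using pideal_add[OF _ pideal_mult[OF _ polyfun_const[of "-1"]], of f n T g] by simp

lemma pideal_trans: "f \<in> pideal n S \<Longrightarrow> S \<subseteq> pideal n T \<Longrightarrow> f \<in> pideal n T"
proof (induction rule: pideal.induct)
  case (pideal_step t c h)
  then show ?case using pideal_add[OF pideal_mult[of t n T c]] by blast
qed (rule pideal_zero)

lemma pideal_mono: "S \<subseteq> T \<Longrightarrow> pideal n S \<subseteq> pideal n T"
  using pideal_trans pideal_base by blast

lemma pideal_finite: "f \<in> pideal n S \<Longrightarrow> \<exists>T\<subseteq>S. finite T \<and> f \<in> pideal n T"
proof (induction rule: pideal.induct)
  case pideal_zero
  then show ?case by (intro exI[of _ "{}"]) (auto intro: pideal.pideal_zero)
next
  case (pideal_step t c h)
  then obtain T where T: "T \<subseteq> S" "finite T" "h \<in> pideal n T" by blast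
  show ?case
    by (rule exI[of _ "insert t T"])
       (use T pideal_step pideal_mono[of T "insert t T" n] in \<open>auto intro!: pideal.pideal_step\<close>)
qed

lemma pideal_finite_set: "finite F \<Longrightarrow> F \<subseteq> pideal n S \<Longrightarrow> \<exists>T\<subseteq>S. finite T \<and> F \<subseteq> pideal n T"
proof (induction rule: finite_induct)
  case (insert f F)
  then obtain T where T: "T \<subseteq> S" "finite T" "F \<subseteq> pideal n T" by auto
  from insert obtain T' where T': "T' \<subseteq> S" "finite T'" "f \<in> pideal n T'" using pideal_finite[of f n S] by auto
  show ?case by (rule exI[of _ "T \<union> T'"]) (use T T' pideal_mono[of T "T \<union> T'" n] pideal_mono[of T' "T \<union> T'" n] in auto)
qed auto

lemma polyfun_mono: "f \<in> polyfun m \<Longrightarrow> m \<le> n \<Longrightarrow> f \<in> polyfun n"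
  by (induction rule: polyfun.induct) (auto intro: polyfun.intros)

definition leadc :: "nat \<Rightarrow> ('k::field list \<Rightarrow> 'k) set \<Rightarrow> nat \<Rightarrow> ('k list \<Rightarrow> 'k) set" where
  "leadc n I d = {t\<in>polyfun n. \<exists>g. (\<forall>i. g i \<in> polyfun n) \<and> (\<lambda>x. t x * (x ! n) ^ d + (\<Sum>i<d. g i x * (x ! n) ^ i)) \<in> I}"

lemma leadc_mono: "I \<subseteq> J \<Longrightarrow> leadc n I d \<subseteq> leadc n J d"
  unfolding leadc_def by blast

lemma leadc_Suc: "leadc n (pideal (Suc n) S) d \<subseteq> leadc n (pideal (Suc n) S) (Suc d)"
proof
  fix t assume "t \<in> leadc n (pideal (Suc n) S) d"
  then obtain g where t: "t \<in> polyfun n" and g: "\<forall>i. g i \<in> polyfun n"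
    "(\<lambda>x. t x * (x ! n) ^ d + (\<Sum>i<d. g i x * (x ! n) ^ i)) \<in> pideal (Suc n) S" unfolding leadc_def by blast
  have "(\<lambda>x. (x ! n) * (t x * (x ! n) ^ d + (\<Sum>i<d. g i x * (x ! n) ^ i))) \<in> pideal (Suc n) S"
    by (rule pideal_mult[OF g(2) polyfun_coord]) simp
  moreover have "(x ! n) * (t x * (x ! n) ^ d + (\<Sum>i<d. g i x * (x ! n) ^ i)) =
     t x * (x ! n) ^ Suc d + (\<Sum>i<Suc d. (case i of 0 \<Rightarrow> (\<lambda>_. 0) | Suc j \<Rightarrow> g j) x * (x ! n) ^ i)" for x
    unfolding sum.lessThan_Suc_shift by (simp add: algebra_simps sum_distrib_left)
  ultimately have *: "(\<lambda>x. t x * (x ! n) ^ Suc d + (\<Sum>i<Suc d. (case i of 0 \<Rightarrow> (\<lambda>_. 0) | Suc j \<Rightarrow> g j) x * (x ! n) ^ i)) \<in> pideal (Suc n) S"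
    by simp
  show "t \<in> leadc n (pideal (Suc n) S) (Suc d)"
    unfolding leadc_def
    by (rule CollectI, rule conjI[OF t], rule exI[of _ "\<lambda>i. case i of 0 \<Rightarrow> (\<lambda>_. 0) | Suc j \<Rightarrow> g j"])
       (use * g(1) in \<open>auto split: nat.split intro: polyfun_const\<close>)
qed

lemma leadc_le: "d \<le> e \<Longrightarrow> leadc n (pideal (Suc n) S) d \<subseteq> leadc n (pideal (Suc n) S) e"
  by (rule lift_Suc_mono_le[of "leadc n (pideal (Suc n) S)"]) (auto intro: leadc_Suc[THEN subsetD])

lemma leadc_ideal: "f \<in> pideal n T \<Longrightarrow> T \<subseteq> leadc n (pideal (Suc n) S) d \<Longrightarrow> f \<in> leadc n (pideal (Suc n) S) d"
proof (induction rule: pideal.induct)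
  case pideal_zero
  have "(\<lambda>x. 0 * (x ! n) ^ d + (\<Sum>i<d. 0 * (x ! n) ^ i)) \<in> pideal (Suc n) S" by (simp add: pideal.pideal_zero)
  then show ?case unfolding leadc_def
    by (intro CollectI conjI polyfun_const exI[of _ "\<lambda>_ _. 0"]) (auto intro: polyfun_const)
next
  case (pideal_step t c h)
  then have "t \<in> leadc n (pideal (Suc n) S) d" "h \<in> leadc n (pideal (Suc n) S) d" by auto
  then obtain a b where t: "t \<in> polyfun n" "\<forall>i. a i \<in> polyfun n"
    "(\<lambda>x. t x * (x ! n) ^ d + (\<Sum>i<d. a i x * (x ! n) ^ i)) \<in> pideal (Suc n) S"
    and h: "h \<in> polyfun n" "\<forall>i. b i \<in> polyfun n"
    "(\<lambda>x. h x * (x ! n) ^ d + (\<Sum>i<d. b i x * (x ! n) ^ i)) \<in> pideal (Suc n) S" unfolding leadc_def by blast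
  have "(\<lambda>x. c x * (t x * (x ! n) ^ d + (\<Sum>i<d. a i x * (x ! n) ^ i)) + (h x * (x ! n) ^ d + (\<Sum>i<d. b i x * (x ! n) ^ i))) \<in> pideal (Suc n) S"
    by (intro pideal_add pideal_mult t h polyfun_mono[OF pideal_step.hyps(2)]) simp
  moreover have "c x * (t x * (x ! n) ^ d + (\<Sum>i<d. a i x * (x ! n) ^ i)) + (h x * (x ! n) ^ d + (\<Sum>i<d. b i x * (x ! n) ^ i)) =
     (c x * t x + h x) * (x ! n) ^ d + (\<Sum>i<d. (c x * a i x + b i x) * (x ! n) ^ i)" for x
    by (simp add: algebra_simps sum_distrib_left sum.distrib)
  ultimately have "(\<lambda>x. (c x * t x + h x) * (x ! n) ^ d + (\<Sum>i<d. (c x * a i x + b i x) * (x ! n) ^ i)) \<in> pideal (Suc n) S" by simp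
  then show ?case unfolding leadc_def
    by (intro CollectI conjI exI[of _ "\<lambda>i x. c x * a i x + b i x"])
       (use t h pideal_step.hyps(2) in \<open>auto intro!: polyfun_add polyfun_mult\<close>)
qed

lemma leadc_choose:
  assumes "finite T" "T \<subseteq> leadc n I d"
  shows "\<exists>F\<subseteq>I. finite F \<and> T \<subseteq> leadc n F d"
proof -
  have "\<forall>t\<in>T. \<exists>f\<in>I. t \<in> leadc n {f} d" using assms(2) unfolding leadc_def by blast
  then obtain F where F: "\<forall>t\<in>T. F t \<in> I \<and> t \<in> leadc n {F t} d" by metis
  show ?thesis
    by (rule exI[of _ "F ` T"]) (use F assms(1) leadc_mono[of "{F _}" "F ` T" n d] in auto)
qed

lemma extend_sum:
  fixes g :: "nat \<Rightarrow> 'a::field list \<Rightarrow> 'a"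
  assumes "\<forall>i\<ge>d. g i = (\<lambda>_. 0)" "d \<le> e"
  shows "(\<Sum>i<d. g i x * (x ! n) ^ i) = (\<Sum>i<e. g i x * (x ! n) ^ i)"
  by (rule sum.mono_neutral_left) (use assms in auto)

lemma polyfun_Suc_form:
  fixes f :: "'a::field list \<Rightarrow> 'a"
  assumes "f \<in> polyfun (Suc n)"
  shows "\<exists>d g. (\<forall>i. g i \<in> polyfun n) \<and> f = (\<lambda>x. \<Sum>i<d. g i x * (x ! n) ^ i)"
proof -
  let ?Q = "{f. \<exists>d g. (\<forall>i. g i \<in> polyfun n) \<and> (\<forall>i\<ge>d. g i = (\<lambda>_. 0)) \<and> f = (\<lambda>x. \<Sum>i<d. g i x * (x ! n) ^ i)}"
  have Qadd: "(\<lambda>x. f x + g x) \<in> ?Q" if "f \<in> ?Q" "g \<in> ?Q" for f g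
  proof -
    from that obtain d a e b where a: "\<forall>i. a i \<in> polyfun n" "\<forall>i\<ge>d. a i = (\<lambda>_. 0)" "f = (\<lambda>x. \<Sum>i<d. a i x * (x ! n) ^ i)"
      and b: "\<forall>i. b i \<in> polyfun n" "\<forall>i\<ge>e. b i = (\<lambda>_. 0)" "g = (\<lambda>x. \<Sum>i<e. b i x * (x ! n) ^ i)" by blast
    have "(\<Sum>i<d. a i x * (x ! n) ^ i) = (\<Sum>i<max d e. a i x * (x ! n) ^ i)"
      "(\<Sum>i<e. b i x * (x ! n) ^ i) = (\<Sum>i<max d e. b i x * (x ! n) ^ i)" for x
      by (rule extend_sum[OF a(2)] extend_sum[OF b(2)], simp)+
    then have "(\<lambda>x. f x + g x) = (\<lambda>x. \<Sum>i<max d e. (a i x + b i x) * (x ! n) ^ i)"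
      unfolding a(3) b(3) by (simp add: sum.distrib distrib_right)
    then show ?thesis
      by (intro CollectI exI[of _ "max d e"] exI[of _ "\<lambda>i x. a i x + b i x"]) (use a b in \<open>auto intro: polyfun_add\<close>)
  qed
  have Qmult: "(\<lambda>x. c x * f x) \<in> ?Q" if "f \<in> ?Q" "c \<in> polyfun n" for f c
  proof -
    from that obtain d a where a: "\<forall>i. a i \<in> polyfun n" "\<forall>i\<ge>d. a i = (\<lambda>_. 0)" "f = (\<lambda>x. \<Sum>i<d. a i x * (x ! n) ^ i)" by blast
    show ?thesis
      by (intro CollectI exI[of _ d] exI[of _ "\<lambda>i x. c x * a i x"])
         (use a that(2) in \<open>auto intro: polyfun_mult simp: sum_distrib_left mult.assoc\<close>)
  qed
  have Qy: "(\<lambda>x. x ! n * f x) \<in> ?Q" if "f \<in> ?Q" for f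
  proof -
    from that obtain d a where a: "\<forall>i. a i \<in> polyfun n" "\<forall>i\<ge>d. a i = (\<lambda>_. 0)" "f = (\<lambda>x. \<Sum>i<d. a i x * (x ! n) ^ i)" by blast
    have e: "x ! n * f x = (\<Sum>i<Suc d. (case i of 0 \<Rightarrow> (\<lambda>_. 0) | Suc j \<Rightarrow> a j) x * (x ! n) ^ i)" for x
      unfolding sum.lessThan_Suc_shift a(3) by (simp add: algebra_simps sum_distrib_left)
    show ?thesis
      by (intro CollectI exI[of _ "Suc d"] exI[of _ "\<lambda>i. case i of 0 \<Rightarrow> (\<lambda>_. 0) | Suc j \<Rightarrow> a j"])
         (use a(1,2) in \<open>auto simp: e split: nat.split intro: polyfun_const\<close>)
  qed
  have Qn: "f \<in> ?Q" if "f \<in> polyfun n" for f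
    by (intro CollectI exI[of _ 1] exI[of _ "\<lambda>i. if i = 0 then f else (\<lambda>_. 0)"])
       (use that in \<open>auto intro: polyfun_const\<close>)
  have Qyk: "(\<lambda>x. (x ! n) ^ k * f x) \<in> ?Q" if "f \<in> ?Q" for f k
  proof (induction k)
    case (Suc k) from Qy[OF Suc.IH] show ?case by (simp only: power_Suc mult.assoc)
  qed (use that in simp)
  have Qsum: "(\<lambda>x. \<Sum>i<d. h i x) \<in> ?Q" if "\<And>i. i < d \<Longrightarrow> h i \<in> ?Q" for d :: nat and h
    using that
  proof (induction d)
    case 0 show ?case using Qn[OF polyfun_const[of 0]] by simp
  next
    case (Suc d)
    then have "(\<lambda>x. \<Sum>i<d. h i x) \<in> ?Q" "h d \<in> ?Q" by simp_all
    from Qadd[OF this] show ?case by (simp only: sum.lessThan_Suc)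
  qed
  from assms have "f \<in> ?Q"
  proof induction
    case (polyfun_const c) show ?case by (rule Qn) (rule polyfun.polyfun_const)
  next
    case (polyfun_coord i)
    show ?case
    proof (cases "i < n")
      case True then show ?thesis by (intro Qn polyfun.polyfun_coord)
    next
      case False
      then have "i = n" using polyfun_coord by simp
      then show ?thesis using Qy[OF Qn[OF polyfun.polyfun_const[of 1]]] by simp
    qed
  next
    case (polyfun_add f g) then show ?case using Qadd by blast
  next
    case (polyfun_mult f g)
    from polyfun_mult.IH(2) obtain d a where a: "\<forall>i. a i \<in> polyfun n" "g = (\<lambda>x. \<Sum>i<d. a i x * (x ! n) ^ i)" by blast
    have "(\<lambda>x. \<Sum>i<d. (x ! n) ^ i * (a i x * f x)) \<in> ?Q"
      by (intro Qsum Qyk Qmult polyfun_mult.IH(1) a(1)[rule_format])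
    moreover have "(\<lambda>x. \<Sum>i<d. (x ! n) ^ i * (a i x * f x)) = (\<lambda>x. f x * g x)"
      unfolding a(2) by (auto simp: sum_distrib_left ac_simps)
    ultimately show ?case by (simp only:)
  qed
  then show ?thesis by blast
qed

theorem polyfun_noetherian:
  fixes S :: "('k::field list \<Rightarrow> 'k) set"
  shows "S \<subseteq> polyfun n \<Longrightarrow> \<exists>T\<subseteq>S. finite T \<and> S \<subseteq> pideal n T"
proof (induction n arbitrary: S)
  case 0
  have const: "\<exists>c. f = (\<lambda>_. c)" if "f \<in> polyfun 0" for f :: "'k list \<Rightarrow> 'k"
    using that by induction auto
  show ?case
  proof (cases "S \<subseteq> {\<lambda>_. 0}")
    case True
    then show ?thesis by (intro exI[of _ "{}"]) (auto intro: pideal_zero)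
  next
    case False
    then obtain f where f: "f \<in> S" "f \<noteq> (\<lambda>_. 0)" by blast
    then have "f \<in> polyfun 0" using 0 by blast
    then obtain c where c: "f = (\<lambda>_. c)" using const[of f] by blast
    with f have "c \<noteq> 0" by auto
    have "g \<in> pideal 0 {f}" if "g \<in> S" for g
    proof -
      have "g \<in> polyfun 0" using 0 that by blast
      then obtain d where "g = (\<lambda>_. d)" using const[of g] by blast
      then show ?thesis using pideal_mult[OF pideal_base[of f "{f}" 0] polyfun_const[of "d / c"]] c \<open>c \<noteq> 0\<close> by simp
    qed
    then show ?thesis using f by (intro exI[of _ "{f}"]) auto
  qed
next
  case (Suc n)
  define I where "I = pideal (Suc n) S"
  have fin: "\<exists>T\<subseteq>L. finite T \<and> L \<subseteq> pideal n T" if "L \<subseteq> polyfun n" for L :: "('k list \<Rightarrow> 'k) set" using Suc.IH[OF that] .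
  have Lsub: "leadc n I d \<subseteq> polyfun n" for d unfolding leadc_def by blast
  obtain T where T: "\<And>d. T d \<subseteq> leadc n I d \<and> finite (T d) \<and> leadc n I d \<subseteq> pideal n (T d)"
    using fin[OF Lsub] by metis
  obtain Ti where Ti: "Ti \<subseteq> (\<Union>d. leadc n I d)" "finite Ti" "(\<Union>d. leadc n I d) \<subseteq> pideal n Ti"
    using fin[of "\<Union>d. leadc n I d"] Lsub by blast
  obtain D where D: "Ti \<subseteq> leadc n I D"
  proof -
    have "\<exists>D. Ti' \<subseteq> leadc n I D" if "finite Ti'" "Ti' \<subseteq> (\<Union>d. leadc n I d)" for Ti'
      using that
    proof (induction rule: finite_induct)
      case (insert t F)
      then obtain D d where D: "F \<subseteq> leadc n I D" "t \<in> leadc n I d" by auto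
      show ?case
        by (rule exI[of _ "max d D"])
           (use D leadc_le[of d "max d D" n S] leadc_le[of D "max d D" n S] in \<open>auto simp: I_def\<close>)
    qed simp
    from this[OF Ti(2,1)] show thesis by (elim exE) (rule that)
  qed
  have "\<exists>F\<subseteq>I. finite F \<and> T d \<subseteq> leadc n F d" for d
    using leadc_choose[of "T d" n I d] T[of d] by blast
  then obtain F where F: "\<And>d. F d \<subseteq> I \<and> finite (F d) \<and> T d \<subseteq> leadc n (F d) d" by metis
  obtain Fi where Fi: "Fi \<subseteq> I" "finite Fi" "Ti \<subseteq> leadc n Fi D"
    using leadc_choose[OF Ti(2) D] by blast
  define Fs where "Fs = Fi \<union> (\<Union>d<D. F d)"
  define J where "J = pideal (Suc n) Fs"
  have FsJ: "Fs \<subseteq> J" unfolding J_def by (auto intro: pideal_base)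
  have FsI: "Fs \<subseteq> I" using F Fi unfolding Fs_def by blast
  have JI: "f \<in> I" if "f \<in> J" for f using that FsI pideal_trans unfolding I_def J_def by blast
  have lead: "leadc n I d \<subseteq> leadc n J d" for d
  proof (cases "d < D")
    case True
    then have "T d \<subseteq> leadc n J d"
      using F[of d] leadc_mono[of "F d" J n d] FsJ unfolding Fs_def by blast
    then show ?thesis using T[of d] leadc_ideal[of _ n "T d" Fs d] unfolding J_def by blast
  next
    case False
    have "Ti \<subseteq> leadc n J D" using Fi leadc_mono[of Fi J n D] FsJ unfolding Fs_def by blast
    also have "\<dots> \<subseteq> leadc n J d" unfolding J_def by (rule leadc_le) (use False in simp)
    finally show ?thesis using Ti(3) leadc_ideal[of _ n Ti Fs d] unfolding J_def by blast
  qed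
  have IJ: "(\<lambda>x. \<Sum>i<d. g i x * (x ! n) ^ i) \<in> J"
    if "\<forall>i. g i \<in> polyfun n" "(\<lambda>x. \<Sum>i<d. g i x * (x ! n) ^ i) \<in> I" for d g
    using that
  proof (induction d arbitrary: g)
    case 0
    then show ?case by (simp add: J_def pideal_zero)
  next
    case (Suc d)
    have "g d \<in> leadc n I d" unfolding leadc_def
      by (intro CollectI conjI exI[of _ g]) (use Suc.prems in \<open>auto simp: add.commute\<close>)
    then obtain h where h: "\<forall>i. h i \<in> polyfun n" "(\<lambda>x. g d x * (x ! n) ^ d + (\<Sum>i<d. h i x * (x ! n) ^ i)) \<in> J"
      using lead unfolding leadc_def by blast
    have "(\<lambda>x. (\<Sum>i<Suc d. g i x * (x ! n) ^ i) - (g d x * (x ! n) ^ d + (\<Sum>i<d. h i x * (x ! n) ^ i))) \<in> I"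
      using pideal_sub Suc.prems(2) JI[OF h(2)] unfolding I_def by blast
    moreover have e: "(\<Sum>i<Suc d. g i x * (x ! n) ^ i) - (g d x * (x ! n) ^ d + (\<Sum>i<d. h i x * (x ! n) ^ i)) =
      (\<Sum>i<d. (g i x - h i x) * (x ! n) ^ i)" for x by (simp add: algebra_simps sum_subtractf)
    moreover have "\<forall>i. (\<lambda>x. g i x - h i x) \<in> polyfun n"
    proof
      fix i
      have "(\<lambda>x. g i x + (-1) * h i x) \<in> polyfun n"
        by (intro polyfun_add polyfun_mult polyfun_const Suc.prems(1)[rule_format] h(1)[rule_format])
      then show "(\<lambda>x. g i x - h i x) \<in> polyfun n" by simp
    qed
    ultimately have "(\<lambda>x. \<Sum>i<d. (g i x - h i x) * (x ! n) ^ i) \<in> J"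
      using Suc.IH[of "\<lambda>i x. g i x - h i x"] by simp
    from pideal_add[OF this[unfolded J_def] h(2)[unfolded J_def]]
    show ?case unfolding J_def[symmetric] by (simp add: algebra_simps sum_subtractf)
  qed
  have SJ: "S \<subseteq> J"
  proof
    fix f assume f: "f \<in> S"
    then have fI: "f \<in> I" unfolding I_def by (rule pideal_base)
    from f Suc.prems obtain d g where dg: "\<forall>i. g i \<in> polyfun n" "f = (\<lambda>x. \<Sum>i<d. g i x * (x ! n) ^ i)"
      using polyfun_Suc_form by blast
    then show "f \<in> J" using IJ[OF dg(1), of d] fI by simp
  qed
  have "finite Fs" unfolding Fs_def using F Fi by auto
  then obtain T' where T': "T' \<subseteq> S" "finite T'" "Fs \<subseteq> pideal (Suc n) T'"
    using pideal_finite_set[of Fs "Suc n" S] FsI unfolding I_def by blast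
  have "f \<in> pideal (Suc n) T'" if "f \<in> S" for f
    using pideal_trans[OF _ T'(3)] SJ that unfolding J_def by blast
  then show ?case using T' by blast
qed

lemma open_affine_finite:
  assumes "openin (zar (affine_space n)) (W :: 'k::field list set)"
  obtains T where "finite T" "T \<subseteq> polyfun n" "W = {x. length x = n \<and> (\<exists>f\<in>T. f x \<noteq> 0)}"
proof -
  from assms obtain S where S: "S \<subseteq> polyfun n" "W = {x. length x = n \<and> (\<exists>f\<in>S. f x \<noteq> 0)}"
    unfolding openin_affine by blast
  obtain T where T: "T \<subseteq> S" "finite T" "S \<subseteq> pideal n T" using polyfun_noetherian[OF S(1)] by blast
  have z: "f x = 0" if "f \<in> pideal n T" "\<forall>t\<in>T. t x = 0" for f x
    using that by induction auto
  show thesis by (rule that[of T]) (use S T z in blast)+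
qed

subsection \<open>Permanence properties\<close>

lemma iso_prod_cong:
  assumes "space_with_functions X" "space_with_functions X'" "space_with_functions Y" "space_with_functions Y'"
    and "iso_spaces X X'" "iso_spaces Y Y'"
  shows "iso_spaces (prod_space X Y) (prod_space X' Y')"
proof -
  interpret XY: two_spaces X Y using assms by (simp add: two_spaces_def)
  interpret XY': two_spaces X' Y' using assms by (simp add: two_spaces_def)
  obtain f f' where f: "morphism X X' f" "morphism X' X f'" "\<And>x. x \<in> pts X \<Longrightarrow> f' (f x) = x" "\<And>y. y \<in> pts X' \<Longrightarrow> f (f' y) = y"
    using iso_spacesE[OF assms(5)] by metis
  obtain g g' where g: "morphism Y Y' g" "morphism Y' Y g'" "\<And>x. x \<in> pts Y \<Longrightarrow> g' (g x) = x" "\<And>y. y \<in> pts Y' \<Longrightarrow> g (g' y) = y"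
    using iso_spacesE[OF assms(6)] by metis
  show ?thesis
  proof (rule iso_spacesI[of _ _ "\<lambda>z. (f (fst z), g (snd z))" "\<lambda>z. (f' (fst z), g' (snd z))"])
    show "morphism (prod_space X Y) (prod_space X' Y') (\<lambda>z. (f (fst z), g (snd z)))"
      by (intro XY'.morphism_pair XY.prod_swf morphism_compose[OF XY.morphism_fst f(1)] morphism_compose[OF XY.morphism_snd g(1)])
    show "morphism (prod_space X' Y') (prod_space X Y) (\<lambda>z. (f' (fst z), g' (snd z)))"
      by (intro XY.morphism_pair XY'.prod_swf morphism_compose[OF XY'.morphism_fst f(2)] morphism_compose[OF XY'.morphism_snd g(2)])
  qed (use f g in \<open>auto simp: XY.pts_prod XY'.pts_prod\<close>)
qed

lemma iso_prod_sub:
  assumes X: "space_with_functions X" and Y: "space_with_functions Y"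
  shows "iso_spaces (prod_space (sub_space X A) (sub_space Y B)) (sub_space (prod_space X Y) (A \<times> B))"
proof -
  interpret XY: two_spaces X Y using assms by (simp add: two_spaces_def)
  interpret S: two_spaces "sub_space X A" "sub_space Y B" using assms by (simp add: two_spaces_def induced_swf)
  note sw = induced_swf[OF XY.prod_swf, of "\<lambda>x. x" "A \<times> B"]
  have i: "morphism (sub_space (prod_space X Y) (A \<times> B)) (prod_space X Y) (\<lambda>x. x)"
    by (rule morphism_induced_map[OF XY.prod_swf])
  have 1: "morphism (prod_space (sub_space X A) (sub_space Y B)) (prod_space X Y) (\<lambda>z. (fst z, snd z))"
    by (intro XY.morphism_pair S.prod_swf morphism_compose[OF S.morphism_fst morphism_induced_map[OF X]]
          morphism_compose[OF S.morphism_snd morphism_induced_map[OF Y]])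
  have 2: "morphism (sub_space (prod_space X Y) (A \<times> B)) (prod_space (sub_space X A) (sub_space Y B)) (\<lambda>z. (fst z, snd z))"
    by (intro S.morphism_pair sw morphism_into_induced morphism_compose[OF i XY.morphism_fst] morphism_compose[OF i XY.morphism_snd])
       (auto simp: pts_induced)
  show ?thesis
    by (rule iso_spacesI[of _ _ "\<lambda>z. z" "\<lambda>z. z"])
       (use 1 2 in \<open>auto intro!: morphism_into_induced S.prod_swf simp: XY.pts_prod S.pts_prod pts_induced\<close>)
qed

lemma iso_prod_affine:
  "iso_spaces (prod_space (affine_space m) (affine_space n)) (affine_space (m + n) :: ('k::field, 'k list) space)"
proof -
  let ?M = "affine_space m :: ('k, 'k list) space" and ?N = "affine_space n :: ('k, 'k list) space"
  interpret MN: two_spaces ?M ?N by (simp add: two_spaces_def affine_swf)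
  interpret P: space_with_functions "prod_space ?M ?N" by (rule MN.prod_swf)
  interpret Q: space_with_functions "affine_space (m + n) :: ('k, 'k list) space" by (rule affine_swf)
  show ?thesis
  proof (rule iso_spacesI[of _ _ "\<lambda>z. fst z @ snd z" "\<lambda>z. (take m z, drop m z)"])
    show "morphism (prod_space ?M ?N) (affine_space (m + n)) (\<lambda>z. fst z @ snd z)"
    proof (rule morphism_affine[OF MN.prod_swf])
      fix i assume i: "i < m + n"
      show "(\<lambda>z. (fst z @ snd z) ! i) \<in> reg (prod_space ?M ?N) (pts (prod_space ?M ?N))"
      proof (cases "i < m")
        case True
        have "(\<lambda>z. fst z ! i) \<in> reg (prod_space ?M ?N) (pts (prod_space ?M ?N))"
          using morphism_reg[OF MN.morphism_fst coord_reg[OF True]] .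
        then show ?thesis by (rule P.cong_reg[OF openin_topspace]) (use True in \<open>auto simp: MN.pts_prod pts_affine nth_append\<close>)
      next
        case False
        have "(\<lambda>z. snd z ! (i - m)) \<in> reg (prod_space ?M ?N) (pts (prod_space ?M ?N))"
          by (rule morphism_reg[OF MN.morphism_snd coord_reg]) (use False i in simp)
        then show ?thesis by (rule P.cong_reg[OF openin_topspace]) (use False in \<open>auto simp: MN.pts_prod pts_affine nth_append\<close>)
      qed
    qed (auto simp: MN.pts_prod pts_affine)
    show "morphism (affine_space (m + n)) (prod_space ?M ?N) (\<lambda>z. (take m z, drop m z))"
    proof (intro MN.morphism_pair affine_swf morphism_affine)
      fix i assume "i < m"
      then show "(\<lambda>x. take m x ! i) \<in> reg (affine_space (m + n)) (pts (affine_space (m + n) :: ('k, 'k list) space))"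
        by (simp add: coord_reg)
    next
      fix i assume i: "i < n"
      show "(\<lambda>x. drop m x ! i) \<in> reg (affine_space (m + n)) (pts (affine_space (m + n) :: ('k, 'k list) space))"
        by (rule Q.cong_reg[OF openin_topspace coord_reg[of "m + i"]]) (use i in \<open>auto simp: pts_affine\<close>)
    qed (auto simp: pts_affine)
  qed (auto simp: MN.pts_prod pts_affine)
qed

lemma closedin_preimage: "morphism X Y f \<Longrightarrow> closedin (zar Y) C \<Longrightarrow> closedin (zar X) {x\<in>pts X. f x \<in> C}"
  by (rule closedin_continuous_map_preimage[OF morphismD(1)])

lemma affine_variety_iso: "affine_variety X \<Longrightarrow> iso_spaces X Y \<Longrightarrow> affine_variety Y"
  unfolding affine_variety_def using iso_spaces_trans iso_spaces_sym by blast

lemma affine_variety_prod: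
  fixes X :: "('k::field, 'p) space" and Y :: "('k, 'q) space"
  assumes X: "space_with_functions X" "affine_variety X" and Y: "space_with_functions Y" "affine_variety Y"
  shows "affine_variety (prod_space X Y)"
proof -
  from X(2) obtain m Z where Z: "closedin (zar (affine_space m)) Z" "iso_spaces X (sub_space (affine_space m) Z)"
    unfolding affine_variety_def by blast
  from Y(2) obtain n Z' where Z': "closedin (zar (affine_space n)) Z'" "iso_spaces Y (sub_space (affine_space n) Z')"
    unfolding affine_variety_def by blast
  let ?M = "affine_space m :: ('k, 'k list) space" and ?N = "affine_space n :: ('k, 'k list) space"
  interpret MN: two_spaces ?M ?N by (simp add: two_spaces_def affine_swf)
  have 1: "iso_spaces (prod_space X Y) (sub_space (prod_space ?M ?N) (Z \<times> Z'))"
    by (rule iso_spaces_trans[OF iso_prod_cong iso_prod_sub]) (auto intro: X Y Z Z' induced_swf affine_swf)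
  have sub: "Z \<subseteq> pts ?M" "Z' \<subseteq> pts ?N" using Z Z' closedin_subset by blast+
  have "Z \<times> Z' = {z\<in>pts (prod_space ?M ?N). fst z \<in> Z} \<inter> {z\<in>pts (prod_space ?M ?N). snd z \<in> Z'}"
    using sub by (auto simp: MN.pts_prod)
  then have cl: "closedin (zar (prod_space ?M ?N)) (Z \<times> Z')"
    using closedin_preimage[OF MN.morphism_fst Z(1)] closedin_preimage[OF MN.morphism_snd Z'(1)] by (simp add: closedin_Int)
  obtain f g where fg: "morphism (prod_space ?M ?N) (affine_space (m + n)) f" "morphism (affine_space (m + n)) (prod_space ?M ?N) g"
    "\<And>x. x \<in> pts (prod_space ?M ?N) \<Longrightarrow> g (f x) = x" "\<And>y. y \<in> pts (affine_space (m + n)) \<Longrightarrow> f (g y) = y"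
    using iso_spacesE[OF iso_prod_affine[of m n]] by metis
  have "iso_spaces (prod_space X Y) (sub_space (affine_space (m + n)) {y\<in>pts (affine_space (m + n)). g y \<in> Z \<times> Z'})"
    by (rule iso_spaces_trans[OF 1 iso_sub_iso[OF MN.prod_swf affine_swf fg]]) (use sub in \<open>auto simp: MN.pts_prod\<close>)
  with closedin_preimage[OF fg(2) cl] show ?thesis unfolding affine_variety_def by blast
qed

lemma polyfun_take: "f \<in> polyfun n \<Longrightarrow> n \<le> m \<Longrightarrow> (\<lambda>x. f (take n x)) \<in> polyfun m"
  by (induction rule: polyfun.induct) (auto intro: polyfun.intros)

lemma affine_variety_principal:
  fixes Z :: "'k::field list set"
  assumes Z: "closedin (zar (affine_space n)) Z" and f: "f \<in> polyfun n"
  shows "affine_variety (sub_space (affine_space n) (Z \<inter> {x. length x = n \<and> f x \<noteq> 0}))"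
proof -
  let ?D = "Z \<inter> {x. length x = n \<and> f x \<noteq> 0}"
  let ?Z' = "{y. length y = Suc n \<and> take n y \<in> Z \<and> f (take n y) * y ! n = 1}"
  let ?A = "sub_space (affine_space n :: ('k, 'k list) space) ?D"
  let ?B = "sub_space (affine_space (Suc n) :: ('k, 'k list) space) ?Z'"
  interpret A: space_with_functions ?A by (intro induced_swf affine_swf)
  interpret B: space_with_functions ?B by (intro induced_swf affine_swf)
  have pA: "pts ?A = ?D" and pB: "pts ?B = ?Z'" by (auto simp: pts_induced pts_affine)
  from Z obtain S where S: "S \<subseteq> polyfun n" "Z = {x. length x = n \<and> (\<forall>f\<in>S. f x = 0)}" unfolding closedin_affine by blast
  have "closedin (zar (affine_space (Suc n))) ?Z'"
    unfolding closedin_affine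
  proof (intro exI conjI)
    let ?S = "insert (\<lambda>y. f (take n y) * y ! n + (-1)) ((\<lambda>g y. g (take n y)) ` S)"
    show "?S \<subseteq> polyfun (Suc n)"
    proof -
      have "(\<lambda>y. f (take n y) * y ! n + (-1)) \<in> polyfun (Suc n)"
        by (intro polyfun_add polyfun_mult polyfun_take[OF f] polyfun_const polyfun_coord) auto
      moreover have "(\<lambda>g y. g (take n y)) ` S \<subseteq> polyfun (Suc n)"
        using S(1) by (auto intro: polyfun_take[of _ n "Suc n"])
      ultimately show ?thesis by blast
    qed
    show "?Z' = {x. length x = Suc n \<and> (\<forall>f\<in>?S. f x = 0)}"
      using S(2) by (auto simp: add_eq_0_iff)
  qed
  moreover have "iso_spaces ?A ?B"
  proof (rule iso_spacesI[of _ _ "\<lambda>x. x @ [inverse (f x)]" "take n"])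
    show "morphism ?A ?B (\<lambda>x. x @ [inverse (f x)])"
    proof (intro morphism_into_induced A.space_with_functions_axioms morphism_affine)
      fix i assume i: "i < Suc n"
      show "(\<lambda>x. (x @ [inverse (f x)]) ! i) \<in> reg ?A (pts ?A)"
      proof (cases "i < n")
        case True
        have "(\<lambda>x. x ! i) \<in> reg ?A (pts ?A)"
          by (rule morphism_reg[OF morphism_induced_map[OF affine_swf] coord_reg[OF True]])
        then show ?thesis
          by (rule A.cong_reg[OF openin_topspace]) (use True in \<open>auto simp: pA nth_append\<close>)
      next
        case False
        have "f \<in> reg ?A (pts ?A)"
          by (rule morphism_reg[OF morphism_induced_map[OF affine_swf] polyfun_reg[OF f]])
        from A.inverse[OF openin_topspace this] have "(\<lambda>x. inverse (f x)) \<in> reg ?A {x\<in>pts ?A. f x \<noteq> 0}" .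
        moreover have "{x\<in>pts ?A. f x \<noteq> 0} = pts ?A" by (auto simp: pA)
        ultimately have "(\<lambda>x. inverse (f x)) \<in> reg ?A (pts ?A)" by simp
        then show ?thesis
          by (rule A.cong_reg[OF openin_topspace]) (use False i in \<open>auto simp: pA nth_append\<close>)
      qed
    qed (auto simp: pA nth_append)
    show "morphism ?B ?A (take n)"
    proof (intro morphism_into_induced B.space_with_functions_axioms morphism_affine)
      fix i assume i: "i < n"
      have "(\<lambda>x. x ! i) \<in> reg ?B (pts ?B)"
        by (rule morphism_reg[OF morphism_induced_map[OF affine_swf] coord_reg]) (use i in simp)
      then show "(\<lambda>x. take n x ! i) \<in> reg ?B (pts ?B)" using i by simp
    qed (auto simp: pB)
    fix y assume "y \<in> pts ?B"
    then have y: "length y = Suc n" "f (take n y) * y ! n = 1" by (auto simp: pB)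
    then have "inverse (f (take n y)) = y ! n" by (simp add: inverse_unique)
    then show "take n y @ [inverse (f (take n y))] = y"
      using y(1) by (metis lessI order_refl take_Suc_conv_app_nth take_all)
  qed (auto simp: pA)
  ultimately show ?thesis unfolding affine_variety_def by blast
qed

lemma open_sub: "openin (zar (sub_space X A)) U \<longleftrightarrow> (\<exists>W. openin (zar X) W \<and> U = A \<inter> W)"
  unfolding openin_induced by (auto simp: Int_def)

lemma finite_affine_cover_locally_closed:
  fixes Z :: "'k::field list set"
  assumes Z: "closedin (zar (affine_space n)) Z" and W: "openin (zar (affine_space n)) W"
  shows "finite_affine_cover (sub_space (affine_space n) (Z \<inter> W))"
proof -
  obtain T where T: "finite T" "T \<subseteq> polyfun n" "W = {x. length x = n \<and> (\<exists>f\<in>T. f x \<noteq> 0)}"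
    using open_affine_finite[OF W] .
  let ?Y = "sub_space (affine_space n :: ('k, 'k list) space) (Z \<inter> W)"
  let ?D = "\<lambda>f. Z \<inter> {x. length x = n \<and> f x \<noteq> 0}"
  show ?thesis unfolding finite_affine_cover_def
  proof (intro exI conjI ballI)
    show "finite (?D ` T)" using T by simp
    show "\<Union>(?D ` T) = pts ?Y" using T(3) by (auto simp: pts_induced pts_affine)
    fix U assume "U \<in> ?D ` T"
    then obtain f where f: "f \<in> T" "U = ?D f" by blast
    have fp: "f \<in> polyfun n" using f T by blast
    show "openin (zar ?Y) U" unfolding open_sub
      by (rule exI[of _ "{x. length x = n \<and> f x \<noteq> 0}"]) (use f T(3) openin_affine_basic[OF fp] in auto)
    have e: "Z \<inter> W \<inter> U = ?D f" using f T(3) by auto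
    show "affine_variety (sub_space ?Y U)"
      using affine_variety_iso[OF affine_variety_principal[OF Z fp] iso_spaces_sym[OF iso_sub_sub[OF affine_swf, where A="Z \<inter> W" and B=U, unfolded e]]] .
  qed
qed

lemma finite_affine_cover_iso:
  assumes X: "space_with_functions X" and Y: "space_with_functions Y"
    and "iso_spaces X Y" "finite_affine_cover X"
  shows "finite_affine_cover Y"
proof -
  obtain f g where fg: "morphism X Y f" "morphism Y X g" "\<And>x. x \<in> pts X \<Longrightarrow> g (f x) = x" "\<And>y. y \<in> pts Y \<Longrightarrow> f (g y) = y"
    using iso_spacesE[OF assms(3)] by metis
  obtain \<U> where U: "finite \<U>" "\<Union>\<U> = pts X" "\<And>U. U \<in> \<U> \<Longrightarrow> openin (zar X) U \<and> affine_variety (sub_space X U)"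
    using assms(4) unfolding finite_affine_cover_def by blast
  show ?thesis unfolding finite_affine_cover_def
  proof (intro exI conjI ballI)
    let ?V = "(\<lambda>U. {y\<in>pts Y. g y \<in> U}) ` \<U>"
    show "finite ?V" using U by simp
    show "\<Union>?V = pts Y" using U(2) morphismD(2)[OF fg(2)] by blast
    fix V assume "V \<in> ?V"
    then obtain A where A: "A \<in> \<U>" "V = {y\<in>pts Y. g y \<in> A}" by blast
    show "openin (zar Y) V" using morphismD(3)[OF fg(2)] U(3) A by blast
    show "affine_variety (sub_space Y V)" unfolding A(2)
      by (rule affine_variety_iso[OF _ iso_sub_iso[OF X Y fg]]) (use U A in auto)
  qed
qed

lemma finite_affine_cover_local:
  assumes X: "space_with_functions X" and V: "finite \<V>" "\<Union>\<V> = pts X"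
    "\<And>V. V \<in> \<V> \<Longrightarrow> openin (zar X) V \<and> finite_affine_cover (sub_space X V)"
  shows "finite_affine_cover X"
proof -
  have "\<forall>V\<in>\<V>. \<exists>\<U>. finite \<U> \<and> \<Union>\<U> = pts (sub_space X V) \<and> (\<forall>U\<in>\<U>. openin (zar (sub_space X V)) U \<and> affine_variety (sub_space (sub_space X V) U))"
    using V(3) unfolding finite_affine_cover_def by blast
  from bchoice[OF this] obtain C where C': "\<forall>V\<in>\<V>. finite (C V) \<and> \<Union>(C V) = pts (sub_space X V) \<and> (\<forall>U\<in>C V. openin (zar (sub_space X V)) U \<and> affine_variety (sub_space (sub_space X V) U))" ..
  note C = bspec[OF C']
  have p: "pts (sub_space X V) = V" if "V \<in> \<V>" for V using V(3)[OF that] openin_subset by (auto simp: pts_induced)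
  show ?thesis unfolding finite_affine_cover_def
  proof (intro exI conjI ballI)
    show "finite (\<Union>V\<in>\<V>. C V)" using V C by blast
    have "\<Union>(\<Union>V\<in>\<V>. C V) = (\<Union>V\<in>\<V>. \<Union>(C V))" by blast
    also have "\<dots> = (\<Union>V\<in>\<V>. V)" using C p by simp
    finally show "\<Union>(\<Union>V\<in>\<V>. C V) = pts X" using V(2) by simp
    fix U assume "U \<in> (\<Union>V\<in>\<V>. C V)"
    then obtain A where A: "A \<in> \<V>" "U \<in> C A" by blast
    then have o: "openin (zar (sub_space X A)) U" and a: "affine_variety (sub_space (sub_space X A) U)" using C by blast+
    from o obtain W where W: "openin (zar X) W" "U = A \<inter> W" unfolding open_sub by blast
    show "openin (zar X) U" using W V(3)[OF A(1)] by auto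
    have e: "A \<inter> U = U" using W by auto
    show "affine_variety (sub_space X U)"
      using affine_variety_iso[OF a iso_sub_sub[OF X, where A=A and B=U]] unfolding e .
  qed
qed

lemma finite_affine_cover_sub:
  fixes X :: "('k::field, 'p) space"
  assumes X: "space_with_functions X" "finite_affine_cover X"
    and C: "closedin (zar X) C" and O: "openin (zar X) G"
  shows "finite_affine_cover (sub_space X (C \<inter> G))"
proof -
  obtain \<U> where U: "finite \<U>" "\<Union>\<U> = pts X" "\<And>U. U \<in> \<U> \<Longrightarrow> openin (zar X) U \<and> affine_variety (sub_space X U)"
    using X(2) unfolding finite_affine_cover_def by blast
  let ?Y = "sub_space X (C \<inter> G)"
  note Y = induced_swf[OF X(1), of "\<lambda>x. x" "C \<inter> G"]
  have CG: "C \<inter> G \<subseteq> pts X" using closedin_subset[OF C] by blast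
  show ?thesis
  proof (rule finite_affine_cover_local[OF Y, of "(\<lambda>U. C \<inter> G \<inter> U) ` \<U>"])
    show "finite ((\<lambda>U. C \<inter> G \<inter> U) ` \<U>)" using U by simp
    show "\<Union>((\<lambda>U. C \<inter> G \<inter> U) ` \<U>) = pts ?Y" using U(2) CG by (auto simp: pts_induced)
    fix V assume "V \<in> (\<lambda>U. C \<inter> G \<inter> U) ` \<U>"
    then obtain A where A: "A \<in> \<U>" "V = C \<inter> G \<inter> A" by blast
    from U(3)[OF A(1)] have oA: "openin (zar X) A" and "affine_variety (sub_space X A)" by auto
    then obtain n Z where Z: "closedin (zar (affine_space n)) Z" "iso_spaces (sub_space X A) (sub_space (affine_space n) Z)"
      unfolding affine_variety_def by blast
    let ?A = "sub_space X A" and ?B = "sub_space (affine_space n :: ('k, 'k list) space) Z"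
    note sA = induced_swf[OF X(1), of "\<lambda>x. x" A] and sB = induced_swf[OF affine_swf, of "\<lambda>x. x" Z n]
    obtain f g where fg: "morphism ?A ?B f" "morphism ?B ?A g" "\<And>x. x \<in> pts ?A \<Longrightarrow> g (f x) = x" "\<And>y. y \<in> pts ?B \<Longrightarrow> f (g y) = y"
      using iso_spacesE[OF Z(2)] by metis
    have g: "morphism ?B X g" using morphism_compose[OF fg(2) morphism_induced_map[OF X(1)]] .
    have pA: "pts ?A = A" using openin_subset[OF oA] by (auto simp: pts_induced)
    have pB: "pts ?B = Z" using closedin_subset[OF Z(1)] by (auto simp: pts_induced)
    have "closedin (zar ?B) {y\<in>pts ?B. g y \<in> C}" by (rule closedin_preimage[OF g C])
    then obtain G1 where G1: "openin (zar (affine_space n)) G1" "Z - {y\<in>Z. g y \<in> C} = Z \<inter> G1"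
      unfolding closedin_def pB open_sub by blast
    have "openin (zar ?B) {y\<in>pts ?B. g y \<in> G}" by (rule morphismD(3)[OF g O])
    then obtain G2 where G2: "openin (zar (affine_space n)) G2" "{y\<in>Z. g y \<in> G} = Z \<inter> G2"
      unfolding pB open_sub by blast
    have e: "{y\<in>pts ?B. g y \<in> V} = (Z \<inter> (pts (affine_space n) - G1)) \<inter> G2"
    proof -
      have "g y \<in> A" if "y \<in> Z" for y using morphismD(2)[OF fg(2)] that pA pB by simp
      then show ?thesis using G1(2) G2(2) A(2) closedin_subset[OF Z(1)] unfolding pB by blast
    qed
    have c: "closedin (zar (affine_space n)) (Z \<inter> (pts (affine_space n) - G1))"
      using Z(1) G1(1) by blast
    have AV: "A \<inter> V = V" using A by auto
    have Bsub: "Z \<inter> {y\<in>pts ?B. g y \<in> V} = Z \<inter> (pts (affine_space n) - G1) \<inter> G2" using e by auto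
    have 1: "iso_spaces (sub_space X V) (sub_space ?A V)"
      using iso_spaces_sym[OF iso_sub_sub[OF X(1), where A=A and B=V]] unfolding AV .
    have 2: "iso_spaces (sub_space ?A V) (sub_space ?B {y\<in>pts ?B. g y \<in> V})"
      by (rule iso_sub_iso[OF sA sB fg]) (use A pA in auto)
    have 3: "iso_spaces (sub_space ?B {y\<in>pts ?B. g y \<in> V}) (sub_space (affine_space n) (Z \<inter> (pts (affine_space n) - G1) \<inter> G2))"
      using iso_sub_sub[OF affine_swf, where A=Z and B="{y\<in>pts ?B. g y \<in> V}"] unfolding Bsub .
    have YV: "C \<inter> G \<inter> V = V" using A by auto
    have 4: "iso_spaces (sub_space ?Y V) (sub_space X V)" using iso_sub_sub[OF X(1), where A="C \<inter> G" and B=V] unfolding YV .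
    have "iso_spaces (sub_space (affine_space n) (Z \<inter> (pts (affine_space n) - G1) \<inter> G2)) (sub_space ?Y V)"
      using iso_spaces_sym[OF iso_spaces_trans[OF 4 iso_spaces_trans[OF 1 iso_spaces_trans[OF 2 3]]]] .
    then have "finite_affine_cover (sub_space ?Y V)"
      using finite_affine_cover_iso[OF _ _ _ finite_affine_cover_locally_closed[OF c G2(1)]] induced_swf[OF Y] induced_swf[OF affine_swf] by blast
    moreover have "openin (zar ?Y) V" unfolding open_sub using oA A by blast
    ultimately show "openin (zar ?Y) V \<and> finite_affine_cover (sub_space ?Y V)" by blast
  qed
qed

lemma finite_affine_cover_prod:
  fixes X :: "('k::field, 'p) space" and Y :: "('k, 'q) space"
  assumes X: "space_with_functions X" "finite_affine_cover X" and Y: "space_with_functions Y" "finite_affine_cover Y"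
  shows "finite_affine_cover (prod_space X Y)"
proof -
  interpret XY: two_spaces X Y using X Y by (simp add: two_spaces_def)
  obtain \<U> where U: "finite \<U>" "\<Union>\<U> = pts X" "\<And>U. U \<in> \<U> \<Longrightarrow> openin (zar X) U \<and> affine_variety (sub_space X U)"
    using X(2) unfolding finite_affine_cover_def by blast
  obtain \<V> where V: "finite \<V>" "\<Union>\<V> = pts Y" "\<And>U. U \<in> \<V> \<Longrightarrow> openin (zar Y) U \<and> affine_variety (sub_space Y U)"
    using Y(2) unfolding finite_affine_cover_def by blast
  show ?thesis unfolding finite_affine_cover_def
  proof (intro exI conjI ballI)
    let ?W = "(\<lambda>(A, B). A \<times> B) ` (\<U> \<times> \<V>)"
    show "finite ?W" using U V by simp
    show "\<Union>?W = pts (prod_space X Y)" unfolding XY.pts_prod U(2)[symmetric] V(2)[symmetric] by auto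
    fix W assume "W \<in> ?W"
    then obtain A B where AB: "A \<in> \<U>" "B \<in> \<V>" "W = A \<times> B" by auto
    show "openin (zar (prod_space X Y)) W" using XY.openin_prod_Times U(3) V(3) AB by blast
    have "affine_variety (prod_space (sub_space X A) (sub_space Y B))"
      by (rule affine_variety_prod) (use U(3) V(3) AB X Y in \<open>auto intro: induced_swf\<close>)
    then show "affine_variety (sub_space (prod_space X Y) W)" unfolding AB(3)
      by (rule affine_variety_iso) (rule iso_prod_sub[OF X(1) Y(1)])
  qed
qed

lemma separated_inj:
  assumes X: "space_with_functions X" and Y: "space_with_functions Y" "separated Y"
    and f: "morphism X Y f" "inj_on f (pts X)"
  shows "separated X"
proof -
  interpret X: two_spaces X X using X by (simp add: two_spaces_def)
  interpret Y: two_spaces Y Y using Y by (simp add: two_spaces_def)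
  have m: "morphism (prod_space X X) (prod_space Y Y) (\<lambda>z. (f (fst z), f (snd z)))"
    by (intro Y.morphism_pair X.prod_swf morphism_compose[OF X.morphism_fst f(1)] morphism_compose[OF X.morphism_snd f(1)])
  have "(\<lambda>x. (x, x)) ` pts X = {z\<in>pts (prod_space X X). (f (fst z), f (snd z)) \<in> (\<lambda>x. (x, x)) ` pts Y}"
    using f(2) morphismD(2)[OF f(1)] by (auto simp: X.pts_prod inj_on_def)
  then show ?thesis using closedin_preimage[OF m] Y(2) unfolding separated_def by simp
qed

lemma separated_prod:
  assumes X: "space_with_functions X" "separated X" and Y: "space_with_functions Y" "separated Y"
  shows "separated (prod_space X Y)"
proof -
  interpret XY: two_spaces X Y using X Y by (simp add: two_spaces_def)
  interpret X: two_spaces X X using X by (simp add: two_spaces_def)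
  interpret Y: two_spaces Y Y using Y by (simp add: two_spaces_def)
  interpret PP: two_spaces "prod_space X Y" "prod_space X Y" using XY.prod_swf by (simp add: two_spaces_def)
  let ?P = "prod_space (prod_space X Y) (prod_space X Y)"
  have 1: "morphism ?P (prod_space X X) (\<lambda>z. (fst (fst z), fst (snd z)))"
    by (intro X.morphism_pair PP.prod_swf morphism_compose[OF PP.morphism_fst XY.morphism_fst] morphism_compose[OF PP.morphism_snd XY.morphism_fst])
  have 2: "morphism ?P (prod_space Y Y) (\<lambda>z. (snd (fst z), snd (snd z)))"
    by (intro Y.morphism_pair PP.prod_swf morphism_compose[OF PP.morphism_fst XY.morphism_snd] morphism_compose[OF PP.morphism_snd XY.morphism_snd])
  have "(\<lambda>x. (x, x)) ` pts (prod_space X Y) =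
    {z\<in>pts ?P. (fst (fst z), fst (snd z)) \<in> (\<lambda>x. (x, x)) ` pts X} \<inter> {z\<in>pts ?P. (snd (fst z), snd (snd z)) \<in> (\<lambda>x. (x, x)) ` pts Y}"
    by (auto simp: PP.pts_prod XY.pts_prod)
  then show ?thesis
    using closedin_preimage[OF 1] closedin_preimage[OF 2] X Y unfolding separated_def by (simp add: closedin_Int)
qed

lemma separated_affine: "separated (affine_space n :: ('k::field, 'k list) space)"
proof -
  let ?N = "affine_space n :: ('k, 'k list) space"
  interpret N: two_spaces ?N ?N by (simp add: two_spaces_def affine_swf)
  interpret P: space_with_functions "prod_space ?N ?N" by (rule N.prod_swf)
  let ?P = "prod_space ?N ?N"
  have r: "(\<lambda>z. fst z ! i + (-1) * snd z ! i) \<in> reg ?P (pts ?P)" if "i < n" for i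
    by (intro P.add[OF openin_topspace] P.mult[OF openin_topspace, of "\<lambda>_. -1"] P.const[OF openin_topspace]
        morphism_reg[OF N.morphism_fst coord_reg[OF that]] morphism_reg[OF N.morphism_snd coord_reg[OF that]])
  have "pts ?P - (\<lambda>x. (x, x)) ` pts ?N = (\<Union>i<n. {z\<in>pts ?P. fst z ! i + (-1) * snd z ! i \<noteq> 0})"
    by (auto simp: N.pts_prod pts_affine list_eq_iff_nth_eq)
  moreover have "openin (zar ?P) (\<Union>i<n. {z\<in>pts ?P. fst z ! i + (-1) * snd z ! i \<noteq> 0})"
    using P.nonzero[OF openin_topspace r] by blast
  ultimately show ?thesis unfolding separated_def closedin_def by (auto simp: N.pts_prod)
qed

lemma variety_swf: "variety X \<Longrightarrow> space_with_functions X"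
  by (simp add: variety_def)

lemma variety_iso: "variety X \<Longrightarrow> space_with_functions Y \<Longrightarrow> iso_spaces X Y \<Longrightarrow> variety Y"
  unfolding variety_def
proof (intro conjI)
  assume a: "space_with_functions X \<and> finite_affine_cover X \<and> separated X" "space_with_functions Y" "iso_spaces X Y"
  show "finite_affine_cover Y" using finite_affine_cover_iso a by blast
  obtain f g where fg: "morphism X Y f" "morphism Y X g" "\<And>x. x \<in> pts X \<Longrightarrow> g (f x) = x" "\<And>y. y \<in> pts Y \<Longrightarrow> f (g y) = y"
    using iso_spacesE[OF a(3)] by metis
  show "separated Y" by (rule separated_inj[OF a(2) _ _ fg(2)]) (use a fg in \<open>auto intro: inj_on_inverseI\<close>)
qed

lemma variety_prod: "variety X \<Longrightarrow> variety Y \<Longrightarrow> variety (prod_space X Y)"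
  unfolding variety_def by (auto intro: finite_affine_cover_prod separated_prod two_spaces.prod_swf two_spaces.intro)

lemma variety_sub_locally_closed:
  assumes "variety X" "closedin (zar X) C" "openin (zar X) G"
  shows "variety (sub_space X (C \<inter> G))"
  unfolding variety_def
proof (intro conjI)
  have X: "space_with_functions X" "finite_affine_cover X" "separated X" using assms by (auto simp: variety_def)
  show "space_with_functions (sub_space X (C \<inter> G))" by (rule induced_swf[OF X(1)])
  show "finite_affine_cover (sub_space X (C \<inter> G))" by (rule finite_affine_cover_sub[OF X(1,2) assms(2,3)])
  show "separated (sub_space X (C \<inter> G))"
    by (rule separated_inj[OF induced_swf[OF X(1)] X(1,3) morphism_induced_map[OF X(1)]]) simp
qed

lemma variety_closed: "variety X \<Longrightarrow> closedin (zar X) C \<Longrightarrow> variety (sub_space X C)"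
  using variety_sub_locally_closed[of X C "pts X"] closedin_subset[of "zar X" C] by (simp add: Int_absorb2)

lemma variety_open: "variety X \<Longrightarrow> openin (zar X) G \<Longrightarrow> variety (sub_space X G)"
  using variety_sub_locally_closed[of X "pts X" G] openin_subset[of "zar X" G] by (simp add: Int_absorb1)

lemma variety_affine_space: "variety (affine_space n :: ('k::field, 'k list) space)"
  unfolding variety_def
proof (intro conjI affine_swf separated_affine)
  let ?N = "affine_space n :: ('k, 'k list) space"
  have i: "iso_spaces (sub_space ?N (pts ?N \<inter> pts ?N)) ?N" by (rule iso_sub_id[OF affine_swf]) simp
  show "finite_affine_cover ?N"
    by (rule finite_affine_cover_iso[OF induced_swf[OF affine_swf] affine_swf i finite_affine_cover_locally_closed]) auto
qed

lemma variety_inj_list: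
  fixes X :: "('k::field, 'p) space"
  assumes "variety X"
  obtains e :: "'p \<Rightarrow> 'k list" where "inj_on e (pts X)"
proof -
  obtain \<U> where U: "finite \<U>" "\<Union>\<U> = pts X" "\<And>U. U \<in> \<U> \<Longrightarrow> openin (zar X) U \<and> affine_variety (sub_space X U)"
    using assms unfolding variety_def finite_affine_cover_def by blast
  have "\<exists>f :: 'p \<Rightarrow> 'k list. inj_on f U" if "U \<in> \<U>" for U
  proof -
    from U(3)[OF that] have o: "openin (zar X) U" and "affine_variety (sub_space X U)" by auto
    then obtain n Z where Z: "iso_spaces (sub_space X U) (sub_space (affine_space n) Z)"
      unfolding affine_variety_def by blast
    have "pts (sub_space X U) = U" using openin_subset[OF o] by (auto simp: pts_induced)
    with iso_spacesE[OF Z] show ?thesis by (metis inj_on_inverseI)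
  qed
  then have "\<forall>U\<in>\<U>. \<exists>f :: 'p \<Rightarrow> 'k list. inj_on f U" by blast
  from bchoice[OF this] obtain f :: "'p set \<Rightarrow> 'p \<Rightarrow> 'k list" where f: "\<And>U. U \<in> \<U> \<Longrightarrow> inj_on (f U) U" by blast
  obtain Us where Us: "set Us = \<U>" using finite_list[OF U(1)] by blast
  define ix where "ix x = (LEAST i. i < length Us \<and> x \<in> Us ! i)" for x
  have ix: "ix x < length Us \<and> x \<in> Us ! ix x" if "x \<in> pts X" for x
  proof -
    have "\<exists>i. i < length Us \<and> x \<in> Us ! i" using that U(2) Us by (metis UnionE in_set_conv_nth)
    then show ?thesis unfolding ix_def by (rule LeastI_ex)
  qed
  define e where "e x = replicate (ix x) 1 @ 0 # f (Us ! ix x) x" for x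
  have len: "length (takeWhile (\<lambda>c. c = 1) (replicate i (1::'k) @ 0 # l)) = i" for i l
    by (induction i) auto
  have "inj_on e (pts X)"
  proof (rule inj_onI)
    fix x y assume xy: "x \<in> pts X" "y \<in> pts X" "e x = e y"
    have "ix x = ix y" using len[of "ix x" "f (Us ! ix x) x"] len[of "ix y" "f (Us ! ix y) y"] xy(3) unfolding e_def by simp
    with xy(3) have "f (Us ! ix x) x = f (Us ! ix x) y" unfolding e_def by simp
    then show "x = y" using f[of "Us ! ix x"] ix[OF xy(1)] ix[OF xy(2)] \<open>ix x = ix y\<close> Us by (metis inj_onD nth_mem)
  qed
  then show thesis by (rule that)
qed

lemma variety_list_copy:
  fixes X :: "('k::field, 'p) space"
  assumes "variety X"
  shows "\<exists>Y :: ('k, 'k list) space. variety Y \<and> iso_spaces X Y"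
proof -
  obtain e :: "'p \<Rightarrow> 'k list" where e: "inj_on e (pts X)" using variety_inj_list[OF assms] .
  let ?Y = "induced_space (inv_into (pts X) e) (e ` pts X) X"
  have "iso_spaces X ?Y" by (rule iso_induced_inj[OF variety_swf[OF assms], of e]) (use e in auto)
  then show ?thesis using variety_iso[OF assms induced_swf[OF variety_swf[OF assms]]] by blast
qed

lemma iso_prod_comm:
  assumes "space_with_functions X" "space_with_functions Y"
  shows "iso_spaces (prod_space X Y) (prod_space Y X)"
proof -
  interpret XY: two_spaces X Y using assms by (simp add: two_spaces_def)
  interpret YX: two_spaces Y X using assms by (simp add: two_spaces_def)
  show ?thesis
    by (rule iso_spacesI[of _ _ "\<lambda>z. (snd z, fst z)" "\<lambda>z. (snd z, fst z)"])
       (auto intro: YX.morphism_pair XY.morphism_pair XY.prod_swf YX.prod_swf XY.morphism_fst XY.morphism_snd YX.morphism_fst YX.morphism_snd)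
qed

lemma iso_prod_assoc:
  assumes "space_with_functions X" "space_with_functions Y" "space_with_functions Z"
  shows "iso_spaces (prod_space (prod_space X Y) Z) (prod_space X (prod_space Y Z))"
proof -
  interpret XY: two_spaces X Y using assms by (simp add: two_spaces_def)
  interpret YZ: two_spaces Y Z using assms by (simp add: two_spaces_def)
  interpret A: two_spaces "prod_space X Y" Z using assms XY.prod_swf by (simp add: two_spaces_def)
  interpret B: two_spaces X "prod_space Y Z" using assms YZ.prod_swf by (simp add: two_spaces_def)
  show ?thesis
  proof (rule iso_spacesI[of _ _ "\<lambda>z. (fst (fst z), (snd (fst z), snd z))" "\<lambda>z. ((fst z, fst (snd z)), snd (snd z))"])
    show "morphism (prod_space (prod_space X Y) Z) (prod_space X (prod_space Y Z)) (\<lambda>z. (fst (fst z), (snd (fst z), snd z)))"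
      by (intro B.morphism_pair YZ.morphism_pair A.prod_swf A.morphism_snd
          morphism_compose[OF A.morphism_fst XY.morphism_fst] morphism_compose[OF A.morphism_fst XY.morphism_snd])
    show "morphism (prod_space X (prod_space Y Z)) (prod_space (prod_space X Y) Z) (\<lambda>z. ((fst z, fst (snd z)), snd (snd z)))"
      by (intro A.morphism_pair XY.morphism_pair B.prod_swf B.morphism_fst
          morphism_compose[OF B.morphism_snd YZ.morphism_fst] morphism_compose[OF B.morphism_snd YZ.morphism_snd])
  qed auto
qed

lemma iso_prod_unit:
  fixes X :: "('k::field, 'p) space"
  assumes X: "space_with_functions X"
  shows "iso_spaces (prod_space (affine_space 0) X) X"
proof -
  interpret P: two_spaces "affine_space 0" X using assms by (simp add: two_spaces_def affine_swf)
  show ?thesis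
  proof (rule iso_spacesI[of _ _ snd "\<lambda>x. ([], x)"])
    show "morphism X (prod_space (affine_space 0) X) (\<lambda>x. ([], x))"
      by (intro P.morphism_pair X morphism_affine morphism_id) auto
  qed (auto simp: P.pts_prod pts_affine intro: P.morphism_snd)
qed

section \<open>The Grothendieck ring of varieties\<close>

text \<open>
  Every variety is isomorphic to one whose points are lists over the field
  (lemma \<open>variety_list_copy\<close>), so this is the type of all isomorphism classes of varieties.
\<close>

quotient_type (overloaded) 'k iso_class = "('k::alg_closed_field, 'k list) space" / partial:
  "\<lambda>X Y. variety X \<and> variety Y \<and> iso_spaces X Y"
proof (rule part_equivpI)
  show "\<exists>X :: ('k, 'k list) space. variety X \<and> variety X \<and> iso_spaces X X"
    using variety_affine_space[of 0] iso_spaces_refl[OF affine_swf] by blast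
  show "symp (\<lambda>X (Y :: ('k, 'k list) space). variety X \<and> variety Y \<and> iso_spaces X Y)"
    by (auto simp: symp_def iso_spaces_sym)
  show "transp (\<lambda>X (Y :: ('k, 'k list) space). variety X \<and> variety Y \<and> iso_spaces X Y)"
    using iso_spaces_trans by (auto simp: transp_def)
qed

definition list_copy :: "('k::field, 'p) space \<Rightarrow> ('k, 'k list) space" where
  "list_copy X = (SOME Y. variety Y \<and> iso_spaces X Y)"

lemma list_copy: assumes "variety X" shows "variety (list_copy X)" "iso_spaces X (list_copy X)"
  using someI_ex[OF variety_list_copy[OF assms]] unfolding list_copy_def by auto


text \<open>
  Only meaningful if \<open>X\<close> is a variety; the points of \<open>X\<close> may have any type.
\<close>

definition iso_class_of :: "('k::alg_closed_field, 'p) space \<Rightarrow> 'k iso_class" where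
  "iso_class_of X = abs_iso_class (list_copy X)"

lemma iso_class_of_eqI:
  assumes "variety X" "variety Y" "iso_spaces X Y"
  shows "iso_class_of X = iso_class_of Y"
  unfolding iso_class_of_def
  by (rule Quotient3_rel_abs[OF Quotient3_iso_class])
     (use list_copy assms iso_spaces_sym iso_spaces_trans in meson)

lemma iso_class_of_cases:
  obtains X :: "('k::alg_closed_field, 'k list) space" where "variety X" "x = iso_class_of X"
proof -
  obtain X where X: "x = abs_iso_class X" "variety X" "iso_spaces X X"
    using Quotient3_abs_rep[OF Quotient3_iso_class, of x] Quotient3_rep_reflp[OF Quotient3_iso_class, of x] by metis
  have "abs_iso_class X = abs_iso_class (list_copy X)"
    by (rule Quotient3_rel_abs[OF Quotient3_iso_class]) (use X list_copy in blast)
  then show thesis using that[of X] X by (simp add: iso_class_of_def)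
qed

lemma iso_prod_congV:
  assumes "variety X" "variety X'" "variety Y" "variety Y'" "iso_spaces X X'" "iso_spaces Y Y'"
  shows "iso_spaces (prod_space X Y) (prod_space X' Y')"
  using iso_prod_cong assms variety_swf by metis

text \<open>
  Addition of isomorphism classes is the product of varieties, with the point as neutral element. It is
  written additively because then the free abelian group \<open>'k iso_class \<Rightarrow>\<^sub>0 int\<close> carries the
  multiplication of a monoid ring, that is, the bilinear extension of the product of varieties.
\<close>

instantiation iso_class :: (alg_closed_field) comm_monoid_add
begin

lift_definition zero_iso_class :: "'a iso_class" is "affine_space 0"
  by (simp add: variety_affine_space iso_spaces_refl affine_swf)

lift_definition plus_iso_class :: "'a iso_class \<Rightarrow> 'a iso_class \<Rightarrow> 'a iso_class"
  is "\<lambda>X Y. list_copy (prod_space X Y)"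
proof -
  fix X X' Y Y' :: "('a, 'a list) space"
  assume "variety X \<and> variety X' \<and> iso_spaces X X'" "variety Y \<and> variety Y' \<and> iso_spaces Y Y'"
  then have "iso_spaces (prod_space X Y) (prod_space X' Y')" "variety (prod_space X Y)" "variety (prod_space X' Y')"
    by (auto intro: iso_prod_congV variety_prod)
  then show "variety (list_copy (prod_space X Y)) \<and> variety (list_copy (prod_space X' Y')) \<and>
       iso_spaces (list_copy (prod_space X Y)) (list_copy (prod_space X' Y'))"
    using list_copy iso_spaces_sym iso_spaces_trans by meson
qed

lemma iso_class_of_prod:
  fixes X :: "('a, 'p) space" and Y :: "('a, 'q) space"
  assumes X: "variety X" and Y: "variety Y"
  shows "iso_class_of X + iso_class_of Y = iso_class_of (prod_space X Y)"
proof -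
  have "iso_class_of X + iso_class_of Y = abs_iso_class (list_copy (prod_space (list_copy X) (list_copy Y)))"
    unfolding iso_class_of_def
    by (rule plus_iso_class.abs_eq) (use X Y list_copy iso_spaces_refl variety_swf in blast)+
  also have "\<dots> = iso_class_of (prod_space (list_copy X) (list_copy Y))" by (simp add: iso_class_of_def)
  also have "\<dots> = iso_class_of (prod_space X Y)"
    by (intro iso_class_of_eqI variety_prod iso_prod_congV list_copy X Y iso_spaces_sym[OF list_copy(2)])
  finally show ?thesis .
qed

lemma zero_iso_class_of: "(0 :: 'a iso_class) = iso_class_of (affine_space 0 :: ('a, 'a list) space)"
  unfolding iso_class_of_def zero_iso_class.abs_eq
  by (rule Quotient3_rel_abs[OF Quotient3_iso_class])
     (use list_copy variety_affine_space in blast)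

instance
proof
  fix a b c :: "'a iso_class"
  obtain A :: "('a, 'a list) space" where A: "variety A" "a = iso_class_of A" by (rule iso_class_of_cases)
  obtain B :: "('a, 'a list) space" where B: "variety B" "b = iso_class_of B" by (rule iso_class_of_cases)
  obtain C :: "('a, 'a list) space" where C: "variety C" "c = iso_class_of C" by (rule iso_class_of_cases)
  note v = A(1) B(1) C(1)
  show "a + b + c = a + (b + c)"
    unfolding A(2) B(2) C(2) using v
    by (simp add: iso_class_of_prod variety_prod iso_class_of_eqI iso_prod_assoc variety_swf)
  show "a + b = b + a"
    unfolding A(2) B(2) using v
    by (simp add: iso_class_of_prod variety_prod iso_class_of_eqI iso_prod_comm variety_swf)
  show "0 + a = a"
    unfolding A(2) zero_iso_class_of using v
    by (simp add: iso_class_of_prod variety_prod variety_affine_space iso_class_of_eqI iso_prod_unit variety_swf)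
qed

end

inductive_set scissor_relations :: "('k::alg_closed_field iso_class \<Rightarrow>\<^sub>0 int) set" where
  scissor: "variety (Y :: ('k, 'k list) space) \<Longrightarrow> closedin (zar Y) Z \<Longrightarrow>
    frag_of (iso_class_of Y) - (frag_of (iso_class_of (sub_space Y (pts Y - Z))) + frag_of (iso_class_of (sub_space Y Z)))
      \<in> scissor_relations"
| zero: "0 \<in> scissor_relations"
| diff: "a \<in> scissor_relations \<Longrightarrow> b \<in> scissor_relations \<Longrightarrow> a - b \<in> scissor_relations"

lemma scissor_uminus: "a \<in> scissor_relations \<Longrightarrow> - a \<in> scissor_relations"
  using scissor_relations.diff[OF scissor_relations.zero] by simp

lemma scissor_add: "a \<in> scissor_relations \<Longrightarrow> b \<in> scissor_relations \<Longrightarrow> a + b \<in> scissor_relations"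
  using scissor_relations.diff[of a "- b"] scissor_uminus[of b] by simp

lemma scissor_any:
  fixes Y :: "('k::alg_closed_field, 'p) space"
  assumes Y: "variety Y" and Z: "closedin (zar Y) Z"
  shows "frag_of (iso_class_of Y) - (frag_of (iso_class_of (sub_space Y (pts Y - Z))) + frag_of (iso_class_of (sub_space Y Z)))
      \<in> scissor_relations"
proof -
  let ?Y = "list_copy Y"
  note lc = list_copy[OF Y]
  obtain f g where fg: "morphism Y ?Y f" "morphism ?Y Y g" "\<And>x. x \<in> pts Y \<Longrightarrow> g (f x) = x" "\<And>y. y \<in> pts ?Y \<Longrightarrow> f (g y) = y"
    using iso_spacesE[OF lc(2)] by metis
  let ?Z = "{y\<in>pts ?Y. g y \<in> Z}"
  have Z': "closedin (zar ?Y) ?Z" by (rule closedin_preimage[OF fg(2) Z])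
  have e: "pts ?Y - ?Z = {y\<in>pts ?Y. g y \<in> pts Y - Z}" using morphismD(2)[OF fg(2)] by auto
  have oY: "openin (zar Y) (pts Y - Z)" and oY': "openin (zar ?Y) (pts ?Y - ?Z)" using Z Z' by auto
  have "iso_class_of Y = iso_class_of ?Y" by (rule iso_class_of_eqI[OF Y lc])
  moreover have "iso_class_of (sub_space Y Z) = iso_class_of (sub_space ?Y ?Z)"
    by (intro iso_class_of_eqI variety_closed Y lc Z Z' iso_sub_iso[OF variety_swf variety_swf fg] closedin_subset[OF Z])
  moreover have "iso_class_of (sub_space Y (pts Y - Z)) = iso_class_of (sub_space ?Y (pts ?Y - ?Z))"
    unfolding e by (intro iso_class_of_eqI variety_open Y lc oY oY'[unfolded e] iso_sub_iso[OF variety_swf variety_swf fg]) auto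
  ultimately show ?thesis using scissor[OF lc(1) Z'] by simp
qed

lemma frag_of_mult: "frag_of a * frag_of b = (frag_of (a + b) :: 'b::comm_monoid_add \<Rightarrow>\<^sub>0 int)"
  by (simp add: mult_single)

lemma scissor_mult_class:
  fixes X :: "('k::alg_closed_field, 'k list) space"
  assumes X: "variety X" and a: "a \<in> scissor_relations"
  shows "frag_of (iso_class_of X) * a \<in> scissor_relations"
  using a
proof induction
  case (scissor Y Z)
  interpret XY: two_spaces X Y using variety_swf X scissor by (auto simp: two_spaces_def)
  note sX = variety_swf[OF X] and sY = variety_swf[OF scissor(1)]
  note v = variety_prod[OF X scissor(1)]
  have ZY: "Z \<subseteq> pts Y" by (rule closedin_subset[OF scissor(2)])
  have "pts X \<times> Z = {z\<in>pts (prod_space X Y). snd z \<in> Z}" using ZY by (auto simp: XY.pts_prod)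
  then have c: "closedin (zar (prod_space X Y)) (pts X \<times> Z)"
    using closedin_preimage[OF XY.morphism_snd scissor(2)] by simp
  have d: "pts (prod_space X Y) - pts X \<times> Z = pts X \<times> (pts Y - Z)" by (auto simp: XY.pts_prod)
  have o: "openin (zar Y) (pts Y - Z)" using scissor(2) by blast
  have i: "iso_spaces (prod_space X (sub_space Y B)) (sub_space (prod_space X Y) (pts X \<times> B))" for B
  proof -
    have "iso_spaces (prod_space X (sub_space Y B)) (prod_space (sub_space X (pts X)) (sub_space Y B))"
      by (rule iso_prod_cong)
         (auto intro: sX sY induced_swf iso_spaces_refl iso_spaces_sym[OF iso_sub_id[OF sX order_refl]])
    then show ?thesis using iso_prod_sub[OF sX sY] by (rule iso_spaces_trans)
  qed
  have "iso_class_of X + iso_class_of Y = iso_class_of (prod_space X Y)" by (rule iso_class_of_prod[OF X scissor(1)])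
  moreover have "iso_class_of X + iso_class_of (sub_space Y Z) = iso_class_of (sub_space (prod_space X Y) (pts X \<times> Z))"
    unfolding iso_class_of_prod[OF X variety_closed[OF scissor]]
    by (intro iso_class_of_eqI variety_prod variety_closed X scissor c i)
  moreover have "iso_class_of X + iso_class_of (sub_space Y (pts Y - Z)) = iso_class_of (sub_space (prod_space X Y) (pts (prod_space X Y) - pts X \<times> Z))"
    unfolding iso_class_of_prod[OF X variety_open[OF scissor(1) o]] d
    by (intro iso_class_of_eqI variety_prod variety_open X scissor o i XY.openin_prod_Times openin_topspace)
  ultimately show ?case using scissor_any[OF v c]
    by (simp only: right_diff_distrib distrib_left frag_of_mult)
next
  case zero then show ?case by (simp add: scissor_relations.zero)
next
  case (diff a b) then show ?case by (simp add: right_diff_distrib scissor_relations.diff)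
qed

lemma scissor_mult:
  fixes a c :: "'k::alg_closed_field iso_class \<Rightarrow>\<^sub>0 int"
  assumes a: "a \<in> scissor_relations"
  shows "c * a \<in> scissor_relations"
proof (rule frag_induction[where S=UNIV and c=c])
  fix x :: "'k iso_class"
  obtain X :: "('k, 'k list) space" where "variety X" "x = iso_class_of X" by (rule iso_class_of_cases)
  then show "frag_of x * a \<in> scissor_relations" using scissor_mult_class a by simp
qed (auto simp: left_diff_distrib intro: scissor_relations.intros)

quotient_type (overloaded) 'k K0_Var = "'k::alg_closed_field iso_class \<Rightarrow>\<^sub>0 int" / "\<lambda>a b. a - b \<in> scissor_relations"
proof (rule equivpI)
  show "reflp (\<lambda>a b. a - b \<in> scissor_relations)" by (simp add: reflp_def scissor_relations.zero)
  show "symp (\<lambda>a b. a - b \<in> scissor_relations)" using scissor_uminus by (fastforce simp: symp_def)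
  show "transp (\<lambda>a b. a - b \<in> scissor_relations)" using scissor_add by (fastforce simp: transp_def)
qed

text \<open>
  Here and below the classes \<open>comm_ring\<close> and \<open>comm_monoid_mult\<close> together express a commutative unital
  ring; \<open>comm_ring_1\<close> would in addition require \<open>0 \<noteq> 1\<close>.
\<close>

instantiation K0_Var :: (alg_closed_field) "{comm_ring, comm_monoid_mult}"
begin

lift_definition zero_K0_Var :: "'a K0_Var" is 0 .

lift_definition one_K0_Var :: "'a K0_Var" is 1 .

lift_definition plus_K0_Var :: "'a K0_Var \<Rightarrow> 'a K0_Var \<Rightarrow> 'a K0_Var" is "(+)"
  by (simp add: scissor_add add_diff_add)

lift_definition uminus_K0_Var :: "'a K0_Var \<Rightarrow> 'a K0_Var" is uminus
  using scissor_uminus by fastforce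

lift_definition minus_K0_Var :: "'a K0_Var \<Rightarrow> 'a K0_Var \<Rightarrow> 'a K0_Var" is "(-)"
proof -
  fix a a' b b' :: "'a iso_class \<Rightarrow>\<^sub>0 int"
  assume "a - a' \<in> scissor_relations" "b - b' \<in> scissor_relations"
  then have "(a - a') - (b - b') \<in> scissor_relations" by (rule scissor_relations.diff)
  then show "a - b - (a' - b') \<in> scissor_relations" by (simp add: algebra_simps)
qed

lift_definition times_K0_Var :: "'a K0_Var \<Rightarrow> 'a K0_Var \<Rightarrow> 'a K0_Var" is "(*)"
proof -
  fix a a' b b' :: "'a iso_class \<Rightarrow>\<^sub>0 int"
  assume "a - a' \<in> scissor_relations" "b - b' \<in> scissor_relations"
  then have "b * (a - a') + a' * (b - b') \<in> scissor_relations" by (intro scissor_add scissor_mult)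
  then show "a * b - a' * b' \<in> scissor_relations" by (simp add: algebra_simps)
qed

instance
proof
  fix x y z :: "'a K0_Var"
  obtain a b c where abs: "x = abs_K0_Var a" "y = abs_K0_Var b" "z = abs_K0_Var c"
    by (metis Quotient3_abs_rep[OF Quotient3_K0_Var])
  note simps = abs plus_K0_Var.abs_eq times_K0_Var.abs_eq uminus_K0_Var.abs_eq minus_K0_Var.abs_eq
    zero_K0_Var.abs_eq one_K0_Var.abs_eq
  show "x + y + z = x + (y + z)" "x + y = y + x" "x * y * z = x * (y * z)" "x * y = y * x" "(x + y) * z = x * z + y * z"
    "0 + x = x" "1 * x = x" "- x + x = 0" "x - y = x + - y"
    unfolding simps by (simp_all add: algebra_simps)
qed

end

definition var_class :: "('k::alg_closed_field, 'p) space \<Rightarrow> 'k K0_Var" where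
  "var_class X = abs_K0_Var (frag_of (iso_class_of X))"

lemma var_class_iso: "variety X \<Longrightarrow> variety Y \<Longrightarrow> iso_spaces X Y \<Longrightarrow> var_class X = var_class Y"
  unfolding var_class_def using iso_class_of_eqI by metis

lemma var_class_scissor:
  assumes "variety Y" "closedin (zar Y) Z"
  shows "var_class Y = var_class (sub_space Y (pts Y - Z)) + var_class (sub_space Y Z)"
  unfolding var_class_def plus_K0_Var.abs_eq K0_Var.abs_eq_iff by (rule scissor_any[OF assms])

lemma var_class_prod:
  assumes "variety X" "variety Y"
  shows "var_class (prod_space X Y) = var_class X * var_class Y"
  unfolding var_class_def iso_class_of_prod[OF assms, symmetric] frag_of_mult[symmetric] times_K0_Var.abs_eq ..

lemma var_class_point: "var_class (affine_space 0 :: ('k::alg_closed_field, 'k list) space) = 1"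
  unfolding var_class_def zero_iso_class_of[symmetric] one_K0_Var.abs_eq by simp

section \<open>The Grothendieck ring of stacks\<close>

inductive_set lefschetz_system :: "'k::alg_closed_field K0_Var set" where
  one: "1 \<in> lefschetz_system"
| L: "s \<in> lefschetz_system \<Longrightarrow> var_class (affine_space 1 :: ('k, 'k list) space) * s \<in> lefschetz_system"
| L_minus_1: "s \<in> lefschetz_system \<Longrightarrow> m > 0 \<Longrightarrow>
    (var_class (affine_space 1 :: ('k, 'k list) space) ^ m - 1) * s \<in> lefschetz_system"

lemma lefschetz_mult: "s \<in> lefschetz_system \<Longrightarrow> t \<in> lefschetz_system \<Longrightarrow> s * t \<in> lefschetz_system"
  by (induction rule: lefschetz_system.induct)
     (auto simp: mult.assoc simp del: One_nat_def intro: lefschetz_system.intros)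

text \<open>
  Localisation of a ring that may have zero divisors.
\<close>

definition fraction_rel :: "'k::alg_closed_field K0_Var \<times> 'k K0_Var \<Rightarrow> 'k K0_Var \<times> 'k K0_Var \<Rightarrow> bool" where
  "fraction_rel = (\<lambda>(a, s) (b, t). s \<in> lefschetz_system \<and> t \<in> lefschetz_system \<and>
     (\<exists>u\<in>lefschetz_system. u * (a * t - b * s) = 0))"

lemma fraction_relI:
  "s \<in> lefschetz_system \<Longrightarrow> t \<in> lefschetz_system \<Longrightarrow> u \<in> lefschetz_system \<Longrightarrow> u * (a * t - b * s) = 0 \<Longrightarrow>
   fraction_rel (a, s) (b, t)"
  unfolding fraction_rel_def by blast

lemma fraction_rel_eq:
  "s \<in> lefschetz_system \<Longrightarrow> t \<in> lefschetz_system \<Longrightarrow> a * t = b * s \<Longrightarrow> fraction_rel (a, s) (b, t)"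
  by (rule fraction_relI[of _ _ 1]) (auto intro: lefschetz_system.intros)

lemma fraction_relE:
  assumes "fraction_rel x y"
  obtains a s b t u where "x = (a, s)" "y = (b, t)" "s \<in> lefschetz_system" "t \<in> lefschetz_system" "u \<in> lefschetz_system"
    "u * (a * t - b * s) = 0"
  using assms unfolding fraction_rel_def by (auto split: prod.splits)

quotient_type (overloaded) 'k K0_St = "'k::alg_closed_field K0_Var \<times> 'k K0_Var" / partial: fraction_rel
proof (rule part_equivpI)
  have "fraction_rel (0 :: 'k K0_Var, 1) (0, 1)" by (rule fraction_rel_eq) (auto intro: lefschetz_system.intros)
  then show "\<exists>x :: 'k K0_Var \<times> 'k K0_Var. fraction_rel x x" ..
  show "symp (fraction_rel :: 'k K0_Var \<times> 'k K0_Var \<Rightarrow> _)"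
  proof (rule sympI)
    fix x y :: "'k K0_Var \<times> 'k K0_Var" assume "fraction_rel x y"
    then obtain a s b t u where *: "x = (a, s)" "y = (b, t)" "s \<in> lefschetz_system" "t \<in> lefschetz_system" "u \<in> lefschetz_system"
      "u * (a * t - b * s) = 0" by (rule fraction_relE)
    have "u * (b * s - a * t) = - (u * (a * t - b * s))" by (simp add: algebra_simps)
    then show "fraction_rel y x" unfolding *(1,2) using *(3-6) by (intro fraction_relI) auto
  qed
  show "transp (fraction_rel :: 'k K0_Var \<times> 'k K0_Var \<Rightarrow> _)"
  proof (rule transpI)
    fix x y z :: "'k K0_Var \<times> 'k K0_Var" assume xy: "fraction_rel x y" and yz: "fraction_rel y z"
    from xy obtain a s b t u where *: "x = (a, s)" "y = (b, t)" "s \<in> lefschetz_system" "t \<in> lefschetz_system" "u \<in> lefschetz_system"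
      "u * (a * t - b * s) = 0" by (rule fraction_relE)
    from yz *(2) obtain c w v where **: "z = (c, w)" "w \<in> lefschetz_system" "v \<in> lefschetz_system"
      "v * (b * w - c * t) = 0" by (auto elim: fraction_relE)
    have "(u * v * t) * (a * w - c * s) = v * w * (u * (a * t - b * s)) + u * s * (v * (b * w - c * t))"
      by (simp add: algebra_simps)
    also have "\<dots> = 0" by (simp add: *(6) **(4))
    finally show "fraction_rel x z" unfolding *(1) **(1)
      by (intro fraction_relI[of _ _ "u * v * t"] lefschetz_mult * **)
  qed
qed

instantiation K0_St :: (alg_closed_field) "{comm_ring, comm_monoid_mult}"
begin

lift_definition zero_K0_St :: "'a K0_St" is "(0, 1)"
  by (rule fraction_rel_eq) (auto intro: lefschetz_system.intros)

lift_definition one_K0_St :: "'a K0_St" is "(1, 1)"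
  by (rule fraction_rel_eq) (auto intro: lefschetz_system.intros)

lift_definition plus_K0_St :: "'a K0_St \<Rightarrow> 'a K0_St \<Rightarrow> 'a K0_St"
  is "\<lambda>(a, s) (b, t). (a * t + b * s, s * t)"
proof -
  fix x x' y y' :: "'a K0_Var \<times> 'a K0_Var" assume xx: "fraction_rel x x'" and yy: "fraction_rel y y'"
  from xx obtain a s a' s' u where *: "x = (a, s)" "x' = (a', s')" "s \<in> lefschetz_system" "s' \<in> lefschetz_system" "u \<in> lefschetz_system"
    "u * (a * s' - a' * s) = 0" by (rule fraction_relE)
  from yy obtain b t b' t' v where **: "y = (b, t)" "y' = (b', t')" "t \<in> lefschetz_system" "t' \<in> lefschetz_system" "v \<in> lefschetz_system"
    "v * (b * t' - b' * t) = 0" by (rule fraction_relE)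
  have "(u * v) * ((a * t + b * s) * (s' * t') - (a' * t' + b' * s') * (s * t)) =
    v * t * t' * (u * (a * s' - a' * s)) + u * s * s' * (v * (b * t' - b' * t))" by (simp add: algebra_simps)
  also have "\<dots> = 0" by (simp add: *(6) **(6))
  finally show "fraction_rel ((case x of (a, s) \<Rightarrow> (\<lambda>(b, t). (a * t + b * s, s * t))) y) ((case x' of (a, s) \<Rightarrow> (\<lambda>(b, t). (a * t + b * s, s * t))) y')"
    unfolding *(1,2) **(1,2) prod.case by (intro fraction_relI[of _ _ "u * v"] lefschetz_mult * **)
qed

lift_definition uminus_K0_St :: "'a K0_St \<Rightarrow> 'a K0_St" is "\<lambda>(a, s). (- a, s)"
proof -
  fix x x' :: "'a K0_Var \<times> 'a K0_Var" assume "fraction_rel x x'"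
  then obtain a s a' s' u where *: "x = (a, s)" "x' = (a', s')" "s \<in> lefschetz_system" "s' \<in> lefschetz_system" "u \<in> lefschetz_system"
    "u * (a * s' - a' * s) = 0" by (rule fraction_relE)
  have "u * (- a * s' - - a' * s) = - (u * (a * s' - a' * s))" by (simp add: algebra_simps)
  then show "fraction_rel (case x of (a, s) \<Rightarrow> (- a, s)) (case x' of (a, s) \<Rightarrow> (- a, s))"
    unfolding *(1,2) prod.case using * by (intro fraction_relI) auto
qed

definition minus_K0_St :: "'a K0_St \<Rightarrow> 'a K0_St \<Rightarrow> 'a K0_St" where
  "minus_K0_St a b = a + - b"

lift_definition times_K0_St :: "'a K0_St \<Rightarrow> 'a K0_St \<Rightarrow> 'a K0_St"
  is "\<lambda>(a, s) (b, t). (a * b, s * t)"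
proof -
  fix x x' y y' :: "'a K0_Var \<times> 'a K0_Var" assume xx: "fraction_rel x x'" and yy: "fraction_rel y y'"
  from xx obtain a s a' s' u where *: "x = (a, s)" "x' = (a', s')" "s \<in> lefschetz_system" "s' \<in> lefschetz_system" "u \<in> lefschetz_system"
    "u * (a * s' - a' * s) = 0" by (rule fraction_relE)
  from yy obtain b t b' t' v where **: "y = (b, t)" "y' = (b', t')" "t \<in> lefschetz_system" "t' \<in> lefschetz_system" "v \<in> lefschetz_system"
    "v * (b * t' - b' * t) = 0" by (rule fraction_relE)
  have "(u * v) * ((a * b) * (s' * t') - (a' * b') * (s * t)) =
    v * b * t' * (u * (a * s' - a' * s)) + u * a' * s * (v * (b * t' - b' * t))" by (simp add: algebra_simps)
  also have "\<dots> = 0" by (simp add: *(6) **(6))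
  finally show "fraction_rel ((case x of (a, s) \<Rightarrow> (\<lambda>(b, t). (a * b, s * t))) y) ((case x' of (a, s) \<Rightarrow> (\<lambda>(b, t). (a * b, s * t))) y')"
    unfolding *(1,2) **(1,2) prod.case by (intro fraction_relI[of _ _ "u * v"] lefschetz_mult * **)
qed

lemma K0_St_eqI:
  "fraction_rel x y \<Longrightarrow> abs_K0_St x = (abs_K0_St y :: 'a K0_St)"
  by (rule Quotient3_rel_abs[OF Quotient3_K0_St])

lemma K0_St_cases:
  obtains a s where "s \<in> lefschetz_system" "x = (abs_K0_St (a, s) :: 'a K0_St)"
  using Quotient3_abs_rep[OF Quotient3_K0_St, of x] Quotient3_rep_reflp[OF Quotient3_K0_St, of x]
  by (metis fraction_relE)

lemma fraction_refl: "s \<in> lefschetz_system \<Longrightarrow> fraction_rel (a, s) (a, s)"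
  by (rule fraction_rel_eq) auto

lemma abs_K0_St_simps:
  "s \<in> lefschetz_system \<Longrightarrow> t \<in> lefschetz_system \<Longrightarrow> abs_K0_St (a, s) + abs_K0_St (b, t) = abs_K0_St (a * t + b * s, s * t)"
  "s \<in> lefschetz_system \<Longrightarrow> t \<in> lefschetz_system \<Longrightarrow> abs_K0_St (a, s) * abs_K0_St (b, t) = abs_K0_St (a * b, s * t)"
  "s \<in> lefschetz_system \<Longrightarrow> - abs_K0_St (a, s) = abs_K0_St (- a, s)"
  by (simp_all add: plus_K0_St.abs_eq times_K0_St.abs_eq uminus_K0_St.abs_eq fraction_refl)

instance
proof
  fix x y z :: "'a K0_St"
  obtain a s where x: "s \<in> lefschetz_system" "x = abs_K0_St (a, s)" by (rule K0_St_cases)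
  obtain b t where y: "t \<in> lefschetz_system" "y = abs_K0_St (b, t)" by (rule K0_St_cases)
  obtain c u where z: "u \<in> lefschetz_system" "z = abs_K0_St (c, u)" by (rule K0_St_cases)
  note S = x(1) y(1) z(1) lefschetz_mult lefschetz_system.one
  note simps = x(2) y(2) z(2) zero_K0_St_def one_K0_St_def map_fun_apply id_apply
  show "x + y + z = x + (y + z)" "x + y = y + x" "x * y * z = x * (y * z)" "x * y = y * x" "(x + y) * z = x * z + y * z"
    by (simp_all add: simps S abs_K0_St_simps) (rule K0_St_eqI, rule fraction_rel_eq; simp add: S algebra_simps)+
  show "0 + x = x" "1 * x = x" "- x + x = 0"
    by (simp_all add: simps S abs_K0_St_simps) (rule K0_St_eqI, rule fraction_rel_eq; simp add: S algebra_simps)+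
  show "x - y = x + - y" by (simp add: minus_K0_St_def)
qed

end

lemma comm_inverse_unique:
  fixes a b c :: "'r::comm_monoid_mult"
  assumes "a * b = 1" "a * c = 1" shows "b = c"
  using assms by (metis mult.assoc mult.commute mult.left_neutral)

text \<open>
  The inverse is the multiplicative inverse of a unit, and \<open>0\<close> on non-units.
\<close>

instantiation K0_St :: (alg_closed_field) inverse
begin

definition inverse_K0_St :: "'a K0_St \<Rightarrow> 'a K0_St" where
  "inverse_K0_St a = (if \<exists>b. a * b = 1 then THE b. a * b = 1 else 0)"

definition divide_K0_St :: "'a K0_St \<Rightarrow> 'a K0_St \<Rightarrow> 'a K0_St" where
  "divide_K0_St a b = a * inverse b"

instance ..

end

lemma inverse_K0_St_eq: "a * b = 1 \<Longrightarrow> inverse a = (b :: 'k::alg_closed_field K0_St)"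
proof -
  assume ab: "a * b = 1"
  have "(THE c. a * c = 1) = b" 
    by (rule the_equality[where P="\<lambda>c. a * c = 1", OF ab]) (rule comm_inverse_unique[OF _ ab])
  then show "inverse a = b" unfolding inverse_K0_St_def using ab by (simp only: if_P[OF exI[of _ b]])
qed

definition of_Var :: "'k::alg_closed_field K0_Var \<Rightarrow> 'k K0_St" where
  "of_Var a = abs_K0_St (a, 1)"

lemma of_Var_0: "of_Var 0 = 0" and of_Var_1: "of_Var 1 = 1"
  by (simp_all add: of_Var_def zero_K0_St_def one_K0_St_def)

lemma of_Var_add: "of_Var (a + b) = of_Var a + of_Var b"
  and of_Var_mult: "of_Var (a * b) = of_Var a * of_Var b"
  and of_Var_uminus: "of_Var (- a) = - of_Var a"
  by (simp_all add: of_Var_def abs_K0_St_simps lefschetz_system.one)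

lemma of_Var_diff: "of_Var (a - b) = of_Var a - of_Var b"
  unfolding diff_conv_add_uminus of_Var_add of_Var_uminus ..

lemma of_Var_power: "of_Var (a ^ n) = of_Var a ^ n"
  by (induction n) (simp_all add: of_Var_1 of_Var_mult)

lemma lefschetz_system_unit: "s \<in> lefschetz_system \<Longrightarrow> of_Var s * abs_K0_St (1, s) = 1"
  unfolding of_Var_def one_K0_St_def map_fun_apply id_apply
  by (simp add: abs_K0_St_simps lefschetz_system.one) (rule K0_St_eqI, rule fraction_rel_eq; simp add: lefschetz_system.one)

definition St_class :: "('k::alg_closed_field, 'p) space \<Rightarrow> 'k K0_St" where
  "St_class X = of_Var (var_class X)"

definition Lef :: "'k::alg_closed_field K0_St" where
  "Lef = St_class (affine_space 1 :: ('k, 'k list) space)"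

lemma Lef_unit: "Lef * inverse Lef = (1 :: 'k::alg_closed_field K0_St)"
proof -
  have "var_class (affine_space 1 :: ('k, 'k list) space) * 1 \<in> lefschetz_system"
    by (intro lefschetz_system.L lefschetz_system.one)
  then have "Lef * abs_K0_St (1, var_class (affine_space 1 :: ('k, 'k list) space)) = 1"
    unfolding Lef_def St_class_def by (intro lefschetz_system_unit) simp
  then show ?thesis using inverse_K0_St_eq by metis
qed

subsection \<open>Adjoining a square root\<close>

quotient_type (overloaded) 'k K0_St_sqrt = "'k::alg_closed_field K0_St poly" /
  "\<lambda>p q. \<exists>h. p - q = [:- Lef, 0, 1:] * h"
proof (rule equivpI)
  show "reflp (\<lambda>p q :: 'k K0_St poly. \<exists>h. p - q = [:- Lef, 0, 1:] * h)"
    by (intro reflpI exI[of _ 0]) simp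
  show "symp (\<lambda>p q :: 'k K0_St poly. \<exists>h. p - q = [:- Lef, 0, 1:] * h)"
  proof (rule sympI, elim exE)
    fix p q h :: "'k K0_St poly" assume "p - q = [:- Lef, 0, 1:] * h"
    then have "q - p = [:- Lef, 0, 1:] * (- h)" by (metis minus_diff_eq mult_minus_right)
    then show "\<exists>h. q - p = [:- Lef, 0, 1:] * h" ..
  qed
  show "transp (\<lambda>p q :: 'k K0_St poly. \<exists>h. p - q = [:- Lef, 0, 1:] * h)"
  proof (rule transpI, elim exE)
    fix p q r h k :: "'k K0_St poly" assume "p - q = [:- Lef, 0, 1:] * h" "q - r = [:- Lef, 0, 1:] * k"
    then have "p - r = [:- Lef, 0, 1:] * (h + k)" unfolding distrib_left by (metis diff_add_cancel add_diff_eq)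
    then show "\<exists>h. p - r = [:- Lef, 0, 1:] * h" ..
  qed
qed

instantiation K0_St_sqrt :: (alg_closed_field) "{comm_ring, comm_monoid_mult, inverse}"
begin

lift_definition zero_K0_St_sqrt :: "'a K0_St_sqrt" is 0 .

lift_definition one_K0_St_sqrt :: "'a K0_St_sqrt" is "[:1:]" .

lift_definition plus_K0_St_sqrt :: "'a K0_St_sqrt \<Rightarrow> 'a K0_St_sqrt \<Rightarrow> 'a K0_St_sqrt" is "(+)"
proof (elim exE)
  fix p p' q q' h k :: "'a K0_St poly" assume "p - p' = [:- Lef, 0, 1:] * h" "q - q' = [:- Lef, 0, 1:] * k"
  then have "p + q - (p' + q') = [:- Lef, 0, 1:] * (h + k)" unfolding distrib_left by (metis add_diff_add)
  then show "\<exists>h. p + q - (p' + q') = [:- Lef, 0, 1:] * h" ..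
qed

lift_definition uminus_K0_St_sqrt :: "'a K0_St_sqrt \<Rightarrow> 'a K0_St_sqrt" is uminus
proof (elim exE)
  fix p p' h :: "'a K0_St poly" assume h: "p - p' = [:- Lef, 0, 1:] * h"
  have "- p - - p' = - (p - p')" by simp
  also have "\<dots> = [:- Lef, 0, 1:] * (- h)" unfolding h mult_minus_right ..
  finally show "\<exists>h. - p - - p' = [:- Lef, 0, 1:] * h" ..
qed

definition minus_K0_St_sqrt :: "'a K0_St_sqrt \<Rightarrow> 'a K0_St_sqrt \<Rightarrow> 'a K0_St_sqrt" where
  "minus_K0_St_sqrt a b = a + - b"

lift_definition times_K0_St_sqrt :: "'a K0_St_sqrt \<Rightarrow> 'a K0_St_sqrt \<Rightarrow> 'a K0_St_sqrt" is "(*)"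
proof (elim exE)
  fix p p' q q' h k :: "'a K0_St poly" assume hk: "p - p' = [:- Lef, 0, 1:] * h" "q - q' = [:- Lef, 0, 1:] * k"
  have "p * q - p' * q' = (p - p') * q + p' * (q - q')" by (simp add: left_diff_distrib right_diff_distrib)
  also have "\<dots> = [:- Lef, 0, 1:] * (h * q + k * p')" unfolding hk distrib_left
    by (simp only: mult.assoc mult.commute[of p'])
  finally show "\<exists>h. p * q - p' * q' = [:- Lef, 0, 1:] * h" ..
qed

definition inverse_K0_St_sqrt :: "'a K0_St_sqrt \<Rightarrow> 'a K0_St_sqrt" where
  "inverse_K0_St_sqrt a = (if \<exists>b. a * b = 1 then THE b. a * b = 1 else 0)"

definition divide_K0_St_sqrt :: "'a K0_St_sqrt \<Rightarrow> 'a K0_St_sqrt \<Rightarrow> 'a K0_St_sqrt" where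
  "divide_K0_St_sqrt a b = a * inverse b"

lemma const_1_mult: "[:1:] * p = (p :: 'a K0_St poly)"
  by (rule poly_eqI) simp

instance
proof
  fix x y z :: "'a K0_St_sqrt"
  obtain a b c where abs: "x = abs_K0_St_sqrt a" "y = abs_K0_St_sqrt b" "z = abs_K0_St_sqrt c"
    by (metis Quotient3_abs_rep[OF Quotient3_K0_St_sqrt])
  note simps = abs plus_K0_St_sqrt.abs_eq times_K0_St_sqrt.abs_eq uminus_K0_St_sqrt.abs_eq
    zero_K0_St_sqrt.abs_eq one_K0_St_sqrt.abs_eq
  show "x + y + z = x + (y + z)" "x + y = y + x" "x * y * z = x * (y * z)" "x * y = y * x" "(x + y) * z = x * z + y * z"
    "0 + x = x" "- x + x = 0"
    unfolding simps by (simp_all add: algebra_simps)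
  show "1 * x = x" unfolding simps const_1_mult ..
  show "x - y = x + - y" by (simp add: minus_K0_St_sqrt_def)
qed

end

lemma inverse_K0_St_sqrt_eq: "a * b = 1 \<Longrightarrow> inverse a = (b :: 'k::alg_closed_field K0_St_sqrt)"
proof -
  assume ab: "a * b = 1"
  have "(THE c. a * c = 1) = b" 
    by (rule the_equality[where P="\<lambda>c. a * c = 1", OF ab]) (rule comm_inverse_unique[OF _ ab])
  then show "inverse a = b" unfolding inverse_K0_St_sqrt_def using ab by (simp only: if_P[OF exI[of _ b]])
qed

definition of_St :: "'k::alg_closed_field K0_St \<Rightarrow> 'k K0_St_sqrt" where
  "of_St a = abs_K0_St_sqrt [:a:]"

definition Lef_sqrt :: "'k::alg_closed_field K0_St_sqrt" where
  "Lef_sqrt = abs_K0_St_sqrt [:0, 1:]"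

lemma Lef_sqrt_square: "Lef_sqrt * Lef_sqrt = of_St Lef"
proof -
  have "[:0, 1:] * [:0, 1:] - [:Lef:] = [:- Lef, 0, 1:] * [:1:]"
    by (simp add: poly_eq_iff coeff_pCons split: nat.split)
  then show ?thesis unfolding Lef_sqrt_def of_St_def times_K0_St_sqrt.abs_eq K0_St_sqrt.abs_eq_iff ..
qed

lemma of_St_mult: "of_St (a * b) = of_St a * of_St b"
  unfolding of_St_def times_K0_St_sqrt.abs_eq by (simp add: mult.commute)

lemma of_St_1: "of_St 1 = 1"
  by (simp add: of_St_def one_K0_St_sqrt.abs_eq)

lemma Lef_sqrt_unit: "Lef_sqrt * inverse Lef_sqrt = (1 :: 'k::alg_closed_field K0_St_sqrt)"
proof -
  have "Lef_sqrt * (Lef_sqrt * of_St (inverse Lef)) = (1 :: 'k K0_St_sqrt)"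
    by (simp add: Lef_sqrt_square Lef_unit of_St_1 flip: mult.assoc of_St_mult)
  then show ?thesis using inverse_K0_St_sqrt_eq by metis
qed

text \<open>
  The library states these instances only for coefficient rings with \<open>0 \<noteq> 1\<close>.
\<close>

instance fps :: ("{semiring_0, monoid_mult}") monoid_mult
proof
  show "1 * a = a" "a * 1 = a" for a :: "'a fps"
    by (simp_all add: fps_eq_iff fps_mult_nth mult_delta_left mult_delta_right)
qed

instance fps :: ("{comm_semiring_0, comm_monoid_mult}") comm_monoid_mult
  by standard simp

text \<open>
  The substitution \<open>F(c t)\<close>.
\<close>

definition fps_dilate :: "'a::{comm_semiring_0, comm_monoid_mult} \<Rightarrow> 'a fps \<Rightarrow> 'a fps" where
  "fps_dilate c F = Abs_fps (\<lambda>n. c ^ n * fps_nth F n)"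

section \<open>Quotients, general linear groups, Grassmannians and noncommutative Quot schemes\<close>

text \<open>
  The quotient topology along \<open>\<pi>\<close>, with the functions whose pullback is regular. If \<open>\<pi>\<close> maps each point to
  its orbit under a group, these are the invariant functions; a geometric quotient, if it exists, is this
  space.
\<close>

definition quotient_space :: "('p \<Rightarrow> 'q) \<Rightarrow> ('k::field, 'p) space \<Rightarrow> ('k, 'q) space" where
  "quotient_space \<pi> X = Space
     (topology (\<lambda>V. V \<subseteq> \<pi> ` pts X \<and> openin (zar X) {x\<in>pts X. \<pi> x \<in> V}))
     (\<lambda>V. {f. (\<lambda>x. f (\<pi> x)) \<in> reg X {x\<in>pts X. \<pi> x \<in> V}})"

lemma openin_quotient:
  "openin (zar (quotient_space \<pi> X)) V \<longleftrightarrow> V \<subseteq> \<pi> ` pts X \<and> openin (zar X) {x\<in>pts X. \<pi> x \<in> V}"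
proof -
  have "istopology (\<lambda>V. V \<subseteq> \<pi> ` pts X \<and> openin (zar X) {x\<in>pts X. \<pi> x \<in> V})"
    unfolding istopology_def
  proof (rule conjI; intro allI impI)
    fix S T assume "S \<subseteq> \<pi> ` pts X \<and> openin (zar X) {x\<in>pts X. \<pi> x \<in> S}" "T \<subseteq> \<pi> ` pts X \<and> openin (zar X) {x\<in>pts X. \<pi> x \<in> T}"
    moreover have "{x\<in>pts X. \<pi> x \<in> S \<inter> T} = {x\<in>pts X. \<pi> x \<in> S} \<inter> {x\<in>pts X. \<pi> x \<in> T}" by blast
    ultimately show "S \<inter> T \<subseteq> \<pi> ` pts X \<and> openin (zar X) {x\<in>pts X. \<pi> x \<in> S \<inter> T}"
      by (simp only: openin_Int) blast
  next
    fix K assume K: "\<forall>S\<in>K. S \<subseteq> \<pi> ` pts X \<and> openin (zar X) {x\<in>pts X. \<pi> x \<in> S}"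
    have "{x\<in>pts X. \<pi> x \<in> \<Union>K} = (\<Union>S\<in>K. {x\<in>pts X. \<pi> x \<in> S})" by blast
    then show "\<Union>K \<subseteq> \<pi> ` pts X \<and> openin (zar X) {x\<in>pts X. \<pi> x \<in> \<Union>K}"
      using K by auto
  qed
  then show ?thesis by (simp add: quotient_space_def topology_inverse')
qed

lemma pts_quotient: "pts (quotient_space \<pi> X) = \<pi> ` pts X"
proof
  show "pts (quotient_space \<pi> X) \<subseteq> \<pi> ` pts X"
    using openin_topspace[of "zar (quotient_space \<pi> X)"] unfolding openin_quotient by blast
  have "{x\<in>pts X. \<pi> x \<in> \<pi> ` pts X} = pts X" by blast
  then have "openin (zar (quotient_space \<pi> X)) (\<pi> ` pts X)" unfolding openin_quotient by simp
  then show "\<pi> ` pts X \<subseteq> pts (quotient_space \<pi> X)" by (rule openin_subset)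
qed

definition mat_coords :: "'k mat \<Rightarrow> 'k list" where
  "mat_coords A = concat (mat_to_list A)"

definition GL_space :: "nat \<Rightarrow> ('k::field, 'k mat) space" where
  "GL_space n = induced_space mat_coords {A \<in> carrier_mat n n. invertible_mat A} (affine_space (n * n))"

abbreviation vspan :: "nat \<Rightarrow> 'k::field vec set \<Rightarrow> 'k vec set" where
  "vspan n S \<equiv> LinearCombinations.module.span class_ring (module_vec TYPE('k) n) S"

text \<open>
  The Grassmannian is the quotient of the space of linearly independent \<open>k\<close>-tuples of vectors by the map
  sending a tuple to its span; its points are all \<open>k\<close>-dimensional subspaces (lemma \<open>pts_grassmannian\<close>).
\<close>

definition subspaces :: "nat \<Rightarrow> nat \<Rightarrow> 'k::field vec set set" where
  "subspaces k n = {W. VectorSpace.subspace class_ring W (module_vec TYPE('k) n) \<and>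
     vectorspace.dim class_ring ((module_vec TYPE('k) n)\<lparr>carrier := W\<rparr>) = k}"

definition frame_space :: "nat \<Rightarrow> nat \<Rightarrow> ('k::field, 'k vec list) space" where
  "frame_space k n = induced_space (\<lambda>vs. concat (map list_of_vec vs))
     {vs. length vs = k \<and> set vs \<subseteq> carrier_vec n \<and> vspan n (set vs) \<in> subspaces k n} (affine_space (k * n))"

definition grassmannian :: "nat \<Rightarrow> nat \<Rightarrow> ('k::field, 'k vec set) space" where
  "grassmannian k n = quotient_space (\<lambda>vs. vspan n (set vs)) (frame_space k n)"

definition tuple_coords :: "'k mat list \<times> 'k vec list \<Rightarrow> 'k list" where
  "tuple_coords = (\<lambda>(Ts, vs). concat (map mat_coords Ts) @ concat (map list_of_vec vs))"

definition tuple_space :: "nat \<Rightarrow> nat \<Rightarrow> nat \<Rightarrow> ('k::field, 'k mat list \<times> 'k vec list) space" where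
  "tuple_space n r d = induced_space tuple_coords
     {(Ts, vs). length Ts = d \<and> set Ts \<subseteq> carrier_mat n n \<and> length vs = r \<and> set vs \<subseteq> carrier_vec n}
     (affine_space (d * n^2 + r * n))"

inductive_set monomials :: "nat \<Rightarrow> 'k::field mat list \<Rightarrow> 'k mat set" for n :: nat and Ts :: "'k mat list" where
  empty: "1\<^sub>m n \<in> monomials n Ts"
| step: "T \<in> set Ts \<Longrightarrow> M \<in> monomials n Ts \<Longrightarrow> T * M \<in> monomials n Ts"

definition stable_space :: "nat \<Rightarrow> nat \<Rightarrow> nat \<Rightarrow> ('k::field, 'k mat list \<times> 'k vec list) space" where
  "stable_space n r d = sub_space (tuple_space n r d)
     {(Ts, vs). vspan n {M *\<^sub>v v | M v. M \<in> monomials n Ts \<and> v \<in> set vs} = carrier_vec n}"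

text \<open>
  In \<open>GL_orbit\<close>, the matrix \<open>h\<close> is the inverse of \<open>g\<close>.
\<close>

definition GL_orbit :: "nat \<Rightarrow> 'k::field mat list \<times> 'k vec list \<Rightarrow> ('k mat list \<times> 'k vec list) set" where
  "GL_orbit n = (\<lambda>(Ts, vs). {(map (\<lambda>T. g * T * h) Ts, map (\<lambda>v. g *\<^sub>v v) vs) | g h.
     g \<in> carrier_mat n n \<and> h \<in> carrier_mat n n \<and> inverts_mat g h \<and> inverts_mat h g})"

definition ncQuot :: "nat \<Rightarrow> nat \<Rightarrow> nat \<Rightarrow> ('k::field, ('k mat list \<times> 'k vec list) set) space" where
  "ncQuot n r d = quotient_space (GL_orbit n) (stable_space n r d)"

definition ncQuot_dim :: "nat \<Rightarrow> nat \<Rightarrow> nat \<Rightarrow> int" where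
  "ncQuot_dim n r d = (int d - 1) * int n ^ 2 + int r * int n"

definition Z_series :: "nat \<Rightarrow> nat \<Rightarrow> complex K0_St_sqrt fps" where
  "Z_series r d = Abs_fps (\<lambda>n. Lef_sqrt powi (- ncQuot_dim n r d) *
     of_St (St_class (ncQuot n r d :: (complex, _) space)) * (Lef_sqrt ^ (r - 1)) ^ n)"

lemma (in vectorspace) subspace_spanning_set:
  assumes fd: "fin_dim" and W: "subspace K W V"
  shows "\<exists>A. finite A \<and> A \<subseteq> W \<and> card A = vectorspace.dim K (vs W) \<and> span A = W"
proof -
  interpret W: vectorspace K "vs W" by (rule subspace_is_vs[OF W])
  have WC: "W \<subseteq> carrier V" and sub: "submodule K W V" using W unfolding subspace_def submodule_def by auto
  have small: "finite A \<and> card A \<le> dim" if "A \<subseteq> carrier (vs W) \<and> W.lin_indpt A" for A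
  proof -
    have A: "A \<subseteq> W" using that by simp
    then have "lin_indpt A" using that span_li_not_depend(2)[OF A sub] by simp
    then show ?thesis using li_le_dim[OF fd] A WC by auto
  qed
  have "\<exists>A. finite A \<and> maximal A (\<lambda>S. S \<subseteq> carrier (vs W) \<and> W.lin_indpt S)"
  proof (rule maximal_exists[where P="\<lambda>S. S \<subseteq> carrier (vs W) \<and> W.lin_indpt S" and N=dim and B="{}"])
    show "finite A \<and> card A \<le> dim" if "A \<subseteq> carrier (vs W) \<and> W.lin_indpt A" for A
      using that by (rule small)
    show "{} \<subseteq> carrier (vs W) \<and> W.lin_indpt {}"
      unfolding W.lin_dep_def by blast
  qed
  then obtain A where A: "finite A" "maximal A (\<lambda>S. S \<subseteq> carrier (vs W) \<and> W.lin_indpt S)" by blast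
  have b: "W.basis A" by (rule W.max_li_is_basis[OF A(2)])
  then have AW: "A \<subseteq> W" and "W.span A = W" unfolding W.basis_def by auto
  then have "span A = W" using span_li_not_depend(1)[OF AW sub] by simp
  moreover have "card A = W.dim" using W.dim_basis[OF A(1) b] by simp
  ultimately show ?thesis using A(1) AW by blast
qed

lemma coords_length: "length vs = k \<Longrightarrow> set vs \<subseteq> carrier_vec n \<Longrightarrow> length (concat (map list_of_vec vs)) = k * n"
  by (induction vs arbitrary: k) auto

lemma pts_grassmannian: "pts (grassmannian k n) = (subspaces k n :: 'k::field vec set set)"
proof -
  interpret vec_space "TYPE('k)" n .
  have "W \<in> (\<lambda>vs. vspan n (set vs)) ` pts (frame_space k n)" if W: "W \<in> subspaces k n" for W :: "'k vec set"
  proof -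
    have sub: "VectorSpace.subspace class_ring W (module_vec TYPE('k) n)"
      and dim: "vectorspace.dim class_ring ((module_vec TYPE('k) n)\<lparr>carrier := W\<rparr>) = k"
      using W unfolding subspaces_def by auto
    obtain A where A: "finite A" "A \<subseteq> W" "card A = k" "vspan n A = W"
      using vectorspace.subspace_spanning_set[OF vec_vs fin_dim sub] dim by blast
    have "W \<subseteq> carrier_vec n" using sub unfolding VectorSpace.subspace_def submodule_def by (auto simp: module_vec_simps)
    obtain vs where vs: "set vs = A" "distinct vs" using finite_distinct_list[OF A(1)] by blast
    have "length vs = k" using vs A(3) distinct_card by metis
    then have "vs \<in> pts (frame_space k n)"
      unfolding frame_space_def pts_induced pts_affine
      using vs A W \<open>W \<subseteq> carrier_vec n\<close> coords_length[of vs k n] by auto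
    then show ?thesis using vs A by (intro image_eqI[of _ _ vs]) auto
  qed
  then show ?thesis
    unfolding grassmannian_def pts_quotient by (auto simp: frame_space_def pts_induced)
qed

end

theory Submission
  imports Defs
begin

text \<open>
  Stratify the tuples \<open>(T, v)\<close> on \<open>V\<^sub>n\<close> by the dimension \<open>k\<close> of the span of all monomials applied to the
  vectors. A tuple in the \<open>k\<close>-th stratum restricts to a stable tuple on that span, and in a basis adapted to
  the span the \<open>T\<close> are block upper triangular. Hence \<open>GL\<^sub>n\<close> times the space of block triangular tuples with
  stable first block is a Zariski locally trivial bundle over the stratum, with fibre the parabolic subgroup
  of \<open>GL\<^sub>n\<close>; the local sections are given by the injective matrices \<open>(w\<^sub>1 v\<^sub>i\<^sub>1, \<dots>, w\<^sub>k v\<^sub>i\<^sub>k)\<close> for monomials \<open>w\<^sub>j\<close>.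
  This expresses the class of the stratum by that of the stable tuples on \<open>V\<^sub>k\<close>, which is
  \<open>[GL\<^sub>k] [ncQuot\<^sup>k]\<close> because the \<open>GL\<^sub>k\<close>-torsor has local sections as well. Adding up all strata
  yields the recursion. The case \<open>d = 0\<close> of the stratification also provides the classes of \<open>GL\<^sub>n\<close> and of the
  Grassmannians that are needed.

  For the generating functions put \<open>C(t) = \<Sum>\<^sub>n L\<^sup>e t\<^sup>n / [GL\<^sub>n]\<close> with \<open>2 e = (d + 1) n\<^sup>2 - n\<close>. The recursion says
  \<open>C(L\<^sup>r t) = C(t) Z\<^sub>r(t)\<close>, so that \<open>Z\<^sub>r\<close> is a product of the series \<open>Z\<^sub>1(L\<^sup>i t)\<close>, and the recursion for
  \<open>[GL\<^sub>n]\<close> says \<open>C(L t) = C(t) + L\<^sup>d\<^sup>/\<^sup>2 t C(L\<^sup>d t)\<close>, which divided by \<open>C(t)\<close> is the functional equation.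
\<close>

section \<open>Restrictions and locally trivial morphisms\<close>

text \<open>Two obstacles shape the argument. The quotients are given only as spaces with functions,
  so that they are varieties has to be proved; and words of arbitrary length form an infinite index
  set, whereas a class can be cut up only finitely often. Both are met by the same device: charts
  are the loci where a determinant built from a word matrix \<open>W\<close> is nonzero. As
  \<open>W (g x) = g * W x\<close>, inverting \<open>W\<close> gives regular normal forms for
  orbits, and the Hilbert basis theorem leaves finitely many charts. Working with \<open>GL\<close>
  times triangular tuples, instead of fibring a stratum over the Grassmannian, makes every
  trivialisation a formula in matrices of fixed size. The price is a factor \<open>[GL]\<close> on
  both sides, so the relation is proved in \<open>K0_Var\<close> and divided only in
  \<open>K0_St\<close>. That \<open>[GL]\<close> is a unit comes from the same relation without
  circularity: one vector, no endomorphisms and \<open>k = 1\<close> only require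
  \<open>L - 1\<close> to be cancelled, and express \<open>[GL]\<close> in dimension
  \<open>n + 1\<close> by \<open>[GL]\<close> in dimension \<open>n\<close>.\<close>

lemma sub_space_open_reg:
  assumes X: "space_with_functions X" and U: "openin (zar X) U" and V: "openin (zar X) V" "V \<subseteq> U"
  shows "f \<in> reg (sub_space X U) V \<longleftrightarrow> f \<in> reg X V"
proof
  interpret X: space_with_functions X by fact
  assume f: "f \<in> reg (sub_space X U) V"
  show "f \<in> reg X V"
  proof (rule X.glue[OF V(1)])
    fix x assume x: "x \<in> V"
    with f obtain W g where W: "openin (zar X) W" "x \<in> W" "g \<in> reg X W" "\<forall>y\<in>V. y \<in> W \<longrightarrow> f y = g y"
      unfolding reg_induced by blast
    have o: "openin (zar X) (V \<inter> W)" using V W by blast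
    show "\<exists>W g. openin (zar X) W \<and> x \<in> W \<and> W \<subseteq> V \<and> g \<in> reg X W \<and> (\<forall>y\<in>W. f y = g y)"
      by (rule exI[of _ "V \<inter> W"], rule exI[of _ g]) (use W x o X.restrict[OF W(1) o _ W(3)] in auto)
  qed
next
  assume "f \<in> reg X V"
  then show "f \<in> reg (sub_space X U) V"
    unfolding reg_induced using V(1) by blast
qed

lemma sub_space_open_openin:
  assumes "openin (zar X) U" "V \<subseteq> U"
  shows "openin (zar (sub_space X U)) V \<longleftrightarrow> openin (zar X) V"
  unfolding open_sub using assms by (metis inf.absorb_iff2 openin_Int)

lemma morphism_inclusion: "space_with_functions X \<Longrightarrow> morphism (sub_space X A) X (\<lambda>x. x)"
  by (rule morphism_induced_map)

lemma morphism_into_sub: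
  assumes "space_with_functions W" "morphism W X f" "\<And>x. x \<in> pts W \<Longrightarrow> f x \<in> A"
  shows "morphism W (sub_space X A) f"
  by (rule morphism_into_induced) (use assms in auto)

section \<open>Locally closed subsets and additivity of classes\<close>

definition locally_closed :: "('k::field, 'p) space \<Rightarrow> 'p set \<Rightarrow> bool" where
  "locally_closed X A \<longleftrightarrow> (\<exists>C G. closedin (zar X) C \<and> openin (zar X) G \<and> A = C \<inter> G)"

lemma locally_closed_open: "openin (zar X) G \<Longrightarrow> locally_closed X G"
  unfolding locally_closed_def using openin_subset by (intro exI[of _ "pts X"] exI[of _ G]) auto

lemma locally_closed_closed: "closedin (zar X) C \<Longrightarrow> locally_closed X C"
  unfolding locally_closed_def using closedin_subset by (intro exI[of _ C] exI[of _ "pts X"]) auto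

lemma locally_closed_Int: "locally_closed X A \<Longrightarrow> locally_closed X B \<Longrightarrow> locally_closed X (A \<inter> B)"
  unfolding locally_closed_def
proof (elim exE conjE)
  fix C G C' G'
  assume "closedin (zar X) C" "openin (zar X) G" "A = C \<inter> G" "closedin (zar X) C'" "openin (zar X) G'" "B = C' \<inter> G'"
  then show "\<exists>C G. closedin (zar X) C \<and> openin (zar X) G \<and> A \<inter> B = C \<inter> G"
    by (intro exI[of _ "C \<inter> C'"] exI[of _ "G \<inter> G'"]) auto
qed

lemma locally_closed_Diff: "locally_closed X A \<Longrightarrow> openin (zar X) V \<Longrightarrow> locally_closed X (A - V)"
proof -
  assume A: "locally_closed X A" and V: "openin (zar X) V"
  have "A \<subseteq> pts X" using A closedin_subset unfolding locally_closed_def by blast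
  then have "A - V = A \<inter> (pts X - V)" by blast
  then show ?thesis using locally_closed_Int[OF A locally_closed_closed[of X "pts X - V"]] V by auto
qed

lemma locally_closed_subset: "locally_closed X A \<Longrightarrow> A \<subseteq> pts X"
  unfolding locally_closed_def using closedin_subset by blast

lemma variety_locally_closed: "variety X \<Longrightarrow> locally_closed X A \<Longrightarrow> variety (sub_space X A)"
  unfolding locally_closed_def using variety_sub_locally_closed by blast

lemma locally_closed_preimage:
  assumes f: "morphism X Y f" and A: "locally_closed Y A"
  shows "locally_closed X {x\<in>pts X. f x \<in> A}"
proof -
  from A obtain C G where CG: "closedin (zar Y) C" "openin (zar Y) G" "A = C \<inter> G" unfolding locally_closed_def by blast
  then have "{x\<in>pts X. f x \<in> A} = {x\<in>pts X. f x \<in> C} \<inter> {x\<in>pts X. f x \<in> G}" by auto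
  then show ?thesis unfolding locally_closed_def using closedin_preimage[OF f CG(1)] morphismD(3)[OF f CG(2)] by blast
qed

text \<open>The trace of \<open>V\<close> is open in \<open>sub_space X A\<close>, so this is a
  scissor relation there. Both pieces are then re-embedded in \<open>X\<close>, so that repeated
  cutting never nests subspaces.\<close>

lemma var_class_split:
  assumes X: "variety X" and A: "locally_closed X A" and V: "openin (zar X) V"
  shows "var_class (sub_space X A) = var_class (sub_space X (A \<inter> V)) + var_class (sub_space X (A - V))"
proof -
  let ?A = "sub_space X A"
  have vA: "variety ?A" by (rule variety_locally_closed[OF X A])
  have pA: "pts ?A = A" using locally_closed_subset[OF A] by (auto simp: pts_sub)
  have oA: "openin (zar ?A) (A \<inter> V)" unfolding open_sub using V by blast
  have d: "A - (A - V) = A \<inter> V" "A - A \<inter> V = A - V" by auto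
  have c: "closedin (zar ?A) (A - V)" unfolding closedin_def pA d using oA by auto
  have AA: "A \<inter> (A \<inter> V) = A \<inter> V" "A \<inter> (A - V) = A - V" by auto
  have "var_class ?A = var_class (sub_space ?A (A \<inter> V)) + var_class (sub_space ?A (A - V))"
    using var_class_scissor[OF vA c] unfolding pA d .
  also have "var_class (sub_space ?A (A \<inter> V)) = var_class (sub_space X (A \<inter> V))"
    using iso_sub_sub[OF variety_swf[OF X], where A=A and B="A \<inter> V"] unfolding AA
    by (intro var_class_iso variety_open[OF vA oA] variety_locally_closed[OF X] locally_closed_Int A locally_closed_open V)
  also have "var_class (sub_space ?A (A - V)) = var_class (sub_space X (A - V))"
    using iso_sub_sub[OF variety_swf[OF X], where A=A and B="A - V"] unfolding AA
    by (intro var_class_iso variety_closed[OF vA c] variety_locally_closed[OF X] locally_closed_Diff A V)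
  finally show ?thesis .
qed

text \<open>Cutting the empty set along itself gives \<open>c = c + c\<close>.\<close>

lemma variety_empty_class:
  fixes X :: "('k::alg_closed_field, 'p) space"
  assumes "variety X"
  shows "var_class (sub_space X {}) = 0"
  using var_class_split[OF assms locally_closed_open[OF openin_empty] openin_empty] by simp

lemma morphism_prod_map:
  assumes X: "space_with_functions X" "space_with_functions X'" "space_with_functions Y" "space_with_functions Y'"
    and f: "morphism X X' f" and g: "morphism Y Y' g"
  shows "morphism (prod_space X Y) (prod_space X' Y') (\<lambda>z. (f (fst z), g (snd z)))"
proof -
  interpret XY: two_spaces X Y using assms by (simp add: two_spaces_def)
  interpret XY': two_spaces X' Y' using assms by (simp add: two_spaces_def)
  show ?thesis
    by (intro XY'.morphism_pair XY.prod_swf morphism_compose[OF XY.morphism_fst f] morphism_compose[OF XY.morphism_snd g])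
qed

text \<open>Zariski local triviality with fibre \<open>F\<close>: over \<open>V i\<close>, the maps
  \<open>a i\<close> and \<open>(b i, f)\<close> are inverse to each other. Transition maps between
  charts never matter, since classes add up over a decomposition of the base into locally closed
  pieces that each lie in one chart.\<close>

lemma var_class_locally_trivial:
  fixes X :: "('k::alg_closed_field, 'p) space" and Y :: "('k, 'q) space" and F :: "('k, 'r) space"
  assumes X: "variety X" and Y: "variety Y" and F: "variety F" and f: "morphism X Y f"
    and N: "finite N" "pts Y \<subseteq> (\<Union>i\<in>N. V i)" and V: "\<And>i. i \<in> N \<Longrightarrow> openin (zar Y) (V i)"
    and a: "\<And>i. i \<in> N \<Longrightarrow> morphism (prod_space F (sub_space Y (V i))) X (a i)"
    and b: "\<And>i. i \<in> N \<Longrightarrow> morphism (sub_space X {x\<in>pts X. f x \<in> V i}) F (b i)"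
    and fa: "\<And>i z y. i \<in> N \<Longrightarrow> z \<in> pts F \<Longrightarrow> y \<in> V i \<Longrightarrow> f (a i (z, y)) = y"
    and ba: "\<And>i z y. i \<in> N \<Longrightarrow> z \<in> pts F \<Longrightarrow> y \<in> V i \<Longrightarrow> b i (a i (z, y)) = z"
    and ab: "\<And>i x. i \<in> N \<Longrightarrow> x \<in> pts X \<Longrightarrow> f x \<in> V i \<Longrightarrow> a i (b i x, f x) = x"
  shows "var_class X = var_class F * var_class Y"
proof -
  let ?P = "\<lambda>Z. {x\<in>pts X. f x \<in> Z}"
  note sX = variety_swf[OF X] and sY = variety_swf[OF Y] and sF = variety_swf[OF F]
  have single: "var_class (sub_space X (?P Z)) = var_class F * var_class (sub_space Y Z)"
    if Z: "locally_closed Y Z" and ZV: "Z \<subseteq> V i" and i: "i \<in> N" for Z i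
  proof -
    have vZ: "variety (sub_space Y Z)" by (rule variety_locally_closed[OF Y Z])
    have vP: "variety (sub_space X (?P Z))" by (intro variety_locally_closed[OF X] locally_closed_preimage[OF f Z])
    interpret FZ: two_spaces F "sub_space Y Z" using sF induced_swf[OF sY] by (simp add: two_spaces_def)
    have pZ: "pts (sub_space Y Z) = Z" using locally_closed_subset[OF Z] by (auto simp: pts_sub)
    have sV: "space_with_functions (sub_space Y (V i))" by (rule induced_swf[OF sY])
    have 1: "morphism (prod_space F (sub_space Y Z)) (prod_space F (sub_space Y (V i))) (\<lambda>z. (fst z, snd z))"
      by (rule morphism_prod_map[OF sF sF FZ.Y.space_with_functions_axioms sV morphism_id[OF sF]])
        (intro morphism_into_sub FZ.Y.space_with_functions_axioms morphism_inclusion[OF sY], use pZ ZV in auto)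
    have 2: "morphism (prod_space F (sub_space Y Z)) X (a i)"
      using morphism_compose[OF 1 a[OF i]] by simp
    have A: "morphism (prod_space F (sub_space Y Z)) (sub_space X (?P Z)) (a i)"
    proof (rule morphism_into_sub[OF FZ.prod_swf 2])
      fix x assume x: "x \<in> pts (prod_space F (sub_space Y Z))"
      then obtain z y where "x = (z, y)" "z \<in> pts F" "y \<in> Z" by (auto simp: FZ.pts_prod pZ)
      then show "a i x \<in> ?P Z" using fa[OF i] ZV morphismD(2)[OF 2 x] by auto
    qed
    have sP: "space_with_functions (sub_space X (?P Z))" by (rule induced_swf[OF sX])
    have B: "morphism (sub_space X (?P Z)) (prod_space F (sub_space Y Z)) (\<lambda>x. (b i x, f x))"
    proof (rule FZ.morphism_pair[OF sP])
      have "morphism (sub_space X (?P Z)) (sub_space X (?P (V i))) (\<lambda>x. x)"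
        by (intro morphism_into_sub sP morphism_inclusion sX) (use ZV in \<open>auto simp: pts_sub\<close>)
      then show "morphism (sub_space X (?P Z)) F (b i)" using morphism_compose[OF _ b[OF i]] by blast
      show "morphism (sub_space X (?P Z)) (sub_space Y Z) f"
        by (intro morphism_into_sub[OF sP] morphism_compose[OF morphism_inclusion[OF sX] f]) (auto simp: pts_sub)
    qed
    have "iso_spaces (sub_space X (?P Z)) (prod_space F (sub_space Y Z))"
      by (rule iso_spacesI[OF B A]) (use fa[OF i] ba[OF i] ab[OF i] ZV in \<open>auto simp: pts_sub FZ.pts_prod subset_iff\<close>)
    then have "var_class (sub_space X (?P Z)) = var_class (prod_space F (sub_space Y Z))"
      by (intro var_class_iso vP variety_prod F vZ)
    then show ?thesis by (simp add: var_class_prod F vZ)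
  qed
  \<comment> \<open>Induction on the number of charts, for all locally closed \<open>Z\<close> at
    once: the part of \<open>Z\<close> in \<open>V i\<close> is settled by \<open>single\<close>,
    and the rest is covered by one chart less.\<close>
  have main: "var_class (sub_space X (?P Z)) = var_class F * var_class (sub_space Y Z)"
    if "finite M" "M \<subseteq> N" "locally_closed Y Z" "Z \<subseteq> (\<Union>i\<in>M. V i)" for M Z
    using that
  proof (induction M arbitrary: Z rule: finite_induct)
    case empty
    then have "Z = {}" by simp
    then show ?case by (simp add: variety_empty_class[OF X] variety_empty_class[OF Y])
  next
    case (insert i M)
    then have iN: "i \<in> N" and M: "M \<subseteq> N" by auto
    let ?V = "V i"
    note lZ = \<open>locally_closed Y Z\<close>
    have o: "openin (zar X) (?P ?V)" by (rule morphismD(3)[OF f V[OF iN]])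
    have e: "?P Z \<inter> ?P ?V = ?P (Z \<inter> ?V)" "?P Z - ?P ?V = ?P (Z - ?V)" by auto
    have "var_class (sub_space X (?P Z)) = var_class (sub_space X (?P (Z \<inter> ?V))) + var_class (sub_space X (?P (Z - ?V)))"
      using var_class_split[OF X locally_closed_preimage[OF f lZ] o] unfolding e .
    also have "var_class (sub_space X (?P (Z \<inter> ?V))) = var_class F * var_class (sub_space Y (Z \<inter> ?V))"
      by (rule single[OF _ _ iN]) (intro locally_closed_Int lZ locally_closed_open V iN, simp)
    also have "var_class (sub_space X (?P (Z - ?V))) = var_class F * var_class (sub_space Y (Z - ?V))"
      by (rule insert.IH[OF M]) (intro locally_closed_Diff lZ V iN, use insert.prems in auto)
    also have "var_class F * var_class (sub_space Y (Z \<inter> ?V)) + var_class F * var_class (sub_space Y (Z - ?V))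
        = var_class F * var_class (sub_space Y Z)"
      using var_class_split[OF Y lZ V[OF iN]] by (simp add: distrib_left)
    finally show ?case .
  qed
  have i: "iso_spaces (sub_space X (?P (pts Y))) X" by (rule iso_sub_id[OF sX]) (use morphismD(2)[OF f] in auto)
  have j: "iso_spaces (sub_space Y (pts Y)) Y" by (rule iso_sub_id[OF sY]) auto
  have l: "locally_closed Y (pts Y)" by (intro locally_closed_open openin_topspace)
  show ?thesis
    using main[OF N(1) order_refl l N(2)]
      var_class_iso[OF variety_locally_closed[OF X locally_closed_preimage[OF f l]] X i]
      var_class_iso[OF variety_locally_closed[OF Y l] Y j] by simp
qed

section \<open>Quotients with local sections\<close>

lemma reg_quotient: "f \<in> reg (quotient_space \<pi> X) V \<longleftrightarrow> (\<lambda>x. f (\<pi> x)) \<in> reg X {x\<in>pts X. \<pi> x \<in> V}"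
  by (simp add: quotient_space_def)

lemma quotient_swf:
  assumes X: "space_with_functions X"
  shows "space_with_functions (quotient_space \<pi> X)" (is "space_with_functions ?Q")
proof
  interpret X: space_with_functions X by fact
  let ?P = "\<lambda>V. {x\<in>pts X. \<pi> x \<in> V}"
  note reg = reg_quotient
  fix U V f g
  have P: "openin (zar ?Q) U \<Longrightarrow> openin (zar X) (?P U)" for U by (simp add: openin_quotient)
  { assume "openin (zar ?Q) U" "openin (zar ?Q) V" "V \<subseteq> U" "f \<in> reg ?Q U"
    then show "f \<in> reg ?Q V" unfolding reg using X.restrict[OF P[of U] P[of V]] by blast }
  { assume U: "openin (zar ?Q) U"
      and g: "\<And>x. x \<in> U \<Longrightarrow> \<exists>V g. openin (zar ?Q) V \<and> x \<in> V \<and> V \<subseteq> U \<and> g \<in> reg ?Q V \<and> (\<forall>y\<in>V. f y = g y)"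
    show "f \<in> reg ?Q U" unfolding reg
    proof (rule X.glue[OF P[OF U]])
      fix x assume x: "x \<in> ?P U"
      then obtain V g where V: "openin (zar ?Q) V" "\<pi> x \<in> V" "V \<subseteq> U" "g \<in> reg ?Q V" "\<forall>y\<in>V. f y = g y" using g by blast
      show "\<exists>V g. openin (zar X) V \<and> x \<in> V \<and> V \<subseteq> ?P U \<and> g \<in> reg X V \<and> (\<forall>y\<in>V. f (\<pi> y) = g y)"
        by (rule exI[of _ "?P V"], rule exI[of _ "\<lambda>x. g (\<pi> x)"]) (use V x P[OF V(1)] in \<open>auto simp: reg\<close>)
    qed }
  { fix c assume "openin (zar ?Q) U" then show "(\<lambda>_. c) \<in> reg ?Q U" unfolding reg by (intro X.const P) }
  { assume "openin (zar ?Q) U" "f \<in> reg ?Q U" "g \<in> reg ?Q U"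
    then show "(\<lambda>x. f x + g x) \<in> reg ?Q U" unfolding reg by (intro X.add P) }
  { assume "openin (zar ?Q) U" "f \<in> reg ?Q U" "g \<in> reg ?Q U"
    then show "(\<lambda>x. f x * g x) \<in> reg ?Q U" unfolding reg by (intro X.mult P) }
  { assume U: "openin (zar ?Q) U" and f: "f \<in> reg ?Q U"
    have e: "?P {x\<in>U. f x \<noteq> 0} = {x\<in>?P U. f (\<pi> x) \<noteq> 0}" by auto
    show "openin (zar ?Q) {x\<in>U. f x \<noteq> 0}"
      using U X.nonzero[OF P[OF U] f[unfolded reg]] unfolding openin_quotient e by blast
    show "(\<lambda>x. inverse (f x)) \<in> reg ?Q {x\<in>U. f x \<noteq> 0}"
      using X.inverse[OF P[OF U] f[unfolded reg]] unfolding reg e . }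
qed

lemma morphism_quotient: "morphism X (quotient_space \<pi> X) \<pi>"
  unfolding morphism_def continuous_map_def pts_quotient openin_quotient reg_quotient by blast

text \<open>Open sets and functions of the quotient are defined by pulling back along
  \<open>\<pi>\<close>, so a map out of it can be tested upstairs. Saturation makes \<open>U\<close>
  the full preimage of its image, hence that image open.\<close>

lemma morphism_from_quotient:
  assumes X: "space_with_functions X" and U: "openin (zar X) U"
    and sat: "\<And>x y. x \<in> U \<Longrightarrow> y \<in> pts X \<Longrightarrow> \<pi> x = \<pi> y \<Longrightarrow> y \<in> U"
    and s: "morphism (sub_space X U) Y (\<lambda>x. s (\<pi> x))"
  shows "morphism (sub_space (quotient_space \<pi> X) (\<pi> ` U)) Y s"
proof -
  let ?Q = "quotient_space \<pi> X"
  let ?V = "\<pi> ` U"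
  have UX: "U \<subseteq> pts X" by (rule openin_subset[OF U])
  have pre: "{x\<in>pts X. \<pi> x \<in> ?V} = U" by (use UX in \<open>auto dest: sat\<close>)
  have oV: "openin (zar ?Q) ?V" unfolding openin_quotient pre using U UX by auto
  have pV: "pts (sub_space ?Q ?V) = ?V" using openin_subset[OF oV] by (auto simp: pts_sub)
  have pU: "pts (sub_space X U) = U" using UX by (auto simp: pts_sub)
  have sQ: "space_with_functions ?Q" by (rule quotient_swf[OF X])
  have e: "{x\<in>pts X. \<pi> x \<in> {q \<in> ?V. s q \<in> W}} = {x\<in>U. s (\<pi> x) \<in> W}" for W using pre by blast
  have o: "openin (zar X) {x\<in>U. s (\<pi> x) \<in> W}" if "openin (zar Y) W" for W
    using morphismD(3)[OF s that] unfolding pU by (subst (asm) sub_space_open_openin[OF U]) auto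
  have o': "openin (zar ?Q) {q\<in>?V. s q \<in> W}" if "openin (zar Y) W" for W
    unfolding openin_quotient e using o[OF that] UX by blast
  show ?thesis unfolding morphism_def continuous_map_def pV
  proof (intro conjI allI impI)
    show "s \<in> ?V \<rightarrow> pts Y" using morphismD(2)[OF s] pU by auto
    fix W assume "openin (zar Y) W"
    then show "openin (zar (sub_space ?Q ?V)) {x \<in> ?V. s x \<in> W}"
      using o' by (subst sub_space_open_openin[OF oV]) auto
  next
    fix W h assume "openin (zar Y) W \<and> h \<in> reg Y W"
    then have W: "openin (zar Y) W" "h \<in> reg Y W" by auto
    have "(\<lambda>x. h (s (\<pi> x))) \<in> reg X {x\<in>U. s (\<pi> x) \<in> W}"
      by (rule sub_space_open_reg[OF X U o[OF W(1)], THEN iffD1]) (use morphismD(4)[OF s W] in \<open>auto simp: pU\<close>)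
    then have "(\<lambda>x. h (s x)) \<in> reg ?Q {q\<in>?V. s q \<in> W}"
      unfolding reg_quotient e .
    then show "(\<lambda>x. h (s x)) \<in> reg (sub_space ?Q ?V) {x \<in> ?V. s x \<in> W}"
      by (subst sub_space_open_reg[OF sQ oV o'[OF W(1)]]) auto
  qed
qed

text \<open>The equaliser is the preimage of the diagonal of \<open>Y\<close> under the pair
  \<open>(f, g)\<close>.\<close>

lemma separated_equalizer_closed:
  assumes X: "space_with_functions X" and Y: "space_with_functions Y" "separated Y"
    and f: "morphism X Y f" and g: "morphism X Y g"
  shows "closedin (zar X) {x\<in>pts X. f x = g x}"
proof -
  interpret YY: two_spaces Y Y using Y by (simp add: two_spaces_def)
  have "morphism X (prod_space Y Y) (\<lambda>x. (f x, g x))" by (rule YY.morphism_pair[OF X f g])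
  then have "closedin (zar X) {x\<in>pts X. (f x, g x) \<in> (\<lambda>x. (x, x)) ` pts Y}"
    by (rule closedin_preimage) (use Y in \<open>simp add: separated_def\<close>)
  moreover have "{x\<in>pts X. (f x, g x) \<in> (\<lambda>x. (x, x)) ` pts Y} = {x\<in>pts X. f x = g x}"
    using morphismD(2)[OF g] by (auto simp: image_iff)
  ultimately show ?thesis by simp
qed

lemma morphism_sub_prod:
  assumes X: "space_with_functions X" and Y: "space_with_functions Y"
  shows "morphism (sub_space (prod_space X Y) (A \<times> B)) (prod_space (sub_space X A) (sub_space Y B)) (\<lambda>z. z)"
proof -
  interpret XY: two_spaces X Y using assms by (simp add: two_spaces_def)
  interpret S: two_spaces "sub_space X A" "sub_space Y B" using assms by (simp add: two_spaces_def induced_swf)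
  note sw = induced_swf[OF XY.prod_swf, of "\<lambda>x. x" "A \<times> B"]
  note i = morphism_inclusion[OF XY.prod_swf, of "A \<times> B"]
  have "morphism (sub_space (prod_space X Y) (A \<times> B)) (prod_space (sub_space X A) (sub_space Y B)) (\<lambda>z. (fst z, snd z))"
    by (intro S.morphism_pair sw morphism_into_sub morphism_compose[OF i XY.morphism_fst] morphism_compose[OF i XY.morphism_snd])
       (auto simp: pts_induced)
  then show ?thesis by simp
qed

text \<open>A class map with local sections, phrased entirely on \<open>X\<close>:
  \<open>\<sigma> i\<close> sends a point of the saturated open set \<open>U i\<close> to a normal
  form in its class, constant on classes by \<open>\<sigma>\<pi>\<close>. Sections can thus be given
  before the quotient is known to be a variety. The closedness \<open>rel\<close> of the equivalence
  relation will supply separatedness.\<close>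

locale local_sections =
  fixes X :: "('k::alg_closed_field, 'p) space" and \<pi> :: "'p \<Rightarrow> 'q" and N :: "'i set"
    and U :: "'i \<Rightarrow> 'p set" and \<sigma> :: "'i \<Rightarrow> 'p \<Rightarrow> 'p"
  assumes X: "variety X" and N: "finite N" and cover: "pts X = (\<Union>i\<in>N. U i)"
    and U: "i \<in> N \<Longrightarrow> openin (zar X) (U i)"
    and sat: "i \<in> N \<Longrightarrow> x \<in> U i \<Longrightarrow> y \<in> pts X \<Longrightarrow> \<pi> x = \<pi> y \<Longrightarrow> y \<in> U i"
    and \<sigma>: "i \<in> N \<Longrightarrow> morphism (sub_space X (U i)) X (\<sigma> i)"
    and \<pi>\<sigma>: "i \<in> N \<Longrightarrow> x \<in> U i \<Longrightarrow> \<pi> (\<sigma> i x) = \<pi> x"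
    and \<sigma>\<pi>: "i \<in> N \<Longrightarrow> x \<in> U i \<Longrightarrow> y \<in> U i \<Longrightarrow> \<pi> x = \<pi> y \<Longrightarrow> \<sigma> i x = \<sigma> i y"
    and rel: "i \<in> N \<Longrightarrow> closedin (zar (prod_space (sub_space X (U i)) X)) {z \<in> U i \<times> pts X. \<pi> (fst z) = \<pi> (snd z)}"
begin

abbreviation "Q \<equiv> quotient_space \<pi> X"

lemma swfX: "space_with_functions X" and swfQ: "space_with_functions Q"
  by (simp_all add: variety_swf[OF X] quotient_swf)

lemma UX: "i \<in> N \<Longrightarrow> U i \<subseteq> pts X"
  using cover by blast

lemma preimage_image: "i \<in> N \<Longrightarrow> {x\<in>pts X. \<pi> x \<in> \<pi> ` U i} = U i"
  by (use UX[of i] in \<open>auto dest: sat\<close>)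

lemma open_image: "i \<in> N \<Longrightarrow> openin (zar Q) (\<pi> ` U i)"
  unfolding openin_quotient preimage_image using U UX by auto

lemma cover_image: "pts Q = (\<Union>i\<in>N. \<pi> ` U i)"
  unfolding pts_quotient cover by blast

definition s :: "'i \<Rightarrow> 'q \<Rightarrow> 'p" where
  "s i q = \<sigma> i (SOME x. x \<in> U i \<and> \<pi> x = q)"

lemma s: "i \<in> N \<Longrightarrow> x \<in> U i \<Longrightarrow> s i (\<pi> x) = \<sigma> i x"
  unfolding s_def
proof (rule \<sigma>\<pi>)
  assume "i \<in> N" "x \<in> U i"
  then have "\<exists>y. y \<in> U i \<and> \<pi> y = \<pi> x" by blast
  from someI_ex[OF this] show "(SOME y. y \<in> U i \<and> \<pi> y = \<pi> x) \<in> U i" "\<pi> (SOME y. y \<in> U i \<and> \<pi> y = \<pi> x) = \<pi> x" by auto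
qed

lemma \<sigma>_in: "i \<in> N \<Longrightarrow> x \<in> U i \<Longrightarrow> \<sigma> i x \<in> U i"
  using sat[of i x "\<sigma> i x"] \<pi>\<sigma>[of i x] morphismD(2)[OF \<sigma>, of i x] UX[of i] by (auto simp: pts_sub)

lemma morphism_s: "i \<in> N \<Longrightarrow> morphism (sub_space Q (\<pi> ` U i)) X (s i)"
proof (rule morphism_from_quotient[OF swfX U sat])
  assume i: "i \<in> N"
  show "morphism (sub_space X (U i)) X (\<lambda>x. s i (\<pi> x))"
    by (rule morphism_cong[OF induced_swf[OF swfX] \<sigma>[OF i]]) (use s[OF i] in \<open>auto simp: pts_sub\<close>)
qed

lemma s_section: "i \<in> N \<Longrightarrow> q \<in> \<pi> ` U i \<Longrightarrow> s i q \<in> U i \<and> \<pi> (s i q) = q"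
  using s \<sigma>_in \<pi>\<sigma> by auto

text \<open>The normal forms are the equaliser of \<open>\<sigma> i\<close> and the inclusion of
  \<open>U i\<close> into the separated space \<open>X\<close>, hence closed in
  \<open>U i\<close>.\<close>

lemma slice_locally_closed: "i \<in> N \<Longrightarrow> locally_closed X {x\<in>U i. \<sigma> i x = x}"
proof -
  assume i: "i \<in> N"
  have p: "pts (sub_space X (U i)) = U i" using UX[OF i] by (auto simp: pts_sub)
  have "closedin (zar (sub_space X (U i))) {x\<in>pts (sub_space X (U i)). \<sigma> i x = x}"
    using X by (intro separated_equalizer_closed[of _ X] \<sigma>[OF i] morphism_inclusion induced_swf swfX) (simp add: variety_def)
  then obtain W where W: "openin (zar X) W" "U i - {x\<in>U i. \<sigma> i x = x} = U i \<inter> W"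
    unfolding closedin_def p open_sub by blast
  have "{x\<in>U i. \<sigma> i x = x} = U i - W" using W(2) by blast
  then show ?thesis using locally_closed_Diff[OF locally_closed_open[OF U[OF i]] W(1)] by simp
qed

text \<open>Each class meeting \<open>U i\<close> has exactly one normal form, so the slice is a
  copy of the chart inside \<open>X\<close>. This is how the quotient inherits affine covers from
  \<open>X\<close>.\<close>

lemma chart_iso: "i \<in> N \<Longrightarrow> iso_spaces (sub_space X {x\<in>U i. \<sigma> i x = x}) (sub_space Q (\<pi> ` U i))"
proof (rule iso_spacesI[of _ _ \<pi> "s i"])
  assume i: "i \<in> N"
  show "morphism (sub_space X {x\<in>U i. \<sigma> i x = x}) (sub_space Q (\<pi> ` U i)) \<pi>"
    by (rule morphism_sub[OF swfX morphism_quotient]) auto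
  show "morphism (sub_space Q (\<pi> ` U i)) (sub_space X {x\<in>U i. \<sigma> i x = x}) (s i)"
  proof (rule morphism_into_sub[OF induced_swf[OF swfQ] morphism_s[OF i]])
    fix q assume "q \<in> pts (sub_space Q (\<pi> ` U i))"
    then obtain x where x: "x \<in> U i" "q = \<pi> x" by (auto simp: pts_sub)
    then show "s i q \<in> {x\<in>U i. \<sigma> i x = x}" using s[OF i] \<sigma>_in[OF i] \<sigma>\<pi>[OF i \<sigma>_in[OF i]] \<pi>\<sigma>[OF i] by auto
  qed
qed (use s s_section in \<open>auto simp: pts_sub\<close>)

theorem variety_quotient: "variety Q"
  unfolding variety_def
proof (intro conjI swfQ)
  show "finite_affine_cover Q"
  proof (rule finite_affine_cover_local[OF swfQ, of "(\<lambda>i. \<pi> ` U i) ` N"])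
    fix V assume "V \<in> (\<lambda>i. \<pi> ` U i) ` N"
    then obtain i where i: "i \<in> N" "V = \<pi> ` U i" by blast
    have "finite_affine_cover (sub_space Q V)" unfolding i(2)
      by (rule finite_affine_cover_iso[OF _ _ chart_iso[OF i(1)]])
        (use variety_locally_closed[OF X slice_locally_closed[OF i(1)]] in \<open>auto simp: variety_def intro: induced_swf swfQ\<close>)
    then show "openin (zar Q) V \<and> finite_affine_cover (sub_space Q V)" using open_image i by blast
  qed (use N cover_image in auto)
  interpret QQ: two_spaces Q Q using swfQ by (simp add: two_spaces_def)
  let ?QQ = "prod_space Q Q"
  let ?D = "(\<lambda>x. (x, x)) ` pts Q"
  \<comment> \<open>The complement of the diagonal is open near each of its points: on a product of
    two charts, the pair of sections pulls the closed relation \<open>rel\<close> back to the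
    diagonal.\<close>
  have "openin (zar ?QQ) (pts ?QQ - ?D)"
  proof (subst openin_subopen, rule ballI)
    fix z assume z: "z \<in> pts ?QQ - ?D"
    then obtain i j where i: "i \<in> N" "fst z \<in> \<pi> ` U i" and j: "j \<in> N" "snd z \<in> \<pi> ` U j"
      using cover_image by (auto simp: QQ.pts_prod)
    let ?VV = "\<pi> ` U i \<times> \<pi> ` U j"
    let ?V = "sub_space Q (\<pi> ` U i)" and ?V' = "sub_space Q (\<pi> ` U j)"
    have o: "openin (zar ?QQ) ?VV" by (intro QQ.openin_prod_Times open_image i j)
    have sw: "space_with_functions ?V" "space_with_functions ?V'" "space_with_functions (sub_space X (U i))"
      by (intro induced_swf swfQ swfX)+
    have 1: "morphism (sub_space ?QQ ?VV) (prod_space ?V ?V') (\<lambda>z. z)" by (rule morphism_sub_prod[OF swfQ swfQ])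
    have s': "morphism ?V (sub_space X (U i)) (s i)"
      by (intro morphism_into_sub sw morphism_s i) (use s_section[OF i(1)] in \<open>auto simp: pts_sub\<close>)
    have 2: "morphism (prod_space ?V ?V') (prod_space (sub_space X (U i)) X) (\<lambda>z. (s i (fst z), s j (snd z)))"
      by (intro morphism_prod_map sw swfX s' morphism_s j)
    have m: "morphism (sub_space ?QQ ?VV) (prod_space (sub_space X (U i)) X) (\<lambda>z. (s i (fst z), s j (snd z)))"
      by (rule morphism_compose[OF 1 2])
    have p: "pts (sub_space ?QQ ?VV) = ?VV" using openin_subset[OF o] by (auto simp: pts_sub)
    have "closedin (zar (sub_space ?QQ ?VV)) {z\<in>?VV. (s i (fst z), s j (snd z)) \<in> {z \<in> U i \<times> pts X. \<pi> (fst z) = \<pi> (snd z)}}"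
      using closedin_preimage[OF m rel[OF i(1)]] unfolding p .
    moreover have "{z\<in>?VV. (s i (fst z), s j (snd z)) \<in> {z \<in> U i \<times> pts X. \<pi> (fst z) = \<pi> (snd z)}} = {z\<in>?VV. fst z = snd z}"
    proof (intro Set.set_eqI iffI)
      fix w assume w: "w \<in> {z\<in>?VV. fst z = snd z}"
      then have "fst w \<in> \<pi> ` U i" "snd w \<in> \<pi> ` U j" unfolding mem_Collect_eq mem_Times_iff by blast+
      then have "s i (fst w) \<in> U i" "\<pi> (s i (fst w)) = fst w" "s j (snd w) \<in> U j" "\<pi> (s j (snd w)) = snd w"
        using s_section[OF i(1), of "fst w"] s_section[OF j(1), of "snd w"] by blast+
      then show "w \<in> {z\<in>?VV. (s i (fst z), s j (snd z)) \<in> {z \<in> U i \<times> pts X. \<pi> (fst z) = \<pi> (snd z)}}"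
        using w UX[OF j(1)] by auto
    next
      fix w assume w: "w \<in> {z\<in>?VV. (s i (fst z), s j (snd z)) \<in> {z \<in> U i \<times> pts X. \<pi> (fst z) = \<pi> (snd z)}}"
      then have "fst w \<in> \<pi> ` U i" "snd w \<in> \<pi> ` U j" unfolding mem_Collect_eq mem_Times_iff by blast+
      then have "\<pi> (s i (fst w)) = fst w" "\<pi> (s j (snd w)) = snd w"
        using s_section[OF i(1), of "fst w"] s_section[OF j(1), of "snd w"] by blast+
      then show "w \<in> {z\<in>?VV. fst z = snd z}" using w by simp
    qed
    ultimately have "openin (zar (sub_space ?QQ ?VV)) (?VV - {z\<in>?VV. fst z = snd z})"
      unfolding closedin_def p by simp
    then have "openin (zar ?QQ) (?VV - {z\<in>?VV. fst z = snd z})"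
      by (subst (asm) sub_space_open_openin[OF o]) auto
    moreover have "z \<in> ?VV - {z\<in>?VV. fst z = snd z}"
      using z i j by (cases z) (auto simp: QQ.pts_prod)
    moreover have "?VV - {z\<in>?VV. fst z = snd z} \<subseteq> pts ?QQ - ?D" using openin_subset[OF o] by auto
    ultimately show "\<exists>T. openin (zar ?QQ) T \<and> z \<in> T \<and> T \<subseteq> pts ?QQ - ?D" by blast
  qed
  then show "separated Q" unfolding separated_def closedin_def by (auto simp: QQ.pts_prod)
qed

text \<open>\<open>\<gamma> i x\<close> is the group element that moves the normal form of
  \<open>x\<close> to \<open>x\<close>. By \<open>\<gamma>\<sigma>\<close> and
  \<open>\<gamma>act\<close> the orbit map at a normal form is a bijection from \<open>G\<close> to
  the fibre with inverse \<open>\<gamma> i\<close>, so freeness of the action is contained in them.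
  This trivialises \<open>X\<close> over the charts of \<open>Q\<close>.\<close>

theorem var_class_quotient:
  fixes G :: "('k, 'g) space"
  assumes G: "variety G"
    and act: "\<And>i. i \<in> N \<Longrightarrow> morphism (prod_space G X) X (\<lambda>z. act (fst z) (snd z))"
    and \<pi>act: "\<And>g x. g \<in> pts G \<Longrightarrow> x \<in> pts X \<Longrightarrow> \<pi> (act g x) = \<pi> x"
    and \<gamma>: "\<And>i. i \<in> N \<Longrightarrow> morphism (sub_space X (U i)) G (\<gamma> i)"
    and \<gamma>\<sigma>: "\<And>i x. i \<in> N \<Longrightarrow> x \<in> U i \<Longrightarrow> act (\<gamma> i x) (\<sigma> i x) = x"
    and \<gamma>act: "\<And>i g x. i \<in> N \<Longrightarrow> g \<in> pts G \<Longrightarrow> x \<in> U i \<Longrightarrow> \<gamma> i (act g (\<sigma> i x)) = g"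
  shows "var_class X = var_class G * var_class Q"
proof (rule var_class_locally_trivial[OF X variety_quotient G morphism_quotient N])
  show "pts Q \<subseteq> (\<Union>i\<in>N. \<pi> ` U i)" using cover_image by simp
  fix i assume i: "i \<in> N"
  show "openin (zar Q) (\<pi> ` U i)" by (rule open_image[OF i])
  note sG = variety_swf[OF G]
  have "morphism (prod_space G (sub_space Q (\<pi> ` U i))) (prod_space G X) (\<lambda>z. (fst z, s i (snd z)))"
    by (intro morphism_prod_map sG swfX induced_swf swfQ morphism_id morphism_s i)
  from morphism_compose[OF this act[OF i]]
  show "morphism (prod_space G (sub_space Q (\<pi> ` U i))) X (\<lambda>z. act (fst z) (s i (snd z)))" by simp
  show "morphism (sub_space X {x\<in>pts X. \<pi> x \<in> \<pi> ` U i}) G (\<gamma> i)" unfolding preimage_image[OF i] by (rule \<gamma>[OF i])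
  fix g q assume g: "g \<in> pts G" and "q \<in> \<pi> ` U i"
  then obtain x where x: "x \<in> U i" "q = \<pi> x" by blast
  show "\<pi> (act (fst (g, q)) (s i (snd (g, q)))) = q" using \<pi>act[OF g, of "s i q"] s_section[OF i, of q] x UX[OF i] by auto
  show "\<gamma> i (act (fst (g, q)) (s i (snd (g, q)))) = g" using \<gamma>act[OF i g x(1)] s[OF i x(1)] x by simp
next
  fix i x assume i: "i \<in> N" and x: "x \<in> pts X" "\<pi> x \<in> \<pi> ` U i"
  then have "x \<in> U i" using preimage_image[OF i] by blast
  then show "act (fst (\<gamma> i x, \<pi> x)) (s i (snd (\<gamma> i x, \<pi> x))) = x" using \<gamma>\<sigma>[OF i] s[OF i] by simp
qed

end

section \<open>Linear algebra\<close>

text \<open>Cramer's rule as a total function: the entries are visibly polynomials in the entries of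
  \<open>A\<close> divided by the determinant, so inversion is regular where the determinant does
  not vanish. For determinant \<open>0\<close> the value is a zero matrix.\<close>

definition mat_inv :: "'k::field mat \<Rightarrow> 'k mat" where
  "mat_inv A = inverse (det A) \<cdot>\<^sub>m adj_mat A"

lemma mat_inv:
  assumes A: "A \<in> carrier_mat n n"
  shows "mat_inv A \<in> carrier_mat n n"
    and "det A \<noteq> 0 \<Longrightarrow> A * mat_inv A = 1\<^sub>m n"
    and "det A \<noteq> 0 \<Longrightarrow> mat_inv A * A = 1\<^sub>m n"
proof -
  note a = adj_mat[OF A]
  show "mat_inv A \<in> carrier_mat n n" using a by (simp add: mat_inv_def)
  assume d: "det A \<noteq> 0"
  have "A * mat_inv A = inverse (det A) \<cdot>\<^sub>m (A * adj_mat A)"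
    unfolding mat_inv_def by (rule mult_smult_distrib[OF A a(1)])
  then show "A * mat_inv A = 1\<^sub>m n" using a d by (auto intro!: eq_matI)
  have "mat_inv A * A = inverse (det A) \<cdot>\<^sub>m (adj_mat A * A)"
    unfolding mat_inv_def using mult_smult_assoc_mat[OF a(1) A] by simp
  then show "mat_inv A * A = 1\<^sub>m n" using a d by (auto intro!: eq_matI)
qed

lemma det_nonzero_of_inverse:
  fixes A :: "'k::field mat"
  assumes "A \<in> carrier_mat n n" "B \<in> carrier_mat n n" "A * B = 1\<^sub>m n"
  shows "det A \<noteq> 0" "det B \<noteq> 0"
  using det_mult[OF assms(1,2)] assms(3) by auto

lemma mat_inv_unique:
  fixes A :: "'k::field mat"
  assumes A: "A \<in> carrier_mat n n" and B: "B \<in> carrier_mat n n" and AB: "A * B = 1\<^sub>m n"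
  shows "mat_inv A = B"
proof -
  have d: "det A \<noteq> 0" by (rule det_nonzero_of_inverse[OF A B AB])
  have "mat_inv A = mat_inv A * (A * B)" using AB mat_inv(1)[OF A] by simp
  also have "\<dots> = B" using mat_inv[OF A] d A B by (simp flip: assoc_mult_mat[of _ n n _ n _ n])
  finally show ?thesis .
qed

lemma det_mat_inv:
  fixes A :: "'k::field mat"
  assumes A: "A \<in> carrier_mat n n" "det A \<noteq> 0"
  shows "det (mat_inv A) \<noteq> 0"
  using det_nonzero_of_inverse(2)[OF A(1) mat_inv(1)[OF A(1)] mat_inv(2)[OF A]] .

lemma invertible_mat_iff_det:
  fixes A :: "'k::field mat"
  assumes A: "A \<in> carrier_mat n n"
  shows "invertible_mat A \<longleftrightarrow> det A \<noteq> 0"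
proof
  assume "invertible_mat A"
  then obtain B where B: "A * B = 1\<^sub>m (dim_row A)" "B * A = 1\<^sub>m (dim_row B)"
    unfolding invertible_mat_def inverts_mat_def by blast
  have "B \<in> carrier_mat n n"
  proof
    show "dim_col B = n" using B(1) A by (metis carrier_matD(1) index_mult_mat(3) index_one_mat(3))
    show "dim_row B = n" using B(2) A by (metis carrier_matD(2) index_mult_mat(3) index_one_mat(3))
  qed
  then show "det A \<noteq> 0" using det_nonzero_of_inverse[OF A _ B(1)[unfolded carrier_matD[OF A]]] by blast
next
  assume "det A \<noteq> 0"
  then show "invertible_mat A"
    using mat_inv[OF A] A unfolding invertible_mat_def inverts_mat_def
    by (intro conjI exI[of _ "mat_inv A"]) auto
qed

section \<open>Matrices of full column rank\<close>

definition mat_injective :: "'k::field mat \<Rightarrow> bool" where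
  "mat_injective M \<longleftrightarrow> (\<forall>v\<in>carrier_vec (dim_col M). M *\<^sub>v v = 0\<^sub>v (dim_row M) \<longrightarrow> v = 0\<^sub>v (dim_col M))"

lemma mat_injectiveI:
  assumes "M \<in> carrier_mat n k" "\<And>v. v \<in> carrier_vec k \<Longrightarrow> M *\<^sub>v v = 0\<^sub>v n \<Longrightarrow> v = 0\<^sub>v k"
  shows "mat_injective M"
  using assms unfolding mat_injective_def by auto

lemma mat_injectiveD:
  "mat_injective M \<Longrightarrow> M \<in> carrier_mat n k \<Longrightarrow> v \<in> carrier_vec k \<Longrightarrow> M *\<^sub>v v = 0\<^sub>v n \<Longrightarrow> v = 0\<^sub>v k"
  unfolding mat_injective_def by auto

lemma mat_injective_cancel:
  assumes M: "mat_injective M" "M \<in> carrier_mat n k" and A: "A \<in> carrier_mat k l" "B \<in> carrier_mat k l"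
    and eq: "M * A = M * B"
  shows "A = B"
proof (rule mat_col_eqI)
  show "dim_row A = dim_row B" "dim_col A = dim_col B" using A by auto
  fix j assume "j < dim_col B"
  then have j: "j < l" using A by auto
  have c: "col A j \<in> carrier_vec k" "col B j \<in> carrier_vec k" using A by auto
  have "M *\<^sub>v col A j = M *\<^sub>v col B j"
    using arg_cong[OF eq, of "\<lambda>X. col X j"] col_mult2[OF M(2) A(1) j] col_mult2[OF M(2) A(2) j] by simp
  then have "M *\<^sub>v (col A j - col B j) = 0\<^sub>v n"
    using mult_minus_distrib_mat_vec[OF M(2) c] M(2) c by auto
  then have "col A j - col B j = 0\<^sub>v k" using mat_injectiveD[OF M] c by auto
  then show "col A j = col B j" using c
    by (metis vec_eq_iff carrier_vecD index_minus_vec(1) index_zero_vec(1) right_minus_eq)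
qed

lemma mat_injective_cancel_vec:
  assumes M: "mat_injective M" "M \<in> carrier_mat n k" and c: "a \<in> carrier_vec k" "b \<in> carrier_vec k"
    and eq: "M *\<^sub>v a = M *\<^sub>v b"
  shows "a = b"
proof -
  have "M *\<^sub>v (a - b) = 0\<^sub>v n" using mult_minus_distrib_mat_vec[OF M(2) c] M(2) c eq by auto
  then have "a - b = 0\<^sub>v k" using mat_injectiveD[OF M] c by auto
  then show "a = b" using c
    by (metis vec_eq_iff carrier_vecD index_minus_vec(1) index_zero_vec(1) right_minus_eq)
qed

lemma mat_injective_mult:
  assumes "M \<in> carrier_mat n k" "N \<in> carrier_mat k l" "mat_injective M" "mat_injective N"
  shows "mat_injective (M * N)"
proof (rule mat_injectiveI)
  show "M * N \<in> carrier_mat n l" using assms by simp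
  fix v assume v: "v \<in> carrier_vec l" "(M * N) *\<^sub>v v = 0\<^sub>v n"
  then have "M *\<^sub>v (N *\<^sub>v v) = 0\<^sub>v n" using assoc_mult_mat_vec[OF assms(1,2) v(1)] by simp
  then have "N *\<^sub>v v = 0\<^sub>v k" using mat_injectiveD[OF assms(3,1)] assms(2) v by auto
  then show "v = 0\<^sub>v l" using mat_injectiveD[OF assms(4,2)] v by auto
qed

lemma mat_injective_factor:
  assumes "M \<in> carrier_mat n k" "N \<in> carrier_mat k l" "mat_injective (M * N)"
  shows "mat_injective N"
proof (rule mat_injectiveI[OF assms(2)])
  fix v assume v: "v \<in> carrier_vec l" "N *\<^sub>v v = 0\<^sub>v k"
  have "(M * N) *\<^sub>v v = M *\<^sub>v 0\<^sub>v k" using assoc_mult_mat_vec[OF assms(1,2) v(1)] v by simp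
  also have "\<dots> = 0\<^sub>v n" using assms(1) by auto
  finally show "v = 0\<^sub>v l" using mat_injectiveD[OF assms(3) mult_carrier_mat[OF assms(1,2)] v(1)] by simp
qed

lemma mat_injective_square:
  assumes "M \<in> carrier_mat n n"
  shows "mat_injective M \<longleftrightarrow> det M \<noteq> 0"
  using det_0_iff_vec_prod_zero_field[OF assms] assms unfolding mat_injective_def by auto

lemma left_inverse_injective:
  assumes "N \<in> carrier_mat k n" "M \<in> carrier_mat n k" "det (N * M) \<noteq> 0"
  shows "mat_injective M"
  using mat_injective_factor[OF assms(1,2)] mat_injective_square[of "N * M" k] assms by simp

text \<open>The standard inclusion of \<open>k\<close>-space in \<open>n\<close>-space for
  \<open>k \<le> n\<close>. Multiplying by it on the right keeps the first \<open>k\<close> columns,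
  multiplying by its transpose on the left keeps the first \<open>k\<close> rows; taking blocks
  becomes associativity of products.\<close>

definition incl_mat :: "nat \<Rightarrow> nat \<Rightarrow> 'k::field mat" where
  "incl_mat n k = mat n k (\<lambda>(i, j). if i = j then 1 else 0)"

lemma incl_mat_carrier[simp]: "incl_mat n k \<in> carrier_mat n k" "dim_row (incl_mat n k) = n" "dim_col (incl_mat n k) = k"
  by (auto simp: incl_mat_def)

lemma incl_mat_mult_vec:
  assumes "v \<in> carrier_vec k"
  shows "incl_mat n k *\<^sub>v v = vec n (\<lambda>i. if i < k then v $ i else 0)"
proof (rule eq_vecI)
  fix i assume i: "i < dim_vec (vec n (\<lambda>i. if i < k then v $ i else 0))"
  have "(incl_mat n k *\<^sub>v v) $ i = (\<Sum>j<k. (if i = j then 1 else 0) * v $ j)"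
    using i assms by (auto simp: incl_mat_def scalar_prod_def atLeast0LessThan intro!: sum.cong)
  also have "\<dots> = (\<Sum>j<k. if i = j then v $ j else 0)" by (rule sum.cong) auto
  finally show "(incl_mat n k *\<^sub>v v) $ i = vec n (\<lambda>i. if i < k then v $ i else 0) $ i" using i by simp
qed simp

lemma mult_incl_mat:
  assumes A: "A \<in> carrier_mat m n" and k: "k \<le> n"
  shows "A * incl_mat n k = mat m k (\<lambda>(i, j). A $$ (i, j))"
proof (rule eq_matI)
  fix i j assume ij: "i < dim_row (mat m k (\<lambda>(i, j). A $$ (i, j)))" "j < dim_col (mat m k (\<lambda>(i, j). A $$ (i, j)))"
  have "(A * incl_mat n k) $$ (i, j) = (\<Sum>l<n. A $$ (i, l) * (if l = j then 1 else 0))"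
    using ij A by (auto simp: incl_mat_def scalar_prod_def atLeast0LessThan intro!: sum.cong)
  also have "\<dots> = (\<Sum>l<n. if l = j then A $$ (i, l) else 0)" by (rule sum.cong) auto
  finally show "(A * incl_mat n k) $$ (i, j) = mat m k (\<lambda>(i, j). A $$ (i, j)) $$ (i, j)" using ij k by simp
qed (use A in auto)

lemma transpose_incl_mult:
  assumes A: "A \<in> carrier_mat n m" and k: "k \<le> n"
  shows "(incl_mat n k)\<^sup>T * A = mat k m (\<lambda>(i, j). A $$ (i, j))"
proof -
  have "(incl_mat n k)\<^sup>T * A = (A\<^sup>T * incl_mat n k)\<^sup>T"
    using A by (simp add: transpose_mult[of _ m n _ k])
  also have "\<dots> = mat k m (\<lambda>(i, j). A $$ (i, j))"
    using A k by (subst mult_incl_mat[of _ m n]) auto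
  finally show ?thesis .
qed

lemma transpose_incl_incl: "k \<le> n \<Longrightarrow> (incl_mat n k)\<^sup>T * incl_mat n k = (1\<^sub>m k :: 'k::field mat)"
  by (subst transpose_incl_mult[of _ n k]) (auto simp: incl_mat_def)

lemma incl_mat_injective: "k \<le> n \<Longrightarrow> mat_injective (incl_mat n k)"
  by (rule left_inverse_injective[of "(incl_mat n k)\<^sup>T" k n]) (auto simp: transpose_incl_incl)

lemma mat_of_cols_snoc_mult:
  fixes u :: "'k::field vec"
  assumes "set vs \<subseteq> carrier_vec n" "u \<in> carrier_vec n" "v \<in> carrier_vec (Suc (length vs))"
  shows "mat_of_cols n (vs @ [u]) *\<^sub>v v =
    mat_of_cols n vs *\<^sub>v vec (length vs) (\<lambda>i. v $ i) + v $ length vs \<cdot>\<^sub>v u"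
proof (rule eq_vecI)
  fix i assume "i < dim_vec (mat_of_cols n vs *\<^sub>v vec (length vs) (\<lambda>i. v $ i) + v $ length vs \<cdot>\<^sub>v u)"
  then have i: "i < n" using assms(2) by simp
  have "(mat_of_cols n (vs @ [u]) *\<^sub>v v) $ i = (\<Sum>j<Suc (length vs). mat_of_cols n (vs @ [u]) $$ (i, j) * v $ j)"
    using i assms(3) by (auto simp: scalar_prod_def atLeast0LessThan intro!: sum.cong)
  also have "\<dots> = (\<Sum>j<length vs. mat_of_cols n vs $$ (i, j) * v $ j) + u $ i * v $ length vs"
    using i by (auto simp: mat_of_cols_index nth_append intro!: sum.cong)
  also have "(\<Sum>j<length vs. mat_of_cols n vs $$ (i, j) * v $ j) = (mat_of_cols n vs *\<^sub>v vec (length vs) (\<lambda>i. v $ i)) $ i"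
    using i by (auto simp: scalar_prod_def atLeast0LessThan intro!: sum.cong)
  finally show "(mat_of_cols n (vs @ [u]) *\<^sub>v v) $ i = (mat_of_cols n vs *\<^sub>v vec (length vs) (\<lambda>i. v $ i) + v $ length vs \<cdot>\<^sub>v u) $ i"
    using i assms by (simp add: mult.commute)
qed (use assms in auto)

text \<open>In a nontrivial relation among the columns \<open>vs @ [u]\<close> the coefficient
  \<open>s\<close> of \<open>u\<close> cannot vanish, because the columns \<open>vs\<close> are
  independent. Dividing by it solves for \<open>u\<close>.\<close>

lemma not_injective_snoc:
  fixes u :: "'k::field vec"
  assumes vs: "set vs \<subseteq> carrier_vec n" and u: "u \<in> carrier_vec n"
    and inj: "mat_injective (mat_of_cols n vs)" and ninj: "\<not> mat_injective (mat_of_cols n (vs @ [u]))"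
  shows "\<exists>c\<in>carrier_vec (length vs). u = mat_of_cols n vs *\<^sub>v c"
proof -
  let ?M = "mat_of_cols n vs"
  obtain v where v: "v \<in> carrier_vec (Suc (length vs))" "mat_of_cols n (vs @ [u]) *\<^sub>v v = 0\<^sub>v n" "v \<noteq> 0\<^sub>v (Suc (length vs))"
    using ninj unfolding mat_injective_def by auto
  define z where "z = vec (length vs) (\<lambda>i. v $ i)"
  define s where "s = v $ length vs"
  have z: "z \<in> carrier_vec (length vs)" by (simp add: z_def)
  have eq: "?M *\<^sub>v z + s \<cdot>\<^sub>v u = 0\<^sub>v n"
    using mat_of_cols_snoc_mult[OF vs u v(1)] v(2) by (simp add: z_def s_def)
  have "s \<noteq> 0"
  proof
    assume s: "s = 0"
    have "?M *\<^sub>v z = 0\<^sub>v n"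
    proof (rule eq_vecI)
      fix i assume "i < dim_vec (0\<^sub>v n)"
      then show "(?M *\<^sub>v z) $ i = 0\<^sub>v n $ i" using arg_cong[OF eq, of "\<lambda>w. w $ i"] s u by auto
    qed simp
    then have z0: "z = 0\<^sub>v (length vs)" using mat_injectiveD[OF inj _ z, of n] by auto
    have "v = 0\<^sub>v (Suc (length vs))"
    proof (rule eq_vecI)
      fix i assume "i < dim_vec (0\<^sub>v (Suc (length vs)) :: 'k vec)"
      then show "v $ i = 0\<^sub>v (Suc (length vs)) $ i"
        using arg_cong[OF z0, of "\<lambda>w. w $ i"] s by (cases "i = length vs") (auto simp: z_def s_def)
    qed (use v in auto)
    then show False using v by simp
  qed
  show ?thesis
  proof (rule bexI)
    show "u = ?M *\<^sub>v ((- inverse s) \<cdot>\<^sub>v z)"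
    proof (rule eq_vecI)
      fix i assume "i < dim_vec (?M *\<^sub>v ((- inverse s) \<cdot>\<^sub>v z))"
      then have i: "i < n" by simp
      have 1: "(?M *\<^sub>v z) $ i + s * u $ i = 0" using arg_cong[OF eq, of "\<lambda>w. w $ i"] i u by auto
      have "(?M *\<^sub>v ((- inverse s) \<cdot>\<^sub>v z)) $ i = - inverse s * (?M *\<^sub>v z) $ i"
        using i z by (subst mult_mat_vec[of _ n "length vs"]) auto
      also have "(?M *\<^sub>v z) $ i = - (s * u $ i)" using 1 by (simp add: eq_neg_iff_add_eq_0)
      finally show "u $ i = (?M *\<^sub>v ((- inverse s) \<cdot>\<^sub>v z)) $ i" using \<open>s \<noteq> 0\<close> by simp
    qed (use u in simp)
  qed (use z in simp)
qed

text \<open>Gaussian elimination, one column at a time. The bound \<open>k \<le> n\<close> falls out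
  of the same induction and is what later limits the number of independent words.\<close>

lemma injective_normal_form:
  fixes M :: "'k::field mat"
  assumes "M \<in> carrier_mat n k" "mat_injective M"
  shows "k \<le> n \<and> (\<exists>P\<in>carrier_mat n n. det P \<noteq> 0 \<and> P * M = incl_mat n k)"
  using assms
proof (induction k arbitrary: M)
  case 0
  have "1\<^sub>m n * M = incl_mat n 0" using 0 by (auto intro!: eq_matI)
  then show ?case using 0 by (intro conjI bexI[of _ "1\<^sub>m n"]) auto
next
  case (Suc k)
  note M = Suc.prems(1)
  define M' where "M' = mat n k (\<lambda>(i, j). M $$ (i, j))"
  have M': "M' \<in> carrier_mat n k" by (simp add: M'_def)
  have MM: "M' = M * incl_mat (Suc k) k" using mult_incl_mat[OF M, of k] by (simp add: M'_def)
  have "mat_injective M'" unfolding MM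
    by (rule mat_injective_mult[OF M _ Suc.prems(2)]) (auto intro: incl_mat_injective)
  from Suc.IH[OF M' this] obtain P where kn: "k \<le> n" and P: "P \<in> carrier_mat n n" "det P \<noteq> 0" "P * M' = incl_mat n k" by blast
  define A where "A = P * M"
  have A: "A \<in> carrier_mat n (Suc k)" using P M by (simp add: A_def)
  have Ainj: "mat_injective A" unfolding A_def
    by (rule mat_injective_mult[OF P(1) M _ Suc.prems(2)]) (use P mat_injective_square in auto)
  have Aincl: "A * incl_mat (Suc k) k = incl_mat n k"
    unfolding A_def using P(3) MM by (simp add: assoc_mult_mat[OF P(1) M, of _ k])
  have Ak: "A $$ (i, j) = (if i = j then 1 else 0)" if "i < n" "j < k" for i j
    using arg_cong[OF Aincl, of "\<lambda>X. X $$ (i, j)"] that mult_incl_mat[OF A, of k] by (simp add: incl_mat_def)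
  \<comment> \<open>There is a pivot at or below row \<open>k\<close>: otherwise the last column is
    the combination of the preceding unit columns with its own entries as coefficients, and
    \<open>v\<close> records that relation.\<close>
  have "\<exists>i. k \<le> i \<and> i < n \<and> A $$ (i, k) \<noteq> 0"
  proof (rule ccontr)
    assume "\<not> ?thesis"
    then have z: "A $$ (i, k) = 0" if "k \<le> i" "i < n" for i using that by blast
    define v where "v = vec (Suc k) (\<lambda>j. if j = k then - 1 else A $$ (j, k))"
    have "A *\<^sub>v v = 0\<^sub>v n"
    proof (rule eq_vecI)
      fix i assume "i < dim_vec (0\<^sub>v n :: 'k vec)"
      then have i: "i < n" by simp
      have "(A *\<^sub>v v) $ i = (\<Sum>j<Suc k. A $$ (i, j) * v $ j)"
        using i A by (auto simp: scalar_prod_def v_def atLeast0LessThan intro!: sum.cong)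
      also have "\<dots> = (\<Sum>j<k. (if i = j then A $$ (j, k) else 0)) - A $$ (i, k)"
      proof -
        have "(\<Sum>j<k. A $$ (i, j) * v $ j) = (\<Sum>j<k. (if i = j then A $$ (j, k) else 0))"
          by (rule sum.cong) (use i in \<open>auto simp: Ak v_def\<close>)
        then show ?thesis by (simp add: v_def)
      qed
      also have "\<dots> = 0" using z[of i] i by auto
      finally show "(A *\<^sub>v v) $ i = 0\<^sub>v n $ i" using i by simp
    qed (use A in auto)
    then have "v = 0\<^sub>v (Suc k)" using mat_injectiveD[OF Ainj A] by (auto simp: v_def)
    then have "v $ k = 0" by simp
    then show False by (simp add: v_def)
  qed
  then obtain i where i: "k \<le> i" "i < n" "A $$ (i, k) \<noteq> 0" by blast
  text \<open>Complete the columns of \<open>A\<close> by all unit vectors \<open>e\<^sub>j\<close> with \<open>j \<ge> k\<close>, \<open>j \<noteq> i\<close>.\<close>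
  define \<tau> where "\<tau> j = (if j = i then k else j)" for j
  define G where "G = mat n n (\<lambda>(r, j). if j = k then A $$ (r, k) else if r = \<tau> j then 1 else 0)"
  have G: "G \<in> carrier_mat n n" by (simp add: G_def)
  have Gv: "(G *\<^sub>v v) $ r = A $$ (r, k) * v $ k + (\<Sum>j\<in>{..<n} - {k}. if r = \<tau> j then v $ j else 0)"
    if "r < n" "v \<in> carrier_vec n" for r v
  proof -
    have "(G *\<^sub>v v) $ r = (\<Sum>j<n. G $$ (r, j) * v $ j)"
      using that by (auto simp: scalar_prod_def G_def atLeast0LessThan intro!: sum.cong)
    also have "\<dots> = G $$ (r, k) * v $ k + (\<Sum>j\<in>{..<n} - {k}. G $$ (r, j) * v $ j)"
      by (rule sum.remove) (use i in auto)
    also have "(\<Sum>j\<in>{..<n} - {k}. G $$ (r, j) * v $ j) = (\<Sum>j\<in>{..<n} - {k}. if r = \<tau> j then v $ j else 0)"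
      by (rule sum.cong) (use that in \<open>auto simp: G_def\<close>)
    finally show ?thesis using that i by (simp add: G_def)
  qed
  have "mat_injective G"
  proof (rule mat_injectiveI[OF G])
    fix v :: "'k vec" assume v: "v \<in> carrier_vec n" "G *\<^sub>v v = 0\<^sub>v n"
    have "(\<Sum>j\<in>{..<n} - {k}. if i = \<tau> j then v $ j else 0) = 0"
      by (rule sum.neutral) (auto simp: \<tau>_def)
    then have vk: "v $ k = 0" using Gv[OF i(2) v(1)] v(2) i by simp
    have "v $ l = 0" if l: "l < n" "l \<noteq> k" for l
    proof -
      have t: "\<tau> l < n" using l i by (auto simp: \<tau>_def)
      have "(\<Sum>j\<in>{..<n} - {k}. if \<tau> l = \<tau> j then v $ j else 0) = (\<Sum>j\<in>{..<n} - {k}. if j = l then v $ j else 0)"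
        by (rule sum.cong) (use l in \<open>auto simp: \<tau>_def split: if_splits\<close>)
      also have "\<dots> = v $ l" using l by (simp add: sum.delta')
      finally show ?thesis using Gv[OF t v(1)] v(2) vk t by simp
    qed
    then show "v = 0\<^sub>v n" using v(1) vk by (intro eq_vecI) auto
  qed
  then have dG: "det G \<noteq> 0" using mat_injective_square[OF G] by simp
  have GA: "G * incl_mat n (Suc k) = A"
  proof -
    have "Suc k \<le> n" using i by simp
    then show ?thesis unfolding mult_incl_mat[OF G \<open>Suc k \<le> n\<close>]
      using A i by (intro eq_matI) (auto simp: G_def \<tau>_def Ak less_Suc_eq)
  qed
  \<comment> \<open>\<open>G\<close> maps the first \<open>k + 1\<close> unit vectors to the columns
    of \<open>A = P * M\<close>, so undoing \<open>G\<close> after \<open>P\<close> gives the normal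
    form.\<close>
  define Q where "Q = mat_inv G * P"
  have Q: "Q \<in> carrier_mat n n" using mat_inv(1)[OF G] P by (simp add: Q_def)
  have "det Q \<noteq> 0" unfolding Q_def
    using det_mult[OF mat_inv(1)[OF G] P(1)] det_mat_inv[OF G dG] P(2) by simp
  moreover have "Q * M = incl_mat n (Suc k)"
  proof -
    have "Q * M = mat_inv G * (G * incl_mat n (Suc k))"
      unfolding Q_def GA A_def by (rule assoc_mult_mat[OF mat_inv(1)[OF G] P(1) M])
    also have "\<dots> = (mat_inv G * G) * incl_mat n (Suc k)"
      by (rule assoc_mult_mat[OF mat_inv(1)[OF G] G, symmetric, of _ "Suc k"]) simp
    also have "\<dots> = incl_mat n (Suc k)" using mat_inv(3)[OF G dG] by simp
    finally show ?thesis .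
  qed
  ultimately show ?case using i Q by auto
qed

section \<open>Words, intertwiners and rank strata\<close>

type_synonym 'k tuple = "'k mat list \<times> 'k vec list"

definition tuples :: "nat \<Rightarrow> nat \<Rightarrow> nat \<Rightarrow> 'k::field tuple set" where
  "tuples n r d = {x. length (fst x) = d \<and> (\<forall>a<d. fst x ! a \<in> carrier_mat n n) \<and>
     length (snd x) = r \<and> (\<forall>j<r. snd x ! j \<in> carrier_vec n)}"

lemma tuples_alt:
  "tuples n r d = {(Ts, vs). length Ts = d \<and> set Ts \<subseteq> carrier_mat n n \<and> length vs = r \<and> set vs \<subseteq> carrier_vec n}"
  unfolding tuples_def by (auto simp: set_conv_nth)

lemma tuplesD:
  assumes "x \<in> tuples n r d"
  shows "length (fst x) = d" "length (snd x) = r"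
    "a < d \<Longrightarrow> fst x ! a \<in> carrier_mat n n" "j < r \<Longrightarrow> snd x ! j \<in> carrier_vec n"
  using assms by (auto simp: tuples_def)

lemma tuple_eqI:
  assumes "x \<in> tuples n r d" "y \<in> tuples n r d"
    "\<And>a. a < d \<Longrightarrow> fst x ! a = fst y ! a" "\<And>j. j < r \<Longrightarrow> snd x ! j = snd y ! j"
  shows "x = y"
  using assms unfolding tuples_def by (auto intro!: prod_eqI nth_equalityI)

text \<open>A pair \<open>(w, j)\<close> encodes the monomial with index list \<open>w\<close>
  applied to the \<open>j\<close>-th vector. Unlike the matrices in \<open>monomials\<close> it does
  not depend on the tuple, so a fixed list of words defines regular functions of a varying
  tuple.\<close>

definition words :: "nat \<Rightarrow> nat \<Rightarrow> (nat list \<times> nat) set" where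
  "words r d = {w. set (fst w) \<subseteq> {..<d} \<and> snd w < r}"

definition word_vec :: "'k::field tuple \<Rightarrow> nat list \<times> nat \<Rightarrow> 'k vec" where
  "word_vec x w = foldr (\<lambda>a u. fst x ! a *\<^sub>v u) (fst w) (snd x ! snd w)"

lemma word_vec_simps:
  "word_vec x ([], j) = snd x ! j"
  "word_vec x (a # w, j) = fst x ! a *\<^sub>v word_vec x (w, j)"
  by (simp_all add: word_vec_def)

lemma words_simps:
  "([], j) \<in> words r d \<longleftrightarrow> j < r"
  "(a # w, j) \<in> words r d \<longleftrightarrow> a < d \<and> (w, j) \<in> words r d"
  by (auto simp: words_def)

lemma word_vec_carrier:
  assumes x: "x \<in> tuples n r d" and w: "w \<in> words r d"
  shows "word_vec x w \<in> carrier_vec n"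
proof -
  have "(v, j) \<in> words r d \<Longrightarrow> word_vec x (v, j) \<in> carrier_vec n" for v j
    by (induction v) (auto simp: word_vec_simps words_simps intro!: mult_mat_vec_carrier[of _ n n] tuplesD[OF x])
  then show ?thesis using w by (cases w) auto
qed

definition word_lists :: "nat \<Rightarrow> nat \<Rightarrow> nat \<Rightarrow> (nat list \<times> nat) list set" where
  "word_lists r d k = {\<nu>. length \<nu> = k \<and> set \<nu> \<subseteq> words r d}"

definition word_mat :: "nat \<Rightarrow> 'k::field tuple \<Rightarrow> (nat list \<times> nat) list \<Rightarrow> 'k mat" where
  "word_mat n x \<nu> = mat_of_cols n (map (word_vec x) \<nu>)"

lemma word_mat_carrier: "\<nu> \<in> word_lists r d k \<Longrightarrow> word_mat n x \<nu> \<in> carrier_mat n k"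
  by (auto simp: word_mat_def word_lists_def)

lemma word_vecs_carrier: "x \<in> tuples n r d \<Longrightarrow> \<nu> \<in> word_lists r d k \<Longrightarrow> set (map (word_vec x) \<nu>) \<subseteq> carrier_vec n"
  using word_vec_carrier by (fastforce simp: word_lists_def)

lemma col_word_mat:
  assumes "x \<in> tuples n r d" "\<nu> \<in> word_lists r d k" "i < k"
  shows "col (word_mat n x \<nu>) i = word_vec x (\<nu> ! i)"
proof -
  have "\<nu> ! i \<in> words r d" using assms(2,3) nth_mem by (fastforce simp: word_lists_def)
  then show ?thesis unfolding word_mat_def
    by (subst col_mat_of_cols) (use assms word_vec_carrier[OF assms(1), of "\<nu> ! i"] in \<open>auto simp: word_lists_def\<close>)
qed

text \<open>\<open>M\<close> is a homomorphism of framed representations of the free algebra from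
  \<open>y\<close> to \<open>x\<close>. One notion covers changes of basis, with \<open>M\<close>
  invertible, and the inclusion of the generated subspace, with \<open>M\<close> injective.\<close>

definition intertwines :: "nat \<Rightarrow> nat \<Rightarrow> 'k::field mat \<Rightarrow> 'k tuple \<Rightarrow> 'k tuple \<Rightarrow> bool" where
  "intertwines r d M y x \<longleftrightarrow> (\<forall>a<d. fst x ! a * M = M * fst y ! a) \<and> (\<forall>j<r. snd x ! j = M *\<^sub>v snd y ! j)"

lemma word_vec_intertwines:
  assumes x: "x \<in> tuples n r d" and y: "y \<in> tuples k r d" and M: "M \<in> carrier_mat n k"
    and i: "intertwines r d M y x" and w: "w \<in> words r d"
  shows "word_vec x w = M *\<^sub>v word_vec y w"
proof -
  have "(v, j) \<in> words r d \<Longrightarrow> word_vec x (v, j) = M *\<^sub>v word_vec y (v, j)" for v j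
  proof (induction v)
    case Nil
    then show ?case using i by (auto simp: word_vec_simps words_simps intertwines_def)
  next
    case (Cons a v)
    then have a: "a < d" and v: "(v, j) \<in> words r d" by (auto simp: words_simps)
    note c = tuplesD(3)[OF x a] tuplesD(3)[OF y a] word_vec_carrier[OF y v]
    have "word_vec x (a # v, j) = (fst x ! a * M) *\<^sub>v word_vec y (v, j)"
      using Cons.IH[OF v] assoc_mult_mat_vec[OF c(1) M c(3)] by (simp add: word_vec_simps)
    also have "\<dots> = M *\<^sub>v (fst y ! a *\<^sub>v word_vec y (v, j))"
      using i a assoc_mult_mat_vec[OF M c(2,3)] by (simp add: intertwines_def)
    finally show ?case by (simp add: word_vec_simps)
  qed
  then show ?thesis using w by (cases w) auto
qed

lemma word_mat_intertwines:
  assumes x: "x \<in> tuples n r d" and y: "y \<in> tuples k r d" and M: "M \<in> carrier_mat n k"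
    and i: "intertwines r d M y x" and \<nu>: "\<nu> \<in> word_lists r d l"
  shows "word_mat n x \<nu> = M * word_mat k y \<nu>"
proof (rule mat_col_eqI)
  note c = word_mat_carrier[OF \<nu>, of n x] word_mat_carrier[OF \<nu>, of k y]
  show "dim_row (word_mat n x \<nu>) = dim_row (M * word_mat k y \<nu>)" "dim_col (word_mat n x \<nu>) = dim_col (M * word_mat k y \<nu>)"
    using c M by auto
  fix j assume "j < dim_col (M * word_mat k y \<nu>)"
  then have j: "j < l" using c by auto
  then have "\<nu> ! j \<in> words r d" using \<nu> by (auto simp: word_lists_def)
  then show "col (word_mat n x \<nu>) j = col (M * word_mat k y \<nu>) j"
    using col_mult2[OF M c(2) j] col_word_mat[OF x \<nu> j] col_word_mat[OF y \<nu> j] word_vec_intertwines[OF x y M i] by simp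
qed

lemma intertwines_compose:
  assumes x: "x \<in> tuples n r d" and y: "y \<in> tuples m r d" and z: "z \<in> tuples k r d"
    and M: "M \<in> carrier_mat n m" and N: "N \<in> carrier_mat m k"
    and i: "intertwines r d M y x" and j: "intertwines r d N z y"
  shows "intertwines r d (M * N) z x"
  unfolding intertwines_def
proof (intro conjI allI impI)
  fix a assume a: "a < d"
  note c = tuplesD(3)[OF x a] tuplesD(3)[OF y a] tuplesD(3)[OF z a]
  have "fst x ! a * (M * N) = fst x ! a * M * N" by (rule assoc_mult_mat[OF c(1) M N, symmetric])
  also have "\<dots> = M * fst y ! a * N" using i a by (simp add: intertwines_def)
  also have "\<dots> = M * (fst y ! a * N)" by (rule assoc_mult_mat[OF M c(2) N])
  also have "\<dots> = M * (N * fst z ! a)" using j a by (simp add: intertwines_def)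
  also have "\<dots> = M * N * fst z ! a" by (rule assoc_mult_mat[OF M N c(3), symmetric])
  finally show "fst x ! a * (M * N) = M * N * fst z ! a" .
next
  fix l assume l: "l < r"
  show "snd x ! l = M * N *\<^sub>v snd z ! l"
    using i j l assoc_mult_mat_vec[OF M N tuplesD(4)[OF z l]] by (simp add: intertwines_def)
qed

section \<open>The action of the general linear group on tuples\<close>

definition act :: "'k::field mat \<Rightarrow> 'k tuple \<Rightarrow> 'k tuple" where
  "act g x = (map (\<lambda>T. g * T * mat_inv g) (fst x), map (\<lambda>v. g *\<^sub>v v) (snd x))"

lemma act_carrier: "g \<in> carrier_mat n n \<Longrightarrow> x \<in> tuples n r d \<Longrightarrow> act g x \<in> tuples n r d"
  unfolding tuples_def act_def using mat_inv(1)[of g n] by (auto intro!: mult_carrier_mat[of _ n n])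

lemma intertwines_act:
  assumes g: "g \<in> carrier_mat n n" "det g \<noteq> 0" and x: "x \<in> tuples n r d"
  shows "intertwines r d g x (act g x)"
  unfolding intertwines_def
proof (intro conjI allI impI)
  fix a assume a: "a < d"
  note c = tuplesD(3)[OF x a]
  have "g * fst x ! a * mat_inv g * g = g * fst x ! a * (mat_inv g * g)"
    by (rule assoc_mult_mat[OF _ mat_inv(1)[OF g(1)] g(1)]) (use c g in auto)
  then show "fst (act g x) ! a * g = g * fst x ! a" using a tuplesD(1)[OF x] mat_inv(3)[OF g] c g by (simp add: act_def)
qed (use tuplesD[OF x] in \<open>auto simp: act_def\<close>)

text \<open>An invertible intertwiner determines its target. Identities for the action can therefore
  be proved by composing intertwiners instead of multiplying out conjugations.\<close>

lemma act_unique: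
  assumes g: "g \<in> carrier_mat n n" "det g \<noteq> 0" and x: "x \<in> tuples n r d" and y: "y \<in> tuples n r d"
    and i: "intertwines r d g y x"
  shows "x = act g y"
proof (rule tuple_eqI[OF x act_carrier[OF g(1) y]])
  fix a assume a: "a < d"
  note c = tuplesD(3)[OF x a]
  have "fst x ! a = fst x ! a * (g * mat_inv g)" using mat_inv(2)[OF g] c by simp
  also have "\<dots> = fst x ! a * g * mat_inv g" by (rule assoc_mult_mat[OF c g(1) mat_inv(1)[OF g(1)], symmetric])
  finally show "fst x ! a = fst (act g y) ! a" using i a tuplesD(1)[OF y] by (simp add: intertwines_def act_def)
qed (use i tuplesD[OF y] in \<open>auto simp: act_def intertwines_def\<close>)

lemma act_mult:
  assumes g: "g \<in> carrier_mat n n" "det g \<noteq> 0" and h: "h \<in> carrier_mat n n" "det h \<noteq> 0" and x: "x \<in> tuples n r d"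
  shows "act (g * h) x = act g (act h x)"
proof (rule act_unique[symmetric])
  note hx = act_carrier[OF h(1) x]
  show "intertwines r d (g * h) x (act g (act h x))"
    by (rule intertwines_compose[OF act_carrier[OF g(1) hx] hx x g(1) h(1) intertwines_act[OF g hx] intertwines_act[OF h x]])
qed (use assms in \<open>auto intro!: act_carrier simp: det_mult\<close>)

lemma act_one:
  assumes x: "x \<in> tuples n r d"
  shows "act (1\<^sub>m n) x = x"
proof (rule act_unique[symmetric, OF _ _ x x])
  show "intertwines r d (1\<^sub>m n) x x" unfolding intertwines_def
    using left_mult_one_mat[OF tuplesD(3)[OF x]] right_mult_one_mat[OF tuplesD(3)[OF x]] tuplesD(4)[OF x] by simp
qed auto

lemma act_inverse:
  assumes g: "g \<in> carrier_mat n n" "det g \<noteq> 0" and x: "x \<in> tuples n r d"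
  shows "act (mat_inv g) (act g x) = x" "act g (act (mat_inv g) x) = x"
  using act_mult[OF mat_inv(1)[OF g(1)] det_mat_inv[OF g] g x] act_mult[OF g mat_inv(1)[OF g(1)] det_mat_inv[OF g] x]
    mat_inv(2,3)[OF g] act_one[OF x] by simp_all

section \<open>The stratification by the dimension of the generated subspace\<close>

definition rank_ge :: "nat \<Rightarrow> nat \<Rightarrow> nat \<Rightarrow> nat \<Rightarrow> 'k::field tuple set" where
  "rank_ge n r d k = {x \<in> tuples n r d. \<exists>\<nu>\<in>word_lists r d k. mat_injective (word_mat n x \<nu>)}"

abbreviation stable_tuples :: "nat \<Rightarrow> nat \<Rightarrow> nat \<Rightarrow> 'k::field tuple set" where
  "stable_tuples n r d \<equiv> rank_ge n r d n"

text \<open>The words of such a tuple span a subspace of dimension exactly \<open>k\<close>. The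
  form as a difference of two sets, both open as it turns out, makes it locally closed at
  once.\<close>

definition stratum :: "nat \<Rightarrow> nat \<Rightarrow> nat \<Rightarrow> nat \<Rightarrow> 'k::field tuple set" where
  "stratum n r d k = rank_ge n r d k - rank_ge n r d (Suc k)"

lemma rank_ge_subset: "rank_ge n r d k \<subseteq> tuples n r d"
  by (auto simp: rank_ge_def)

lemma stable_tuples_det:
  "x \<in> stable_tuples n r d \<longleftrightarrow> x \<in> tuples n r d \<and> (\<exists>\<nu>\<in>word_lists r d n. det (word_mat n x \<nu>) \<noteq> 0)"
  unfolding rank_ge_def using mat_injective_square[OF word_mat_carrier] by blast

lemma rank_ge_0: "rank_ge n r d 0 = tuples n r d"
proof -
  have "[] \<in> word_lists r d 0" by (simp add: word_lists_def)
  moreover have "mat_injective (word_mat n x [])" for x :: "'k::field tuple"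
    by (rule mat_injectiveI[of _ n 0]) (auto simp: word_mat_def)
  ultimately show ?thesis unfolding rank_ge_def by blast
qed

lemma rank_ge_Suc_dim: "k > n \<Longrightarrow> rank_ge n r d k = {}"
  unfolding rank_ge_def using injective_normal_form[OF word_mat_carrier] leD by blast

lemma rank_ge_Suc: "rank_ge n r d (Suc k) \<subseteq> rank_ge n r d k"
proof
  fix x :: "'k::field tuple" assume "x \<in> rank_ge n r d (Suc k)"
  then obtain \<nu> where x: "x \<in> tuples n r d" and \<nu>: "\<nu> \<in> word_lists r d (Suc k)" "mat_injective (word_mat n x \<nu>)"
    by (auto simp: rank_ge_def)
  have t: "take k \<nu> \<in> word_lists r d k" using \<nu>(1) set_take_subset[of k \<nu>] by (auto simp: word_lists_def)
  have "word_mat n x (take k \<nu>) = word_mat n x \<nu> * incl_mat (Suc k) k"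
    by (subst mult_incl_mat[OF word_mat_carrier[OF \<nu>(1)]])
      (use \<nu>(1) in \<open>auto simp: word_mat_def word_lists_def mat_of_cols_index intro!: eq_matI\<close>)
  moreover have "mat_injective \<dots>"
    by (rule mat_injective_mult[OF word_mat_carrier[OF \<nu>(1)] _ \<nu>(2)]) (auto intro: incl_mat_injective)
  ultimately have "mat_injective (word_mat n x (take k \<nu>))" by simp
  then show "x \<in> rank_ge n r d k" using x t by (auto simp: rank_ge_def)
qed

text \<open>A list of \<open>k\<close> independent words that no further word extends independently
  already spans all words.\<close>

lemma word_vec_in_column_space:
  assumes x: "x \<in> tuples n r d" "x \<notin> rank_ge n r d (Suc k)" and \<nu>: "\<nu> \<in> word_lists r d k" "mat_injective (word_mat n x \<nu>)"
    and w: "w \<in> words r d"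
  shows "\<exists>c\<in>carrier_vec k. word_vec x w = word_mat n x \<nu> *\<^sub>v c"
proof -
  have "\<nu> @ [w] \<in> word_lists r d (Suc k)" using \<nu> w by (auto simp: word_lists_def)
  then have "\<not> mat_injective (word_mat n x (\<nu> @ [w]))" using x by (auto simp: rank_ge_def)
  then show ?thesis
    using not_injective_snoc[OF word_vecs_carrier[OF x(1) \<nu>(1)] word_vec_carrier[OF x(1) w]] \<nu>
    by (auto simp: word_mat_def word_lists_def)
qed

text \<open>The column space of the word matrix is the subspace generated by \<open>x\<close>. In
  the basis of its columns the restriction of \<open>x\<close> to this subspace is \<open>y\<close>,
  obtained with a left inverse \<open>L\<close>; in that basis the words of \<open>\<nu>\<close>
  become the unit vectors, which makes \<open>y\<close> stable.\<close>

lemma stratum_reduce: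
  assumes x: "x \<in> stratum n r d k" and \<nu>: "\<nu> \<in> word_lists r d k" "mat_injective (word_mat n x \<nu>)"
  shows "\<exists>y\<in>stable_tuples k r d. intertwines r d (word_mat n x \<nu>) y x"
proof -
  let ?M = "word_mat n x \<nu>"
  note M = word_mat_carrier[OF \<nu>(1), of n x]
  have xt: "x \<in> tuples n r d" and xn: "x \<notin> rank_ge n r d (Suc k)" using x rank_ge_subset by (auto simp: stratum_def rank_ge_def)
  obtain P where P: "P \<in> carrier_mat n n" "P * ?M = incl_mat n k" and kn: "k \<le> n" using injective_normal_form[OF M \<nu>(2)] by blast
  \<comment> \<open>The normal form followed by truncation to the first \<open>k\<close>
    coordinates: a left inverse of the word matrix.\<close>
  define L where "L = (incl_mat n k)\<^sup>T * P"
  have L: "L \<in> carrier_mat k n" unfolding L_def by (rule mult_carrier_mat[OF _ P(1)]) simp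
  have LM: "L * ?M = 1\<^sub>m k" unfolding L_def
    using assoc_mult_mat[of "(incl_mat n k)\<^sup>T" k n P n ?M k] P M transpose_incl_incl[OF kn] by simp
  \<comment> \<open>\<open>?M * L\<close> is a projection onto the column space and hence fixes
    every word.\<close>
  have MLu: "?M *\<^sub>v (L *\<^sub>v word_vec x w) = word_vec x w" if w: "w \<in> words r d" for w
  proof -
    obtain c where c: "c \<in> carrier_vec k" "word_vec x w = ?M *\<^sub>v c"
      using word_vec_in_column_space[OF xt xn \<nu> w] by blast
    have "L *\<^sub>v (?M *\<^sub>v c) = c" using assoc_mult_mat_vec[OF L M c(1)] LM c(1) by simp
    then show ?thesis using c by simp
  qed
  define y where "y = (map (\<lambda>T. L * (T * ?M)) (fst x), map (\<lambda>v. L *\<^sub>v v) (snd x))"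
  have y: "y \<in> tuples k r d" using xt L M by (auto simp: y_def tuples_def intro!: mult_carrier_mat[of _ _ n])
  have i: "intertwines r d ?M y x" unfolding intertwines_def
  proof (intro conjI allI impI)
    fix a assume a: "a < d"
    have T: "fst x ! a \<in> carrier_mat n n" by (rule tuplesD(3)[OF xt a])
    have TM: "fst x ! a * ?M \<in> carrier_mat n k" using T M by simp
    have LTM: "L * (fst x ! a * ?M) \<in> carrier_mat k k" using L TM by simp
    \<comment> \<open>Column by column: the \<open>a\<close>-th endomorphism sends the word in
      column \<open>j\<close> to a longer word, which again lies in the column space.\<close>
    have "fst x ! a * ?M = ?M * (L * (fst x ! a * ?M))"
    proof (rule mat_col_eqI)
      fix j assume "j < dim_col (?M * (L * (fst x ! a * ?M)))"
      then have j: "j < k" using LTM M by simp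
      then have w: "\<nu> ! j \<in> words r d" using \<nu> by (auto simp: word_lists_def)
      obtain v l where vl: "\<nu> ! j = (v, l)" by (cases "\<nu> ! j")
      have "col (fst x ! a * ?M) j = word_vec x (a # v, l)"
        using col_mult2[OF T M j] col_word_mat[OF xt \<nu>(1) j] vl by (simp add: word_vec_simps)
      moreover have "(a # v, l) \<in> words r d" using w a vl by (simp add: words_simps)
      ultimately show "col (fst x ! a * ?M) j = col (?M * (L * (fst x ! a * ?M))) j"
        using col_mult2[OF M LTM j] col_mult2[OF L TM j] MLu by simp
    qed (use T M L in auto)
    then show "fst x ! a * ?M = ?M * fst y ! a" using a tuplesD(1)[OF xt] by (simp add: y_def)
  next
    fix j assume j: "j < r"
    then have "([], j) \<in> words r d" by (simp add: words_simps)
    from MLu[OF this] show "snd x ! j = ?M *\<^sub>v snd y ! j" using j tuplesD(2)[OF xt] by (simp add: y_def word_vec_simps)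
  qed
  have "?M * word_mat k y \<nu> = ?M * 1\<^sub>m k" using word_mat_intertwines[OF xt y M i \<nu>(1)] M by simp
  then have "word_mat k y \<nu> = 1\<^sub>m k"
    using mat_injective_cancel[OF \<nu>(2) M word_mat_carrier[OF \<nu>(1)] one_carrier_mat] by blast
  then have "y \<in> stable_tuples k r d" using y \<nu>(1) unfolding stable_tuples_det by (auto intro!: bexI[of _ \<nu>])
  then show ?thesis using i by blast
qed

text \<open>Converse of \<open>stratum_reduce\<close>: the subspace generated by \<open>x\<close> is
  the image of \<open>M\<close>. Independent words of \<open>x\<close> come from independent words
  of \<open>y\<close>, and there is room for at most \<open>k\<close> of those.\<close>

lemma intertwines_stratum:
  assumes x: "x \<in> tuples n r d" and y: "y \<in> stable_tuples k r d" and M: "M \<in> carrier_mat n k" "mat_injective M"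
    and i: "intertwines r d M y x"
  shows "x \<in> stratum n r d k"
proof -
  have yt: "y \<in> tuples k r d" using y rank_ge_subset by blast
  obtain \<nu> where \<nu>: "\<nu> \<in> word_lists r d k" "mat_injective (word_mat k y \<nu>)" using y by (auto simp: rank_ge_def)
  have "mat_injective (word_mat n x \<nu>)"
    unfolding word_mat_intertwines[OF x yt M(1) i \<nu>(1)] by (rule mat_injective_mult[OF M(1) word_mat_carrier[OF \<nu>(1)] M(2) \<nu>(2)])
  then have "x \<in> rank_ge n r d k" using x \<nu> by (auto simp: rank_ge_def)
  moreover have "x \<notin> rank_ge n r d (Suc k)"
  proof
    assume "x \<in> rank_ge n r d (Suc k)"
    then obtain \<mu> where \<mu>: "\<mu> \<in> word_lists r d (Suc k)" "mat_injective (word_mat n x \<mu>)" by (auto simp: rank_ge_def)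
    have "mat_injective (word_mat k y \<mu>)"
      using mat_injective_factor[OF M(1) word_mat_carrier[OF \<mu>(1)]] \<mu>(2) word_mat_intertwines[OF x yt M(1) i \<mu>(1)] by simp
    then show False using injective_normal_form[OF word_mat_carrier[OF \<mu>(1)], of k y] by simp
  qed
  ultimately show ?thesis by (simp add: stratum_def)
qed

lemma stratum_top: "stratum n r d n = stable_tuples n r d"
  using rank_ge_Suc_dim[of n "Suc n"] by (auto simp: stratum_def)

lemma word_mat_act:
  assumes g: "g \<in> carrier_mat n n" "det g \<noteq> 0" and x: "x \<in> tuples n r d" and \<nu>: "\<nu> \<in> word_lists r d k"
  shows "word_mat n (act g x) \<nu> = g * word_mat n x \<nu>"
  by (rule word_mat_intertwines[OF act_carrier[OF g(1) x] x g(1) intertwines_act[OF g x] \<nu>])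

lemma stable_act:
  assumes g: "g \<in> carrier_mat n n" "det g \<noteq> 0" and x: "x \<in> stable_tuples n r d"
  shows "act g x \<in> stable_tuples n r d"
  using intertwines_stratum[OF act_carrier[OF g(1)] x g(1) _ intertwines_act[OF g]] x rank_ge_subset mat_injective_square[OF g(1)] g
  unfolding stratum_top by blast

subsection \<open>Spans and orbits\<close>

lemma span_cols:
  assumes "set vs \<subseteq> carrier_vec n"
  shows "vspan n (set vs) = {mat_of_cols n vs *\<^sub>v c | c. c \<in> carrier_vec (length vs)}"
proof -
  interpret vec_space "TYPE('a)" n .
  have "vspan n (set vs) = span_list vs" using span_list_as_span[OF assms] by simp
  also have "\<dots> = {mat_of_cols n vs *\<^sub>v vec (length vs) c | c. True}"
    using lincomb_list_as_mat_mult[of vs] assms unfolding span_list_def by force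
  also have "\<dots> = {mat_of_cols n vs *\<^sub>v c | c. c \<in> carrier_vec (length vs)}"
  proof -
    have "\<exists>f. c = vec (length vs) f" if "c \<in> carrier_vec (length vs)" for c :: "'a vec"
      using that by (intro exI[of _ "($) c"]) (auto intro!: eq_vecI)
    then show ?thesis by (auto intro: vec_carrier)
  qed
  finally show ?thesis .
qed

text \<open>Preimages of the unit vectors form a right inverse \<open>N\<close> of \<open>M\<close>.
  Having a left inverse, \<open>N\<close> is injective, with \<open>n\<close> columns of length
  \<open>k\<close>.\<close>

lemma surjective_mat_dim:
  fixes M :: "'k::field mat"
  assumes M: "M \<in> carrier_mat n k" and s: "carrier_vec n \<subseteq> {M *\<^sub>v c | c. c \<in> carrier_vec k}"
  shows "n \<le> k"
proof -
  have "\<exists>c. c \<in> carrier_vec k \<and> unit_vec n i = M *\<^sub>v c" for i using s by (auto dest: subsetD[of _ _ "unit_vec n i"])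
  then obtain c where c: "\<And>i. c i \<in> carrier_vec k \<and> unit_vec n i = M *\<^sub>v c i" by metis
  define N where "N = mat_of_cols k (map c [0..<n])"
  have N: "N \<in> carrier_mat k n" using mat_of_cols_carrier(1)[of k "map c [0..<n]"] by (simp add: N_def)
  have "M * N = 1\<^sub>m n"
  proof (rule mat_col_eqI)
    fix j assume "j < dim_col (1\<^sub>m n :: 'k mat)"
    then have j: "j < n" by simp
    have "col N j = c j" unfolding N_def by (subst col_mat_of_cols) (use c j in auto)
    then show "col (M * N) j = col (1\<^sub>m n) j" using col_mult2[OF M N j] c j by simp
  qed (use M N in auto)
  then have "mat_injective N" by (intro left_inverse_injective[OF M N]) simp
  then show ?thesis using injective_normal_form[OF N] by simp
qed

lemma monomials_words:
  assumes x: "x \<in> tuples n r d"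
  shows "{M *\<^sub>v v | M v. M \<in> monomials n (fst x) \<and> v \<in> set (snd x)} = word_vec x ` words r d" (is "?S = ?W")
proof
  have 1: "(\<exists>w. set w \<subseteq> {..<d} \<and> M \<in> carrier_mat n n \<and> (\<forall>j<r. M *\<^sub>v snd x ! j = word_vec x (w, j)))" if "M \<in> monomials n (fst x)" for M
    using that
  proof induction
    case empty
    show ?case by (rule exI[of _ "[]"]) (use tuplesD[OF x] in \<open>auto simp: word_vec_simps\<close>)
  next
    case (step T M)
    then obtain w where w: "set w \<subseteq> {..<d}" "M \<in> carrier_mat n n" "\<forall>j<r. M *\<^sub>v snd x ! j = word_vec x (w, j)" by blast
    obtain a where a: "a < d" "T = fst x ! a" using step(1) tuplesD(1)[OF x] by (auto simp: in_set_conv_nth)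
    show ?case
      by (rule exI[of _ "a # w"])
        (use w a tuplesD[OF x] in \<open>auto simp: word_vec_simps assoc_mult_mat_vec[of _ n n _ n] intro!: mult_carrier_mat[of _ n n]\<close>)
  qed
  show "?S \<subseteq> ?W"
  proof
    fix u assume "u \<in> ?S"
    then obtain M j where M: "M \<in> monomials n (fst x)" "j < r" "u = M *\<^sub>v snd x ! j"
      using tuplesD(2)[OF x] by (auto simp: in_set_conv_nth)
    from 1[OF M(1)] obtain w where "set w \<subseteq> {..<d}" "\<forall>j<r. M *\<^sub>v snd x ! j = word_vec x (w, j)" by blast
    then show "u \<in> ?W" using M by (intro image_eqI[of _ _ "(w, j)"]) (auto simp: words_def)
  qed
  have 2: "\<exists>M\<in>monomials n (fst x) \<inter> carrier_mat n n. word_vec x (w, j) = M *\<^sub>v snd x ! j" if "(w, j) \<in> words r d" for w j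
    using that
  proof (induction w)
    case Nil
    then show ?case using tuplesD[OF x] by (intro bexI[of _ "1\<^sub>m n"]) (auto simp: word_vec_simps words_simps intro: monomials.empty)
  next
    case (Cons a w)
    then have a: "a < d" and w: "(w, j) \<in> words r d" by (auto simp: words_simps)
    from Cons.IH[OF w] obtain M where M: "M \<in> monomials n (fst x)" "M \<in> carrier_mat n n" "word_vec x (w, j) = M *\<^sub>v snd x ! j" by blast
    have T: "fst x ! a \<in> set (fst x)" using a tuplesD(1)[OF x] by simp
    have v: "snd x ! j \<in> carrier_vec n" using w tuplesD(4)[OF x] by (auto simp: words_def)
    show ?case
      by (rule bexI[of _ "fst x ! a * M"])
        (use M monomials.step[OF T M(1)] tuplesD(3)[OF x a] v in \<open>auto simp: word_vec_simps assoc_mult_mat_vec[of _ n n _ n]\<close>)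
  qed
  show "?W \<subseteq> ?S"
  proof
    fix u assume "u \<in> ?W"
    then obtain w j where wj: "(w, j) \<in> words r d" "u = word_vec x (w, j)" by auto
    from 2[OF wj(1)] obtain M where "M \<in> monomials n (fst x)" "u = M *\<^sub>v snd x ! j" using wj(2) by blast
    moreover have "snd x ! j \<in> set (snd x)" using wj(1) tuplesD(2)[OF x] by (auto simp: words_def)
    ultimately show "u \<in> ?S" by blast
  qed
qed

lemma span_words_iff:
  assumes x: "x \<in> tuples n r d"
  shows "vspan n (word_vec x ` words r d) = carrier_vec n \<longleftrightarrow> x \<in> stable_tuples n r d"
proof
  interpret vec_space "TYPE('a)" n .
  let ?S = "word_vec x ` words r d"
  have S: "?S \<subseteq> carrier_vec n" using word_vec_carrier[OF x] by blast
  { assume "x \<in> stable_tuples n r d"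
    then obtain \<nu> where \<nu>: "\<nu> \<in> word_lists r d n" "det (word_mat n x \<nu>) \<noteq> 0" unfolding stable_tuples_det by blast
    note M = word_mat_carrier[OF \<nu>(1), of n x]
    have "carrier_vec n \<subseteq> vspan n (set (map (word_vec x) \<nu>))"
    proof
      fix u :: "'a vec" assume u: "u \<in> carrier_vec n"
      have "u = word_mat n x \<nu> *\<^sub>v (mat_inv (word_mat n x \<nu>) *\<^sub>v u)"
        using assoc_mult_mat_vec[OF M mat_inv(1)[OF M] u] mat_inv(2)[OF M \<nu>(2)] u by simp
      moreover have "mat_inv (word_mat n x \<nu>) *\<^sub>v u \<in> carrier_vec n" using mat_inv(1)[OF M] u by simp
      ultimately show "u \<in> vspan n (set (map (word_vec x) \<nu>))"
        unfolding span_cols[OF word_vecs_carrier[OF x \<nu>(1)]] using \<nu>(1) unfolding word_mat_def word_lists_def by auto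
    qed
    moreover have "vspan n (set (map (word_vec x) \<nu>)) \<subseteq> vspan n ?S"
      by (rule span_is_monotone) (use \<nu> in \<open>auto simp: word_lists_def\<close>)
    moreover have "vspan n ?S \<subseteq> carrier_vec n" using span_is_subset2[OF S] .
    ultimately show "vspan n ?S = carrier_vec n" by blast }
  { assume sp: "vspan n ?S = carrier_vec n"
    show "x \<in> stable_tuples n r d"
    proof (rule ccontr)
      assume "x \<notin> stable_tuples n r d"
      \<comment> \<open>Every tuple has rank at least \<open>0\<close>, so an unstable one drops out
        at some \<open>k < n\<close>. Its words then lie in the span of \<open>k\<close> vectors,
        too few for \<open>n\<close>-space.\<close>
      then obtain k where k: "k < n" "x \<in> rank_ge n r d k" "x \<notin> rank_ge n r d (Suc k)"
        using x dec_induct[of 0 n "\<lambda>k. x \<in> rank_ge n r d k"] rank_ge_0 by (metis le0)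
      then obtain \<nu> where \<nu>: "\<nu> \<in> word_lists r d k" "mat_injective (word_mat n x \<nu>)" by (auto simp: rank_ge_def)
      have "?S \<subseteq> vspan n (set (map (word_vec x) \<nu>))"
      proof
        fix u assume "u \<in> ?S"
        then obtain w where "w \<in> words r d" "u = word_vec x w" by blast
        with word_vec_in_column_space[OF x k(3) \<nu> this(1)] show "u \<in> vspan n (set (map (word_vec x) \<nu>))"
          unfolding span_cols[OF word_vecs_carrier[OF x \<nu>(1)]] using \<nu>(1) unfolding word_mat_def word_lists_def by auto
      qed
      then have "vspan n ?S \<subseteq> vspan n (set (map (word_vec x) \<nu>))"
        using span_subsetI[OF word_vecs_carrier[OF x \<nu>(1)]] by blast
      then have "carrier_vec n \<subseteq> {word_mat n x \<nu> *\<^sub>v c | c. c \<in> carrier_vec k}"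
        unfolding sp span_cols[OF word_vecs_carrier[OF x \<nu>(1)]] using \<nu>(1) unfolding word_mat_def word_lists_def by auto
      from surjective_mat_dim[OF word_mat_carrier[OF \<nu>(1)] this] show False using k(1) by simp
    qed }
qed

lemma GL_orbit_alt:
  assumes x: "x \<in> tuples n r d"
  shows "GL_orbit n x = {act g x | g. g \<in> carrier_mat n n \<and> det g \<noteq> 0}"
proof -
  have "(\<exists>h. h \<in> carrier_mat n n \<and> inverts_mat g h \<and> inverts_mat h g \<and> P h) \<longleftrightarrow> det g \<noteq> 0 \<and> P (mat_inv g)"
    if g: "g \<in> carrier_mat n n" for g :: "'a mat" and P
  proof
    assume "\<exists>h. h \<in> carrier_mat n n \<and> inverts_mat g h \<and> inverts_mat h g \<and> P h"
    then obtain h where h: "h \<in> carrier_mat n n" "g * h = 1\<^sub>m n" "P h" using g by (auto simp: inverts_mat_def)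
    then show "det g \<noteq> 0 \<and> P (mat_inv g)"
      using det_nonzero_of_inverse(1)[OF g h(1,2)] mat_inv_unique[OF g h(1,2)] by simp
  next
    assume "det g \<noteq> 0 \<and> P (mat_inv g)"
    then show "\<exists>h. h \<in> carrier_mat n n \<and> inverts_mat g h \<and> inverts_mat h g \<and> P h"
      using mat_inv[OF g] g by (intro exI[of _ "mat_inv g"]) (auto simp: inverts_mat_def)
  qed
  note eq = this
  show ?thesis
  proof (intro Set.set_eqI iffI)
    fix y assume "y \<in> GL_orbit n x"
    then obtain g h where gh: "g \<in> carrier_mat n n" "h \<in> carrier_mat n n" "inverts_mat g h" "inverts_mat h g"
      "y = (map (\<lambda>T. g * T * h) (fst x), map (\<lambda>v. g *\<^sub>v v) (snd x))" unfolding GL_orbit_def by (auto split: prod.splits)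
    then have "det g \<noteq> 0 \<and> y = act g x"
      using eq[OF gh(1), of "\<lambda>h. y = (map (\<lambda>T. g * T * h) (fst x), map (\<lambda>v. g *\<^sub>v v) (snd x))"] unfolding act_def by blast
    then show "y \<in> {act g x | g. g \<in> carrier_mat n n \<and> det g \<noteq> 0}" using gh(1) by blast
  next
    fix y assume "y \<in> {act g x | g. g \<in> carrier_mat n n \<and> det g \<noteq> 0}"
    then obtain g where g: "g \<in> carrier_mat n n" "det g \<noteq> 0" "y = act g x" by blast
    then obtain h where "h \<in> carrier_mat n n" "inverts_mat g h" "inverts_mat h g"
      "y = (map (\<lambda>T. g * T * h) (fst x), map (\<lambda>v. g *\<^sub>v v) (snd x))"
      using eq[OF g(1), of "\<lambda>h. y = (map (\<lambda>T. g * T * h) (fst x), map (\<lambda>v. g *\<^sub>v v) (snd x))"] unfolding act_def by blast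
    then show "y \<in> GL_orbit n x" using g(1) unfolding GL_orbit_def case_prod_beta by blast
  qed
qed

lemma GL_orbit_eq_iff:
  assumes x: "x \<in> tuples n r d" and y: "y \<in> tuples n r d"
  shows "GL_orbit n x = GL_orbit n y \<longleftrightarrow> (\<exists>g\<in>carrier_mat n n. det g \<noteq> 0 \<and> y = act g x)"
proof
  assume "GL_orbit n x = GL_orbit n y"
  moreover have "y \<in> GL_orbit n y" unfolding GL_orbit_alt[OF y] using act_one[OF y]
    by (intro CollectI exI[of _ "1\<^sub>m n"]) auto
  ultimately show "\<exists>g\<in>carrier_mat n n. det g \<noteq> 0 \<and> y = act g x" unfolding GL_orbit_alt[OF x] by blast
next
  have sub: "GL_orbit n y \<subseteq> GL_orbit n x"
    if "x \<in> tuples n r d" "y \<in> tuples n r d" "g\<in>carrier_mat n n" "det g \<noteq> 0" "y = act g x" for x y and g :: "'a mat"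
    unfolding GL_orbit_alt[OF that(1)] GL_orbit_alt[OF that(2)]
  proof
    fix z assume "z \<in> {act g y |g. g \<in> carrier_mat n n \<and> det g \<noteq> 0}"
    then obtain h where h: "h \<in> carrier_mat n n" "det h \<noteq> 0" "z = act h y" by blast
    then show "z \<in> {act g x |g. g \<in> carrier_mat n n \<and> det g \<noteq> 0}"
      using act_mult[OF h(1,2) that(3,4,1)] that det_mult[OF h(1) that(3)] by (intro CollectI exI[of _ "h * g"]) auto
  qed
  assume "\<exists>g\<in>carrier_mat n n. det g \<noteq> 0 \<and> y = act g x"
  then obtain g where g: "g\<in>carrier_mat n n" "det g \<noteq> 0" "y = act g x" by blast
  then have "x = act (mat_inv g) y" using act_inverse(1)[OF g(1,2) x] by simp
  then show "GL_orbit n x = GL_orbit n y"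
    using sub[OF x y g] sub[OF y x mat_inv(1)[OF g(1)] det_mat_inv[OF g(1,2)]] by blast
qed

section \<open>Regular matrix-valued functions\<close>

text \<open>Morphisms to a space of matrices, checked entrywise on all of \<open>X\<close>. For a
  map given only on an open part, \<open>X\<close> is replaced by the corresponding
  \<open>sub_space\<close>.\<close>

definition regular_mat :: "('k::field, 'p) space \<Rightarrow> nat \<Rightarrow> nat \<Rightarrow> ('p \<Rightarrow> 'k mat) \<Rightarrow> bool" where
  "regular_mat X a b M \<longleftrightarrow> (\<forall>x\<in>pts X. M x \<in> carrier_mat a b) \<and>
     (\<forall>i<a. \<forall>j<b. (\<lambda>x. M x $$ (i, j)) \<in> reg X (pts X))"

definition regular_vec :: "('k::field, 'p) space \<Rightarrow> nat \<Rightarrow> ('p \<Rightarrow> 'k vec) \<Rightarrow> bool" where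
  "regular_vec X a v \<longleftrightarrow> (\<forall>x\<in>pts X. v x \<in> carrier_vec a) \<and> (\<forall>i<a. (\<lambda>x. v x $ i) \<in> reg X (pts X))"

definition regular_tuple :: "('k::field, 'p) space \<Rightarrow> nat \<Rightarrow> nat \<Rightarrow> nat \<Rightarrow> ('p \<Rightarrow> 'k tuple) \<Rightarrow> bool" where
  "regular_tuple X n r d t \<longleftrightarrow> (\<forall>x\<in>pts X. t x \<in> tuples n r d) \<and>
     (\<forall>a<d. regular_mat X n n (\<lambda>x. fst (t x) ! a)) \<and> (\<forall>j<r. regular_vec X n (\<lambda>x. snd (t x) ! j))"

lemma regular_matD:
  assumes "regular_mat X a b M"
  shows "x \<in> pts X \<Longrightarrow> M x \<in> carrier_mat a b"
    and "i < a \<Longrightarrow> j < b \<Longrightarrow> (\<lambda>x. M x $$ (i, j)) \<in> reg X (pts X)"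
  using assms by (auto simp: regular_mat_def)

lemma regular_vecD:
  assumes "regular_vec X a v"
  shows "x \<in> pts X \<Longrightarrow> v x \<in> carrier_vec a" and "i < a \<Longrightarrow> (\<lambda>x. v x $ i) \<in> reg X (pts X)"
  using assms by (auto simp: regular_vec_def)

lemma regular_tupleD:
  assumes "regular_tuple X n r d t"
  shows "x \<in> pts X \<Longrightarrow> t x \<in> tuples n r d"
    and "a < d \<Longrightarrow> regular_mat X n n (\<lambda>x. fst (t x) ! a)"
    and "j < r \<Longrightarrow> regular_vec X n (\<lambda>x. snd (t x) ! j)"
  using assms by (auto simp: regular_tuple_def)

lemma regular_mat_compose: "regular_mat Y a b M \<Longrightarrow> morphism X Y f \<Longrightarrow> regular_mat X a b (\<lambda>x. M (f x))"
  unfolding regular_mat_def using morphismD(2)[of X Y f] morphism_reg[of X Y f "\<lambda>x. M x $$ _"] by blast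

lemma regular_vec_compose: "regular_vec Y a v \<Longrightarrow> morphism X Y f \<Longrightarrow> regular_vec X a (\<lambda>x. v (f x))"
  unfolding regular_vec_def using morphismD(2)[of X Y f] morphism_reg[of X Y f "\<lambda>x. v x $ _"] by blast

lemma regular_tuple_compose:
  assumes t: "regular_tuple Y n r d t" and f: "morphism X Y f"
  shows "regular_tuple X n r d (\<lambda>x. t (f x))"
  unfolding regular_tuple_def
  using regular_mat_compose[OF regular_tupleD(2)[OF t] f] regular_vec_compose[OF regular_tupleD(3)[OF t] f]
    regular_tupleD(1)[OF t morphismD(2)[OF f]] by blast

context space_with_functions
begin

lemma regI: "f \<in> reg X (pts X) \<Longrightarrow> (\<And>x. x \<in> pts X \<Longrightarrow> f x = g x) \<Longrightarrow> g \<in> reg X (pts X)"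
  by (rule cong_reg[OF openin_topspace])

lemma prod_reg: "(\<And>i. i \<in> A \<Longrightarrow> f i \<in> reg X (pts X)) \<Longrightarrow> (\<lambda>x. \<Prod>i\<in>A. f i x) \<in> reg X (pts X)"
  by (induction A rule: infinite_finite_induct) (auto intro: const mult)

lemma diff_reg: "f \<in> reg X (pts X) \<Longrightarrow> g \<in> reg X (pts X) \<Longrightarrow> (\<lambda>x. f x - g x) \<in> reg X (pts X)"
  using add[OF openin_topspace _ mult[OF openin_topspace const[OF openin_topspace, of "-1"]], of f g] by simp

lemma regular_mat_cong:
  assumes "regular_mat X a b M" "\<And>x. x \<in> pts X \<Longrightarrow> M x = N x"
  shows "regular_mat X a b N"
  unfolding regular_mat_def
proof (intro conjI ballI allI impI)
  fix i j assume "i < a" "j < b"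
  from regular_matD(2)[OF assms(1) this] show "(\<lambda>x. N x $$ (i, j)) \<in> reg X (pts X)"
    by (rule regI) (use assms(2) in auto)
qed (use regular_matD(1)[OF assms(1)] assms(2) in auto)

lemma regular_vec_cong:
  assumes "regular_vec X a v" "\<And>x. x \<in> pts X \<Longrightarrow> v x = w x"
  shows "regular_vec X a w"
  unfolding regular_vec_def
proof (intro conjI ballI allI impI)
  fix i assume "i < a"
  from regular_vecD(2)[OF assms(1) this] show "(\<lambda>x. w x $ i) \<in> reg X (pts X)"
    by (rule regI) (use assms(2) in auto)
qed (use regular_vecD(1)[OF assms(1)] assms(2) in auto)

lemma regular_mat_const: "A \<in> carrier_mat a b \<Longrightarrow> regular_mat X a b (\<lambda>_. A)"
  unfolding regular_mat_def by (auto intro: const)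

lemma regular_mat_mat:
  assumes "\<And>i j. i < a \<Longrightarrow> j < b \<Longrightarrow> (\<lambda>x. f x i j) \<in> reg X (pts X)"
  shows "regular_mat X a b (\<lambda>x. mat a b (\<lambda>(i, j). f x i j))"
  unfolding regular_mat_def using assms by auto

lemma regular_vec_vec:
  assumes "\<And>i. i < a \<Longrightarrow> (\<lambda>x. f x i) \<in> reg X (pts X)"
  shows "regular_vec X a (\<lambda>x. vec a (\<lambda>i. f x i))"
  unfolding regular_vec_def using assms by auto

lemma regular_mat_mult:
  assumes M: "regular_mat X a b M" and N: "regular_mat X b c N"
  shows "regular_mat X a c (\<lambda>x. M x * N x)"
  unfolding regular_mat_def
proof (intro conjI ballI allI impI)
  fix i j assume ij: "i < a" "j < c"
  have "(\<lambda>x. \<Sum>l<b. M x $$ (i, l) * N x $$ (l, j)) \<in> reg X (pts X)"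
    by (intro sum_reg mult openin_topspace regular_matD(2)[OF M] regular_matD(2)[OF N] ij) auto
  then show "(\<lambda>x. (M x * N x) $$ (i, j)) \<in> reg X (pts X)"
  proof (rule regI)
    fix x assume "x \<in> pts X"
    from regular_matD(1)[OF M this] regular_matD(1)[OF N this] ij
    show "(\<Sum>l<b. M x $$ (i, l) * N x $$ (l, j)) = (M x * N x) $$ (i, j)"
      by (auto simp: scalar_prod_def atLeast0LessThan intro!: sum.cong)
  qed
qed (auto intro: mult_carrier_mat[OF regular_matD(1)[OF M] regular_matD(1)[OF N]])

lemma regular_mat_mult_vec:
  assumes M: "regular_mat X a b M" and v: "regular_vec X b v"
  shows "regular_vec X a (\<lambda>x. M x *\<^sub>v v x)"
  unfolding regular_vec_def
proof (intro conjI ballI allI impI)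
  fix i assume i: "i < a"
  have "(\<lambda>x. \<Sum>l<b. M x $$ (i, l) * v x $ l) \<in> reg X (pts X)"
    by (intro sum_reg mult openin_topspace regular_matD(2)[OF M] regular_vecD(2)[OF v] i) auto
  then show "(\<lambda>x. (M x *\<^sub>v v x) $ i) \<in> reg X (pts X)"
  proof (rule regI)
    fix x assume "x \<in> pts X"
    from regular_matD(1)[OF M this] regular_vecD(1)[OF v this] i
    show "(\<Sum>l<b. M x $$ (i, l) * v x $ l) = (M x *\<^sub>v v x) $ i"
      by (auto simp: scalar_prod_def atLeast0LessThan intro!: sum.cong)
  qed
qed (auto intro: mult_mat_vec_carrier[OF regular_matD(1)[OF M] regular_vecD(1)[OF v]])

lemma regular_mat_smult:
  assumes M: "regular_mat X a b M" and c: "c \<in> reg X (pts X)"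
  shows "regular_mat X a b (\<lambda>x. c x \<cdot>\<^sub>m M x)"
  unfolding regular_mat_def
proof (intro conjI ballI allI impI)
  fix i j assume ij: "i < a" "j < b"
  have "(\<lambda>x. c x * M x $$ (i, j)) \<in> reg X (pts X)"
    by (intro mult openin_topspace regular_matD(2)[OF M] c ij)
  then show "(\<lambda>x. (c x \<cdot>\<^sub>m M x) $$ (i, j)) \<in> reg X (pts X)"
  proof (rule regI)
    fix x assume "x \<in> pts X"
    from regular_matD(1)[OF M this] ij show "c x * M x $$ (i, j) = (c x \<cdot>\<^sub>m M x) $$ (i, j)" by auto
  qed
qed (rule smult_carrier_mat[OF regular_matD(1)[OF M]])

lemma regular_mat_of_cols:
  assumes "\<And>j. j < k \<Longrightarrow> regular_vec X n (\<lambda>x. v x j)"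
  shows "regular_mat X n k (\<lambda>x. mat_of_cols n (map (v x) [0..<k]))"
  unfolding regular_mat_def
proof (intro conjI ballI allI impI)
  fix i j assume ij: "i < n" "j < k"
  from regular_vecD(2)[OF assms[OF ij(2)] ij(1)]
  show "(\<lambda>x. mat_of_cols n (map (v x) [0..<k]) $$ (i, j)) \<in> reg X (pts X)"
    using ij by (simp add: mat_of_cols_index)
qed (metis diff_zero length_map length_upt mat_of_cols_carrier(1))

lemma regular_det:
  assumes M: "regular_mat X n n M"
  shows "(\<lambda>x. det (M x)) \<in> reg X (pts X)"
proof -
  have "(\<lambda>x. \<Sum>p\<in>{p. p permutes {0..<n}}. signof p * (\<Prod>i = 0..<n. M x $$ (i, p i))) \<in> reg X (pts X)"
  proof (intro sum_reg mult openin_topspace const prod_reg regular_matD(2)[OF M])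
    fix p i assume "p \<in> {p. p permutes {0..<n}}" "i \<in> {0..<n}"
    then show "i < n" "p i < n" using permutes_in_image by fastforce+
  qed
  then show ?thesis by (rule regI) (use det_def'[OF regular_matD(1)[OF M]] in auto)
qed

lemma regular_adj_mat:
  assumes M: "regular_mat X n n M"
  shows "regular_mat X n n (\<lambda>x. adj_mat (M x))"
  unfolding regular_mat_def
proof (intro conjI ballI allI impI)
  fix i j assume ij: "i < n" "j < n"
  have "regular_mat X (n - 1) (n - 1) (\<lambda>x. mat (n - 1) (n - 1) (\<lambda>(a, b). M x $$ (if a < j then a else Suc a, if b < i then b else Suc b)))"
    by (intro regular_mat_mat regular_matD(2)[OF M]) auto
  from mult[OF openin_topspace const[OF openin_topspace, of "(-1) ^ (j + i)"] regular_det[OF this]]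
  have "(\<lambda>x. (-1) ^ (j + i) * det (mat (n - 1) (n - 1) (\<lambda>(a, b). M x $$ (if a < j then a else Suc a, if b < i then b else Suc b)))) \<in> reg X (pts X)" .
  then show "(\<lambda>x. adj_mat (M x) $$ (i, j)) \<in> reg X (pts X)"
  proof (rule regI)
    fix x assume "x \<in> pts X"
    from regular_matD(1)[OF M this] ij
    show "(-1) ^ (j + i) * det (mat (n - 1) (n - 1) (\<lambda>(a, b). M x $$ (if a < j then a else Suc a, if b < i then b else Suc b))) = adj_mat (M x) $$ (i, j)"
      by (auto simp: adj_mat_def cofactor_def mat_delete_def)
  qed
qed (use adj_mat(1)[OF regular_matD(1)[OF M]] in auto)

lemma regular_mat_inv:
  assumes M: "regular_mat X n n M" and d: "\<And>x. x \<in> pts X \<Longrightarrow> det (M x) \<noteq> 0"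
  shows "regular_mat X n n (\<lambda>x. mat_inv (M x))"
  unfolding mat_inv_def
proof (rule regular_mat_smult[OF regular_adj_mat[OF M]])
  have "{x\<in>pts X. det (M x) \<noteq> 0} = pts X" using d by auto
  then show "(\<lambda>x. inverse (det (M x))) \<in> reg X (pts X)"
    using inverse[OF openin_topspace regular_det[OF M]] by simp
qed

lemma regular_word_vec:
  assumes t: "regular_tuple X n r d t" and w: "w \<in> words r d"
  shows "regular_vec X n (\<lambda>x. word_vec (t x) w)"
proof -
  have "(v, j) \<in> words r d \<Longrightarrow> regular_vec X n (\<lambda>x. word_vec (t x) (v, j))" for v j
    by (induction v) (auto simp: word_vec_simps words_simps intro!: regular_mat_mult_vec regular_tupleD[OF t])
  then show ?thesis using w by (cases w) auto
qed

lemma regular_word_mat: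
  assumes t: "regular_tuple X n r d t" and \<nu>: "\<nu> \<in> word_lists r d k"
  shows "regular_mat X n k (\<lambda>x. word_mat n (t x) \<nu>)"
proof -
  have "regular_mat X n k (\<lambda>x. mat_of_cols n (map (\<lambda>j. word_vec (t x) (\<nu> ! j)) [0..<k]))"
  proof (intro regular_mat_of_cols regular_word_vec[OF t])
    fix j assume "j < k"
    then show "\<nu> ! j \<in> words r d" using \<nu> nth_mem by (fastforce simp: word_lists_def)
  qed
  moreover have "map (\<lambda>j. word_vec (t x) (\<nu> ! j)) [0..<k] = map (word_vec (t x)) \<nu>" for x
    using \<nu> by (auto simp: word_lists_def intro!: nth_equalityI)
  ultimately show ?thesis by (simp add: word_mat_def)
qed

lemma regular_act:
  assumes g: "regular_mat X n n g" "\<And>x. x \<in> pts X \<Longrightarrow> det (g x) \<noteq> 0" and t: "regular_tuple X n r d t"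
  shows "regular_tuple X n r d (\<lambda>x. act (g x) (t x))"
  unfolding regular_tuple_def
proof (intro conjI ballI allI impI)
  fix a assume a: "a < d"
  have "regular_mat X n n (\<lambda>x. g x * fst (t x) ! a * mat_inv (g x))"
    by (intro regular_mat_mult[of _ n] g regular_tupleD(2)[OF t a] regular_mat_inv)
  then show "regular_mat X n n (\<lambda>x. fst (act (g x) (t x)) ! a)"
  proof (rule regular_mat_cong)
    fix x assume "x \<in> pts X"
    from tuplesD(1)[OF regular_tupleD(1)[OF t this]] a
    show "g x * fst (t x) ! a * mat_inv (g x) = fst (act (g x) (t x)) ! a" by (simp add: act_def)
  qed
next
  fix j assume j: "j < r"
  have "regular_vec X n (\<lambda>x. g x *\<^sub>v snd (t x) ! j)"
    by (intro regular_mat_mult_vec[of _ n] g regular_tupleD(3)[OF t j])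
  then show "regular_vec X n (\<lambda>x. snd (act (g x) (t x)) ! j)"
  proof (rule regular_vec_cong)
    fix x assume "x \<in> pts X"
    from tuplesD(2)[OF regular_tupleD(1)[OF t this]] j
    show "g x *\<^sub>v snd (t x) ! j = snd (act (g x) (t x)) ! j" by (simp add: act_def)
  qed
qed (use act_carrier[OF regular_matD(1)[OF g(1)] regular_tupleD(1)[OF t]] in auto)

lemma open_nonzero: "f \<in> reg X (pts X) \<Longrightarrow> openin (zar X) {x\<in>pts X. f x \<noteq> 0}"
  by (rule nonzero[OF openin_topspace])

lemma closed_eq: "f \<in> reg X (pts X) \<Longrightarrow> g \<in> reg X (pts X) \<Longrightarrow> closedin (zar X) {x\<in>pts X. f x = g x}"
proof -
  assume "f \<in> reg X (pts X)" "g \<in> reg X (pts X)"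
  from open_nonzero[OF diff_reg[OF this]] have "openin (zar X) {x\<in>pts X. f x - g x \<noteq> 0}" .
  moreover have "pts X - {x\<in>pts X. f x = g x} = {x\<in>pts X. f x - g x \<noteq> 0}" by auto
  ultimately show ?thesis unfolding closedin_def by auto
qed

lemma closed_ball: "(\<And>i. i \<in> A \<Longrightarrow> closedin (zar X) {x\<in>pts X. P i x}) \<Longrightarrow> closedin (zar X) {x\<in>pts X. \<forall>i\<in>A. P i x}"
proof (cases "A = {}")
  case False
  assume "\<And>i. i \<in> A \<Longrightarrow> closedin (zar X) {x\<in>pts X. P i x}"
  moreover have "{x\<in>pts X. \<forall>i\<in>A. P i x} = (\<Inter>i\<in>A. {x\<in>pts X. P i x})" using False by auto
  ultimately show ?thesis using False by auto
qed simp

lemma closed_mat_eq: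
  assumes M: "regular_mat X a b M" and N: "regular_mat X a b N"
  shows "closedin (zar X) {x\<in>pts X. M x = N x}"
proof -
  have "closedin (zar X) {x\<in>pts X. \<forall>i\<in>{..<a}. \<forall>j\<in>{..<b}. M x $$ (i, j) = N x $$ (i, j)}"
    by (intro closed_ball closed_eq regular_matD(2)[OF M] regular_matD(2)[OF N]) auto
  moreover have "M x = N x \<longleftrightarrow> (\<forall>i\<in>{..<a}. \<forall>j\<in>{..<b}. M x $$ (i, j) = N x $$ (i, j))" if "x \<in> pts X" for x
    using regular_matD(1)[OF M that] regular_matD(1)[OF N that] by (auto intro!: eq_matI)
  ultimately show ?thesis by (simp cong: conj_cong)
qed

lemma closed_vec_eq:
  assumes v: "regular_vec X a v" and w: "regular_vec X a w"
  shows "closedin (zar X) {x\<in>pts X. v x = w x}"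
proof -
  have "closedin (zar X) {x\<in>pts X. \<forall>i\<in>{..<a}. v x $ i = w x $ i}"
    by (intro closed_ball closed_eq regular_vecD(2)[OF v] regular_vecD(2)[OF w]) auto
  moreover have "v x = w x \<longleftrightarrow> (\<forall>i\<in>{..<a}. v x $ i = w x $ i)" if "x \<in> pts X" for x
    using regular_vecD(1)[OF v that] regular_vecD(1)[OF w that] by (auto intro!: eq_vecI)
  ultimately show ?thesis by (simp cong: conj_cong)
qed

lemma closed_conj: "closedin (zar X) {x\<in>pts X. P x} \<Longrightarrow> closedin (zar X) {x\<in>pts X. Q x} \<Longrightarrow>
  closedin (zar X) {x\<in>pts X. P x \<and> Q x}"
proof -
  have "{x\<in>pts X. P x \<and> Q x} = {x\<in>pts X. P x} \<inter> {x\<in>pts X. Q x}" by blast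
  then show "closedin (zar X) {x\<in>pts X. P x} \<Longrightarrow> closedin (zar X) {x\<in>pts X. Q x} \<Longrightarrow> ?thesis" by (simp add: closedin_Int)
qed

end

subsection \<open>Coordinates\<close>

lemma nth_concat_uniform:
  assumes "\<And>x. x \<in> set xs \<Longrightarrow> length x = m" "i < length xs" "j < m"
  shows "concat xs ! (i * m + j) = xs ! i ! j"
  using assms
proof (induction xs arbitrary: i)
  case (Cons x xs)
  then show ?case by (cases i) (auto simp: nth_append)
qed simp

lemma length_concat_uniform:
  "(\<And>x. x \<in> set xs \<Longrightarrow> length x = m) \<Longrightarrow> length (concat xs) = length xs * m"
  by (induction xs) auto

lemma mat_coords_nth:
  assumes "A \<in> carrier_mat a b" "i < a" "j < b"
  shows "mat_coords A ! (i * b + j) = A $$ (i, j)"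
  unfolding mat_coords_def by (subst nth_concat_uniform) (use assms in \<open>auto simp: mat_to_list_def\<close>)

lemma length_mat_coords: "A \<in> carrier_mat a b \<Longrightarrow> length (mat_coords A) = a * b"
proof -
  assume A: "A \<in> carrier_mat a b"
  have "length y = b" if "y \<in> set (mat_to_list A)" for y using that A by (auto simp: mat_to_list_def)
  then have "length (concat (mat_to_list A)) = length (mat_to_list A) * b" by (rule length_concat_uniform)
  then show ?thesis using A by (simp add: mat_coords_def mat_to_list_def)
qed

lemma index_div_mod: "k < a * b \<Longrightarrow> k div b < a \<and> k mod b < b \<and> k = (k div b) * b + k mod (b::nat)"
  by (cases "b = 0") (auto simp: less_mult_imp_div_less)

lemma pts_GL_space: "pts (GL_space n) = {A \<in> carrier_mat n n. det A \<noteq> (0 :: 'k::field)}"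
  unfolding GL_space_def pts_induced pts_affine by (auto simp: length_mat_coords invertible_mat_iff_det)

lemma GL_swf: "space_with_functions (GL_space n)"
  unfolding GL_space_def by (intro induced_swf affine_swf)

lemma regular_GL_space: "regular_mat (GL_space n) n n (\<lambda>A. A :: 'k::field mat)"
  unfolding regular_mat_def
proof (intro conjI ballI allI impI)
  interpret space_with_functions "GL_space n :: ('k, _) space" by (rule GL_swf)
  fix i j assume ij: "i < n" "j < n"
  have "i * n + j < Suc i * n" using ij by simp
  also have "\<dots> \<le> n * n" using ij by (intro mult_le_mono1) simp
  finally have "(\<lambda>x. mat_coords x ! (i * n + j)) \<in> reg (GL_space n) (pts (GL_space n :: ('k, _) space))"
    unfolding GL_space_def by (intro morphism_reg[OF morphism_induced_map[OF affine_swf] coord_reg])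
  then show "(\<lambda>A. A $$ (i, j)) \<in> reg (GL_space n) (pts (GL_space n :: ('k, _) space))"
    by (rule regI) (use ij mat_coords_nth in \<open>auto simp: pts_GL_space\<close>)
qed (auto simp: pts_GL_space)

lemma morphism_GL_space:
  fixes X :: "('k::field, 'p) space"
  assumes X: "space_with_functions X" and M: "regular_mat X n n M" and d: "\<And>x. x \<in> pts X \<Longrightarrow> det (M x) \<noteq> 0"
  shows "morphism X (GL_space n) M"
  unfolding GL_space_def
proof (intro morphism_into_induced[OF X] morphism_affine[OF X])
  interpret space_with_functions X by (rule X)
  fix k assume k: "k < n * n"
  note dm = index_div_mod[OF k]
  have "(\<lambda>x. M x $$ (k div n, k mod n)) \<in> reg X (pts X)" using regular_matD(2)[OF M] dm by blast
  then show "(\<lambda>x. mat_coords (M x) ! k) \<in> reg X (pts X)"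
    by (rule regI) (use mat_coords_nth[OF regular_matD(1)[OF M], of _ "k div n" "k mod n"] dm in simp)
next
  fix x assume x: "x \<in> pts X"
  note c = regular_matD(1)[OF M x]
  show "length (mat_coords (M x)) = n * n" by (rule length_mat_coords[OF c])
  show "M x \<in> {A \<in> carrier_mat n n. invertible_mat A}" using c d[OF x] invertible_mat_iff_det[OF c] by simp
qed

lemma length_tuple_coords:
  assumes x: "x \<in> tuples n r d"
  shows "length (concat (map mat_coords (fst x))) = d * (n * n)" "length (tuple_coords x) = d * n\<^sup>2 + r * n"
proof -
  let ?A = "concat (map mat_coords (fst x))" and ?B = "concat (map list_of_vec (snd x))"
  have sub: "set (fst x) \<subseteq> carrier_mat n n" "set (snd x) \<subseteq> carrier_vec n" using x unfolding tuples_alt by auto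
  have A: "length ?A = length (map mat_coords (fst x)) * (n * n)"
    by (rule length_concat_uniform) (use sub(1) length_mat_coords[of _ n n] in auto)
  then show "length ?A = d * (n * n)" using tuplesD(1)[OF x] by simp
  moreover have "length ?B = length (map list_of_vec (snd x)) * n"
    by (rule length_concat_uniform) (use sub(2) in auto)
  ultimately show "length (tuple_coords x) = d * n\<^sup>2 + r * n"
    using tuplesD(2)[OF x] by (simp add: tuple_coords_def case_prod_beta power2_eq_square)
qed

lemma pts_tuple_space: "pts (tuple_space n r d) = (tuples n r d :: 'k::field tuple set)"
  unfolding tuple_space_def pts_induced pts_affine tuples_alt[symmetric] using length_tuple_coords(2) by blast

lemma tuple_swf: "space_with_functions (tuple_space n r d)"
  unfolding tuple_space_def by (intro induced_swf affine_swf)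

lemma tuple_coords_nth:
  assumes x: "x \<in> tuples n r d"
  shows "a < d \<Longrightarrow> i < n \<Longrightarrow> j < n \<Longrightarrow> tuple_coords x ! (a * (n * n) + (i * n + j)) = fst x ! a $$ (i, j)"
    and "l < r \<Longrightarrow> i < n \<Longrightarrow> tuple_coords x ! (d * (n * n) + (l * n + i)) = snd x ! l $ i"
proof -
  let ?A = "concat (map mat_coords (fst x))" and ?B = "concat (map list_of_vec (snd x))"
  have sub: "set (fst x) \<subseteq> carrier_mat n n" "set (snd x) \<subseteq> carrier_vec n" using x unfolding tuples_alt by auto
  have cA: "length y = n * n" if "y \<in> set (map mat_coords (fst x))" for y
    using that sub(1) length_mat_coords[of _ n n] by auto
  have cB: "length y = n" if "y \<in> set (map list_of_vec (snd x))" for y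
    using that sub(2) by auto
  note lA = length_tuple_coords(1)[OF x]
  have e: "tuple_coords x = ?A @ ?B" by (simp add: tuple_coords_def case_prod_beta)
  { assume a: "a < d" "i < n" "j < n"
    have "i * n + j < Suc i * n" using a by simp
    also have "\<dots> \<le> n * n" using a by (intro mult_le_mono1) simp
    finally have ij: "i * n + j < n * n" .
    have "a * (n * n) + (i * n + j) < Suc a * (n * n)" using ij by simp
    also have "\<dots> \<le> d * (n * n)" using a by (intro mult_le_mono1) simp
    finally have "tuple_coords x ! (a * (n * n) + (i * n + j)) = ?A ! (a * (n * n) + (i * n + j))"
      unfolding e by (simp add: nth_append lA)
    also have "?A ! (a * (n * n) + (i * n + j)) = map mat_coords (fst x) ! a ! (i * n + j)"
      by (rule nth_concat_uniform[OF _ _ ij]) (rule cA, use a tuplesD(1)[OF x] in simp_all)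
    also have "\<dots> = mat_coords (fst x ! a) ! (i * n + j)" using a tuplesD(1)[OF x] by simp
    also have "\<dots> = fst x ! a $$ (i, j)" by (rule mat_coords_nth[OF tuplesD(3)[OF x]]) (use a in auto)
    finally show "tuple_coords x ! (a * (n * n) + (i * n + j)) = fst x ! a $$ (i, j)" . }
  { assume l: "l < r" "i < n"
    have "tuple_coords x ! (d * (n * n) + (l * n + i)) = ?B ! (l * n + i)" unfolding e by (simp add: nth_append lA)
    also have "?B ! (l * n + i) = map list_of_vec (snd x) ! l ! i"
      by (rule nth_concat_uniform[OF _ _ l(2)]) (rule cB, use l tuplesD(2)[OF x] in simp_all)
    also have "\<dots> = list_of_vec (snd x ! l) ! i" using l tuplesD(2)[OF x] by simp
    also have "\<dots> = snd x ! l $ i" using tuplesD(4)[OF x l(1)] l by simp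
    finally show "tuple_coords x ! (d * (n * n) + (l * n + i)) = snd x ! l $ i" . }
qed

lemma regular_tuple_space: "regular_tuple (tuple_space n r d) n r d (\<lambda>x. x :: 'k::field tuple)"
  unfolding regular_tuple_def
proof (intro conjI ballI allI impI)
  let ?X = "tuple_space n r d :: ('k, _) space"
  interpret space_with_functions ?X by (rule tuple_swf)
  have c: "(\<lambda>x. tuple_coords x ! k) \<in> reg ?X (pts ?X)" if "k < d * n\<^sup>2 + r * n" for k
    unfolding tuple_space_def by (intro morphism_reg[OF morphism_induced_map[OF affine_swf] coord_reg] that)
  { fix a assume a: "a < d"
    show "regular_mat ?X n n (\<lambda>x. fst x ! a)" unfolding regular_mat_def
    proof (intro conjI ballI allI impI)
      fix i j assume ij: "i < n" "j < n"
      have "i * n + j < Suc i * n" using ij by simp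
      also have "\<dots> \<le> n * n" using ij by (intro mult_le_mono1) simp
      finally have "a * (n * n) + (i * n + j) < Suc a * (n * n)" by simp
      also have "\<dots> \<le> d * (n * n)" using a by (intro mult_le_mono1) simp
      finally have "a * (n * n) + (i * n + j) < d * n\<^sup>2 + r * n" by (simp add: power2_eq_square)
      from c[OF this] show "(\<lambda>x. fst x ! a $$ (i, j)) \<in> reg ?X (pts ?X)"
        by (rule regI) (use a ij tuple_coords_nth(1) in \<open>auto simp: pts_tuple_space\<close>)
    qed (use a in \<open>auto simp: pts_tuple_space tuplesD(3)\<close>) }
  { fix l assume l: "l < r"
    show "regular_vec ?X n (\<lambda>x. snd x ! l)" unfolding regular_vec_def
    proof (intro conjI ballI allI impI)
      fix i assume i: "i < n"
      have "l * n + i < Suc l * n" using i by simp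
      also have "\<dots> \<le> r * n" using l by (intro mult_le_mono1) simp
      finally have "d * (n * n) + (l * n + i) < d * n\<^sup>2 + r * n" by (simp add: power2_eq_square)
      from c[OF this] show "(\<lambda>x. snd x ! l $ i) \<in> reg ?X (pts ?X)"
        by (rule regI) (use l i tuple_coords_nth(2) in \<open>auto simp: pts_tuple_space\<close>)
    qed (use l in \<open>auto simp: pts_tuple_space tuplesD(4)\<close>) }
qed (auto simp: pts_tuple_space)

lemma morphism_tuple_space:
  fixes X :: "('k::field, 'p) space"
  assumes X: "space_with_functions X" and t: "regular_tuple X n r d t"
  shows "morphism X (tuple_space n r d) t"
  unfolding tuple_space_def
proof (intro morphism_into_induced[OF X] morphism_affine[OF X])
  interpret space_with_functions X by (rule X)
  note tt = regular_tupleD(1)[OF t]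
  show "length (tuple_coords (t x)) = d * n\<^sup>2 + r * n" if "x \<in> pts X" for x
    by (rule length_tuple_coords(2)[OF tt[OF that]])
  fix k assume k: "k < d * n\<^sup>2 + r * n"
  show "(\<lambda>x. tuple_coords (t x) ! k) \<in> reg X (pts X)"
  proof (cases "k < d * (n * n)")
    case True
    note dm = index_div_mod[OF True]
    define a i j where "a = k div (n * n)" and "i = k mod (n * n) div n" and "j = k mod (n * n) mod n"
    have ij: "i < n \<and> j < n \<and> k mod (n * n) = i * n + j" unfolding i_def j_def using index_div_mod[of "k mod (n * n)" n n] dm by blast
    then have kk: "k = a * (n * n) + (i * n + j)" using dm a_def by simp
    have a: "a < d" using dm a_def by simp
    from regular_matD(2)[OF regular_tupleD(2)[OF t a], of i j] ij
    have "(\<lambda>x. fst (t x) ! a $$ (i, j)) \<in> reg X (pts X)" by blast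
    then show ?thesis by (rule regI) (use tuple_coords_nth(1)[OF tt a] ij kk in auto)
  next
    case False
    then have "k - d * (n * n) < r * n" using k by (simp add: power2_eq_square)
    note dm = index_div_mod[OF this]
    define l i where "l = (k - d * (n * n)) div n" and "i = (k - d * (n * n)) mod n"
    have kk: "k = d * (n * n) + (l * n + i)" and l: "l < r" and i: "i < n" using False dm l_def i_def by auto
    have "(\<lambda>x. snd (t x) ! l $ i) \<in> reg X (pts X)" by (rule regular_vecD(2)[OF regular_tupleD(3)[OF t l] i])
    then show ?thesis by (rule regI) (use tuple_coords_nth(2)[OF tt l i] kk in auto)
  qed
qed (use regular_tupleD(1)[OF t] in \<open>auto simp: tuples_alt\<close>)

text \<open>With injective coordinates the point set is a relabelling of its image, a locally closed
  subset of affine space.\<close>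

lemma variety_affine_induced:
  fixes \<phi> :: "'p \<Rightarrow> 'k::field list"
  assumes inj: "inj_on \<phi> P" and L: "locally_closed (affine_space N) (\<phi> ` P)"
  shows "variety (induced_space \<phi> P (affine_space N))"
proof -
  let ?A = "sub_space (affine_space N) (\<phi> ` P)" and ?I = "induced_space \<phi> P (affine_space N)"
  have PA: "\<phi> ` P \<subseteq> pts (affine_space N)" by (rule locally_closed_subset[OF L])
  have sI: "space_with_functions ?I" and sA: "space_with_functions ?A" by (intro induced_swf affine_swf)+
  have "iso_spaces ?A ?I"
  proof (rule iso_spacesI[of _ _ "inv_into P \<phi>" \<phi>])
    show "morphism ?I ?A \<phi>" by (rule morphism_into_sub[OF sI morphism_induced_map[OF affine_swf]]) (auto simp: pts_induced)
    have "morphism ?A (affine_space N) (\<lambda>x. \<phi> (inv_into P \<phi> x))"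
      by (rule morphism_cong[OF sA morphism_inclusion[OF affine_swf]]) (auto simp: pts_sub f_inv_into_f)
    then show "morphism ?A ?I (inv_into P \<phi>)"
      by (rule morphism_into_induced[OF sA]) (auto simp: pts_sub inv_into_into)
  qed (use inj in \<open>auto simp: pts_induced f_inv_into_f\<close>)
  then show ?thesis using variety_iso[OF variety_locally_closed[OF variety_affine_space L] sI] by simp
qed

lemma list_nth_mat: "mat_coords (mat a b (\<lambda>(i, j). xs ! (i * b + j))) = xs" if "length xs = a * b" for xs :: "'a list"
proof (rule nth_equalityI)
  let ?M = "mat a b (\<lambda>(i, j). xs ! (i * b + j))"
  show "length (mat_coords ?M) = length xs" using that length_mat_coords[of ?M a b] by simp
  fix k assume "k < length (mat_coords ?M)"
  then have "k < a * b" using length_mat_coords[of ?M a b] by simp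
  note dm = index_div_mod[OF this]
  then show "mat_coords ?M ! k = xs ! k"
    using mat_coords_nth[of ?M a b "k div b" "k mod b"] by simp
qed

lemma variety_GL: "variety (GL_space n :: ('k::field, _) space)"
  unfolding GL_space_def
proof (rule variety_affine_induced)
  let ?P = "{A \<in> carrier_mat n n. invertible_mat A} :: 'k mat set"
  show "inj_on mat_coords ?P"
  proof (rule inj_onI)
    fix A B :: "'k mat" assume A: "A \<in> ?P" and B: "B \<in> ?P" and eq: "mat_coords A = mat_coords B"
    show "A = B"
      by (rule eq_matI) (use A B mat_coords_nth[of A n n] mat_coords_nth[of B n n] eq in auto)
  qed
  define M where "M = (\<lambda>xs :: 'k list. mat n n (\<lambda>(i, j). xs ! (i * n + j)))"
  interpret A: space_with_functions "affine_space (n * n) :: ('k, _) space" by (rule affine_swf)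
  have "regular_mat (affine_space (n * n)) n n M" unfolding M_def
  proof (intro A.regular_mat_mat coord_reg)
    fix i j assume ij: "i < n" "j < n"
    have "i * n + j < Suc i * n" using ij by simp
    also have "\<dots> \<le> n * n" using ij by (intro mult_le_mono1) simp
    finally show "i * n + j < n * n" .
  qed
  from A.open_nonzero[OF A.regular_det[OF this]]
  have o: "openin (zar (affine_space (n * n))) {xs\<in>pts (affine_space (n * n)). det (M xs) \<noteq> 0}" .
  have "mat_coords ` ?P = {xs\<in>pts (affine_space (n * n)). det (M xs) \<noteq> 0}"
  proof (intro Set.set_eqI iffI)
    fix xs assume "xs \<in> mat_coords ` ?P"
    then obtain A where A: "A \<in> carrier_mat n n" "invertible_mat A" "xs = mat_coords A" by blast
    have "M xs = A" unfolding M_def A(3) by (rule eq_matI) (use A mat_coords_nth[OF A(1)] in auto)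
    then show "xs \<in> {xs\<in>pts (affine_space (n * n)). det (M xs) \<noteq> 0}"
      using A length_mat_coords[OF A(1)] invertible_mat_iff_det[OF A(1)] by (simp add: pts_affine)
  next
    fix xs :: "'k list" assume xs: "xs \<in> {xs\<in>pts (affine_space (n * n)). det (M xs) \<noteq> 0}"
    have c: "M xs \<in> carrier_mat n n" by (simp add: M_def)
    show "xs \<in> mat_coords ` ?P"
      using xs list_nth_mat[of xs n n] invertible_mat_iff_det[OF c] c
      by (intro image_eqI[of _ _ "M xs"]) (auto simp: M_def pts_affine)
  qed
  then show "locally_closed (affine_space (n * n)) (mat_coords ` ?P)" using locally_closed_open[OF o] by simp
qed

lemma tuple_space_affine: "iso_spaces (tuple_space n r d) (affine_space (d * n\<^sup>2 + r * n) :: ('k::field, _) space)"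
proof -
  let ?N = "d * n\<^sup>2 + r * n"
  let ?A = "affine_space ?N :: ('k, _) space"
  \<comment> \<open>The inverse of \<open>tuple_coords\<close>: the matrices row by row, followed by
    the vectors.\<close>
  define t :: "'k list \<Rightarrow> 'k tuple" where "t xs = (map (\<lambda>a. mat n n (\<lambda>(i, j). xs ! (a * (n * n) + (i * n + j)))) [0..<d],
    map (\<lambda>l. vec n (\<lambda>i. xs ! (d * (n * n) + (l * n + i)))) [0..<r])" for xs
  have b1: "a * (n * n) + (i * n + j) < ?N" if "a < d" "i < n" "j < n" for a i j
  proof -
    have "i * n + j < Suc i * n" using that by simp
    also have "\<dots> \<le> n * n" using that by (intro mult_le_mono1) simp
    finally have "a * (n * n) + (i * n + j) < Suc a * (n * n)" by simp
    also have "\<dots> \<le> d * (n * n)" using that by (intro mult_le_mono1) simp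
    finally show ?thesis by (simp add: power2_eq_square)
  qed
  have b2: "d * (n * n) + (l * n + i) < ?N" if "l < r" "i < n" for l i
  proof -
    have "l * n + i < Suc l * n" using that by simp
    also have "\<dots> \<le> r * n" using that by (intro mult_le_mono1) simp
    finally show ?thesis by (simp add: power2_eq_square)
  qed
  interpret A: space_with_functions ?A by (rule affine_swf)
  have tt: "t xs \<in> tuples n r d" for xs by (auto simp: t_def tuples_def)
  have "regular_tuple ?A n r d t" unfolding regular_tuple_def
  proof (intro conjI ballI allI impI tt)
    fix a assume a: "a < d"
    have "regular_mat ?A n n (\<lambda>xs. mat n n (\<lambda>(i, j). xs ! (a * (n * n) + (i * n + j))))"
      by (intro A.regular_mat_mat coord_reg b1 a)
    then show "regular_mat ?A n n (\<lambda>xs. fst (t xs) ! a)" using a by (simp add: t_def)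
  next
    fix l assume l: "l < r"
    have "regular_vec ?A n (\<lambda>xs. vec n (\<lambda>i. xs ! (d * (n * n) + (l * n + i))))"
      by (intro A.regular_vec_vec coord_reg b2 l)
    then show "regular_vec ?A n (\<lambda>xs. snd (t xs) ! l)" using l by (simp add: t_def)
  qed
  then have m: "morphism ?A (tuple_space n r d) t" by (rule morphism_tuple_space[OF affine_swf])
  have m': "morphism (tuple_space n r d) ?A tuple_coords"
    unfolding tuple_space_def by (rule morphism_induced_map[OF affine_swf])
  show ?thesis
  proof (rule iso_spacesI[OF m' m])
    fix x :: "'k tuple" assume "x \<in> pts (tuple_space n r d)"
    then have x: "x \<in> tuples n r d" by (simp add: pts_tuple_space)
    show "t (tuple_coords x) = x"
    proof (rule tuple_eqI[OF tt x])
      fix a assume a: "a < d"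
      show "fst (t (tuple_coords x)) ! a = fst x ! a"
        by (rule eq_matI) (use a tuplesD(3)[OF x a] tuple_coords_nth(1)[OF x a] in \<open>auto simp: t_def\<close>)
    next
      fix l assume l: "l < r"
      show "snd (t (tuple_coords x)) ! l = snd x ! l"
        by (rule eq_vecI) (use l tuplesD(4)[OF x l] tuple_coords_nth(2)[OF x l] in \<open>auto simp: t_def\<close>)
    qed
  next
    fix xs :: "'k list" assume "xs \<in> pts ?A"
    then have len: "length xs = ?N" by (simp add: pts_affine)
    have len': "length (tuple_coords (t xs)) = ?N" by (rule length_tuple_coords(2)[OF tt])
    show "tuple_coords (t xs) = xs"
    proof (rule nth_equalityI)
      fix k assume "k < length (tuple_coords (t xs))"
      then have k: "k < ?N" using len' by simp
      show "tuple_coords (t xs) ! k = xs ! k"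
      proof (cases "k < d * (n * n)")
        case True
        note dm = index_div_mod[OF True]
        define a i j where "a = k div (n * n)" and "i = k mod (n * n) div n" and "j = k mod (n * n) mod n"
        have ij: "i < n \<and> j < n \<and> k mod (n * n) = i * n + j" unfolding i_def j_def using index_div_mod[of "k mod (n * n)" n n] dm by blast
        then have kk: "k = a * (n * n) + (i * n + j)" using dm a_def by simp
        have a: "a < d" using dm a_def by simp
        show ?thesis unfolding kk using tuple_coords_nth(1)[OF tt a, of i j xs] ij a by (simp add: t_def)
      next
        case False
        then have "k - d * (n * n) < r * n" using k by (simp add: power2_eq_square)
        note dm = index_div_mod[OF this]
        define l i where "l = (k - d * (n * n)) div n" and "i = (k - d * (n * n)) mod n"
        have kk: "k = d * (n * n) + (l * n + i)" and l: "l < r" and i: "i < n" using False dm l_def i_def by auto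
        show ?thesis unfolding kk using tuple_coords_nth(2)[OF tt l i, of xs] l i by (simp add: t_def)
      qed
    qed (simp add: len len')
  qed
qed

lemma variety_tuple: "variety (tuple_space n r d :: ('k::field, _) space)"
  by (rule variety_iso[OF variety_affine_space tuple_swf iso_spaces_sym[OF tuple_space_affine]])

text \<open>\<open>W i\<close> is where the polynomials of some set \<open>S i\<close> do not all
  vanish. By the Hilbert basis theorem finitely many members of these sets generate the ideal of all
  of them, and one index for each generator suffices. The charts below are indexed by words and
  matrices, hence the need to pass to a finite subfamily.\<close>

lemma tuple_space_quasi_compact:
  fixes W :: "'i \<Rightarrow> 'k::field tuple set"
  assumes W: "\<And>i. i \<in> I \<Longrightarrow> openin (zar (tuple_space n r d)) (W i)"
  shows "\<exists>N\<subseteq>I. finite N \<and> (\<Union>i\<in>N. W i) = (\<Union>i\<in>I. W i)"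
proof -
  let ?M = "d * n\<^sup>2 + r * n"
  have "\<exists>S. S \<subseteq> polyfun ?M \<and> W i = {x \<in> tuples n r d. \<exists>f\<in>S. f (tuple_coords x) \<noteq> 0}" if i: "i \<in> I" for i
  proof -
    obtain G where G: "openin (zar (affine_space ?M)) G" "W i = {x \<in> tuples n r d. tuple_coords x \<in> G}"
      using W[OF i] unfolding tuple_space_def openin_induced tuples_alt[symmetric] by blast
    then obtain S where S: "S \<subseteq> polyfun ?M" "G = {x. length x = ?M \<and> (\<exists>f\<in>S. f x \<noteq> 0)}" unfolding openin_affine by blast
    show ?thesis by (rule exI[of _ S]) (use G S length_tuple_coords(2) in auto)
  qed
  then have "\<forall>i\<in>I. \<exists>S. S \<subseteq> polyfun ?M \<and> W i = {x \<in> tuples n r d. \<exists>f\<in>S. f (tuple_coords x) \<noteq> 0}" by blast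
  from bchoice[OF this] obtain S where S': "\<forall>i\<in>I. S i \<subseteq> polyfun ?M \<and> W i = {x \<in> tuples n r d. \<exists>f\<in>S i. f (tuple_coords x) \<noteq> 0}" ..
  note S = bspec[OF S']
  have "(\<Union>i\<in>I. S i) \<subseteq> polyfun ?M" using S by blast
  from polyfun_noetherian[OF this] obtain T where T: "T \<subseteq> (\<Union>i\<in>I. S i)" "finite T" "(\<Union>i\<in>I. S i) \<subseteq> pideal ?M T" by blast
  have "\<forall>f\<in>T. \<exists>i. i \<in> I \<and> f \<in> S i" using T(1) by blast
  from bchoice[OF this] obtain c where c': "\<forall>f\<in>T. c f \<in> I \<and> f \<in> S (c f)" ..
  note c = bspec[OF c']
  have z: "f x = 0" if "f \<in> pideal ?M T" "\<forall>t\<in>T. t x = 0" for f x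
    using that by induction auto
  have "(\<Union>i\<in>I. W i) \<subseteq> (\<Union>i\<in>c ` T. W i)"
  proof
    fix x assume "x \<in> (\<Union>i\<in>I. W i)"
    then obtain i where i0: "i \<in> I" "x \<in> W i" by blast
    then obtain f where i: "i \<in> I" "f \<in> S i" "f (tuple_coords x) \<noteq> 0" and x: "x \<in> tuples n r d" using S[OF i0(1)] by blast
    then have "f \<in> pideal ?M T" using T(3) by blast
    then obtain t where t: "t \<in> T" "t (tuple_coords x) \<noteq> 0" using z[of f "tuple_coords x"] i(3) by blast
    then have "x \<in> W (c t)" using S[OF conjunct1[OF c[OF t(1)]]] c[OF t(1)] x t by blast
    then show "x \<in> (\<Union>i\<in>c ` T. W i)" using t by blast
  qed
  then show ?thesis using T(2) c by (intro exI[of _ "c ` T"]) blast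
qed

section \<open>The noncommutative Quot scheme\<close>

text \<open>Open sets of \<open>X\<close> consist of points of \<open>X\<close>, so the remainder of
  \<open>A\<close> is invisible to the induced structure. The result is an equality of spaces, not
  just an isomorphism.\<close>

lemma sub_space_cong: "A \<inter> pts X = B \<inter> pts X \<Longrightarrow> sub_space X A = sub_space X B"
proof -
  assume eq: "A \<inter> pts X = B \<inter> pts X"
  have "(\<exists>U. openin (zar X) U \<and> S = (\<lambda>x. x) -` U \<inter> A) \<longleftrightarrow> (\<exists>U. openin (zar X) U \<and> S = (\<lambda>x. x) -` U \<inter> B)" for S
  proof -
    have "(\<lambda>x. x) -` U \<inter> A = (\<lambda>x. x) -` U \<inter> B" if "openin (zar X) U" for U
      using eq openin_subset[OF that] by auto
    then show ?thesis by metis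
  qed
  then have "pullback_topology A (\<lambda>x. x) (zar X) = pullback_topology B (\<lambda>x. x) (zar X)"
    unfolding pullback_topology_def by simp
  then show ?thesis unfolding induced_space_def by simp
qed

lemma stable_space_alt: "stable_space n r d = sub_space (tuple_space n r d) (stable_tuples n r d)"
  unfolding stable_space_def
proof (rule sub_space_cong)
  show "{(Ts, vs). vspan n {M *\<^sub>v v |M v. M \<in> monomials n Ts \<and> v \<in> set vs} = carrier_vec n} \<inter> pts (tuple_space n r d)
    = stable_tuples n r d \<inter> pts (tuple_space n r d :: ('a, _) space)"
  proof (intro Set.set_eqI)
    fix x :: "'a tuple"
    show "x \<in> {(Ts, vs). vspan n {M *\<^sub>v v |M v. M \<in> monomials n Ts \<and> v \<in> set vs} = carrier_vec n} \<inter> pts (tuple_space n r d)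
      \<longleftrightarrow> x \<in> stable_tuples n r d \<inter> pts (tuple_space n r d :: ('a, _) space)"
      using monomials_words[of x n r d] span_words_iff[of x n r d] unfolding pts_tuple_space by (cases x) auto
  qed
qed

text \<open>The condition says that the top \<open>k\<close> rows of \<open>h\<close> times the word
  matrix form an invertible block. Letting \<open>h\<close> run through all invertible matrices
  replaces the choice of a nonzero minor and keeps the invertible block at a fixed place.\<close>

definition chart :: "nat \<Rightarrow> nat \<Rightarrow> nat \<Rightarrow> nat \<Rightarrow> (nat list \<times> nat) list \<times> 'k::field mat \<Rightarrow> 'k tuple set" where
  "chart n r d k = (\<lambda>(\<nu>, h). {x \<in> tuples n r d. det ((incl_mat n k)\<^sup>T * (h * word_mat n x \<nu>)) \<noteq> 0})"

definition chart_index :: "nat \<Rightarrow> nat \<Rightarrow> nat \<Rightarrow> nat \<Rightarrow> ((nat list \<times> nat) list \<times> 'k::field mat) set" where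
  "chart_index n r d k = word_lists r d k \<times> {h \<in> carrier_mat n n. det h \<noteq> 0}"

lemma rank_ge_charts:
  assumes "k \<le> n"
  shows "rank_ge n r d k = (\<Union>i\<in>chart_index n r d k. chart n r d k i)"
proof (intro Set.set_eqI iffI)
  fix x :: "'a tuple" assume "x \<in> rank_ge n r d k"
  then obtain \<nu> where x: "x \<in> tuples n r d" and \<nu>: "\<nu> \<in> word_lists r d k" "mat_injective (word_mat n x \<nu>)" by (auto simp: rank_ge_def)
  obtain P where P: "P \<in> carrier_mat n n" "det P \<noteq> 0" "P * word_mat n x \<nu> = incl_mat n k"
    using injective_normal_form[OF word_mat_carrier[OF \<nu>(1)] \<nu>(2)] by blast
  \<comment> \<open>With \<open>h = P\<close> the top block is the identity.\<close>
  have "(incl_mat n k)\<^sup>T * incl_mat n k = (1\<^sub>m k :: 'a mat)" by (rule transpose_incl_incl[OF assms])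
  then have "x \<in> chart n r d k (\<nu>, P)" using x P by (simp add: chart_def)
  then show "x \<in> (\<Union>i\<in>chart_index n r d k. chart n r d k i)" using P \<nu>(1) unfolding chart_index_def by blast
next
  fix x :: "'a tuple" assume "x \<in> (\<Union>i\<in>chart_index n r d k. chart n r d k i)"
  then obtain \<nu> h where x: "x \<in> tuples n r d" and \<nu>: "\<nu> \<in> word_lists r d k" and h: "h \<in> carrier_mat n n"
    and d: "det ((incl_mat n k)\<^sup>T * (h * word_mat n x \<nu>)) \<noteq> 0" unfolding chart_index_def chart_def by auto
  have "mat_injective (h * word_mat n x \<nu>)"
    by (rule left_inverse_injective[OF _ _ d]) (use h word_mat_carrier[OF \<nu>, of n x] in auto)
  then have "mat_injective (word_mat n x \<nu>)" using mat_injective_factor[OF h word_mat_carrier[OF \<nu>]] by blast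
  then show "x \<in> rank_ge n r d k" using x \<nu> by (auto simp: rank_ge_def)
qed

lemma open_chart:
  assumes "i \<in> chart_index n r d k"
  shows "openin (zar (tuple_space n r d)) (chart n r d k i :: 'k::field tuple set)"
proof -
  interpret space_with_functions "tuple_space n r d :: ('k, _) space" by (rule tuple_swf)
  obtain \<nu> h where i: "i = (\<nu>, h)" and \<nu>: "\<nu> \<in> word_lists r d k" and h: "h \<in> carrier_mat n n"
    using assms unfolding chart_index_def by auto
  have "regular_mat (tuple_space n r d) k k (\<lambda>x :: 'k tuple. (incl_mat n k)\<^sup>T * (h * word_mat n x \<nu>))"
    by (intro regular_mat_mult[of _ n] regular_mat_const regular_word_mat[OF regular_tuple_space \<nu>] h) simp
  from open_nonzero[OF regular_det[OF this]] show ?thesis unfolding i chart_def pts_tuple_space prod.case .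
qed

lemma open_rank_ge: "openin (zar (tuple_space n r d)) (rank_ge n r d k :: 'k::field tuple set)"
proof (cases "k \<le> n")
  case True
  show ?thesis unfolding rank_ge_charts[OF True] by (intro openin_Union ballI) (auto intro: open_chart)
next
  case False
  then have "rank_ge n r d k = ({} :: 'k tuple set)" by (intro rank_ge_Suc_dim) simp
  then show ?thesis by simp
qed

lemma open_rank_ge_alt: "openin (zar (tuple_space n r d)) {x \<in> tuples n r d. det (word_mat n x \<nu>) \<noteq> (0 :: 'k::field)}"
  if "\<nu> \<in> word_lists r d n"
proof -
  interpret space_with_functions "tuple_space n r d :: ('k, _) space" by (rule tuple_swf)
  from open_nonzero[OF regular_det[OF regular_word_mat[OF regular_tuple_space that]]]
  show ?thesis unfolding pts_tuple_space .
qed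

lemma variety_stable: "variety (stable_space n r d :: ('k::field, _) space)"
  unfolding stable_space_alt by (intro variety_open variety_tuple open_rank_ge)

lemma pts_stable: "pts (stable_space n r d) = stable_tuples n r d"
  unfolding stable_space_alt pts_sub pts_tuple_space using rank_ge_subset by blast

lemma morphism_stable_tuple: "morphism (stable_space n r d) (tuple_space n r d) (\<lambda>x. x)"
  unfolding stable_space_alt by (rule morphism_inclusion[OF tuple_swf])

lemma regular_stable: "regular_tuple (stable_space n r d) n r d (\<lambda>x. x)"
  by (rule regular_tuple_compose[OF regular_tuple_space morphism_stable_tuple])

lemma morphism_stable:
  assumes "space_with_functions X" "regular_tuple X n r d t" "\<And>x. x \<in> pts X \<Longrightarrow> t x \<in> stable_tuples n r d"
  shows "morphism X (stable_space n r d) t"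
  unfolding stable_space_alt by (intro morphism_into_sub morphism_tuple_space assms)

text \<open>Where the word matrix \<open>W\<close> of \<open>n\<close> words is invertible, it is a
  basis attached to the tuple, and it transforms by \<open>W (g x) = g * W x\<close>. Hence the
  inverse of \<open>W\<close> moves \<open>x\<close> to the only tuple in its orbit with
  \<open>W = 1\<close>, and \<open>W\<close> is the group element leading back to \<open>x\<close>.
  These are the \<open>\<sigma>\<close> and \<open>\<gamma>\<close> of the torsor.\<close>

lemma ncQuot_facts:
  "variety (ncQuot n r d :: ('k::alg_closed_field, _) space)"
  "var_class (stable_space n r d :: ('k, _) space) = var_class (GL_space n :: ('k, _) space) * var_class (ncQuot n r d :: ('k, _) space)"
proof -
  let ?X = "stable_space n r d :: ('k, _) space"
  let ?W = "\<lambda>x :: 'k tuple. word_mat n x"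
  define U where "U \<nu> = {x \<in> tuples n r d. det (?W x \<nu>) \<noteq> 0}" for \<nu>
  have oU: "openin (zar (tuple_space n r d)) (U \<nu>)" if "\<nu> \<in> word_lists r d n" for \<nu>
    unfolding U_def by (rule open_rank_ge_alt[OF that])
  obtain N where N: "N \<subseteq> word_lists r d n" "finite N" "(\<Union>\<nu>\<in>N. U \<nu>) = (\<Union>\<nu>\<in>word_lists r d n. U \<nu>)"
    using tuple_space_quasi_compact[of "word_lists r d n" n r d U] oU by blast
  note NW = N(1)
  have st: "stable_tuples n r d = (\<Union>\<nu>\<in>word_lists r d n. U \<nu>)"
    unfolding U_def by (auto simp: stable_tuples_det)
  note sX = variety_swf[OF variety_stable, of n r d]
  note Ut = rank_ge_subset[of n r d n]
  have in_orbit: "\<exists>g. g \<in> carrier_mat n n \<and> det g \<noteq> 0 \<and> y = act g x"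
    if "x \<in> tuples n r d" "y \<in> tuples n r d" "GL_orbit n x = GL_orbit n y" for x y :: "'k tuple"
    using that GL_orbit_eq_iff by blast
  have US: "U \<nu> \<subseteq> stable_tuples n r d" if "\<nu> \<in> N" for \<nu> using that st N by blast
  have act\<sigma>: "act (?W x \<nu>) (act (mat_inv (?W x \<nu>)) x) = x" if "\<nu> \<in> N" "x \<in> U \<nu>" for \<nu> x
    by (rule act_inverse(2)[of _ n x r d]) (use that N word_mat_carrier[of \<nu> r d n n x] in \<open>auto simp: U_def\<close>)
  have inv: "mat_inv (?W x \<nu>) \<in> carrier_mat n n" "det (mat_inv (?W x \<nu>)) \<noteq> 0" if "\<nu> \<in> N" "x \<in> U \<nu>" for \<nu> x
    using that N(1) mat_inv(1)[OF word_mat_carrier, of \<nu> r d n x] det_mat_inv[OF word_mat_carrier, of \<nu> r d n x]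
    by (auto simp: U_def)
  interpret local_sections ?X "GL_orbit n" N U "\<lambda>\<nu> x. act (mat_inv (?W x \<nu>)) x"
  proof
    show "variety ?X" by (rule variety_stable)
    show "finite N" by fact
    show "pts ?X = (\<Union>i\<in>N. U i)" unfolding pts_stable using N st by simp
    fix \<nu> assume \<nu>: "\<nu> \<in> N"
    then have \<nu>': "\<nu> \<in> word_lists r d n" using N by blast
    show oX: "openin (zar ?X) (U \<nu>)"
      unfolding stable_space_alt by (subst sub_space_open_openin[OF open_rank_ge US[OF \<nu>]]) (rule oU[OF \<nu>'])
    let ?Y = "sub_space ?X (U \<nu>)"
    have sY: "space_with_functions ?Y" by (rule induced_swf[OF sX])
    have pY: "pts ?Y = U \<nu>" unfolding pts_sub pts_stable using US[OF \<nu>] by blast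
    have tY: "regular_tuple ?Y n r d (\<lambda>x. x)"
      by (rule regular_tuple_compose[OF regular_stable morphism_inclusion[OF sX]])
    have WY: "regular_mat ?Y n n (\<lambda>x. mat_inv (?W x \<nu>))"
      by (intro space_with_functions.regular_mat_inv[OF sY] space_with_functions.regular_word_mat[OF sY tY \<nu>'])
        (use pY in \<open>auto simp: U_def\<close>)
    show "morphism ?Y ?X (\<lambda>x. act (mat_inv (?W x \<nu>)) x)"
      by (intro morphism_stable[OF sY] space_with_functions.regular_act[OF sY WY _ tY] stable_act)
        (use inv[OF \<nu>] US[OF \<nu>] pY in auto)
    fix x assume x: "x \<in> U \<nu>"
    then have xt: "x \<in> tuples n r d" by (simp add: U_def)
    show "GL_orbit n (act (mat_inv (?W x \<nu>)) x) = GL_orbit n x"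
      by (rule GL_orbit_eq_iff[THEN iffD2, symmetric, OF xt act_carrier[OF inv(1)[OF \<nu> x] xt]]) (use inv[OF \<nu> x] in blast)
    { fix y assume y: "y \<in> pts ?X" "GL_orbit n x = GL_orbit n y"
      then have yt: "y \<in> tuples n r d" using Ut pts_stable by blast
      obtain g where g: "g \<in> carrier_mat n n" "det g \<noteq> 0" "y = act g x" using in_orbit[OF xt yt y(2)] by blast
      have "?W y \<nu> = g * ?W x \<nu>" unfolding g(3) by (rule word_mat_act[OF g(1,2) xt \<nu>'])
      then show "y \<in> U \<nu>" using det_mult[OF g(1) word_mat_carrier[OF \<nu>']] g(2) x yt by (auto simp: U_def) }
    { fix y assume y: "y \<in> U \<nu>" "GL_orbit n x = GL_orbit n y"
      then have yt: "y \<in> tuples n r d" by (simp add: U_def)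
      obtain g where g: "g \<in> carrier_mat n n" "det g \<noteq> 0" "y = act g x" using in_orbit[OF xt yt y(2)] by blast
      have W: "?W y \<nu> = g * ?W x \<nu>" unfolding g(3) by (rule word_mat_act[OF g(1,2) xt \<nu>'])
      note cx = word_mat_carrier[OF \<nu>', of n x] and cy = word_mat_carrier[OF \<nu>', of n y]
      have dy: "det (?W y \<nu>) \<noteq> 0" using y by (simp add: U_def)
      \<comment> \<open>The inverses of the two word matrices differ by \<open>g\<close> as well, so
        \<open>x\<close> and \<open>y\<close> have the same normal form.\<close>
      have "mat_inv (?W y \<nu>) * g * ?W x \<nu> = 1\<^sub>m n"
        using assoc_mult_mat[OF mat_inv(1)[OF cy] g(1) cx] W mat_inv(3)[OF cy dy] by simp
      then have "mat_inv (?W x \<nu>) = mat_inv (?W y \<nu>) * g"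
        by (intro mat_inv_unique[OF cx] mat_mult_left_right_inverse[OF _ cx]) (use mat_inv(1)[OF cy] g(1) in auto)
      then show "act (mat_inv (?W x \<nu>)) x = act (mat_inv (?W y \<nu>)) y"
        using act_mult[OF mat_inv(1)[OF cy] det_mat_inv[OF cy dy] g(1,2) xt] g(3) by simp }
  next
    fix \<nu> assume \<nu>: "\<nu> \<in> N"
    then have \<nu>': "\<nu> \<in> word_lists r d n" using N by blast
    let ?Y = "sub_space ?X (U \<nu>)"
    have sY: "space_with_functions ?Y" by (rule induced_swf[OF sX])
    have pY: "pts ?Y = U \<nu>" unfolding pts_sub pts_stable using US[OF \<nu>] by blast
    interpret YX: two_spaces ?Y ?X using sX sY by (simp add: two_spaces_def)
    let ?Z = "prod_space ?Y ?X"
    interpret Z: space_with_functions ?Z by (rule YX.prod_swf)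
    have pZ: "pts ?Z = U \<nu> \<times> stable_tuples n r d" unfolding YX.pts_prod pY pts_stable ..
    have t1: "regular_tuple ?Z n r d (\<lambda>z. fst z)"
      by (rule regular_tuple_compose[OF regular_stable morphism_compose[OF YX.morphism_fst morphism_inclusion[OF sX]]])
    have t2: "regular_tuple ?Z n r d (\<lambda>z. snd z)"
      by (rule regular_tuple_compose[OF regular_stable YX.morphism_snd])
    \<comment> \<open>The only matrix that can intertwine the two tuples, since it has to carry one
      word matrix to the other. Lying in the same orbit thereby becomes a system of regular
      equations.\<close>
    define g where "g z = ?W (snd z) \<nu> * mat_inv (?W (fst z) \<nu>)" for z :: "'k tuple \<times> 'k tuple"
    have rg: "regular_mat ?Z n n g" unfolding g_def
      by (intro Z.regular_mat_mult[of _ n] Z.regular_mat_inv Z.regular_word_mat[OF t1 \<nu>'] Z.regular_word_mat[OF t2 \<nu>'])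
        (use pZ in \<open>auto simp: U_def\<close>)
    have "closedin (zar ?Z) {z\<in>pts ?Z. (\<forall>a\<in>{..<d}. fst (snd z) ! a * g z = g z * fst (fst z) ! a) \<and>
        (\<forall>j\<in>{..<r}. snd (snd z) ! j = g z *\<^sub>v snd (fst z) ! j)}"
      by (intro Z.closed_conj Z.closed_ball Z.closed_mat_eq[of n n] Z.closed_vec_eq[of n] Z.regular_mat_mult[of _ n]
          Z.regular_mat_mult_vec[of _ n] rg regular_tupleD[OF t1] regular_tupleD[OF t2]) auto
    moreover have "(\<forall>a\<in>{..<d}. fst (snd z) ! a * g z = g z * fst (fst z) ! a) \<and> (\<forall>j\<in>{..<r}. snd (snd z) ! j = g z *\<^sub>v snd (fst z) ! j)
        \<longleftrightarrow> GL_orbit n (fst z) = GL_orbit n (snd z)" if z: "z \<in> U \<nu> \<times> stable_tuples n r d" for z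
    proof -
      obtain x y where xy: "z = (x, y)" "x \<in> U \<nu>" "y \<in> stable_tuples n r d" using z by blast
      have xt: "x \<in> tuples n r d" and yt: "y \<in> tuples n r d" using xy Ut by (auto simp: U_def)
      have dx: "det (?W x \<nu>) \<noteq> 0" using xy by (simp add: U_def)
      note cx = word_mat_carrier[OF \<nu>', of n x] and cy = word_mat_carrier[OF \<nu>', of n y]
      have gc: "g z \<in> carrier_mat n n" using mat_inv(1)[OF cx] cy by (simp add: g_def xy)
      have "intertwines r d (g z) x y \<longleftrightarrow> GL_orbit n x = GL_orbit n y"
      proof
        assume i: "intertwines r d (g z) x y"
        \<comment> \<open>The intertwiner is automatically invertible: some word list
          \<open>\<mu>\<close>, in general different from \<open>\<nu>\<close>, has an invertible
          word matrix at the stable tuple \<open>y\<close>, and that matrix has \<open>g z\<close>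
          as a factor.\<close>
        obtain \<mu> where \<mu>: "\<mu> \<in> word_lists r d n" "det (?W y \<mu>) \<noteq> 0" using xy(3) unfolding stable_tuples_det by blast
        have "det (g z) \<noteq> 0"
          using word_mat_intertwines[OF yt xt gc i \<mu>(1)] \<mu>(2) det_mult[OF gc word_mat_carrier[OF \<mu>(1)]] by auto
        then show "GL_orbit n x = GL_orbit n y"
          unfolding GL_orbit_eq_iff[OF xt yt] using act_unique[OF gc _ yt xt i] gc by blast
      next
        assume "GL_orbit n x = GL_orbit n y"
        then obtain h where h: "h \<in> carrier_mat n n" "det h \<noteq> 0" "y = act h x" using in_orbit[OF xt yt] by blast
        have "g z = h * (?W x \<nu> * mat_inv (?W x \<nu>))"
          unfolding g_def xy fst_conv snd_conv h(3) word_mat_act[OF h(1,2) xt \<nu>'] by (rule assoc_mult_mat[OF h(1) cx mat_inv(1)[OF cx]])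
        then have "g z = h" using mat_inv(2)[OF cx dx] h(1) by simp
        then show "intertwines r d (g z) x y" using intertwines_act[OF h(1,2) xt] h(3) by simp
      qed
      then show ?thesis unfolding intertwines_def xy by (simp add: Ball_def)
    qed
    ultimately show "closedin (zar ?Z) {z \<in> U \<nu> \<times> pts ?X. GL_orbit n (fst z) = GL_orbit n (snd z)}"
      unfolding pZ pts_stable by (simp cong: conj_cong)
  qed
  show "variety (ncQuot n r d :: ('k, _) space)" unfolding ncQuot_def by (rule variety_quotient)
  show "var_class ?X = var_class (GL_space n :: ('k, _) space) * var_class (ncQuot n r d :: ('k, _) space)"
    unfolding ncQuot_def
  proof (rule var_class_quotient[OF variety_GL, where act = act and \<gamma> = "\<lambda>\<nu> x. ?W x \<nu>"])
    note sG = variety_swf[OF variety_GL, of n]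
    interpret GX: two_spaces "GL_space n :: ('k, _) space" ?X using sX sG by (simp add: two_spaces_def)
    let ?Z = "prod_space (GL_space n) ?X"
    interpret Z: space_with_functions ?Z by (rule GX.prod_swf)
    fix \<nu> assume "\<nu> \<in> N"
    have t: "regular_tuple ?Z n r d (\<lambda>z. snd z)" by (rule regular_tuple_compose[OF regular_stable GX.morphism_snd])
    have g: "regular_mat ?Z n n (\<lambda>z. fst z)" by (rule regular_mat_compose[OF regular_GL_space GX.morphism_fst])
    show "morphism ?Z ?X (\<lambda>z. act (fst z) (snd z))"
      by (intro morphism_stable GX.prod_swf Z.regular_act g t stable_act) (auto simp: GX.pts_prod pts_GL_space pts_stable)
  next
    fix g :: "'k mat" and x :: "'k tuple" assume "g \<in> pts (GL_space n)" "x \<in> pts ?X"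
    then have g: "g \<in> carrier_mat n n" "det g \<noteq> 0" and x: "x \<in> tuples n r d" using Ut by (auto simp: pts_GL_space pts_stable)
    show "GL_orbit n (act g x) = GL_orbit n x"
      by (rule GL_orbit_eq_iff[THEN iffD2, symmetric, OF x act_carrier[OF g(1) x]]) (use g in blast)
  next
    fix \<nu> assume \<nu>: "\<nu> \<in> N"
    then have \<nu>': "\<nu> \<in> word_lists r d n" using NW by blast
    let ?Y = "sub_space ?X (U \<nu>)"
    have sY: "space_with_functions ?Y" by (rule induced_swf[OF sX])
    have tY: "regular_tuple ?Y n r d (\<lambda>x. x)"
      by (rule regular_tuple_compose[OF regular_stable morphism_inclusion[OF sX]])
    show "morphism ?Y (GL_space n) (\<lambda>x. ?W x \<nu>)"
      by (rule morphism_GL_space[OF sY space_with_functions.regular_word_mat[OF sY tY \<nu>']]) (auto simp: pts_sub U_def)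
    fix x assume x: "x \<in> U \<nu>"
    show "act (?W x \<nu>) (act (mat_inv (?W x \<nu>)) x) = x" by (rule act\<sigma>[OF \<nu> x])
    fix g :: "'k mat" assume "g \<in> pts (GL_space n)"
    then have g: "g \<in> carrier_mat n n" "det g \<noteq> 0" by (auto simp: pts_GL_space)
    have xt: "x \<in> tuples n r d" and dx: "det (?W x \<nu>) \<noteq> 0" using x by (auto simp: U_def)
    note cx = word_mat_carrier[OF \<nu>', of n x]
    note ix = inv[OF \<nu> x]
    have "?W (act g (act (mat_inv (?W x \<nu>)) x)) \<nu> = g * (mat_inv (?W x \<nu>) * ?W x \<nu>)"
      using word_mat_act[OF g act_carrier[OF ix(1) xt] \<nu>'] word_mat_act[OF ix xt \<nu>'] by simp
    then show "?W (act g (act (mat_inv (?W x \<nu>)) x)) \<nu> = g" using mat_inv(3)[OF cx dx] g(1) by simp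
  qed
qed

section \<open>Frames and Grassmannians\<close>

text \<open>Generation and independence may be evaluated inside the span, where a generating set
  with as many elements as the dimension is a basis.\<close>

lemma (in vectorspace) dim_span_eq_card_iff:
  assumes S: "finite S" "S \<subseteq> carrier V"
  shows "vectorspace.dim K (vs (span S)) = card S \<longleftrightarrow> lin_indpt S"
proof -
  have sub: "subspace K (span S) V" by (rule span_is_subspace[OF S(2)])
  interpret W: vectorspace K "vs (span S)" by (rule subspace_is_vs[OF sub])
  have subm: "submodule K (span S) V" using sub unfolding subspace_def by simp
  have SW: "S \<subseteq> span S" using in_own_span[OF S(2)] by blast
  have sp: "W.span S = span S" and li: "W.lin_dep S = lin_dep S" using span_li_not_depend[OF SW subm] by auto
  have cW: "S \<subseteq> carrier (vs (span S))" using SW by simp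
  show ?thesis
  proof
    assume "W.dim = card S"
    then have "W.basis S" by (intro W.dim_gen_is_basis[OF S(1) cW]) (auto simp: sp)
    then show "lin_indpt S" unfolding W.basis_def li by blast
  next
    assume "lin_indpt S"
    then have "W.basis S" unfolding W.basis_def li sp using SW by auto
    then show "W.dim = card S" using W.dim_basis[OF S(1)] by blast
  qed
qed

lemma (in vectorspace) dim_span_le:
  assumes S: "finite S" "S \<subseteq> carrier V"
  shows "vectorspace.dim K (vs (span S)) \<le> card S"
proof -
  have sub: "subspace K (span S) V" by (rule span_is_subspace[OF S(2)])
  interpret W: vectorspace K "vs (span S)" by (rule subspace_is_vs[OF sub])
  have subm: "submodule K (span S) V" using sub unfolding subspace_def by simp
  have SW: "S \<subseteq> span S" using in_own_span[OF S(2)] by blast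
  have sp: "W.span S = span S" using span_li_not_depend[OF SW subm] by auto
  show ?thesis by (rule W.gen_ge_dim) (use S SW sp in auto)
qed

lemma mult_mat_unit_vec:
  fixes M :: "'k::field mat"
  shows "M \<in> carrier_mat n k \<Longrightarrow> j < k \<Longrightarrow> M *\<^sub>v unit_vec k j = col M j"
  by (rule eq_vecI) auto

lemma mat_of_cols_injective_iff:
  fixes vs :: "'k::field vec list"
  assumes vs: "set vs \<subseteq> carrier_vec n"
  shows "mat_injective (mat_of_cols n vs) \<longleftrightarrow> distinct vs \<and> \<not> module.lin_dep class_ring (module_vec TYPE('k) n) (set vs)"
proof -
  interpret vec_space "TYPE('k)" n .
  let ?M = "mat_of_cols n vs"
  have M: "?M \<in> carrier_mat n (length vs)" by simp
  have lc: "lincomb a (set vs) = ?M *\<^sub>v vec (length vs) (\<lambda>i. a (vs ! i))" if "distinct vs" for a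
  proof -
    have "\<forall>w\<in>set vs. dim_vec w = n" using vs by auto
    then show ?thesis using lincomb_as_lincomb_list_distinct[OF vs that, of a] lincomb_list_as_mat_mult[of vs] by simp
  qed
  show ?thesis
  proof
    assume inj: "mat_injective ?M"
    have d: "distinct vs"
    proof (rule ccontr)
      assume "\<not> distinct vs"
      then obtain i j where ij: "i < length vs" "j < length vs" "i \<noteq> j" "vs ! i = vs ! j" unfolding distinct_conv_nth by blast
      have "col ?M i = col ?M j" using ij vs by (simp add: col_mat_of_cols subset_iff)
      then have "?M *\<^sub>v unit_vec (length vs) i = ?M *\<^sub>v unit_vec (length vs) j"
        unfolding mult_mat_unit_vec[OF M ij(1)] mult_mat_unit_vec[OF M ij(2)] .
      from mat_injective_cancel_vec[OF inj M unit_vec_carrier unit_vec_carrier this]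
      have "unit_vec (length vs) i = (unit_vec (length vs) j :: 'k vec)" .
      then have "unit_vec (length vs) i $ i = (unit_vec (length vs) j :: 'k vec) $ i" by simp
      then show False using ij by simp
    qed
    moreover have "lin_indpt (set vs)"
    proof (rule finite_lin_indpt2)
      fix a :: "'k vec \<Rightarrow> 'k" assume "lincomb a (set vs) = 0\<^sub>v n"
      then have z: "vec (length vs) (\<lambda>i. a (vs ! i)) = 0\<^sub>v (length vs)"
        unfolding lc[OF d] by (intro mat_injectiveD[OF inj M]) auto
      have "a (vs ! i) = 0" if "i < length vs" for i using arg_cong[OF z, of "\<lambda>v. v $ i"] that by simp
      then show "\<forall>v\<in>set vs. a v = 0" by (metis in_set_conv_nth)
    qed (use vs in auto)
    ultimately show "distinct vs \<and> lin_indpt (set vs)" by blast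
  next
    assume "distinct vs \<and> lin_indpt (set vs)"
    then have d: "distinct vs" and li: "lin_indpt (set vs)" by auto
    show "mat_injective ?M"
    proof (rule mat_injectiveI[OF M])
      fix v :: "'k vec" assume v: "v \<in> carrier_vec (length vs)" "?M *\<^sub>v v = 0\<^sub>v n"
      \<comment> \<open>A coefficient function on the set of columns in place of their list;
        \<open>distinct vs\<close> makes the index of a column unique.\<close>
      define a where "a w = v $ (THE i. i < length vs \<and> vs ! i = w)" for w
      have a: "a (vs ! i) = v $ i" if "i < length vs" for i
      proof -
        have "(THE j. j < length vs \<and> vs ! j = vs ! i) = i"
          by (rule the_equality) (use that d nth_eq_iff_index_eq in auto)
        then show ?thesis by (simp add: a_def)
      qed
      have "vec (length vs) (\<lambda>i. a (vs ! i)) = v" using v a by (intro eq_vecI) auto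
      then have z: "lincomb a (set vs) = 0\<^sub>v n" unfolding lc[OF d] using v by simp
      have "a w = 0" if "w \<in> set vs" for w
      proof (rule ccontr)
        assume "a w \<noteq> 0"
        then have "lin_dep (set vs)" unfolding lin_dep_def using z that
          by (intro exI[of _ "set vs"] exI[of _ a] exI[of _ w]) auto
        then show False using li by simp
      qed
      then have "v $ i = 0" if "i < length vs" for i using a[OF that] that by simp
      then show "v = 0\<^sub>v (length vs)" using v(1) by (intro eq_vecI) simp_all
    qed
  qed
qed

lemma frame_iff:
  fixes vs :: "'k::field vec list"
  assumes vs: "set vs \<subseteq> carrier_vec n" "length vs = k"
  shows "vspan n (set vs) \<in> subspaces k n \<longleftrightarrow> mat_injective (mat_of_cols n vs)"
proof -
  interpret vec_space "TYPE('k)" n .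
  let ?D = "vectorspace.dim class_ring ((module_vec TYPE('k) n)\<lparr>carrier := span (set vs)\<rparr>)"
  have fc: "finite (set vs)" "set vs \<subseteq> carrier V" using vs by auto
  have sub: "subspace class_ring (span (set vs)) V" by (rule span_is_subspace) (use vs in simp)
  have iff: "?D = card (set vs) \<longleftrightarrow> lin_indpt (set vs)"
    using vectorspace.dim_span_eq_card_iff[OF vec_vs fc] .
  have le: "?D \<le> card (set vs)" using vectorspace.dim_span_le[OF vec_vs fc] .
  have "?D = k \<longleftrightarrow> distinct vs \<and> lin_indpt (set vs)"
  proof
    assume D: "?D = k"
    \<comment> \<open>The dimension is at most the number of distinct vectors, which is at most
      \<open>k\<close>. Equality therefore excludes repetitions.\<close>
    then have "card (set vs) = k" using le card_length[of vs] vs(2) by simp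
    then show "distinct vs \<and> lin_indpt (set vs)" using D iff card_distinct[of vs] vs(2) by simp
  next
    assume "distinct vs \<and> lin_indpt (set vs)"
    then show "?D = k" using iff distinct_card[of vs] vs(2) by simp
  qed
  then show ?thesis unfolding subspaces_def using sub mat_of_cols_injective_iff[OF vs(1)] by simp
qed

section \<open>Frames as tuples without endomorphisms, \<open>d = 0\<close>\<close>

definition vec_mat :: "nat \<Rightarrow> 'k::field tuple \<Rightarrow> 'k mat" where
  "vec_mat n x = mat_of_cols n (snd x)"

lemma vec_mat_carrier: "x \<in> tuples n r d \<Longrightarrow> vec_mat n x \<in> carrier_mat n r"
  using tuplesD(2)[of x n r d] mat_of_cols_carrier(1)[of n "snd x"] by (simp add: vec_mat_def)

text \<open>Without endomorphisms the only words are the vectors themselves, so a list of words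
  selects columns of the matrix of vectors; the second factor is the selection matrix.\<close>

lemma word_mat_no_endos:
  assumes x: "x \<in> tuples n r 0" and \<nu>: "\<nu> \<in> word_lists r 0 l"
  shows "word_mat n x \<nu> = vec_mat n x * mat r l (\<lambda>(i, c). if i = snd (\<nu> ! c) then 1 else 0)"
proof (rule eq_matI)
  note M = vec_mat_carrier[OF x]
  fix i c assume "i < dim_row (vec_mat n x * mat r l (\<lambda>(i, c). if i = snd (\<nu> ! c) then 1 else 0))"
    "c < dim_col (vec_mat n x * mat r l (\<lambda>(i, c). if i = snd (\<nu> ! c) then 1 else 0))"
  then have ic: "i < n" "c < l" using M by auto
  have "\<nu> ! c \<in> words r 0" using \<nu> ic(2) nth_mem by (fastforce simp: word_lists_def)
  then have w: "\<nu> ! c = ([], snd (\<nu> ! c))" "snd (\<nu> ! c) < r" by (auto simp: words_def intro!: prod_eqI)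
  have "word_vec x (\<nu> ! c) = snd x ! snd (\<nu> ! c)" by (subst w(1)) (simp add: word_vec_simps)
  then have "word_mat n x \<nu> $$ (i, c) = vec_mat n x $$ (i, snd (\<nu> ! c))"
    using ic \<nu> w(2) tuplesD(2)[OF x] by (simp add: word_mat_def vec_mat_def mat_of_cols_index word_lists_def)
  also have "\<dots> = (\<Sum>j<r. vec_mat n x $$ (i, j) * (if j = snd (\<nu> ! c) then 1 else 0))"
    using w(2) by (simp add: if_distrib cong: if_cong)
  also have "\<dots> = (vec_mat n x * mat r l (\<lambda>(i, c). if i = snd (\<nu> ! c) then 1 else 0)) $$ (i, c)"
    using ic M by (auto simp: scalar_prod_def atLeast0LessThan intro!: sum.cong)
  finally show "word_mat n x \<nu> $$ (i, c) = (vec_mat n x * mat r l (\<lambda>(i, c). if i = snd (\<nu> ! c) then 1 else 0)) $$ (i, c)" .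
qed (use \<nu> vec_mat_carrier[OF x] in \<open>auto simp: word_mat_def word_lists_def\<close>)

text \<open>Otherwise the selection matrix would be injective with more columns than rows.\<close>

lemma rank_ge_no_endos_empty:
  assumes "k > r"
  shows "rank_ge n r 0 k = {}"
proof -
  have False if x: "x \<in> rank_ge n r 0 k" for x :: "'a tuple"
  proof -
    obtain \<nu> where xt: "x \<in> tuples n r 0" and \<nu>: "\<nu> \<in> word_lists r 0 k" "mat_injective (word_mat n x \<nu>)"
      using x by (auto simp: rank_ge_def)
    have "mat_injective (mat r k (\<lambda>(i, c). if i = snd (\<nu> ! c) then 1 else 0) :: 'a mat)"
      by (rule mat_injective_factor[OF vec_mat_carrier[OF xt] mat_carrier \<nu>(2)[unfolded word_mat_no_endos[OF xt \<nu>(1)]]])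
    from injective_normal_form[OF _ this, of r k] assms show False by simp
  qed
  then show ?thesis by blast
qed

definition vec_word_list :: "nat \<Rightarrow> (nat list \<times> nat) list" where
  "vec_word_list r = map (\<lambda>j. ([], j)) [0..<r]"

lemma vec_word_list: "vec_word_list r \<in> word_lists r d r"
  by (auto simp: vec_word_list_def word_lists_def words_def)

lemma word_mat_vec_word_list: "x \<in> tuples n r d \<Longrightarrow> word_mat n x (vec_word_list r) = vec_mat n x"
  using tuplesD(2)[of x n r d]
  by (auto simp: word_mat_def vec_mat_def vec_word_list_def word_vec_simps o_def intro!: arg_cong[of _ _ "mat_of_cols n"] nth_equalityI)

text \<open>A list of \<open>k\<close> independent words selects from the \<open>k\<close> given
  vectors by a square matrix \<open>S\<close>. It is injective, hence invertible, and the selection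
  can be undone.\<close>

lemma frames_iff:
  assumes x: "x \<in> tuples n k 0"
  shows "x \<in> rank_ge n k 0 k \<longleftrightarrow> mat_injective (vec_mat n x)"
proof
  assume "mat_injective (vec_mat n x)"
  then show "x \<in> rank_ge n k 0 k"
    using x vec_word_list[of k 0] word_mat_vec_word_list[OF x] unfolding rank_ge_def by (auto intro!: bexI[of _ "vec_word_list k"])
next
  assume "x \<in> rank_ge n k 0 k"
  then obtain \<nu> where \<nu>: "\<nu> \<in> word_lists k 0 k" "mat_injective (word_mat n x \<nu>)" by (auto simp: rank_ge_def)
  define S where "S = (mat k k (\<lambda>(i, c). if i = snd (\<nu> ! c) then 1 else 0) :: 'a mat)"
  have S: "S \<in> carrier_mat k k" by (simp add: S_def)
  have e: "word_mat n x \<nu> = vec_mat n x * S" unfolding S_def by (rule word_mat_no_endos[OF x \<nu>(1)])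
  note M = vec_mat_carrier[OF x]
  have "mat_injective S" using mat_injective_factor[OF M S] \<nu>(2) e by simp
  then have d: "det S \<noteq> 0" using mat_injective_square[OF S] by simp
  have "vec_mat n x = word_mat n x \<nu> * mat_inv S"
    unfolding e using assoc_mult_mat[OF M S mat_inv(1)[OF S]] mat_inv(2)[OF S d] M by simp
  moreover have "mat_injective \<dots>"
    by (rule mat_injective_mult[OF word_mat_carrier[OF \<nu>(1)] mat_inv(1)[OF S] \<nu>(2)])
      (use mat_injective_square[OF mat_inv(1)[OF S]] det_mat_inv[OF S d] in simp)
  ultimately show "mat_injective (vec_mat n x)" by simp
qed

text \<open>A copy of \<open>frame_space\<close> whose points are tuples, so that the rank strata
  and their charts apply.\<close>

definition frame_tuples :: "nat \<Rightarrow> nat \<Rightarrow> ('k::field, 'k tuple) space" where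
  "frame_tuples k n = sub_space (tuple_space n k 0) (rank_ge n k 0 k)"

lemma variety_frame_tuples: "variety (frame_tuples k n :: ('k::field, _) space)"
  unfolding frame_tuples_def by (intro variety_open variety_tuple open_rank_ge)

lemma pts_frame_tuples: "pts (frame_tuples k n) = rank_ge n k 0 k"
  unfolding frame_tuples_def pts_sub pts_tuple_space using rank_ge_subset by blast

lemma frame_swf: "space_with_functions (frame_space k n)"
  unfolding frame_space_def by (intro induced_swf affine_swf)

lemma pts_frame_space: "vs \<in> pts (frame_space k n) \<longleftrightarrow> ([], vs) \<in> rank_ge n k 0 k"
proof -
  have t: "([], vs) \<in> tuples n k 0 \<longleftrightarrow> length vs = k \<and> set vs \<subseteq> carrier_vec n" by (auto simp: tuples_alt)
  have "vs \<in> pts (frame_space k n) \<longleftrightarrow> length vs = k \<and> set vs \<subseteq> carrier_vec n \<and> vspan n (set vs) \<in> subspaces k n"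
    unfolding frame_space_def pts_induced pts_affine using coords_length[of vs k n] by auto
  also have "\<dots> \<longleftrightarrow> ([], vs) \<in> rank_ge n k 0 k"
    using frames_iff[of "([], vs)" n k] frame_iff[of vs n k] t rank_ge_subset[of n k 0 k] by (auto simp: vec_mat_def)
  finally show ?thesis .
qed

lemma frame_morphisms:
  "morphism (frame_space k n) (frame_tuples k n :: ('k::field, _) space) (\<lambda>vs. ([], vs))"
  "morphism (frame_tuples k n) (frame_space k n :: ('k, _) space) snd"
proof -
  let ?c = "\<lambda>vs :: 'k vec list. concat (map list_of_vec vs)"
  have e: "tuple_coords ([], vs) = ?c vs" for vs :: "'k vec list" by (simp add: tuple_coords_def)
  have N: "0 * n\<^sup>2 + k * n = k * n" by simp
  have c: "morphism (frame_space k n) (affine_space (0 * n\<^sup>2 + k * n)) (\<lambda>vs :: 'k vec list. tuple_coords ([], vs))"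
    unfolding e N frame_space_def by (rule morphism_induced_map[OF affine_swf])
  have "morphism (frame_space k n) (tuple_space n k 0) (\<lambda>vs. ([], vs) :: 'k tuple)"
    unfolding tuple_space_def
  proof (rule morphism_into_induced[OF frame_swf])
    show "morphism (frame_space k n) (affine_space (0 * n\<^sup>2 + k * n)) (\<lambda>vs :: 'k vec list. tuple_coords ([], vs))" by (rule c)
    fix vs :: "'k vec list" assume "vs \<in> pts (frame_space k n)"
    then have "([], vs) \<in> (tuples n k 0 :: 'k tuple set)" using pts_frame_space rank_ge_subset by blast
    then show "([], vs) \<in> {(Ts :: 'k mat list, vs). length Ts = 0 \<and> set Ts \<subseteq> carrier_mat n n \<and> length vs = k \<and> set vs \<subseteq> carrier_vec n}"
      unfolding tuples_alt .
  qed
  then show "morphism (frame_space k n) (frame_tuples k n :: ('k, _) space) (\<lambda>vs. ([], vs))"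
    unfolding frame_tuples_def by (rule morphism_into_sub[OF frame_swf]) (simp add: pts_frame_space)
  have F: "fst x = []" if "x \<in> pts (frame_tuples k n)" for x :: "'k tuple"
    using that rank_ge_subset tuplesD(1) unfolding pts_frame_tuples by fastforce
  have sT: "space_with_functions (frame_tuples k n :: ('k, _) space)" by (rule variety_swf[OF variety_frame_tuples])
  have "morphism (tuple_space n k 0 :: ('k, _) space) (affine_space (0 * n\<^sup>2 + k * n)) tuple_coords"
    unfolding tuple_space_def by (rule morphism_induced_map[OF affine_swf])
  then have "morphism (frame_tuples k n :: ('k, _) space) (affine_space (k * n)) tuple_coords"
    using morphism_compose[OF morphism_inclusion[OF tuple_swf]] unfolding frame_tuples_def N by blast
  then have "morphism (frame_tuples k n :: ('k, _) space) (affine_space (k * n)) (\<lambda>x. ?c (snd x))"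
    by (rule morphism_cong[OF sT]) (use F e in \<open>metis prod.collapse\<close>)
  then show "morphism (frame_tuples k n) (frame_space k n :: ('k, _) space) snd"
    unfolding frame_space_def
  proof (rule morphism_into_induced[OF sT])
    fix x :: "'k tuple" assume x: "x \<in> pts (frame_tuples k n)"
    then have "([], snd x) \<in> rank_ge n k 0 k" using F[OF x] pts_frame_tuples by (metis prod.collapse)
    then have "snd x \<in> pts (frame_space k n)" by (simp add: pts_frame_space)
    then show "snd x \<in> {vs. length vs = k \<and> set vs \<subseteq> carrier_vec n \<and> vspan n (set vs) \<in> subspaces k n}"
      unfolding frame_space_def pts_induced by blast
  qed
qed

lemma frame_tuples_eq: "x \<in> pts (frame_tuples k n) \<Longrightarrow> x = ([], snd x)"
  using rank_ge_subset tuplesD(1) unfolding pts_frame_tuples by (fastforce intro!: prod_eqI)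

lemma morphism_from_whole_quotient:
  assumes X: "space_with_functions X" and s: "morphism X Y (\<lambda>x. s (\<pi> x))"
  shows "morphism (quotient_space \<pi> X) Y s"
proof -
  let ?Q = "quotient_space \<pi> X"
  have sQ: "space_with_functions ?Q" by (rule quotient_swf[OF X])
  have im: "\<pi> ` pts X = pts ?Q" by (simp add: pts_quotient)
  have "morphism (sub_space X (pts X)) Y (\<lambda>x. s (\<pi> x))"
    by (rule morphism_compose[OF morphism_inclusion[OF X] s])
  then have 1: "morphism (sub_space ?Q (pts ?Q)) Y s"
    unfolding im[symmetric] by (intro morphism_from_quotient[where s = s and \<pi> = \<pi>] X openin_topspace)
  have "morphism ?Q (sub_space ?Q (pts ?Q)) (\<lambda>x. x)" by (rule morphism_into_sub[OF sQ morphism_id[OF sQ]])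
  from morphism_compose[OF this 1] show ?thesis .
qed

lemma quotient_iso:
  assumes X: "space_with_functions X" and X': "space_with_functions X'"
    and f: "morphism X X' f" and g: "morphism X' X g" and gf: "\<And>x. x \<in> pts X \<Longrightarrow> g (f x) = x"
    and \<pi>: "\<And>x. x \<in> pts X \<Longrightarrow> \<pi>' (f x) = \<pi> x" and \<pi>': "\<And>x. x \<in> pts X' \<Longrightarrow> \<pi> (g x) = \<pi>' x"
  shows "iso_spaces (quotient_space \<pi> X) (quotient_space \<pi>' X')"
proof (rule iso_spacesI)
  show "morphism (quotient_space \<pi> X) (quotient_space \<pi>' X') (\<lambda>q. q)"
    by (rule morphism_from_whole_quotient[OF X], rule morphism_cong[OF X morphism_compose[OF f morphism_quotient]]) (rule \<pi>)
  show "morphism (quotient_space \<pi>' X') (quotient_space \<pi> X) (\<lambda>q. q)"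
    by (rule morphism_from_whole_quotient[OF X'], rule morphism_cong[OF X' morphism_compose[OF g morphism_quotient]]) (rule \<pi>')
qed simp_all

lemma column_space_factor:
  fixes M :: "'k::field mat"
  assumes M: "M \<in> carrier_mat n k" and M': "M' \<in> carrier_mat n l"
    and sub: "\<And>c. c \<in> carrier_vec l \<Longrightarrow> \<exists>b\<in>carrier_vec k. M' *\<^sub>v c = M *\<^sub>v b"
  shows "\<exists>C\<in>carrier_mat k l. M' = M * C"
proof -
  have "\<forall>j. \<exists>b. b \<in> carrier_vec k \<and> M' *\<^sub>v unit_vec l j = M *\<^sub>v b" using sub[OF unit_vec_carrier] by blast
  from choice[OF this] obtain b where b: "\<forall>j. b j \<in> carrier_vec k \<and> M' *\<^sub>v unit_vec l j = M *\<^sub>v b j" ..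
  define C where "C = mat_of_cols k (map b [0..<l])"
  have C: "C \<in> carrier_mat k l" using mat_of_cols_carrier(1)[of k "map b [0..<l]"] by (simp add: C_def)
  have "M' = M * C"
  proof (rule mat_col_eqI)
    fix j assume "j < dim_col (M * C)"
    then have j: "j < l" using C by simp
    have cb: "col C j = b j" unfolding C_def by (subst col_mat_of_cols) (use b j in auto)
    have "col M' j = M' *\<^sub>v unit_vec l j" using mult_mat_unit_vec[OF M' j] by simp
    then show "col M' j = col (M * C) j" using col_mult2[OF M C j] cb b by simp
  qed (use M M' C in auto)
  then show ?thesis using C by blast
qed

text \<open>A matrix whose columns lie in the column space of another factors through it. For two
  frames of the same subspace the factor is square and injective, hence invertible.\<close>

lemma vspan_frames_eq_iff:
  assumes x: "x \<in> tuples n k 0" "mat_injective (vec_mat n x)" and y: "y \<in> tuples n k 0" "mat_injective (vec_mat n y)"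
  shows "vspan n (set (snd x)) = vspan n (set (snd y)) \<longleftrightarrow>
    (\<exists>C\<in>carrier_mat k k. det C \<noteq> 0 \<and> vec_mat n y = vec_mat n x * C)"
proof -
  let ?M = "vec_mat n"
  note Mx = vec_mat_carrier[OF x(1)] and My = vec_mat_carrier[OF y(1)]
  have sp: "vspan n (set (snd z)) = {?M z *\<^sub>v c | c. c \<in> carrier_vec k}" if "z \<in> tuples n k 0" for z :: "'a tuple"
  proof -
    have "set (snd z) \<subseteq> carrier_vec n" using that by (auto simp: tuples_alt)
    then show ?thesis using span_cols[of "snd z" n] tuplesD(2)[OF that] by (simp add: vec_mat_def)
  qed
  show ?thesis
  proof
    assume eq: "vspan n (set (snd x)) = vspan n (set (snd y))"
    have "\<exists>b\<in>carrier_vec k. ?M y *\<^sub>v c = ?M x *\<^sub>v b" if "c \<in> carrier_vec k" for c using eq that unfolding sp[OF x(1)] sp[OF y(1)] by blast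
    then obtain C where C: "C \<in> carrier_mat k k" "?M y = ?M x * C" using column_space_factor[OF Mx My] by blast
    have "mat_injective C" using mat_injective_factor[OF Mx C(1)] y(2) C(2) by simp
    then show "\<exists>C\<in>carrier_mat k k. det C \<noteq> 0 \<and> ?M y = ?M x * C" using C mat_injective_square[OF C(1)] by blast
  next
    assume "\<exists>C\<in>carrier_mat k k. det C \<noteq> 0 \<and> ?M y = ?M x * C"
    then obtain C where C: "C \<in> carrier_mat k k" "det C \<noteq> 0" "?M y = ?M x * C" by blast
    have 1: "?M y *\<^sub>v c = ?M x *\<^sub>v (C *\<^sub>v c)" if "c \<in> carrier_vec k" for c
      unfolding C(3) by (rule assoc_mult_mat_vec[OF Mx C(1) that])
    have 2: "?M x *\<^sub>v c = ?M y *\<^sub>v (mat_inv C *\<^sub>v c)" if "c \<in> carrier_vec k" for c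
    proof -
      have ic: "mat_inv C *\<^sub>v c \<in> carrier_vec k" using mat_inv(1)[OF C(1)] that by simp
      show ?thesis
        using 1[OF ic] assoc_mult_mat_vec[OF C(1) mat_inv(1)[OF C(1)] that] mat_inv(2)[OF C(1,2)] that by simp
    qed
    show "vspan n (set (snd x)) = vspan n (set (snd y))" unfolding sp[OF x(1)] sp[OF y(1)]
    proof safe
      fix c :: "'a vec" assume c: "c \<in> carrier_vec k"
      then show "\<exists>b. ?M x *\<^sub>v c = ?M y *\<^sub>v b \<and> b \<in> carrier_vec k"
        using 2[OF c] mult_mat_vec_carrier[OF mat_inv(1)[OF C(1)] c] by blast
      show "\<exists>b. ?M y *\<^sub>v c = ?M x *\<^sub>v b \<and> b \<in> carrier_vec k"
        using 1[OF c] mult_mat_vec_carrier[OF C(1) c] by blast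
    qed
  qed
qed

text \<open>Change of the frame within its span. It acts from the right: first \<open>C\<close> and
  then \<open>D\<close> amounts to \<open>C * D\<close>.\<close>

definition right_act :: "nat \<Rightarrow> 'k::field mat \<Rightarrow> 'k tuple \<Rightarrow> 'k tuple" where
  "right_act n C x = ([], cols (vec_mat n x * C))"

lemma right_act:
  assumes x: "x \<in> tuples n k d" and C: "C \<in> carrier_mat k l"
  shows "right_act n C x \<in> tuples n l 0" "vec_mat n (right_act n C x) = vec_mat n x * C"
proof -
  have MC: "vec_mat n x * C \<in> carrier_mat n l" using vec_mat_carrier[OF x] C by simp
  then show "right_act n C x \<in> tuples n l 0"
    using C by (auto simp: right_act_def tuples_def)
  show "vec_mat n (right_act n C x) = vec_mat n x * C"
    using MC mat_of_cols_cols[of "vec_mat n x * C"] by (simp add: right_act_def vec_mat_def)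
qed

lemma tuple_eq_of_vec_mat:
  assumes x: "x \<in> tuples n k 0" and y: "y \<in> tuples n k 0" and eq: "vec_mat n x = vec_mat n y"
  shows "x = y"
proof (rule tuple_eqI[OF x y])
  fix j assume j: "j < k"
  have "col (vec_mat n z) j = snd z ! j" if "z \<in> tuples n k 0" for z :: "'a tuple"
    unfolding vec_mat_def by (rule col_mat_of_cols) (use tuplesD[OF that] j in auto)
  then show "snd x ! j = snd y ! j" using x y eq by metis
qed simp

text \<open>The pattern of \<open>ncQuot_facts\<close> with the group on the other side. The role of
  the word matrix is taken by the block \<open>B h x\<close>, the top \<open>k\<close> rows of
  \<open>h\<close> times the frame. It is multiplied by \<open>C\<close> on the right when the frame
  is, and the normal form is the frame for which it is the identity.\<close>

lemma grassmannian_facts: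
  "variety (grassmannian k n :: ('k::alg_closed_field, _) space)"
  "var_class (frame_tuples k n :: ('k, _) space) = var_class (GL_space k :: ('k, _) space) * var_class (grassmannian k n :: ('k, _) space)"
proof -
  let ?X = "frame_tuples k n :: ('k, _) space"
  let ?F = "rank_ge n k 0 k :: 'k tuple set"
  let ?M = "vec_mat n :: 'k tuple \<Rightarrow> 'k mat"
  let ?\<pi> = "\<lambda>x :: 'k tuple. vspan n (set (snd x))"
  define H where "H = {h \<in> carrier_mat n n. det h \<noteq> (0::'k)}"
  define B where "B h x = (incl_mat n k)\<^sup>T * (h * ?M x)" for h x
  define U where "U h = {x \<in> tuples n k 0. det (B h x) \<noteq> 0}" for h
  have Bc: "B h x \<in> carrier_mat k k" if "h \<in> H" "x \<in> tuples n k 0" for h x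
    using that vec_mat_carrier[OF that(2)] by (auto simp: B_def H_def intro!: mult_carrier_mat[of _ k n])
  have B_right: "B h (right_act n C x) = B h x * C" if "h \<in> H" "x \<in> tuples n k 0" "C \<in> carrier_mat k k" for h x C
  proof -
    have h: "h \<in> carrier_mat n n" using that by (simp add: H_def)
    note M = vec_mat_carrier[OF that(2)]
    have "B h (right_act n C x) = (incl_mat n k)\<^sup>T * (h * ?M x * C)"
      unfolding B_def right_act(2)[OF that(2,3)] assoc_mult_mat[OF h M that(3)] ..
    also have "\<dots> = (incl_mat n k)\<^sup>T * (h * ?M x) * C"
      by (rule assoc_mult_mat[OF _ _ that(3), symmetric]) (use h M in auto)
    finally show ?thesis by (simp add: B_def)
  qed
  have U_chart: "U h = chart n k 0 k (vec_word_list k, h)" for h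
    unfolding U_def chart_def B_def prod.case using word_mat_vec_word_list by (metis (mono_tags, lifting))
  have oU: "openin (zar (tuple_space n k 0)) (U h)" if "h \<in> H" for h
    unfolding U_chart by (rule open_chart) (use that in \<open>auto simp: chart_index_def vec_word_list H_def\<close>)
  have UF: "U h \<subseteq> ?F" if "h \<in> H" for h
  proof
    fix x assume x: "x \<in> U h"
    then have xt: "x \<in> tuples n k 0" by (simp add: U_def)
    have h: "h \<in> carrier_mat n n" using that by (simp add: H_def)
    have "mat_injective (h * ?M x)"
      by (rule left_inverse_injective[of "(incl_mat n k)\<^sup>T" k n]) (use x h vec_mat_carrier[OF xt] in \<open>auto simp: U_def B_def\<close>)
    then show "x \<in> ?F" using mat_injective_factor[OF h vec_mat_carrier[OF xt]] frames_iff[OF xt] by blast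
  qed
  have FU: "\<exists>h\<in>H. x \<in> U h" if "x \<in> ?F" for x
  proof -
    have xt: "x \<in> tuples n k 0" using that rank_ge_subset by blast
    then have inj: "mat_injective (?M x)" using frames_iff that by blast
    obtain P where P: "P \<in> carrier_mat n n" "det P \<noteq> 0" "P * ?M x = incl_mat n k" and kn: "k \<le> n"
      using injective_normal_form[OF vec_mat_carrier[OF xt] inj] by blast
    have "B P x = 1\<^sub>m k" unfolding B_def P(3) by (rule transpose_incl_incl[OF kn])
    then show ?thesis using P xt by (intro bexI[of _ P]) (auto simp: U_def H_def)
  qed
  have cov: "?F = (\<Union>h\<in>H. U h)" using UF FU by blast
  obtain N where N: "N \<subseteq> H" "finite N" "(\<Union>h\<in>N. U h) = (\<Union>h\<in>H. U h)"
    using tuple_space_quasi_compact[of H n k 0 U] oU by blast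
  note NH = N(1)
  note sX = variety_swf[OF variety_frame_tuples, of k n]
  have tX: "regular_tuple ?X n k 0 (\<lambda>x. x)"
    unfolding frame_tuples_def by (rule regular_tuple_compose[OF regular_tuple_space morphism_inclusion[OF tuple_swf]])
  have Ft: "x \<in> tuples n k 0" "mat_injective (?M x)" if "x \<in> ?F" for x
  proof -
    show "x \<in> tuples n k 0" using that rank_ge_subset by blast
    then show "mat_injective (?M x)" using frames_iff that by blast
  qed
  have Ut: "x \<in> tuples n k 0" "det (B h x) \<noteq> 0" "x \<in> ?F" if "h \<in> H" "x \<in> U h" for h x
    using that UF[OF that(1)] by (auto simp: U_def)
  have regM: "regular_mat Y n k (\<lambda>y. ?M (t y))" if "space_with_functions Y" "regular_tuple Y n k 0 t"
    for Y :: "('k, 'z) space" and t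
    by (rule space_with_functions.regular_mat_cong[OF that(1) space_with_functions.regular_word_mat[OF that vec_word_list]])
      (use regular_tupleD(1)[OF that(2)] word_mat_vec_word_list in blast)
  have regB: "regular_mat Y k k (\<lambda>y. B h (t y))" if "space_with_functions Y" "regular_tuple Y n k 0 t" "h \<in> H"
    for Y :: "('k, 'z) space" and t h
    unfolding B_def
    by (intro space_with_functions.regular_mat_mult[OF that(1), of _ n] space_with_functions.regular_mat_const[OF that(1)] regM that)
      (use that(3) in \<open>auto simp: H_def\<close>)
  have regR: "regular_tuple Y n k 0 (\<lambda>y. right_act n (C y) (t y))"
    if "space_with_functions Y" "regular_tuple Y n k 0 t" "regular_mat Y k k C"
    for Y :: "('k, 'z) space" and t C
    unfolding regular_tuple_def
  proof (intro conjI ballI allI impI)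
    fix y assume y: "y \<in> pts Y"
    show "right_act n (C y) (t y) \<in> tuples n k 0"
      by (rule right_act(1)[OF regular_tupleD(1)[OF that(2) y] regular_matD(1)[OF that(3) y]])
  next
    fix j assume j: "j < k"
    interpret Y: space_with_functions Y by fact
    have MC: "regular_mat Y n k (\<lambda>y. ?M (t y) * C y)" by (intro Y.regular_mat_mult[of _ k] regM that)
    have "regular_vec Y n (\<lambda>y. vec n (\<lambda>i. (?M (t y) * C y) $$ (i, j)))"
      by (intro Y.regular_vec_vec regular_matD(2)[OF MC] j)
    then show "regular_vec Y n (\<lambda>y. snd (right_act n (C y) (t y)) ! j)"
    proof (rule Y.regular_vec_cong)
      fix y assume y: "y \<in> pts Y"
      define A where "A = ?M (t y) * C y"
      have A: "A \<in> carrier_mat n k" unfolding A_def by (rule regular_matD(1)[OF MC y])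
      have "vec n (\<lambda>i. A $$ (i, j)) = cols A ! j" using A j by (simp add: col_def)
      then show "vec n (\<lambda>i. (?M (t y) * C y) $$ (i, j)) = snd (right_act n (C y) (t y)) ! j"
        by (simp add: A_def right_act_def)
    qed
  qed simp
  have right_F: "right_act n C x \<in> ?F" if "x \<in> ?F" "C \<in> carrier_mat k k" "det C \<noteq> 0" for x C
    using frames_iff[OF right_act(1)[OF Ft(1)[OF that(1)] that(2)]] right_act(2)[OF Ft(1)[OF that(1)] that(2)]
      mat_injective_mult[OF vec_mat_carrier[OF Ft(1)[OF that(1)]] that(2) Ft(2)[OF that(1)]] mat_injective_square[OF that(2)] that(3) by simp
  have morR: "morphism Y ?X (\<lambda>y. right_act n (C y) (t y))"
    if "space_with_functions Y" "regular_tuple Y n k 0 t" "regular_mat Y k k C"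
      "\<And>y. y \<in> pts Y \<Longrightarrow> t y \<in> ?F \<and> det (C y) \<noteq> 0"
    for Y :: "('k, 'z) space" and t C
    unfolding frame_tuples_def
    by (intro morphism_into_sub morphism_tuple_space that(1) regR that(2,3) right_F)
      (use that(4) regular_matD(1)[OF that(3)] in auto)
  have \<pi>R: "?\<pi> (right_act n C x) = ?\<pi> x" if "x \<in> ?F" "C \<in> carrier_mat k k" "det C \<noteq> 0" for x C
  proof -
    have r: "right_act n C x \<in> ?F" by (rule right_F[OF that])
    show ?thesis
      by (rule vspan_frames_eq_iff[THEN iffD2, symmetric, OF Ft[OF that(1)] Ft[OF r]])
        (use that right_act(2)[OF Ft(1)[OF that(1)] that(2)] in blast)
  qed
  have \<pi>_iff: "?\<pi> x = ?\<pi> y \<longleftrightarrow> (\<exists>C\<in>carrier_mat k k. det C \<noteq> 0 \<and> ?M y = ?M x * C)" if "x \<in> ?F" "y \<in> ?F" for x y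
    by (rule vspan_frames_eq_iff[OF Ft[OF that(1)] Ft[OF that(2)]])
  have eqR: "y = right_act n C x" if "x \<in> tuples n k 0" "y \<in> tuples n k 0" "C \<in> carrier_mat k k" "?M y = ?M x * C" for x y :: "'k tuple" and C
    by (rule tuple_eq_of_vec_mat[OF that(2) right_act(1)[OF that(1,3)]]) (use that right_act(2)[OF that(1,3)] in simp)
  have RR: "right_act n D (right_act n C x) = right_act n (C * D) x"
    if "x \<in> tuples n k 0" "C \<in> carrier_mat k k" "D \<in> carrier_mat k k" for x :: "'k tuple" and C D
    by (rule eqR[OF that(1) right_act(1)[OF right_act(1)[OF that(1,2)] that(3)] mult_carrier_mat[OF that(2,3)]])
      (use right_act(2)[OF right_act(1)[OF that(1,2)] that(3)] right_act(2)[OF that(1,2)]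
        assoc_mult_mat[OF vec_mat_carrier[OF that(1)] that(2,3)] in simp)
  have R1: "right_act n (1\<^sub>m k) x = x" if "x \<in> tuples n k 0" for x :: "'k tuple"
    by (rule eqR[OF that that, symmetric]) (use vec_mat_carrier[OF that] in auto)
  note iB = mat_inv[OF Bc] and dB = det_mat_inv[OF Bc]
  interpret local_sections ?X ?\<pi> N U "\<lambda>h x. right_act n (mat_inv (B h x)) x"
  proof
    show "variety ?X" by (rule variety_frame_tuples)
    show "finite N" by fact
    show "pts ?X = (\<Union>i\<in>N. U i)" unfolding pts_frame_tuples cov using N by simp
    fix h assume "h \<in> N"
    then have h: "h \<in> H" using N by blast
    show "openin (zar ?X) (U h)"
      unfolding frame_tuples_def by (subst sub_space_open_openin[OF open_rank_ge UF[OF h]]) (rule oU[OF h])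
    let ?Y = "sub_space ?X (U h)"
    have sY: "space_with_functions ?Y" by (rule induced_swf[OF sX])
    have pY: "pts ?Y = U h" unfolding pts_sub pts_frame_tuples using UF[OF h] by blast
    have tY: "regular_tuple ?Y n k 0 (\<lambda>x. x)" by (rule regular_tuple_compose[OF tX morphism_inclusion[OF sX]])
    show "morphism ?Y ?X (\<lambda>x. right_act n (mat_inv (B h x)) x)"
      by (intro morR sY tY space_with_functions.regular_mat_inv[OF sY] regB h)
        (use pY Ut[OF h] dB[OF h] in auto)
    fix x assume x: "x \<in> U h"
    note xU = Ut[OF h x]
    show "?\<pi> (right_act n (mat_inv (B h x)) x) = ?\<pi> x"
      by (rule \<pi>R[OF xU(3) iB(1)[OF h xU(1)] dB[OF h xU(1,2)]])
    { fix y assume y: "y \<in> pts ?X" "?\<pi> x = ?\<pi> y"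
      then have yF: "y \<in> ?F" by (simp add: pts_frame_tuples)
      obtain C where C: "C \<in> carrier_mat k k" "det C \<noteq> 0" "?M y = ?M x * C" using \<pi>_iff[OF xU(3) yF] y(2) by blast
      have "y = right_act n C x" by (rule eqR[OF xU(1) Ft(1)[OF yF] C(1,3)])
      then have "B h y = B h x * C" using B_right[OF h xU(1) C(1)] by simp
      then show "y \<in> U h" using det_mult[OF Bc[OF h xU(1)] C(1)] C(2) xU(2) Ft(1)[OF yF] by (simp add: U_def) }
    { fix y assume y: "y \<in> U h" "?\<pi> x = ?\<pi> y"
      note yU = Ut[OF h y(1)]
      obtain C where C: "C \<in> carrier_mat k k" "det C \<noteq> 0" "?M y = ?M x * C" using \<pi>_iff[OF xU(3) yU(3)] y(2) by blast
      have yx: "y = right_act n C x" by (rule eqR[OF xU(1) yU(1) C(1,3)])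
      have By: "B h y = B h x * C" unfolding yx by (rule B_right[OF h xU(1) C(1)])
      note iy = iB(1)[OF h yU(1)]
      have "B h x * (C * mat_inv (B h y)) = 1\<^sub>m k"
        using assoc_mult_mat[OF Bc[OF h xU(1)] C(1) iy] By iB(2)[OF h yU(1,2)] by simp
      then have "mat_inv (B h x) = C * mat_inv (B h y)"
        by (rule mat_inv_unique[OF Bc[OF h xU(1)] mult_carrier_mat[OF C(1) iy]])
      then show "right_act n (mat_inv (B h x)) x = right_act n (mat_inv (B h y)) y"
        using RR[OF xU(1) C(1) iy] yx by simp }
  next
    fix h assume "h \<in> N"
    then have h: "h \<in> H" using N by blast
    let ?Y = "sub_space ?X (U h)"
    have sY: "space_with_functions ?Y" by (rule induced_swf[OF sX])
    have pY: "pts ?Y = U h" unfolding pts_sub pts_frame_tuples using UF[OF h] by blast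
    interpret YX: two_spaces ?Y ?X using sX sY by (simp add: two_spaces_def)
    let ?Z = "prod_space ?Y ?X"
    interpret Z: space_with_functions ?Z by (rule YX.prod_swf)
    have pZ: "pts ?Z = U h \<times> ?F" unfolding YX.pts_prod pY pts_frame_tuples ..
    have t1: "regular_tuple ?Z n k 0 (\<lambda>z. fst z)"
      by (rule regular_tuple_compose[OF tX morphism_compose[OF YX.morphism_fst morphism_inclusion[OF sX]]])
    have t2: "regular_tuple ?Z n k 0 (\<lambda>z. snd z)"
      by (rule regular_tuple_compose[OF tX YX.morphism_snd])
    \<comment> \<open>The only possible change of frame, read off from the blocks
      \<open>B h\<close>.\<close>
    let ?C = "\<lambda>z. mat_inv (B h (fst z)) * B h (snd z)"
    have dZ: "det (B h (fst z)) \<noteq> 0" if "z \<in> pts ?Z" for z using that Ut[OF h] unfolding pZ by auto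
    have "closedin (zar ?Z) {z\<in>pts ?Z. ?M (snd z) = ?M (fst z) * ?C z}"
      by (intro Z.closed_mat_eq[of n k] Z.regular_mat_mult[of _ k] Z.regular_mat_inv dZ regM regB h YX.prod_swf t1 t2)
    moreover have "?M (snd z) = ?M (fst z) * ?C z \<longleftrightarrow> ?\<pi> (fst z) = ?\<pi> (snd z)" if z: "z \<in> U h \<times> ?F" for z
    proof -
      obtain x y where xy: "z = (x, y)" "x \<in> U h" "y \<in> ?F" using z by blast
      note xU = Ut[OF h xy(2)] and yF = Ft[OF xy(3)]
      note Bx = Bc[OF h xU(1)] and By = Bc[OF h yF(1)]
      have Cc: "?C z \<in> carrier_mat k k" using iB(1)[OF h xU(1)] By by (simp add: xy)
      have "?M y = ?M x * ?C z \<longleftrightarrow> ?\<pi> x = ?\<pi> y"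
      proof
        assume eq: "?M y = ?M x * ?C z"
        have "mat_injective (?C z)" using mat_injective_factor[OF vec_mat_carrier[OF xU(1)] Cc] yF(2) eq by simp
        then show "?\<pi> x = ?\<pi> y" unfolding \<pi>_iff[OF xU(3) xy(3)] using Cc mat_injective_square[OF Cc] eq by blast
      next
        assume "?\<pi> x = ?\<pi> y"
        then obtain C where C: "C \<in> carrier_mat k k" "?M y = ?M x * C" using \<pi>_iff[OF xU(3) xy(3)] by blast
        have "y = right_act n C x" by (rule eqR[OF xU(1) yF(1) C])
        then have "?C z = mat_inv (B h x) * (B h x * C)" using B_right[OF h xU(1) C(1)] by (simp add: xy)
        also have "\<dots> = mat_inv (B h x) * B h x * C" by (rule assoc_mult_mat[OF iB(1)[OF h xU(1)] Bx C(1), symmetric])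
        also have "\<dots> = C" using iB(3)[OF h xU(1,2)] C(1) by simp
        finally show "?M y = ?M x * ?C z" using C(2) by simp
      qed
      then show ?thesis by (simp add: xy)
    qed
    ultimately show "closedin (zar ?Z) {z \<in> U h \<times> pts ?X. ?\<pi> (fst z) = ?\<pi> (snd z)}"
      unfolding pZ pts_frame_tuples by (simp cong: conj_cong)
  qed
  \<comment> \<open>Both quotients have the subspaces themselves as points, and the isomorphism is
    the identity on them.\<close>
  have iso: "iso_spaces Q (grassmannian k n)" unfolding grassmannian_def
    by (rule quotient_iso[OF sX frame_swf frame_morphisms(2,1)]) (use frame_tuples_eq in auto)
  have sG: "space_with_functions (grassmannian k n :: ('k, _) space)"
    unfolding grassmannian_def by (rule quotient_swf[OF frame_swf])
  show vG: "variety (grassmannian k n :: ('k, _) space)" by (rule variety_iso[OF variety_quotient sG iso])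
  have "var_class ?X = var_class (GL_space k :: ('k, _) space) * var_class Q"
  proof (rule var_class_quotient[OF variety_GL, where act = "right_act n" and \<gamma> = B])
    note sL = variety_swf[OF variety_GL, of k]
    interpret GX: two_spaces "GL_space k :: ('k, _) space" ?X using sX sL by (simp add: two_spaces_def)
    let ?Z = "prod_space (GL_space k) ?X"
    have t: "regular_tuple ?Z n k 0 (\<lambda>z. snd z)" by (rule regular_tuple_compose[OF tX GX.morphism_snd])
    have g: "regular_mat ?Z k k (\<lambda>z. fst z)" by (rule regular_mat_compose[OF regular_GL_space GX.morphism_fst])
    show "morphism ?Z ?X (\<lambda>z. right_act n (fst z) (snd z))"
      by (intro morR GX.prod_swf g t) (auto simp: GX.pts_prod pts_GL_space pts_frame_tuples)
  next
    fix g :: "'k mat" and x :: "'k tuple" assume "g \<in> pts (GL_space k)" "x \<in> pts ?X"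
    then show "?\<pi> (right_act n g x) = ?\<pi> x" using \<pi>R[of x g] by (auto simp: pts_GL_space pts_frame_tuples)
  next
    fix h assume "h \<in> N"
    then have h: "h \<in> H" using NH by blast
    let ?Y = "sub_space ?X (U h)"
    have sY: "space_with_functions ?Y" by (rule induced_swf[OF sX])
    have tY: "regular_tuple ?Y n k 0 (\<lambda>x. x)" by (rule regular_tuple_compose[OF tX morphism_inclusion[OF sX]])
    show "morphism ?Y (GL_space k) (B h)"
      by (rule morphism_GL_space[OF sY regB[OF sY tY h]]) (use Ut[OF h] in \<open>auto simp: pts_sub\<close>)
    fix x assume x: "x \<in> U h"
    note xU = Ut[OF h x]
    show "right_act n (B h x) (right_act n (mat_inv (B h x)) x) = x"
      using RR[OF xU(1) iB(1)[OF h xU(1)] Bc[OF h xU(1)]] iB(3)[OF h xU(1,2)] R1[OF xU(1)] by simp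
    fix g :: "'k mat" assume "g \<in> pts (GL_space k)"
    then have g: "g \<in> carrier_mat k k" by (auto simp: pts_GL_space)
    have "B h (right_act n (mat_inv (B h x)) x) = 1\<^sub>m k"
      using B_right[OF h xU(1) iB(1)[OF h xU(1)]] iB(2)[OF h xU(1,2)] by simp
    then show "B h (right_act n g (right_act n (mat_inv (B h x)) x)) = g"
      using B_right[OF h right_act(1)[OF xU(1) iB(1)[OF h xU(1)]] g] g by simp
  qed
  then show "var_class ?X = var_class (GL_space k :: ('k, _) space) * var_class (grassmannian k n :: ('k, _) space)"
    using var_class_iso[OF variety_quotient vG iso] by simp
qed

section \<open>Classes of the rank strata\<close>

lemma det_block_lower:
  fixes G :: "'k::field mat"
  assumes G: "G \<in> carrier_mat (k + m) (k + m)" and z: "\<And>i j. i < m \<Longrightarrow> j < k \<Longrightarrow> G $$ (k + i, j) = 0"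
  shows "det G = det (mat k k (\<lambda>(i, j). G $$ (i, j))) * det (mat m m (\<lambda>(i, j). G $$ (k + i, k + j)))"
proof -
  have "G = four_block_mat (mat k k (\<lambda>(i, j). G $$ (i, j))) (mat k m (\<lambda>(i, j). G $$ (i, k + j)))
     (0\<^sub>m m k) (mat m m (\<lambda>(i, j). G $$ (k + i, k + j)))" (is "G = ?F")
  proof (rule eq_matI)
    fix i j assume "i < dim_row ?F" "j < dim_col ?F"
    then show "G $$ (i, j) = ?F $$ (i, j)" using z[of "i - k" j] by (auto simp: not_less)
  qed (use G in auto)
  then have "det G = det ?F" by simp
  also have "\<dots> = det (mat k k (\<lambda>(i, j). G $$ (i, j))) * det (mat m m (\<lambda>(i, j). G $$ (k + i, k + j)))"
    by (rule det_four_block_mat_lower_left_zero) auto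
  finally show ?thesis .
qed

lemma incl_mat_mult:
  assumes A: "A \<in> carrier_mat k l"
  shows "incl_mat n k * A = mat n l (\<lambda>(i, j). if i < k then A $$ (i, j) else 0)"
proof (rule eq_matI)
  fix i j assume "i < dim_row (mat n l (\<lambda>(i, j). if i < k then A $$ (i, j) else 0))"
    "j < dim_col (mat n l (\<lambda>(i, j). if i < k then A $$ (i, j) else 0))"
  then have ij: "i < n" "j < l" by auto
  have "(incl_mat n k * A) $$ (i, j) = (\<Sum>c<k. (if i = c then 1 else 0) * A $$ (c, j))"
    using ij A by (auto simp: incl_mat_def scalar_prod_def atLeast0LessThan intro!: sum.cong)
  also have "\<dots> = (\<Sum>c<k. if i = c then A $$ (c, j) else 0)" by (rule sum.cong) auto
  finally show "(incl_mat n k * A) $$ (i, j) = mat n l (\<lambda>(i, j). if i < k then A $$ (i, j) else 0) $$ (i, j)" using ij by simp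
qed (use A in auto)

text \<open>The upper left blocks come from \<open>y\<close>, the lower left ones vanish, and
  \<open>e\<close> lists the last \<open>m\<close> columns of the endomorphisms row by row. For
  stable \<open>y\<close> these are exactly the tuples whose generated subspace is spanned by the
  first \<open>k\<close> unit vectors.\<close>

definition block_tuple :: "nat \<Rightarrow> nat \<Rightarrow> nat \<Rightarrow> nat \<Rightarrow> 'k::field tuple \<Rightarrow> 'k list \<Rightarrow> 'k tuple" where
  "block_tuple k m r d y e =
    (map (\<lambda>a. mat (k + m) (k + m) (\<lambda>(i, j). if j < k then if i < k then fst y ! a $$ (i, j) else 0
       else e ! (a * ((k + m) * m) + (i * m + (j - k))))) [0..<d],
     map (\<lambda>l. vec (k + m) (\<lambda>i. if i < k then snd y ! l $ i else 0)) [0..<r])"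

definition top_tuple :: "nat \<Rightarrow> 'k::field tuple \<Rightarrow> 'k tuple" where
  "top_tuple k x = (map (\<lambda>T. mat k k (\<lambda>(i, j). T $$ (i, j))) (fst x), map (\<lambda>v. vec k (\<lambda>i. v $ i)) (snd x))"

definition side_entries :: "nat \<Rightarrow> nat \<Rightarrow> nat \<Rightarrow> 'k::field tuple \<Rightarrow> 'k list" where
  "side_entries k m d x = map (\<lambda>q. fst x ! (q div ((k + m) * m)) $$ (q mod ((k + m) * m) div m, k + q mod ((k + m) * m) mod m))
     [0..<d * ((k + m) * m)]"

lemma nested_index_less:
  assumes "a < d" "i < n" "j < (m::nat)"
  shows "a * (n * m) + (i * m + j) < d * (n * m)" "i * m + j < n * m"
proof -
  have "i * m + j < Suc i * m" using assms by simp
  also have "\<dots> \<le> n * m" using assms by (intro mult_le_mono1) simp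
  finally show 1: "i * m + j < n * m" .
  then have "a * (n * m) + (i * m + j) < Suc a * (n * m)" by simp
  also have "\<dots> \<le> d * (n * m)" using assms by (intro mult_le_mono1) simp
  finally show "a * (n * m) + (i * m + j) < d * (n * m)" .
qed

lemma nested_index_div_mod:
  assumes "i < n" "j < (m::nat)"
  shows "(a * (n * m) + (i * m + j)) div (n * m) = a" "(a * (n * m) + (i * m + j)) mod (n * m) div m = i"
    "(a * (n * m) + (i * m + j)) mod (n * m) mod m = j"
proof -
  have l: "i * m + j < n * m" using nested_index_less(2)[of 0 1 i n j m] assms by simp
  have nm: "n * m \<noteq> 0" using assms by auto
  have "(i * m + j + a * (n * m)) div (n * m) = (i * m + j) div (n * m) + a" by (rule div_mult_self1[OF nm, THEN trans]) simp
  then show "(a * (n * m) + (i * m + j)) div (n * m) = a" using l by (simp add: add.commute)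
  have md: "(a * (n * m) + (i * m + j)) mod (n * m) = i * m + j" using l by simp
  show "(a * (n * m) + (i * m + j)) mod (n * m) div m = i" unfolding md using assms by simp
  show "(a * (n * m) + (i * m + j)) mod (n * m) mod m = j" unfolding md using assms by simp
qed

lemma nested_index_cases:
  assumes "q < d * (n * (m::nat))"
  obtains a i j where "a < d" "i < n" "j < m" "q = a * (n * m) + (i * m + j)"
proof -
  note dm = index_div_mod[OF assms]
  then have "q mod (n * m) < n * m" by blast
  note dm' = index_div_mod[OF this]
  show thesis
    by (rule that[of "q div (n * m)" "q mod (n * m) div m" "q mod (n * m) mod m"]) (use dm dm' in auto)
qed

lemma length_side_entries: "length (side_entries k m d x) = d * ((k + m) * m)"
  by (simp add: side_entries_def)

lemma side_entries_nth:
  assumes "a < d" "i < k + m" "j < m"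
  shows "side_entries k m d x ! (a * ((k + m) * m) + (i * m + j)) = fst x ! a $$ (i, k + j)"
  using nested_index_less(1)[OF assms] nested_index_div_mod[OF assms(2,3), of a] by (simp add: side_entries_def)

lemma nth_map_upt_0: "i < n \<Longrightarrow> map f [0..<n] ! i = f i"
  by simp

lemma block_tuple_nth:
  "a < d \<Longrightarrow> fst (block_tuple k m r d y e) ! a = mat (k + m) (k + m) (\<lambda>(i, j). if j < k then if i < k then fst y ! a $$ (i, j) else 0
       else e ! (a * ((k + m) * m) + (i * m + (j - k))))"
  "l < r \<Longrightarrow> snd (block_tuple k m r d y e) ! l = vec (k + m) (\<lambda>i. if i < k then snd y ! l $ i else 0)"
  unfolding block_tuple_def fst_conv snd_conv by (rule nth_map_upt_0, assumption)+

lemma block_tuple_carrier: "block_tuple k m r d y e \<in> tuples (k + m) r d"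
  by (auto simp: block_tuple_def tuples_def)

lemma top_tuple_carrier: "x \<in> tuples n r d \<Longrightarrow> top_tuple k x \<in> tuples k r d"
  by (auto simp: top_tuple_def tuples_def)

lemma intertwines_block:
  assumes y: "y \<in> tuples k r d"
  shows "intertwines r d (incl_mat (k + m) k) y (block_tuple k m r d y e)"
  unfolding intertwines_def
proof (intro conjI allI impI)
  fix a assume a: "a < d"
  have T: "fst (block_tuple k m r d y e) ! a \<in> carrier_mat (k + m) (k + m)" by (rule tuplesD(3)[OF block_tuple_carrier a])
  show "fst (block_tuple k m r d y e) ! a * incl_mat (k + m) k = incl_mat (k + m) k * fst y ! a"
    unfolding mult_incl_mat[OF T le_add1] incl_mat_mult[OF tuplesD(3)[OF y a]]
    by (rule eq_matI) (use a in \<open>auto simp: block_tuple_def\<close>)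
next
  fix l assume l: "l < r"
  show "snd (block_tuple k m r d y e) ! l = incl_mat (k + m) k *\<^sub>v snd y ! l"
    unfolding incl_mat_mult_vec[OF tuplesD(4)[OF y l]] using l by (simp add: block_tuple_nth)
qed

lemma top_block:
  assumes y: "y \<in> tuples k r d"
  shows "top_tuple k (block_tuple k m r d y e) = y"
proof (rule tuple_eqI[OF top_tuple_carrier[OF block_tuple_carrier] y])
  fix a assume a: "a < d"
  show "fst (top_tuple k (block_tuple k m r d y e)) ! a = fst y ! a"
    by (rule eq_matI) (use a tuplesD(3)[OF y a] in \<open>auto simp: top_tuple_def block_tuple_def\<close>)
next
  fix l assume l: "l < r"
  show "snd (top_tuple k (block_tuple k m r d y e)) ! l = snd y ! l"
    by (rule eq_vecI) (use l tuplesD(4)[OF y l] in \<open>auto simp: top_tuple_def block_tuple_def\<close>)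
qed

lemma side_block:
  assumes e: "length e = d * ((k + m) * m)"
  shows "side_entries k m d (block_tuple k m r d y e) = e"
proof (rule nth_equalityI)
  fix q assume "q < length (side_entries k m d (block_tuple k m r d y e))"
  then have "q < d * ((k + m) * m)" by (simp add: length_side_entries)
  then obtain a i j where q: "a < d" "i < k + m" "j < m" "q = a * ((k + m) * m) + (i * m + j)" by (rule nested_index_cases)
  show "side_entries k m d (block_tuple k m r d y e) ! q = e ! q"
    unfolding q(4) side_entries_nth[OF q(1,2,3)] using q by (simp add: block_tuple_def)
qed (simp add: e length_side_entries)

text \<open>To intertwine the standard inclusion means that the first \<open>k\<close> columns of
  the endomorphisms, and the vectors, are those of \<open>y\<close> padded by zeros. The remaining
  columns are arbitrary and are returned by \<open>side_entries\<close>.\<close>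

lemma intertwines_incl_block:
  assumes x: "x \<in> tuples (k + m) r d" and y: "y \<in> tuples k r d" and i: "intertwines r d (incl_mat (k + m) k) y x"
  shows "x = block_tuple k m r d y (side_entries k m d x)" "top_tuple k x = y"
proof -
  show e: "x = block_tuple k m r d y (side_entries k m d x)"
  proof (rule tuple_eqI[OF x block_tuple_carrier])
    fix a assume a: "a < d"
    note T = tuplesD(3)[OF x a]
    have eq: "mat (k + m) k (\<lambda>(i, j). fst x ! a $$ (i, j)) = mat (k + m) k (\<lambda>(i, j). if i < k then fst y ! a $$ (i, j) else 0)"
      using i a unfolding intertwines_def mult_incl_mat[OF T le_add1, symmetric] incl_mat_mult[OF tuplesD(3)[OF y a], symmetric] by simp
    have left: "fst x ! a $$ (i, j) = (if i < k then fst y ! a $$ (i, j) else 0)" if "i < k + m" "j < k" for i j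
      using arg_cong[OF eq, of "\<lambda>A. A $$ (i, j)"] that by simp
    have right: "fst x ! a $$ (i, j) = side_entries k m d x ! (a * ((k + m) * m) + (i * m + (j - k)))"
      if "i < k + m" "j < k + m" "\<not> j < k" for i j
      using side_entries_nth[OF a that(1), of "j - k" x] that by simp
    show "fst x ! a = fst (block_tuple k m r d y (side_entries k m d x)) ! a"
      by (rule eq_matI) (use a T left right in \<open>auto simp: block_tuple_def\<close>)
  next
    fix l assume l: "l < r"
    then have "snd x ! l = incl_mat (k + m) k *\<^sub>v snd y ! l" using i by (simp add: intertwines_def)
    then show "snd x ! l = snd (block_tuple k m r d y (side_entries k m d x)) ! l"
      using l incl_mat_mult_vec[OF tuplesD(4)[OF y l], of "k + m"] by (simp add: block_tuple_nth)
  qed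
  show "top_tuple k x = y" by (subst e) (rule top_block[OF y])
qed

lemma regular_block_tuple:
  fixes X :: "('k::field, 'p) space"
  assumes X: "space_with_functions X" and y: "regular_tuple X k r d y" and e: "morphism X (affine_space (d * ((k + m) * m))) e"
  shows "regular_tuple X (k + m) r d (\<lambda>x. block_tuple k m r d (y x) (e x))"
  unfolding regular_tuple_def
proof (intro conjI ballI allI impI block_tuple_carrier)
  interpret X: space_with_functions X by fact
  { fix a assume a: "a < d"
    have "regular_mat X (k + m) (k + m) (\<lambda>x. mat (k + m) (k + m) (\<lambda>(i, j). if j < k then if i < k then fst (y x) ! a $$ (i, j) else 0
       else e x ! (a * ((k + m) * m) + (i * m + (j - k)))))"
    proof (rule X.regular_mat_mat)
      fix i j assume ij: "i < k + m" "j < k + m"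
      consider "j < k" "i < k" | "j < k" "\<not> i < k" | "\<not> j < k" by blast
      then show "(\<lambda>x. if j < k then if i < k then fst (y x) ! a $$ (i, j) else 0
         else e x ! (a * ((k + m) * m) + (i * m + (j - k)))) \<in> reg X (pts X)"
      proof cases
        case 1 then show ?thesis using regular_matD(2)[OF regular_tupleD(2)[OF y a]] by simp
      next
        case 2 then show ?thesis by (simp add: X.const)
      next
        case 3
        then have "a * ((k + m) * m) + (i * m + (j - k)) < d * ((k + m) * m)" using nested_index_less(1)[OF a ij(1), of "j - k" m] ij by simp
        from morphism_reg[OF e coord_reg[OF this]] show ?thesis using 3 by simp
      qed
    qed
    then show "regular_mat X (k + m) (k + m) (\<lambda>x. fst (block_tuple k m r d (y x) (e x)) ! a)" using a by (simp add: block_tuple_nth) }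
  { fix l assume l: "l < r"
    have "regular_vec X (k + m) (\<lambda>x. vec (k + m) (\<lambda>i. if i < k then snd (y x) ! l $ i else 0))"
    proof (rule X.regular_vec_vec)
      fix i
      show "(\<lambda>x. if i < k then snd (y x) ! l $ i else 0) \<in> reg X (pts X)"
        using regular_vecD(2)[OF regular_tupleD(3)[OF y l]] X.const by (cases "i < k") auto
    qed
    then show "regular_vec X (k + m) (\<lambda>x. snd (block_tuple k m r d (y x) (e x)) ! l)" using l by (simp add: block_tuple_nth) }
qed

lemma regular_top_tuple:
  fixes X :: "('k::field, 'p) space"
  assumes X: "space_with_functions X" and t: "regular_tuple X (k + m) r d t"
  shows "regular_tuple X k r d (\<lambda>x. top_tuple k (t x))"
  unfolding regular_tuple_def
proof (intro conjI ballI allI impI)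
  interpret X: space_with_functions X by fact
  note tt = regular_tupleD(1)[OF t]
  { fix x assume "x \<in> pts X" then show "top_tuple k (t x) \<in> tuples k r d" by (rule top_tuple_carrier[OF tt]) }
  { fix a assume a: "a < d"
    have "regular_mat X k k (\<lambda>x. mat k k (\<lambda>(i, j). fst (t x) ! a $$ (i, j)))"
      by (intro X.regular_mat_mat regular_matD(2)[OF regular_tupleD(2)[OF t a]]) auto
    then show "regular_mat X k k (\<lambda>x. fst (top_tuple k (t x)) ! a)"
      by (rule X.regular_mat_cong) (use tuplesD(1)[OF tt] a in \<open>simp add: top_tuple_def\<close>) }
  { fix l assume l: "l < r"
    have "regular_vec X k (\<lambda>x. vec k (\<lambda>i. snd (t x) ! l $ i))"
      by (intro X.regular_vec_vec regular_vecD(2)[OF regular_tupleD(3)[OF t l]]) auto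
    then show "regular_vec X k (\<lambda>x. snd (top_tuple k (t x)) ! l)"
      by (rule X.regular_vec_cong) (use tuplesD(2)[OF tt] l in \<open>simp add: top_tuple_def\<close>) }
qed

lemma morphism_side_entries:
  fixes X :: "('k::field, 'p) space"
  assumes X: "space_with_functions X" and t: "regular_tuple X (k + m) r d t"
  shows "morphism X (affine_space (d * ((k + m) * m))) (\<lambda>x. side_entries k m d (t x))"
proof (rule morphism_affine[OF X])
  fix q assume "q < d * ((k + m) * m)"
  then obtain a i j where q: "a < d" "i < k + m" "j < m" "q = a * ((k + m) * m) + (i * m + j)" by (rule nested_index_cases)
  have "(\<lambda>x. fst (t x) ! a $$ (i, k + j)) \<in> reg X (pts X)"
    by (rule regular_matD(2)[OF regular_tupleD(2)[OF t q(1)] q(2)]) (use q in simp)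
  then show "(\<lambda>x. side_entries k m d (t x) ! q) \<in> reg X (pts X)"
    unfolding q(4) side_entries_nth[OF q(1-3)] .
qed (simp add: length_side_entries)

subsection \<open>The parabolic subgroup\<close>

text \<open>The stabiliser of the span of the first \<open>k\<close> unit vectors.\<close>

definition parabolic :: "nat \<Rightarrow> nat \<Rightarrow> ('k::field, 'k mat) space" where
  "parabolic k m = sub_space (GL_space (k + m)) {p. \<forall>i\<in>{..<m}. \<forall>j\<in>{..<k}. p $$ (k + i, j) = 0}"

lemma variety_parabolic: "variety (parabolic k m :: ('k::field, _) space)"
proof -
  interpret space_with_functions "GL_space (k + m) :: ('k, _) space" by (rule GL_swf)
  let ?P = "{p. \<forall>i\<in>{..<m}. \<forall>j\<in>{..<k}. p $$ (k + i, j) = 0} :: 'k mat set"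
  have "closedin (zar (GL_space (k + m))) {p\<in>pts (GL_space (k + m)). \<forall>i\<in>{..<m}. \<forall>j\<in>{..<k}. p $$ (k + i, j) = (0::'k)}"
    by (intro closed_ball closed_eq regular_matD(2)[OF regular_GL_space] const) auto
  then have "variety (sub_space (GL_space (k + m)) {p\<in>pts (GL_space (k + m)). \<forall>i\<in>{..<m}. \<forall>j\<in>{..<k}. p $$ (k + i, j) = (0::'k)})"
    by (rule variety_closed[OF variety_GL])
  also have "sub_space (GL_space (k + m)) {p\<in>pts (GL_space (k + m)). \<forall>i\<in>{..<m}. \<forall>j\<in>{..<k}. p $$ (k + i, j) = (0::'k)} = parabolic k m"
    unfolding parabolic_def by (rule sub_space_cong) blast
  finally show ?thesis .
qed

lemma pts_parabolic:
  "p \<in> pts (parabolic k m) \<longleftrightarrow> p \<in> carrier_mat (k + m) (k + m) \<and> det p \<noteq> 0 \<and> (\<forall>i<m. \<forall>j<k. p $$ (k + i, j) = (0 :: 'k::field))"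
  by (auto simp: parabolic_def pts_sub pts_GL_space)

lemma morphism_parabolic:
  fixes X :: "('k::field, 'p) space"
  assumes "space_with_functions X" "regular_mat X (k + m) (k + m) M" "\<And>x. x \<in> pts X \<Longrightarrow> M x \<in> pts (parabolic k m)"
  shows "morphism X (parabolic k m) M"
proof -
  have "M x \<in> {p. \<forall>i\<in>{..<m}. \<forall>j\<in>{..<k}. p $$ (k + i, j) = 0}" "det (M x) \<noteq> 0" if "x \<in> pts X" for x
    using assms(3)[OF that] by (auto simp: pts_parabolic)
  then show ?thesis unfolding parabolic_def by (intro morphism_into_sub morphism_GL_space assms(1,2))
qed

lemma var_class_affine: "var_class (affine_space N :: ('k::alg_closed_field, _) space) = var_class (affine_space 1 :: ('k, 'k list) space) ^ N"
proof (induction N)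
  case 0
  show ?case using var_class_point by simp
next
  case (Suc N)
  let ?A = "\<lambda>N. affine_space N :: ('k, 'k list) space"
  have "var_class (prod_space (?A 1) (?A N)) = var_class (?A (1 + N))"
    by (intro var_class_iso variety_prod variety_affine_space iso_prod_affine)
  then show ?case using Suc by (simp add: var_class_prod[OF variety_affine_space variety_affine_space])
qed

text \<open>As a variety, though not as a group, it is the product of the two diagonal blocks and
  the unrestricted upper right block.\<close>

lemma var_class_parabolic:
  "var_class (parabolic k m :: ('k::alg_closed_field, _) space) =
    var_class (GL_space k :: ('k, _) space) * (var_class (GL_space m :: ('k, _) space) * var_class (affine_space 1 :: ('k, 'k list) space) ^ (k * m))"
proof -
  let ?P = "parabolic k m :: ('k, _) space"
  let ?A = "affine_space (k * m) :: ('k, 'k list) space"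
  let ?K = "GL_space k :: ('k, _) space" and ?M = "GL_space m :: ('k, _) space"
  note sP = variety_swf[OF variety_parabolic, of k m]
  interpret MA: two_spaces ?M ?A by (simp add: two_spaces_def GL_swf affine_swf)
  interpret KMA: two_spaces ?K "prod_space ?M ?A" by (simp add: two_spaces_def GL_swf MA.prod_swf)
  interpret P: space_with_functions ?P by (rule sP)
  let ?Z = "prod_space ?K (prod_space ?M ?A)"
  interpret Z: space_with_functions ?Z by (rule KMA.prod_swf)
  define f where "f p = (mat k k (\<lambda>(i, j). p $$ (i, j)), (mat m m (\<lambda>(i, j). p $$ (k + i, k + j)),
     map (\<lambda>q. p $$ (q div m, k + q mod m)) [0..<k * m]))" for p :: "'k mat"
  define g where "g z = mat (k + m) (k + m) (\<lambda>(i, j). if j < k then if i < k then fst z $$ (i, j) else 0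
     else if i < k then snd (snd z) ! (i * m + (j - k)) else fst (snd z) $$ (i - k, j - k))" for z :: "'k mat \<times> 'k mat \<times> 'k list"
  have rP: "regular_mat ?P (k + m) (k + m) (\<lambda>p. p)" unfolding parabolic_def
    by (rule regular_mat_compose[OF regular_GL_space morphism_inclusion[OF GL_swf]])
  have detp: "det p = det (fst (f p)) * det (fst (snd (f p)))" if "p \<in> pts ?P" for p
    using det_block_lower[of p k m] that by (simp add: f_def pts_parabolic)
  have mf: "morphism ?P ?Z (\<lambda>p. (fst (f p), (fst (snd (f p)), snd (snd (f p)))))"
  proof (intro KMA.morphism_pair MA.morphism_pair sP morphism_GL_space)
    show "regular_mat ?P k k (\<lambda>p. fst (f p))" unfolding f_def fst_conv
      by (intro P.regular_mat_mat regular_matD(2)[OF rP]) auto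
    show "regular_mat ?P m m (\<lambda>p. fst (snd (f p)))" unfolding f_def fst_conv snd_conv
      by (intro P.regular_mat_mat regular_matD(2)[OF rP]) auto
    fix p assume p: "p \<in> pts ?P"
    then have "det p \<noteq> 0" by (simp add: pts_parabolic)
    then show "det (fst (f p)) \<noteq> 0" "det (fst (snd (f p))) \<noteq> 0" using detp[OF p] by auto
  next
    show "morphism ?P ?A (\<lambda>p. snd (snd (f p)))"
    proof (rule morphism_affine[OF sP])
      fix q assume q: "q < k * m"
      have "(\<lambda>p. p $$ (q div m, k + q mod m)) \<in> reg ?P (pts ?P)"
        by (rule regular_matD(2)[OF rP]) (use index_div_mod[OF q] in auto)
      then show "(\<lambda>p. snd (snd (f p)) ! q) \<in> reg ?P (pts ?P)" using q by (simp add: f_def)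
    qed (simp add: f_def)
  qed
  have pZ: "pts ?Z = {z. fst z \<in> carrier_mat k k \<and> det (fst z) \<noteq> 0 \<and> fst (snd z) \<in> carrier_mat m m \<and> det (fst (snd z)) \<noteq> 0
     \<and> length (snd (snd z)) = k * m}"
    by (auto simp: KMA.pts_prod MA.pts_prod pts_GL_space pts_affine)
  have gblocks: "mat k k (\<lambda>(i, j). g z $$ (i, j)) = fst z" "mat m m (\<lambda>(i, j). g z $$ (k + i, k + j)) = fst (snd z)"
    if "z \<in> pts ?Z" for z using that by (auto simp: g_def pZ intro!: eq_matI)
  have gP: "g z \<in> pts ?P" if "z \<in> pts ?Z" for z
  proof -
    have c: "g z \<in> carrier_mat (k + m) (k + m)" by (simp add: g_def)
    have z: "g z $$ (k + i, j) = 0" if "i < m" "j < k" for i j using that by (simp add: g_def)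
    have "det (g z) \<noteq> 0" using det_block_lower[OF c z] gblocks[OF that] that by (auto simp: pZ)
    then show ?thesis using c z by (simp add: pts_parabolic)
  qed
  have r1: "regular_mat ?Z k k fst" by (rule regular_mat_compose[OF regular_GL_space KMA.morphism_fst])
  have r2: "regular_mat ?Z m m (\<lambda>z. fst (snd z))"
    by (rule regular_mat_compose[OF regular_GL_space morphism_compose[OF KMA.morphism_snd MA.morphism_fst]])
  have r3: "(\<lambda>z. snd (snd z) ! q) \<in> reg ?Z (pts ?Z)" if "q < k * m" for q
    by (rule morphism_reg[OF morphism_compose[OF KMA.morphism_snd MA.morphism_snd] coord_reg[OF that]])
  have mg: "morphism ?Z ?P g"
  proof (rule morphism_parabolic[OF KMA.prod_swf _ gP])
    show "regular_mat ?Z (k + m) (k + m) g" unfolding g_def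
    proof (rule Z.regular_mat_mat)
      fix i j assume ij: "i < k + m" "j < k + m"
      consider "j < k" "i < k" | "j < k" "\<not> i < k" | "\<not> j < k" "i < k" | "\<not> j < k" "\<not> i < k" by blast
      then show "(\<lambda>z. if j < k then if i < k then fst z $$ (i, j) else 0
         else if i < k then snd (snd z) ! (i * m + (j - k)) else fst (snd z) $$ (i - k, j - k)) \<in> reg ?Z (pts ?Z)"
      proof cases
        case 1 then show ?thesis using regular_matD(2)[OF r1] by simp
      next
        case 2 then show ?thesis by (simp add: Z.const)
      next
        case 3
        then have "i * m + (j - k) < k * m" using nested_index_less(2)[of 0 1 i k "j - k" m] ij by simp
        from r3[OF this] show ?thesis using 3 by simp
      next
        case 4 then show ?thesis using regular_matD(2)[OF r2, of "i - k" "j - k"] ij by simp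
      qed
    qed
  qed
  have "iso_spaces ?P ?Z"
  proof (rule iso_spacesI[OF mf mg])
    fix p assume p: "p \<in> pts ?P"
    show "g (fst (f p), (fst (snd (f p)), snd (snd (f p)))) = p"
    proof (rule eq_matI)
      fix i j assume "i < dim_row p" "j < dim_col p"
      then have ij: "i < k + m" "j < k + m" using p by (auto simp: pts_parabolic)
      have z: "p $$ (i, j) = 0" if "\<not> i < k" "j < k"
      proof -
        have "p $$ (k + (i - k), j) = 0" using p that ij unfolding pts_parabolic by (metis add_less_cancel_left le_add_diff_inverse not_less)
        then show ?thesis using that by simp
      qed
      have b: "i * m + (j - k) < k * m" "(i * m + (j - k)) div m = i" "(i * m + (j - k)) mod m = j - k" if "i < k" "\<not> j < k"
      proof -
        define c where "c = j - k"
        have c: "c < m" using that ij by (simp add: c_def)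
        show "i * m + (j - k) < k * m" using nested_index_less(2)[of 0 1 i k c m] that c by (simp add: c_def)
        show "(i * m + (j - k)) div m = i" "(i * m + (j - k)) mod m = j - k" unfolding c_def[symmetric] using c by simp_all
      qed
      show "g (fst (f p), (fst (snd (f p)), snd (snd (f p)))) $$ (i, j) = p $$ (i, j)"
        using ij z b by (auto simp: g_def f_def)
    qed (use p in \<open>auto simp: g_def pts_parabolic\<close>)
  next
    fix z assume z: "z \<in> pts ?Z"
    have "map (\<lambda>q. g z $$ (q div m, k + q mod m)) [0..<k * m] = snd (snd z)"
    proof (rule nth_equalityI)
      fix q assume "q < length (map (\<lambda>q. g z $$ (q div m, k + q mod m)) [0..<k * m])"
      then have q: "q < k * m" by simp
      note dm = index_div_mod[OF q]
      show "map (\<lambda>q. g z $$ (q div m, k + q mod m)) [0..<k * m] ! q = snd (snd z) ! q"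
        using q dm by (simp add: g_def)
    qed (use z in \<open>auto simp: pZ\<close>)
    then show "(fst (f (g z)), (fst (snd (f (g z))), snd (snd (f (g z))))) = z"
      using gblocks[OF z] by (simp add: f_def)
  qed
  then have "var_class ?P = var_class ?Z"
    by (intro var_class_iso variety_parabolic variety_prod variety_GL variety_affine_space)
  then show ?thesis
    by (simp add: var_class_prod variety_prod variety_GL variety_affine_space var_class_affine[of "k * m"])
qed

text \<open>The word matrix, extended by the last \<open>m\<close> columns of the inverse of
  \<open>h\<close> to a square matrix. On the stratum within the chart of \<open>(\<nu>, h)\<close>
  it is an invertible frame adapted to the generated subspace and depends regularly on
  \<open>x\<close>.\<close>

definition completed_frame :: "nat \<Rightarrow> nat \<Rightarrow> (nat list \<times> nat) list \<times> 'k::field mat \<Rightarrow> 'k tuple \<Rightarrow> 'k mat" where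
  "completed_frame k m = (\<lambda>(\<nu>, h) x. mat_inv h * mat (k + m) (k + m)
     (\<lambda>(i, j). if j < k then (h * word_mat (k + m) x \<nu>) $$ (i, j) else if i = j then 1 else 0))"

lemma completed_frame:
  fixes x :: "'k::field tuple"
  assumes i: "(\<nu>, h) \<in> chart_index (k + m) r d k" and x: "x \<in> chart (k + m) r d k (\<nu>, h)"
  shows "completed_frame k m (\<nu>, h) x \<in> carrier_mat (k + m) (k + m)"
    and "det (completed_frame k m (\<nu>, h) x) \<noteq> 0"
    and "completed_frame k m (\<nu>, h) x * incl_mat (k + m) k = word_mat (k + m) x \<nu>"
proof -
  let ?n = "k + m"
  have \<nu>: "\<nu> \<in> word_lists r d k" and h: "h \<in> carrier_mat ?n ?n" "det h \<noteq> 0" using i by (auto simp: chart_index_def)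
  note M = word_mat_carrier[OF \<nu>, of ?n x]
  define Z where "Z = h * word_mat ?n x \<nu>"
  have Z: "Z \<in> carrier_mat ?n k" using h M by (simp add: Z_def)
  define G where "G = mat ?n ?n (\<lambda>(i, j). if j < k then Z $$ (i, j) else if i = j then 1 else 0)"
  have G: "G \<in> carrier_mat ?n ?n" by (simp add: G_def)
  have f: "completed_frame k m (\<nu>, h) x = mat_inv h * G" by (simp only: completed_frame_def G_def Z_def prod.case)
  note ih = mat_inv(1)[OF h(1)]
  show "completed_frame k m (\<nu>, h) x \<in> carrier_mat ?n ?n" using ih G by (simp add: f)
  have T: "(incl_mat ?n k)\<^sup>T * Z = mat k k (\<lambda>(i, j). Z $$ (i, j))" by (rule transpose_incl_mult[OF Z]) simp
  \<comment> \<open>Block lower triangular, with the block that the chart makes invertible and an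
    identity block on the diagonal.\<close>
  have "G = four_block_mat (mat k k (\<lambda>(i, j). Z $$ (i, j))) (0\<^sub>m k m) (mat m k (\<lambda>(i, j). Z $$ (k + i, j))) (1\<^sub>m m)" (is "G = ?F")
    by (rule eq_matI) (auto simp: G_def)
  then have "det G = det ?F" by simp
  also have "\<dots> = det (mat k k (\<lambda>(i, j). Z $$ (i, j))) * det (1\<^sub>m m :: 'k mat)"
    by (rule det_four_block_mat_upper_right_zero) auto
  finally have "det G \<noteq> 0" using x T by (simp add: chart_def Z_def)
  then show "det (completed_frame k m (\<nu>, h) x) \<noteq> 0"
    unfolding f det_mult[OF ih G] using det_mat_inv[OF h] by simp
  have "G * incl_mat ?n k = Z" unfolding mult_incl_mat[OF G le_add1]
    by (rule eq_matI) (use Z in \<open>auto simp: G_def\<close>)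
  then have "completed_frame k m (\<nu>, h) x * incl_mat ?n k = mat_inv h * Z"
    unfolding f using assoc_mult_mat[OF ih G incl_mat_carrier(1)] by simp
  also have "\<dots> = mat_inv h * h * word_mat ?n x \<nu>"
    unfolding Z_def by (rule assoc_mult_mat[OF ih h(1) M, symmetric])
  also have "\<dots> = word_mat ?n x \<nu>" using mat_inv(3)[OF h] M by simp
  finally show "completed_frame k m (\<nu>, h) x * incl_mat ?n k = word_mat ?n x \<nu>" .
qed

lemma chart_injective:
  assumes i: "(\<nu>, h) \<in> chart_index n r d k" and x: "x \<in> chart n r d k (\<nu>, h)"
  shows "mat_injective (word_mat n x \<nu>)"
proof -
  have \<nu>: "\<nu> \<in> word_lists r d k" and h: "h \<in> carrier_mat n n" using i by (auto simp: chart_index_def)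
  have "mat_injective (h * word_mat n x \<nu>)"
    by (rule left_inverse_injective[of "(incl_mat n k)\<^sup>T" k n]) (use x h word_mat_carrier[OF \<nu>, of n x] in \<open>auto simp: chart_def\<close>)
  then show ?thesis using mat_injective_factor[OF h word_mat_carrier[OF \<nu>]] by blast
qed

section \<open>The bundle over a stratum\<close>

definition stratum_space :: "nat \<Rightarrow> nat \<Rightarrow> nat \<Rightarrow> nat \<Rightarrow> ('k::field, 'k tuple) space" where
  "stratum_space n r d k = sub_space (tuple_space n r d) (stratum n r d k)"

lemma locally_closed_stratum: "locally_closed (tuple_space n r d) (stratum n r d k :: 'k::field tuple set)"
  unfolding stratum_def by (intro locally_closed_Diff locally_closed_open open_rank_ge)

lemma variety_stratum: "variety (stratum_space n r d k :: ('k::field, _) space)"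
  unfolding stratum_space_def by (intro variety_locally_closed variety_tuple locally_closed_stratum)

lemma stratum_subset: "stratum n r d k \<subseteq> tuples n r d"
  unfolding stratum_def using rank_ge_subset by blast

lemma pts_stratum_space: "pts (stratum_space n r d k) = stratum n r d k"
  unfolding stratum_space_def pts_sub pts_tuple_space using stratum_subset by blast

lemma regular_stratum: "regular_tuple (stratum_space n r d k) n r d (\<lambda>x. x)"
  unfolding stratum_space_def by (rule regular_tuple_compose[OF regular_tuple_space morphism_inclusion[OF tuple_swf]])

text \<open>The first \<open>k\<close> columns of \<open>p\<close> stay in the span of the first
  \<open>k\<close> unit vectors; \<open>q\<close> is the upper left block.\<close>

lemma parabolic_incl:
  fixes p :: "'k::field mat"
  assumes p: "p \<in> pts (parabolic k m)"
  shows "\<exists>q\<in>carrier_mat k k. det q \<noteq> 0 \<and> p * incl_mat (k + m) k = incl_mat (k + m) k * q"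
proof -
  have pc: "p \<in> carrier_mat (k + m) (k + m)" and dp: "det p \<noteq> 0" and z: "\<And>i j. i < m \<Longrightarrow> j < k \<Longrightarrow> p $$ (k + i, j) = 0"
    using p by (auto simp: pts_parabolic)
  define q where "q = mat k k (\<lambda>(i, j). p $$ (i, j))"
  have q: "q \<in> carrier_mat k k" by (simp add: q_def)
  have z': "p $$ (i, j) = 0" if "i < k + m" "j < k" "\<not> i < k" for i j
    using z[of "i - k" j] that by simp
  have e: "p * incl_mat (k + m) k = incl_mat (k + m) k * q"
    unfolding mult_incl_mat[OF pc le_add1] incl_mat_mult[OF q] by (rule eq_matI) (auto simp: q_def z')
  have "det q \<noteq> 0" using det_block_lower[OF pc z] dp by (auto simp: q_def)
  then show ?thesis using q e by blast
qed

text \<open>The bundle map \<open>f\<close> sends \<open>(g, (y, e))\<close> to the block triangular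
  tuple of \<open>y\<close> and \<open>e\<close>, moved by \<open>g\<close>. As \<open>g\<close> and
  the image determine \<open>y\<close> and \<open>e\<close>, the fibre over \<open>x\<close> is the
  set of all \<open>g\<close> whose first \<open>k\<close> columns span the subspace generated by
  \<open>x\<close>. Two such \<open>g\<close> differ by a parabolic factor on the right. The two
  sides are the class of the total space and the product of fibre and base.\<close>

lemma var_class_stratum:
  "var_class (GL_space (k + m) :: ('k::alg_closed_field, _) space) *
     (var_class (stable_space k r d :: ('k, _) space) * var_class (affine_space 1 :: ('k, 'k list) space) ^ (d * ((k + m) * m))) =
   var_class (parabolic k m :: ('k, _) space) * var_class (stratum_space (k + m) r d k :: ('k, _) space)"
proof -
  let ?n = "k + m"
  let ?N = "d * (?n * m)"
  let ?GL = "GL_space ?n :: ('k, _) space" and ?S = "stable_space k r d :: ('k, _) space"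
  let ?A = "affine_space ?N :: ('k, 'k list) space" and ?B = "stratum_space ?n r d k :: ('k, _) space"
  let ?P = "parabolic k m :: ('k, _) space"
  let ?J = "incl_mat ?n k :: 'k mat"
  let ?blk = "block_tuple k m r d :: 'k tuple \<Rightarrow> _"
  let ?cf = "completed_frame k m :: _ \<Rightarrow> 'k tuple \<Rightarrow> _"
  note sS = variety_swf[OF variety_stable, of k r d] and sB = variety_swf[OF variety_stratum, of ?n r d k]
    and sP = variety_swf[OF variety_parabolic, of k m]
  interpret SA: two_spaces ?S ?A using sS by (simp add: two_spaces_def affine_swf)
  interpret E: two_spaces ?GL "prod_space ?S ?A" by (simp add: two_spaces_def GL_swf SA.prod_swf)
  let ?E = "prod_space ?GL (prod_space ?S ?A)"
  have sE: "space_with_functions ?E" by (rule E.prod_swf)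
  have vE: "variety ?E" by (intro variety_prod variety_GL variety_stable variety_affine_space)
  have pE: "z \<in> pts ?E \<longleftrightarrow> fst z \<in> carrier_mat ?n ?n \<and> det (fst z) \<noteq> 0 \<and> fst (snd z) \<in> stable_tuples k r d \<and> length (snd (snd z)) = ?N" for z
    by (cases z) (auto simp: E.pts_prod SA.pts_prod pts_GL_space pts_stable pts_affine)
  have St: "y \<in> tuples k r d" if "y \<in> stable_tuples k r d" for y :: "'k tuple" using that rank_ge_subset by blast
  have Bt: "x \<in> tuples ?n r d" if "x \<in> stratum ?n r d k" for x :: "'k tuple" using that stratum_subset by blast
  have Jc: "?J \<in> carrier_mat ?n k" and Jinj: "mat_injective ?J" by (auto intro: incl_mat_injective)
  define f where "f z = act (fst z) (?blk (fst (snd z)) (snd (snd z)))" for z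
  have f_int: "intertwines r d (fst z * ?J) (fst (snd z)) (f z)" and f_stratum: "f z \<in> stratum ?n r d k"
    and f_mat: "fst z * ?J \<in> carrier_mat ?n k" and f_inj: "mat_injective (fst z * ?J)" if "z \<in> pts ?E" for z
  proof -
    obtain g y e where z: "z = (g, (y, e))" by (cases z) auto
    have g: "g \<in> carrier_mat ?n ?n" "det g \<noteq> 0" and y: "y \<in> stable_tuples k r d" using that z pE by auto
    note yt = St[OF y]
    show gJ: "fst z * ?J \<in> carrier_mat ?n k" using g by (simp add: z)
    show gi: "mat_injective (fst z * ?J)"
      using mat_injective_mult[OF g(1) Jc _ Jinj] mat_injective_square[OF g(1)] g(2) by (simp add: z)
    show i: "intertwines r d (fst z * ?J) (fst (snd z)) (f z)"
      unfolding f_def z fst_conv snd_conv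
      by (rule intertwines_compose[OF act_carrier[OF g(1) block_tuple_carrier] block_tuple_carrier yt g(1) Jc
            intertwines_act[OF g block_tuple_carrier] intertwines_block[OF yt]])
    show "f z \<in> stratum ?n r d k"
      by (rule intertwines_stratum[OF _ _ gJ gi i]) (use y g in \<open>auto simp: f_def z intro!: act_carrier block_tuple_carrier\<close>)
  qed
  have reg_g: "regular_mat ?E ?n ?n fst" by (rule regular_mat_compose[OF regular_GL_space E.morphism_fst])
  have reg_y: "regular_tuple ?E k r d (\<lambda>z. fst (snd z))"
    by (rule regular_tuple_compose[OF regular_stable morphism_compose[OF E.morphism_snd SA.morphism_fst]])
  have mor_e: "morphism ?E ?A (\<lambda>z. snd (snd z))" by (rule morphism_compose[OF E.morphism_snd SA.morphism_snd])
  have mf: "morphism ?E ?B f"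
    unfolding stratum_space_def f_def
    by (intro morphism_into_sub sE morphism_tuple_space space_with_functions.regular_act[OF sE reg_g]
        regular_block_tuple[OF sE reg_y mor_e] f_stratum[unfolded f_def]) (use pE in auto)
  define I where "I = (chart_index ?n r d k :: ((nat list \<times> nat) list \<times> 'k mat) set)"
  have "\<exists>N\<subseteq>I. finite N \<and> (\<Union>i\<in>N. chart ?n r d k i) = (\<Union>i\<in>I. chart ?n r d k i)"
    by (rule tuple_space_quasi_compact, rule open_chart) (simp add: I_def)
  then obtain N where N: "N \<subseteq> I" "finite N" "(\<Union>i\<in>N. chart ?n r d k i) = (\<Union>i\<in>I. chart ?n r d k i)" by auto
  define V where "V i = chart ?n r d k i \<inter> stratum ?n r d k" for i :: "(nat list \<times> nat) list \<times> 'k mat"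
  have idx: "\<exists>\<nu> h. i = (\<nu>, h) \<and> \<nu> \<in> word_lists r d k \<and> h \<in> carrier_mat ?n ?n \<and> det h \<noteq> 0" if "i \<in> N" for i
    using that N(1) unfolding I_def chart_index_def by auto
  have cf: "?cf i x \<in> carrier_mat ?n ?n" "det (?cf i x) \<noteq> 0" "?cf i x * ?J = word_mat ?n x (fst i)" "mat_injective (word_mat ?n x (fst i))"
    "x \<in> tuples ?n r d" "\<exists>y\<in>stable_tuples k r d. intertwines r d (word_mat ?n x (fst i)) y x"
    if "i \<in> N" "x \<in> V i" for i x
  proof -
    obtain \<nu> h where i: "i = (\<nu>, h)" by (cases i)
    have iI: "(\<nu>, h) \<in> chart_index ?n r d k" using that N(1) i I_def by blast
    have x: "x \<in> chart ?n r d k (\<nu>, h)" "x \<in> stratum ?n r d k" using that i by (auto simp: V_def)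
    show "?cf i x \<in> carrier_mat ?n ?n" "det (?cf i x) \<noteq> 0" "?cf i x * ?J = word_mat ?n x (fst i)"
      using completed_frame[OF iI x(1)] by (auto simp: i)
    show inj: "mat_injective (word_mat ?n x (fst i))" using chart_injective[OF iI x(1)] by (simp add: i)
    show "x \<in> tuples ?n r d" by (rule Bt[OF x(2)])
    show "\<exists>y\<in>stable_tuples k r d. intertwines r d (word_mat ?n x (fst i)) y x"
      by (rule stratum_reduce[OF x(2) _ inj]) (use iI in \<open>auto simp: i chart_index_def\<close>)
  qed
  have reg_cf: "regular_mat Y ?n ?n (\<lambda>y. ?cf i (t y))"
    if "space_with_functions Y" "regular_tuple Y ?n r d t" "i \<in> N" for Y :: "('k, 'z) space" and t i
  proof -
    interpret Y: space_with_functions Y by fact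
    from idx[OF that(3)] obtain \<nu> h where i: "i = (\<nu>, h)" and \<nu>: "\<nu> \<in> word_lists r d k" and h: "h \<in> carrier_mat ?n ?n" by blast
    have rZ: "regular_mat Y ?n k (\<lambda>y. h * word_mat ?n (t y) \<nu>)"
      by (intro Y.regular_mat_mult[of _ ?n] Y.regular_mat_const Y.regular_word_mat[OF that(2) \<nu>] h)
    have "regular_mat Y ?n ?n (\<lambda>y. mat ?n ?n (\<lambda>(i, j). if j < k then (h * word_mat ?n (t y) \<nu>) $$ (i, j) else if i = j then 1 else 0))"
    proof (rule Y.regular_mat_mat)
      fix a b assume "a < ?n" "b < ?n"
      then show "(\<lambda>y. if b < k then (h * word_mat ?n (t y) \<nu>) $$ (a, b) else if a = b then 1 else 0) \<in> reg Y (pts Y)"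
        using regular_matD(2)[OF rZ, of a b] Y.const by (cases "b < k") auto
    qed
    then show ?thesis unfolding i completed_frame_def prod.case
      by (intro Y.regular_mat_mult[of _ ?n] Y.regular_mat_const mat_inv(1)[OF h])
  qed
  text \<open>Moving a point of the chart by the inverse of an admissible frame makes it block triangular.\<close>
  have reduce: "act (mat_inv (?cf i x * p)) x = ?blk (top_tuple k (act (mat_inv (?cf i x * p)) x)) (side_entries k m d (act (mat_inv (?cf i x * p)) x))"
    "top_tuple k (act (mat_inv (?cf i x * p)) x) \<in> stable_tuples k r d"
    "?cf i x * p \<in> carrier_mat ?n ?n" "det (?cf i x * p) \<noteq> 0"
    if iN: "i \<in> N" and xV: "x \<in> V i" and p: "p \<in> pts ?P" for i x p
  proof -
    note c = cf[OF iN xV]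
    obtain y where y: "y \<in> stable_tuples k r d" "intertwines r d (word_mat ?n x (fst i)) y x" using c(6) by blast
    note yt = St[OF y(1)]
    obtain q where q: "q \<in> carrier_mat k k" "det q \<noteq> 0" "p * ?J = ?J * q" using parabolic_incl[OF p] by blast
    have pc: "p \<in> carrier_mat ?n ?n" "det p \<noteq> 0" using p by (auto simp: pts_parabolic)
    let ?g = "?cf i x * p"
    show g: "?g \<in> carrier_mat ?n ?n" using c(1) pc by simp
    show dg: "det ?g \<noteq> 0" using det_mult[OF c(1) pc(1)] c(2) pc(2) by simp
    note ig = mat_inv(1)[OF g] and idg = det_mat_inv[OF g dg]
    note iq = mat_inv(1)[OF q(1)] and idq = det_mat_inv[OF q(1,2)]
    let ?y = "act (mat_inv q) y"
    have yt': "?y \<in> tuples k r d" by (rule act_carrier[OF iq yt])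
    have ys: "?y \<in> stable_tuples k r d" by (rule stable_act[OF iq idq y(1)])
    have "intertwines r d q ?y y"
      using intertwines_act[OF q(1,2) yt'] act_inverse(2)[OF q(1,2) yt] by simp
    then have 1: "intertwines r d (word_mat ?n x (fst i) * q) ?y x"
      using intertwines_compose[OF c(5) yt yt' _ q(1) y(2)] c(3) c(1) by (metis Jc mult_carrier_mat)
    have gJ: "word_mat ?n x (fst i) * q = ?g * ?J"
      using assoc_mult_mat[OF c(1) Jc q(1)] assoc_mult_mat[OF c(1) pc(1) Jc] c(3) q(3) by simp
    let ?z = "act (mat_inv ?g) x"
    have zt: "?z \<in> tuples ?n r d" by (rule act_carrier[OF ig c(5)])
    have gJc: "?g * ?J \<in> carrier_mat ?n k" using g by simp
    have "intertwines r d (mat_inv ?g * (?g * ?J)) ?y ?z"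
      by (rule intertwines_compose[OF zt c(5) yt' ig gJc intertwines_act[OF ig idg c(5)] 1[unfolded gJ]])
    also have "mat_inv ?g * (?g * ?J) = ?J"
      using assoc_mult_mat[OF ig g Jc] mat_inv(3)[OF g dg] by simp
    finally have J: "intertwines r d ?J ?y ?z" .
    from intertwines_incl_block[OF zt yt' J] ys
    show "?z = ?blk (top_tuple k ?z) (side_entries k m d ?z)" "top_tuple k ?z \<in> stable_tuples k r d" by simp_all
  qed
  \<comment> \<open>Trivialisation over a chart: the group element is the completed frame times
    \<open>p\<close>, and the triangular tuple is found by moving \<open>x\<close> back with it.
    Conversely \<open>b\<close> divides a given frame by the completed one.\<close>
  define a where "a i w = (?cf i (snd w) * fst w, (top_tuple k (act (mat_inv (?cf i (snd w) * fst w)) (snd w)),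
      side_entries k m d (act (mat_inv (?cf i (snd w) * fst w)) (snd w))))" for i and w :: "'k mat \<times> 'k tuple"
  define b where "b i z = mat_inv (?cf i (f z)) * fst z" for i z
  have fa: "f (a i (p, x)) = x" "b i (a i (p, x)) = p" if "i \<in> N" "p \<in> pts ?P" "x \<in> V i" for i p x
  proof -
    note rd = reduce[OF that(1,3,2)] and c = cf[OF that(1,3)]
    have pc: "p \<in> carrier_mat ?n ?n" using that(2) by (auto simp: pts_parabolic)
    have "f (a i (p, x)) = act (?cf i x * p) (act (mat_inv (?cf i x * p)) x)"
      unfolding f_def a_def fst_conv snd_conv rd(1)[symmetric] ..
    then show f: "f (a i (p, x)) = x" using act_inverse(2)[OF rd(3,4) c(5)] by simp
    have "b i (a i (p, x)) = mat_inv (?cf i x) * (?cf i x * p)" unfolding b_def f by (simp add: a_def)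
    also have "\<dots> = mat_inv (?cf i x) * ?cf i x * p" by (rule assoc_mult_mat[OF mat_inv(1)[OF c(1)] c(1) pc, symmetric])
    also have "\<dots> = p" using mat_inv(3)[OF c(1,2)] pc by simp
    finally show "b i (a i (p, x)) = p" .
  qed
  have bP: "b i z \<in> pts ?P" "?cf i (f z) * b i z = fst z" if "i \<in> N" "z \<in> pts ?E" "f z \<in> V i" for i z
  proof -
    note c = cf[OF that(1,3)]
    from idx[OF that(1)] obtain \<nu> h where i: "i = (\<nu>, h)" and \<nu>: "\<nu> \<in> word_lists r d k" by blast
    have g: "fst z \<in> carrier_mat ?n ?n" "det (fst z) \<noteq> 0" and y: "fst (snd z) \<in> stable_tuples k r d" using that(2) pE by auto
    note ic = mat_inv(1)[OF c(1)]
    have bc: "b i z \<in> carrier_mat ?n ?n" using ic g by (simp add: b_def)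
    have db: "det (b i z) \<noteq> 0" unfolding b_def det_mult[OF ic g(1)] using det_mat_inv[OF c(1,2)] g(2) by simp
    show cb: "?cf i (f z) * b i z = fst z"
      unfolding b_def using assoc_mult_mat[OF c(1) ic g(1)] mat_inv(2)[OF c(1,2)] g(1) by simp
    \<comment> \<open>Words of \<open>f z\<close> are words of \<open>y\<close> pushed forward. So
      the first \<open>k\<close> columns of the two frames agree up to the square factor
      \<open>?w\<close>, which is injective and hence invertible; therefore \<open>b i z\<close>
      preserves the standard subspace.\<close>
    let ?w = "word_mat k (fst (snd z)) \<nu>"
    have w: "?w \<in> carrier_mat k k" by (rule word_mat_carrier[OF \<nu>])
    have e: "?cf i (f z) * ?J = fst z * ?J * ?w"
      using word_mat_intertwines[OF c(5) St[OF y] f_mat[OF that(2)] f_int[OF that(2)] \<nu>] c(3) by (simp add: i)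
    have "mat_injective ?w"
      using mat_injective_factor[OF f_mat[OF that(2)] w] c(3,4) e by (simp add: i)
    then have dw: "det ?w \<noteq> 0" using mat_injective_square[OF w] by simp
    note iw = mat_inv(1)[OF w]
    have gJ: "fst z * ?J = ?cf i (f z) * ?J * mat_inv ?w"
      unfolding e using assoc_mult_mat[OF f_mat[OF that(2)] w iw] mat_inv(2)[OF w dw] f_mat[OF that(2)] by simp
    have "b i z * ?J = mat_inv (?cf i (f z)) * (fst z * ?J)" unfolding b_def by (rule assoc_mult_mat[OF ic g(1) Jc])
    also have "\<dots> = mat_inv (?cf i (f z)) * (?cf i (f z) * (?J * mat_inv ?w))"
      unfolding gJ using assoc_mult_mat[OF c(1) Jc iw] by simp
    also have "\<dots> = mat_inv (?cf i (f z)) * ?cf i (f z) * (?J * mat_inv ?w)"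
      by (rule assoc_mult_mat[OF ic c(1) mult_carrier_mat[OF Jc iw], symmetric])
    also have "\<dots> = ?J * mat_inv ?w" using mat_inv(3)[OF c(1,2)] mult_carrier_mat[OF Jc iw] by simp
    finally have bJ: "b i z * ?J = ?J * mat_inv ?w" .
    have "b i z $$ (k + s, t) = 0" if st: "s < m" "t < k" for s t
      using arg_cong[OF bJ, of "\<lambda>A. A $$ (k + s, t)"] st unfolding mult_incl_mat[OF bc le_add1] incl_mat_mult[OF iw] by simp
    then show "b i z \<in> pts ?P" using bc db by (simp add: pts_parabolic)
  qed
  have "var_class ?E = var_class ?P * var_class ?B"
  proof (rule var_class_locally_trivial[OF vE variety_stratum variety_parabolic mf N(2), where V = V and a = a and b = b])
    show "pts ?B \<subseteq> (\<Union>i\<in>N. V i)"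
    proof
      fix x assume "x \<in> pts ?B"
      then have x: "x \<in> stratum ?n r d k" by (simp add: pts_stratum_space)
      then have "x \<in> rank_ge ?n r d k" by (simp add: stratum_def)
      then have "x \<in> (\<Union>i\<in>N. chart ?n r d k i)" unfolding N(3) I_def rank_ge_charts[OF le_add1] .
      then show "x \<in> (\<Union>i\<in>N. V i)" using x by (auto simp: V_def)
    qed
    fix i assume iN: "i \<in> N"
    show oV: "openin (zar ?B) (V i)"
      unfolding stratum_space_def open_sub V_def
      by (rule exI[of _ "chart ?n r d k i"]) (use iN N(1) open_chart[of i ?n r d k] in \<open>auto simp: I_def\<close>)
    let ?V = "sub_space ?B (V i)"
    have sV: "space_with_functions ?V" by (rule induced_swf[OF sB])
    have pV: "pts ?V = V i" unfolding pts_sub pts_stratum_space by (auto simp: V_def)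
    interpret PV: two_spaces ?P ?V using sP sV by (simp add: two_spaces_def)
    let ?W = "prod_space ?P ?V"
    have sW: "space_with_functions ?W" by (rule PV.prod_swf)
    interpret W: space_with_functions ?W by (rule sW)
    have tW: "regular_tuple ?W ?n r d snd"
      by (rule regular_tuple_compose[OF regular_stratum morphism_compose[OF PV.morphism_snd morphism_inclusion[OF sB]]])
    have gP: "regular_mat ?P ?n ?n (\<lambda>p. p)" unfolding parabolic_def
      by (rule regular_mat_compose[OF regular_GL_space morphism_inclusion[OF GL_swf]])
    have gW: "regular_mat ?W ?n ?n (\<lambda>w. ?cf i (snd w) * fst w)"
      by (intro W.regular_mat_mult[of _ ?n] reg_cf[OF sW tW iN] regular_mat_compose[OF gP PV.morphism_fst])
    have pW: "fst w \<in> pts ?P" "snd w \<in> V i" if "w \<in> pts ?W" for w using that by (auto simp: PV.pts_prod pV)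
    have dW: "det (?cf i (snd w) * fst w) \<noteq> 0" "?cf i (snd w) * fst w \<in> carrier_mat ?n ?n"
      "top_tuple k (act (mat_inv (?cf i (snd w) * fst w)) (snd w)) \<in> stable_tuples k r d" if "w \<in> pts ?W" for w
      using reduce[OF iN pW(2)[OF that] pW(1)[OF that]] by blast+
    have idW: "det (mat_inv (?cf i (snd w) * fst w)) \<noteq> 0" if "w \<in> pts ?W" for w
      by (rule det_mat_inv[OF dW(2)[OF that] dW(1)[OF that]])
    have zW: "regular_tuple ?W ?n r d (\<lambda>w. act (mat_inv (?cf i (snd w) * fst w)) (snd w))"
      by (intro W.regular_act W.regular_mat_inv gW tW dW(1) idW)
    show "morphism ?W ?E (a i)" unfolding a_def
      by (intro E.morphism_pair SA.morphism_pair sW morphism_GL_space gW dW morphism_stable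
        regular_top_tuple[OF sW zW] morphism_side_entries[OF sW zW])
    let ?U = "sub_space ?E {z\<in>pts ?E. f z \<in> V i}"
    have sU: "space_with_functions ?U" by (rule induced_swf[OF sE])
    interpret U: space_with_functions ?U by (rule sU)
    have fU: "regular_tuple ?U ?n r d f"
      using regular_tuple_compose[OF regular_stratum morphism_compose[OF morphism_inclusion[OF sE] mf]] .
    have pU: "z \<in> pts ?E \<and> f z \<in> V i" if "z \<in> pts ?U" for z using that by (auto simp: pts_sub)
    show "morphism ?U ?P (b i)"
    proof (rule morphism_parabolic[OF sU])
      show "regular_mat ?U ?n ?n (b i)" unfolding b_def
        by (intro U.regular_mat_mult[of _ ?n] U.regular_mat_inv reg_cf[OF sU fU iN] regular_mat_compose[OF reg_g morphism_inclusion[OF sE]])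
          (use pU cf(2)[OF iN] in blast)
      fix z assume "z \<in> pts ?U"
      from pU[OF this] show "b i z \<in> pts ?P" using bP(1)[OF iN] by blast
    qed
  next
    fix i z assume iN: "i \<in> N" and z: "z \<in> pts ?E" and fz: "f z \<in> V i"
    note bz = bP[OF iN z fz]
    have g: "fst z \<in> carrier_mat ?n ?n" "det (fst z) \<noteq> 0" and y: "fst (snd z) \<in> tuples k r d" and e: "length (snd (snd z)) = ?N"
      using z pE St by auto
    have "act (mat_inv (fst z)) (f z) = ?blk (fst (snd z)) (snd (snd z))"
      unfolding f_def by (rule act_inverse(1)[OF g block_tuple_carrier])
    then show "a i (b i z, f z) = z"
      unfolding a_def fst_conv snd_conv bz(2) using top_block[OF y] side_block[OF e] by simp
  qed (use fa in auto)
  then show ?thesis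
    by (simp add: var_class_prod variety_GL variety_prod variety_stable variety_affine_space var_class_affine[of ?N])
qed

text \<open>Telescoping along the open filtration by \<open>rank_ge\<close>, which starts with the
  whole affine space and is empty beyond \<open>n\<close>.\<close>

lemma var_class_tuple_strata:
  fixes n r d :: nat
  shows "var_class (affine_space 1 :: ('k::alg_closed_field, 'k list) space) ^ (d * n\<^sup>2 + r * n) =
    (\<Sum>k\<le>n. var_class (stratum_space n r d k :: ('k, _) space))"
proof -
  let ?X = "tuple_space n r d :: ('k, _) space"
  let ?R = "\<lambda>k. rank_ge n r d k :: 'k tuple set"
  have step: "var_class (sub_space ?X (?R k)) = var_class (stratum_space n r d k :: ('k, _) space) + var_class (sub_space ?X (?R (Suc k)))" for k
  proof -
    have "?R k \<inter> ?R (Suc k) = ?R (Suc k)" using rank_ge_Suc by blast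
    moreover have "var_class (sub_space ?X (?R k)) = var_class (sub_space ?X (?R k \<inter> ?R (Suc k))) + var_class (sub_space ?X (?R k - ?R (Suc k)))"
      by (intro var_class_split variety_tuple locally_closed_open open_rank_ge)
    ultimately show ?thesis by (simp add: stratum_space_def stratum_def add.commute)
  qed
  have sum: "var_class (sub_space ?X (?R 0)) = (\<Sum>k<l. var_class (stratum_space n r d k :: ('k, _) space)) + var_class (sub_space ?X (?R l))" for l
  proof (induction l)
    case (Suc l)
    then show ?case using step[of l] by (simp add: add.assoc)
  qed simp
  have "?R (Suc n) = {}" by (rule rank_ge_Suc_dim) simp
  then have z: "var_class (sub_space ?X (?R (Suc n))) = 0" using variety_empty_class[OF variety_tuple] by simp
  have "var_class (affine_space 1 :: ('k, 'k list) space) ^ (d * n\<^sup>2 + r * n) = var_class ?X"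
    unfolding var_class_affine[symmetric] by (intro var_class_iso variety_affine_space variety_tuple iso_spaces_sym[OF tuple_space_affine])
  also have "\<dots> = var_class (sub_space ?X (?R 0))"
    by (intro var_class_iso variety_tuple variety_open open_rank_ge iso_spaces_sym[OF iso_sub_id] tuple_swf)
      (simp add: rank_ge_0 pts_tuple_space)
  finally show ?thesis using sum[of "Suc n"] z by (simp add: lessThan_Suc_atMost)
qed

lemma stratum_space_top: "stratum_space n r d n = stable_space n r d"
  unfolding stratum_space_def stratum_top stable_space_alt ..

text \<open>Without endomorphisms, \<open>k\<close> vectors never generate more than
  \<open>k\<close> dimensions, so the next step of the filtration is empty.\<close>

lemma frame_tuples_stratum: "frame_tuples k n = stratum_space n k 0 k"
  unfolding frame_tuples_def stratum_space_def stratum_def rank_ge_no_endos_empty[OF lessI] by simp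

section \<open>The motivic recursion\<close>

lemma unit_cancel:
  fixes u :: "'r::comm_monoid_mult"
  assumes "u * v = 1" "u * a = u * b"
  shows "a = b"
  using assms by (metis mult.assoc mult.commute mult.left_neutral)

definition is_unit_elem :: "'r::comm_monoid_mult \<Rightarrow> bool" where
  "is_unit_elem u \<longleftrightarrow> (\<exists>v. u * v = 1)"

lemma is_unit_elem_mult: "is_unit_elem u \<Longrightarrow> is_unit_elem v \<Longrightarrow> is_unit_elem (u * v)"
  unfolding is_unit_elem_def
proof (elim exE)
  fix a b assume "u * a = 1" "v * b = 1"
  have "u * v * (a * b) = (u * a) * (v * b)" by (simp add: ac_simps)
  then show "\<exists>w. u * v * w = 1" using \<open>u * a = 1\<close> \<open>v * b = 1\<close> by auto
qed

lemma is_unit_elem_one: "is_unit_elem 1"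
  unfolding is_unit_elem_def by (rule exI[of _ 1]) simp

lemma is_unit_elem_power: "is_unit_elem u \<Longrightarrow> is_unit_elem (u ^ n)"
  by (induction n) (auto intro: is_unit_elem_mult is_unit_elem_one)

lemma is_unit_elem_cancel: "is_unit_elem u \<Longrightarrow> u * a = u * b \<Longrightarrow> a = b"
  unfolding is_unit_elem_def using unit_cancel by blast

lemma inverse_K0_St: "is_unit_elem a \<Longrightarrow> a * inverse a = (1 :: 'k::alg_closed_field K0_St)"
  unfolding is_unit_elem_def using inverse_K0_St_eq by metis

lemma is_unit_Lef: "is_unit_elem (Lef :: 'k::alg_closed_field K0_St)"
  unfolding is_unit_elem_def using Lef_unit by blast

lemma is_unit_Lef_power_minus_1: "m > 0 \<Longrightarrow> is_unit_elem (Lef ^ m - 1 :: 'k::alg_closed_field K0_St)"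
proof -
  assume m: "m > 0"
  let ?L = "var_class (affine_space 1 :: ('k, 'k list) space)"
  have "(?L ^ m - 1) * 1 \<in> lefschetz_system" by (intro lefschetz_system.L_minus_1 lefschetz_system.one m)
  then have "of_Var (?L ^ m - 1) * abs_K0_St (1, ?L ^ m - 1) = 1" by (intro lefschetz_system_unit) simp
  moreover have "of_Var (?L ^ m - 1) = Lef ^ m - 1" by (simp add: of_Var_diff of_Var_power of_Var_1 Lef_def St_class_def)
  ultimately show ?thesis unfolding is_unit_elem_def by metis
qed

section \<open>Classes of strata, general linear groups and Grassmannians\<close>

abbreviation GL_class :: "nat \<Rightarrow> 'k::alg_closed_field K0_St" where
  "GL_class n \<equiv> St_class (GL_space n :: ('k, _) space)"

abbreviation Quot_class :: "nat \<Rightarrow> nat \<Rightarrow> nat \<Rightarrow> 'k::alg_closed_field K0_St" where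
  "Quot_class n r d \<equiv> St_class (ncQuot n r d :: ('k, _) space)"

abbreviation Gr_class :: "nat \<Rightarrow> nat \<Rightarrow> 'k::alg_closed_field K0_St" where
  "Gr_class k n \<equiv> St_class (grassmannian k n :: ('k, _) space)"

abbreviation stratum_class :: "nat \<Rightarrow> nat \<Rightarrow> nat \<Rightarrow> nat \<Rightarrow> 'k::alg_closed_field K0_St" where
  "stratum_class n r d k \<equiv> St_class (stratum_space n r d k :: ('k, _) space)"

text \<open>The bundle formula as a relation between strata alone: stable tuples form the top
  stratum on \<open>k\<close>-space, and the class of the parabolic group is expanded.\<close>

lemma stratum_class_relation:
  "GL_class (k + m) * (stratum_class k r d k * Lef ^ (d * ((k + m) * m))) =
   (GL_class k * (GL_class m * Lef ^ (k * m))) * (stratum_class (k + m) r d k :: 'k::alg_closed_field K0_St)"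
  using arg_cong[OF var_class_stratum[of k m r d, where 'k = 'k, unfolded var_class_parabolic], of of_Var]
  by (simp add: of_Var_mult of_Var_power St_class_def Lef_def stratum_space_top)

lemma of_Var_sum: "of_Var (\<Sum>i\<in>A. f i) = (\<Sum>i\<in>A. of_Var (f i))"
  by (induction A rule: infinite_finite_induct) (auto simp: of_Var_0 of_Var_add)

lemma sum_stratum_class:
  "Lef ^ (d * n\<^sup>2 + r * n) = (\<Sum>k\<le>n. stratum_class n r d k :: 'k::alg_closed_field K0_St)"
  using arg_cong[OF var_class_tuple_strata[of d n r, where 'k = 'k], of of_Var]
  by (simp add: of_Var_power of_Var_sum St_class_def Lef_def)

lemma stratum_class_top: "stratum_class n r d n = GL_class n * (Quot_class n r d :: 'k::alg_closed_field K0_St)"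
  using arg_cong[OF ncQuot_facts(2)[of n r d, where 'k = 'k], of of_Var]
  by (simp add: of_Var_mult St_class_def stratum_space_top)

lemma stratum_class_frames: "stratum_class n k 0 k = GL_class k * (Gr_class k n :: 'k::alg_closed_field K0_St)"
  using arg_cong[OF grassmannian_facts(2)[of k n, where 'k = 'k], of of_Var]
  by (simp add: of_Var_mult St_class_def frame_tuples_stratum)

lemma St_class_iso: "variety X \<Longrightarrow> variety Y \<Longrightarrow> iso_spaces X Y \<Longrightarrow> St_class X = St_class Y"
  unfolding St_class_def using var_class_iso by metis

text \<open>For \<open>d = 0\<close>, stability of \<open>n\<close> vectors in
  \<open>n\<close>-space says that they are the columns of an invertible matrix.\<close>

lemma stratum_class_square: "stratum_class n n 0 n = (GL_class n :: 'k::alg_closed_field K0_St)"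
  unfolding stratum_space_top
proof (rule St_class_iso[OF variety_stable variety_GL])
  let ?X = "stable_space n n 0 :: ('k, _) space" and ?G = "GL_space n :: ('k, _) space"
  note sX = variety_swf[OF variety_stable, of n n 0]
  have Xt: "x \<in> tuples n n 0" "det (vec_mat n x) \<noteq> 0" if "x \<in> pts ?X" for x
  proof -
    show x: "x \<in> tuples n n 0" using that rank_ge_subset unfolding pts_stable by blast
    show "det (vec_mat n x) \<noteq> 0"
      using that frames_iff[OF x] mat_injective_square[OF vec_mat_carrier[OF x]] unfolding pts_stable by blast
  qed
  have tc: "([], cols A) \<in> tuples n n 0" "vec_mat n ([], cols A) = A" if "A \<in> carrier_mat n n" for A :: "'k mat"
    using that mat_of_cols_cols[of A] by (auto simp: tuples_def vec_mat_def)
  show "iso_spaces ?X ?G"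
  proof (rule iso_spacesI[of _ _ "vec_mat n" "\<lambda>A. ([], cols A)"])
    interpret X: space_with_functions ?X by (rule sX)
    interpret G: space_with_functions ?G by (rule GL_swf)
    have "regular_mat ?X n n (\<lambda>x. vec_mat n x)"
      by (rule X.regular_mat_cong[OF X.regular_word_mat[OF regular_stable vec_word_list]]) (use Xt word_mat_vec_word_list in blast)
    then show "morphism ?X ?G (vec_mat n)" using morphism_GL_space[OF sX] Xt by blast
    have "regular_tuple ?G n n 0 (\<lambda>A. ([], cols A))" unfolding regular_tuple_def
    proof (intro conjI ballI allI impI)
      fix j assume j: "j < n"
      have "regular_vec ?G n (\<lambda>A. vec n (\<lambda>i. A $$ (i, j)))"
        by (intro G.regular_vec_vec regular_matD(2)[OF regular_GL_space] j)
      then show "regular_vec ?G n (\<lambda>A. snd ([], cols A) ! j)"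
        by (rule G.regular_vec_cong) (use j in \<open>auto simp: pts_GL_space col_def\<close>)
    qed (use tc in \<open>auto simp: pts_GL_space\<close>)
    then show "morphism ?G ?X (\<lambda>A. ([], cols A))"
    proof (rule morphism_stable[OF GL_swf])
      fix A :: "'k mat" assume "A \<in> pts ?G"
      then have A: "A \<in> carrier_mat n n" "det A \<noteq> 0" by (auto simp: pts_GL_space)
      then show "([], cols A) \<in> stable_tuples n n 0"
        using frames_iff[OF tc(1)[OF A(1)]] tc(2)[OF A(1)] mat_injective_square[OF A(1)] by simp
    qed
    fix x assume x: "x \<in> pts ?X"
    note c = vec_mat_carrier[OF Xt(1)[OF x]]
    show "([], cols (vec_mat n x)) = x"
      by (rule tuple_eq_of_vec_mat[OF tc(1)[OF c] Xt(1)[OF x]]) (rule tc(2)[OF c])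
  next
    fix A :: "'k mat" assume "A \<in> pts ?G"
    then show "vec_mat n ([], cols A) = A" using tc by (auto simp: pts_GL_space)
  qed
qed

lemma St_class_point:
  fixes X :: "('k::alg_closed_field, 'p) space"
  assumes X: "variety X" and p: "pts X = {p}"
  shows "St_class X = 1"
proof -
  note sX = variety_swf[OF X]
  interpret X: space_with_functions X by (rule sX)
  interpret A: space_with_functions "affine_space 0 :: ('k, 'k list) space" by (rule affine_swf)
  have "iso_spaces X (affine_space 0 :: ('k, 'k list) space)"
  proof (rule iso_spacesI[of _ _ "\<lambda>_. []" "\<lambda>_. p"])
    show "morphism X (affine_space 0 :: ('k, 'k list) space) (\<lambda>_. [])" by (rule morphism_affine[OF sX]) auto
    show "morphism (affine_space 0 :: ('k, 'k list) space) X (\<lambda>_. p)"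
      unfolding morphism_def continuous_map_def
    proof (intro conjI allI impI)
      have o: "openin (zar (affine_space 0 :: ('k, 'k list) space)) {x \<in> pts (affine_space 0). p \<in> V}" for V
        by (cases "p \<in> V") auto
      then show "openin (zar (affine_space 0 :: ('k, 'k list) space)) {x \<in> pts (affine_space 0). p \<in> V}" for V .
      show "(\<lambda>x. h p) \<in> reg (affine_space 0 :: ('k, 'k list) space) {x \<in> pts (affine_space 0). p \<in> V}" for V and h :: "'p \<Rightarrow> 'k"
        by (rule A.const[OF o])
    qed (simp add: p)
  qed (auto simp: p pts_affine)
  from St_class_iso[OF X variety_affine_space this] show ?thesis
    by (simp add: St_class_def of_Var_1 var_class_point[where 'k = 'k])
qed

text \<open>A single vector that is not independent is zero, so this stratum is a point.\<close>

lemma stratum_class_one_vector: "stratum_class n 1 0 0 = (1 :: 'k::alg_closed_field K0_St)"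
proof (rule St_class_point[OF variety_stratum])
  let ?x = "([], [0\<^sub>v n]) :: 'k tuple"
  have t: "?x \<in> tuples n 1 0" by (simp add: tuples_def)
  have "x = ?x" if x: "x \<in> stratum n 1 0 0" for x :: "'k tuple"
  proof -
    have xt: "x \<in> tuples n 1 0" using x stratum_subset by blast
    then obtain u where u: "x = ([], [u])" "u \<in> carrier_vec n" by (cases x) (auto simp: tuples_def length_Suc_conv)
    have "\<not> mat_injective (vec_mat n x)" using x frames_iff[OF xt] by (simp add: stratum_def)
    then have "\<not> mat_injective (mat_of_cols n ([] @ [u]))" by (simp add: vec_mat_def u)
    moreover have "mat_injective (mat_of_cols n ([] :: 'k vec list))"
      by (rule mat_injectiveI[of _ n 0]) auto
    ultimately obtain c where "c \<in> carrier_vec 0" "u = mat_of_cols n [] *\<^sub>v c"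
      using not_injective_snoc[of "[]" n u] u(2) by auto
    then have "u = 0\<^sub>v n" by (auto intro!: eq_vecI simp: scalar_prod_def)
    then show ?thesis by (simp add: u)
  qed
  moreover have "?x \<in> stratum n 1 0 0"
  proof -
    have "\<not> mat_injective (vec_mat n ?x)"
    proof
      assume inj: "mat_injective (vec_mat n ?x)"
      have M: "vec_mat n ?x \<in> carrier_mat n 1" by (rule vec_mat_carrier[OF t])
      have "vec_mat n ?x *\<^sub>v unit_vec 1 0 = 0\<^sub>v n"
        using mult_mat_unit_vec[OF M, of 0] by (auto simp: vec_mat_def)
      then have "unit_vec 1 0 = (0\<^sub>v 1 :: 'k vec)" by (rule mat_injectiveD[OF inj M unit_vec_carrier])
      then have "unit_vec 1 0 $ 0 = (0\<^sub>v 1 :: 'k vec) $ 0" by simp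
      then show False by simp
    qed
    then show ?thesis using frames_iff[OF t] t by (simp add: stratum_def rank_ge_0)
  qed
  ultimately show "pts (stratum_space n 1 0 0) = {?x}" unfolding pts_stratum_space by blast
qed

lemma St_class_empty: "variety (X :: ('k::alg_closed_field, 'p) space) \<Longrightarrow> St_class (sub_space X {}) = 0"
  by (simp add: St_class_def variety_empty_class of_Var_0)

text \<open>For one vector and \<open>d = 0\<close> only two strata are nonempty: the origin and its
  complement in affine space.\<close>

lemma stratum_class_one_vector_top:
  assumes "n > 0"
  shows "stratum_class n 1 0 1 = (Lef ^ n - 1 :: 'k::alg_closed_field K0_St)"
proof -
  have z: "stratum_class n 1 0 k = (0 :: 'k K0_St)" if "k > 1" for k
  proof -
    have "stratum n 1 0 k = ({} :: 'k tuple set)" using rank_ge_no_endos_empty[OF that] by (auto simp: stratum_def)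
    then show ?thesis unfolding stratum_space_def using St_class_empty[OF variety_tuple] by simp
  qed
  have "Lef ^ n = (\<Sum>k\<le>n. stratum_class n 1 0 k :: 'k K0_St)" using sum_stratum_class[of 0 n 1] by simp
  also have "\<dots> = (\<Sum>k\<in>{0, 1}. stratum_class n 1 0 k)"
    by (rule sum.mono_neutral_right) (use assms z in auto)
  finally show ?thesis using stratum_class_one_vector[of n, where 'k = 'k] by simp
qed

lemma GL_class_0: "GL_class 0 = (1 :: 'k::alg_closed_field K0_St)"
  using sum_stratum_class[of 0 0 0, where 'k = 'k] stratum_class_square[of 0, where 'k = 'k] by simp

text \<open>The stratum relation for one vector, \<open>d = 0\<close> and \<open>k = 1\<close>. Both
  sides contain the unit \<open>L - 1\<close>, on the left as the class of nonzero scalars, on the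
  right as \<open>GL_class 1\<close>. Nothing else is cancelled, so that all
  \<open>GL_class n\<close> are units can be deduced from this.\<close>

lemma GL_class_Suc: "GL_class (Suc n) = GL_class n * Lef ^ n * (Lef ^ Suc n - 1 :: 'k::alg_closed_field K0_St)"
proof -
  have 1: "stratum_class 1 1 0 1 = (Lef - 1 :: 'k K0_St)" using stratum_class_one_vector_top[of 1, where 'k = 'k] by simp
  have u: "is_unit_elem (Lef - 1 :: 'k K0_St)" using is_unit_Lef_power_minus_1[of 1, where 'k = 'k] by simp
  have "GL_class (1 + n) * stratum_class 1 1 0 1 = GL_class 1 * (GL_class n * Lef ^ n) * (stratum_class (1 + n) 1 0 1 :: 'k K0_St)"
    using stratum_class_relation[of 1 n 1 0, where 'k = 'k] by simp
  then have "GL_class (Suc n) * (Lef - 1) = (Lef - 1) * (GL_class n * Lef ^ n) * (Lef ^ Suc n - 1 :: 'k K0_St)"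
    using stratum_class_one_vector_top[of "Suc n", where 'k = 'k] stratum_class_square[of 1, where 'k = 'k] 1 by simp
  then have "(Lef - 1) * GL_class (Suc n) = (Lef - 1) * (GL_class n * Lef ^ n * (Lef ^ Suc n - 1 :: 'k K0_St))"
    by (simp only: ac_simps)
  then show ?thesis by (rule is_unit_elem_cancel[OF u])
qed

lemma is_unit_GL_class: "is_unit_elem (GL_class n :: 'k::alg_closed_field K0_St)"
proof (induction n)
  case 0
  show ?case by (simp add: GL_class_0 is_unit_elem_one)
next
  case (Suc n)
  then show ?case unfolding GL_class_Suc
    by (intro is_unit_elem_mult is_unit_elem_power is_unit_Lef is_unit_Lef_power_minus_1) auto
qed

text \<open>The stratum relation for \<open>k\<close> vectors and \<open>d = 0\<close>: the top
  stratum on \<open>k\<close>-space is the general linear group, and the one on the larger space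
  consists of frames.\<close>

lemma GL_class_grassmannian:
  "GL_class (k + m) = GL_class m * Lef ^ (k * m) * (GL_class k * (Gr_class k (k + m) :: 'k::alg_closed_field K0_St))"
proof -
  have "GL_class k * GL_class (k + m) = GL_class k * (GL_class m * Lef ^ (k * m) * (GL_class k * (Gr_class k (k + m) :: 'k K0_St)))"
    using stratum_class_relation[of k m k 0, where 'k = 'k] unfolding stratum_class_square stratum_class_frames
    by (simp add: ac_simps)
  then show ?thesis by (rule is_unit_elem_cancel[OF is_unit_GL_class])
qed

text \<open>Inserting the class of the larger general linear group makes the common unit
  \<open>?u\<close> cancel. The remaining exponent counts the entries in the last \<open>m\<close>
  columns of \<open>d\<close> matrices.\<close>

lemma stratum_class_eq:
  "stratum_class (k + m) r d k = Quot_class k r d * GL_class k * Gr_class k (k + m) * (Lef ^ (d * ((k + m) * m)) :: 'k::alg_closed_field K0_St)"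
proof -
  let ?u = "GL_class k * (GL_class m * Lef ^ (k * m)) :: 'k K0_St"
  have u: "is_unit_elem ?u" by (intro is_unit_elem_mult is_unit_GL_class is_unit_elem_power is_unit_Lef)
  have "?u * stratum_class (k + m) r d k = GL_class (k + m) * (GL_class k * Quot_class k r d * Lef ^ (d * ((k + m) * m)))"
    using stratum_class_relation[of k m r d, where 'k = 'k] unfolding stratum_class_top[of k] by simp
  also have "\<dots> = ?u * (Quot_class k r d * GL_class k * Gr_class k (k + m) * Lef ^ (d * ((k + m) * m)))"
    unfolding GL_class_grassmannian[of k m] by (simp only: ac_simps)
  finally show ?thesis by (rule is_unit_elem_cancel[OF u])
qed

lemma quot_recursion:
  "Lef ^ (d * n\<^sup>2 + r * n) =
    (\<Sum>k\<le>n. Quot_class k r d * GL_class k * Gr_class k n * (Lef ^ (d * (n * (n - k))) :: 'k::alg_closed_field K0_St))"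
  unfolding sum_stratum_class
proof (rule sum.cong[OF refl])
  fix k assume "k \<in> {..n}"
  then show "stratum_class n r d k = Quot_class k r d * GL_class k * Gr_class k n * (Lef ^ (d * (n * (n - k))) :: 'k K0_St)"
    using stratum_class_eq[of k "n - k" r d, where 'k = 'k] by simp
qed

lemma Lef_powi_neg: "Lef ^ a * Lef powi (- int a) = (1 :: 'k::alg_closed_field K0_St)"
proof (cases "a = 0")
  case False
  have "Lef ^ a * inverse Lef ^ a = (1 :: 'k K0_St)"
    using Lef_unit[where 'k = 'k] by (simp flip: power_mult_distrib)
  then show ?thesis using False by (simp add: power_int_def)
qed simp

lemma Gr_class_self: "Gr_class n n = (1 :: 'k::alg_closed_field K0_St)"
proof -
  have "GL_class n * Gr_class n n = GL_class n * (1 :: 'k K0_St)"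
    using GL_class_grassmannian[of n 0, where 'k = 'k] by (simp add: GL_class_0)
  then show ?thesis by (rule is_unit_elem_cancel[OF is_unit_GL_class])
qed

lemma Quot_class_formula:
  "(Quot_class n r d :: 'k::alg_closed_field K0_St) = Lef ^ (d * n^2) / GL_class n *
    (Lef ^ (r * n) - (\<Sum>k<n. Quot_class k r d * GL_class k * Gr_class k n * Lef powi (- int (d * n * k))))"
proof -
  let ?S = "\<Sum>k<n. Quot_class k r d * GL_class k * Gr_class k n * Lef powi (- int (d * n * k)) :: 'k K0_St"
  have "(\<Sum>k<n. Quot_class k r d * GL_class k * Gr_class k n * Lef ^ (d * (n * (n - k)))) = Lef ^ (d * n^2) * ?S"
    unfolding sum_distrib_left
  proof (rule sum.cong[OF refl])
    fix k assume "k \<in> {..<n}"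
    \<comment> \<open>The exponent \<open>d n (n - k)\<close> of the stratum is
      \<open>d n^2 - d n k\<close>, which allows \<open>L^(d n^2)\<close> to be taken out of the
      sum.\<close>
    then have "n * n = n * (n - k) + n * k" by (simp flip: distrib_left)
    then have "d * n\<^sup>2 = d * (n * (n - k)) + d * n * k" by (simp add: power2_eq_square distrib_left flip: mult.assoc)
    then have eq: "Lef ^ (d * (n * (n - k))) = (Lef ^ (d * n\<^sup>2) * Lef powi (- int (d * n * k)) :: 'k K0_St)"
      using Lef_powi_neg[of "d * n * k", where 'k = 'k] by (simp add: power_add mult.assoc del: of_nat_mult)
    show "Quot_class k r d * GL_class k * Gr_class k n * Lef ^ (d * (n * (n - k))) =
      Lef ^ (d * n\<^sup>2) * (Quot_class k r d * GL_class k * Gr_class k n * Lef powi (- int (d * n * k)) :: 'k K0_St)"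
      unfolding eq by (rule mult.left_commute)
  qed
  \<comment> \<open>The summand for \<open>k = n\<close> is the class sought times
    \<open>GL_class n\<close>, because \<open>Gr_class n n = 1\<close>.\<close>
  then have "Lef ^ (d * n\<^sup>2 + r * n) = Lef ^ (d * n^2) * ?S + Quot_class n r d * GL_class n"
    using quot_recursion[of d n r, where 'k = 'k] by (simp add: Gr_class_self flip: lessThan_Suc_atMost)
  then have "Quot_class n r d * GL_class n = Lef ^ (d * n^2) * (Lef ^ (r * n) - ?S)"
    by (simp add: power_add right_diff_distrib eq_diff_eq ac_simps)
  then have "Quot_class n r d * GL_class n * inverse (GL_class n) = Lef ^ (d * n^2) * (Lef ^ (r * n) - ?S) * inverse (GL_class n)" by simp
  then have "(Quot_class n r d :: 'k K0_St) = Lef ^ (d * n^2) * (Lef ^ (r * n) - ?S) * inverse (GL_class n)"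
    using inverse_K0_St[OF is_unit_GL_class[of n, where 'k = 'k]] by (simp add: mult.assoc)
  then show ?thesis by (simp add: divide_K0_St_def ac_simps)
qed

section \<open>The functional equations\<close>

lemma of_St_add: "of_St (a + b) = of_St a + of_St b"
  by (simp add: of_St_def plus_K0_St_sqrt.abs_eq)

lemma of_St_0: "of_St 0 = 0"
  by (simp add: of_St_def zero_K0_St_sqrt.abs_eq)

lemma of_St_uminus: "of_St (- a) = - of_St a"
  by (simp add: of_St_def uminus_K0_St_sqrt.abs_eq)

lemma of_St_diff: "of_St (a - b) = of_St a - of_St b"
  using of_St_add[of a "- b"] by (simp add: of_St_uminus)

lemma of_St_power: "of_St (a ^ n) = of_St a ^ n"
  by (induction n) (simp_all add: of_St_1 of_St_mult)

lemma of_St_sum: "of_St (\<Sum>i\<in>A. f i) = (\<Sum>i\<in>A. of_St (f i))"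
  by (induction A rule: infinite_finite_induct) (simp_all add: of_St_0 of_St_add)

lemma inverse_K0_St_sqrt: "is_unit_elem a \<Longrightarrow> a * inverse a = (1 :: 'k::alg_closed_field K0_St_sqrt)"
  unfolding is_unit_elem_def using inverse_K0_St_sqrt_eq by metis

lemma is_unit_of_St: "is_unit_elem a \<Longrightarrow> is_unit_elem (of_St a)"
  unfolding is_unit_elem_def using of_St_mult of_St_1 by metis

section \<open>Half-integral powers of the Lefschetz motive\<close>

abbreviation upow :: "int \<Rightarrow> 'k::alg_closed_field K0_St_sqrt" where
  "upow e \<equiv> Lef_sqrt powi e"

lemma upow_nat: "upow (int m) = (Lef_sqrt ^ m :: 'k::alg_closed_field K0_St_sqrt)"
  by (simp add: power_int_def)

lemma upow_neg: "upow (- int m) = (inverse Lef_sqrt ^ m :: 'k::alg_closed_field K0_St_sqrt)"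
  by (cases "m = 0") (simp_all add: power_int_def)

lemma upow_add_1: "upow (e + 1) = upow e * (Lef_sqrt :: 'k::alg_closed_field K0_St_sqrt)"
proof (cases "e \<ge> 0")
  case True
  then have "nat (e + 1) = Suc (nat e)" by simp
  then show ?thesis using True by (simp add: power_int_def mult.commute)
next
  case False
  then obtain m where m: "e = - int (Suc m)" by (cases e rule: int_cases) auto
  have "upow e * Lef_sqrt = inverse Lef_sqrt ^ m * (Lef_sqrt * inverse (Lef_sqrt :: 'k K0_St_sqrt))"
    unfolding m upow_neg by (simp add: ac_simps)
  moreover have "e + 1 = - int m" by (simp add: m)
  ultimately show ?thesis by (simp add: upow_neg Lef_sqrt_unit)
qed

lemma upow_add_nat: "upow (e + int m) = upow e * (upow (int m) :: 'k::alg_closed_field K0_St_sqrt)"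
proof (induction m)
  case (Suc m)
  have "upow (e + int (Suc m)) = (upow (e + int m + 1) :: 'k K0_St_sqrt)" by (simp add: ac_simps)
  also have "\<dots> = upow e * upow (int m + 1)" unfolding upow_add_1 Suc by (rule mult.assoc)
  finally show ?case by (simp add: ac_simps)
qed simp

text \<open>The exponent law for integers rests on the invertibility of \<open>Lef_sqrt\<close>.
  With it, comparing powers of \<open>L\<close> becomes arithmetic with integers that count half
  powers.\<close>

lemma upow_add: "upow (e + f) = upow e * (upow f :: 'k::alg_closed_field K0_St_sqrt)"
proof (cases f rule: int_cases2)
  case (nonneg m)
  then show ?thesis by (simp only: upow_add_nat)
next
  case (nonpos m)
  have "upow (int m) * upow (- int m) = (1 :: 'k K0_St_sqrt)"
    using upow_add_nat[of "- int m" m, where 'k = 'k] by (simp add: mult.commute)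
  moreover have "upow e = upow (e + f) * (upow (int m) :: 'k K0_St_sqrt)"
    using upow_add_nat[of "e + f" m, where 'k = 'k] nonpos by simp
  ultimately show ?thesis using nonpos by (simp add: mult.assoc)
qed

lemma upow_Lef: "of_St Lef ^ m = (upow (2 * int m) :: 'k::alg_closed_field K0_St_sqrt)"
proof -
  have "upow (2 * int m) = (Lef_sqrt ^ (2 * m) :: 'k K0_St_sqrt)" by (simp add: power_int_def nat_mult_distrib)
  then show ?thesis by (simp add: power_mult power2_eq_square Lef_sqrt_square)
qed

section \<open>Cancellation and dilation of power series\<close>

lemma fps_cancel:
  fixes C A B :: "'r::{comm_ring, comm_monoid_mult} fps"
  assumes C: "fps_nth C 0 = 1" and eq: "C * A = C * B"
  shows "A = B"
proof -
  have "fps_nth A n = fps_nth B n" for n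
  proof (induction n rule: less_induct)
    case (less n)
    have s: "fps_nth (C * F) n = fps_nth F n + (\<Sum>i=1..n. fps_nth C i * fps_nth F (n - i))" for F :: "'r fps"
      using sum.atLeast_Suc_atMost[of 0 n "\<lambda>i. fps_nth C i * fps_nth F (n - i)"] by (simp add: fps_mult_nth C)
    have "(\<Sum>i=1..n. fps_nth C i * fps_nth A (n - i)) = (\<Sum>i=1..n. fps_nth C i * fps_nth B (n - i))"
      by (rule sum.cong) (use less in auto)
    then show ?case using s[of A] s[of B] eq by simp
  qed
  then show ?thesis by (rule fps_ext)
qed

lemma fps_dilate_nth: "fps_nth (fps_dilate c F) n = c ^ n * fps_nth F n"
  by (simp add: fps_dilate_def)

lemma fps_dilate_mult: "fps_dilate c (A * B) = fps_dilate c A * fps_dilate c B"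
proof (rule fps_ext)
  fix n
  have "c ^ n * (fps_nth A i * fps_nth B (n - i)) = c ^ i * fps_nth A i * (c ^ (n - i) * fps_nth B (n - i))" if "i \<in> {0..n}" for i
  proof -
    have "c ^ n = c ^ i * c ^ (n - i)" using that by (simp flip: power_add)
    then show ?thesis by (simp only: ac_simps)
  qed
  then show "fps_nth (fps_dilate c (A * B)) n = fps_nth (fps_dilate c A * fps_dilate c B) n"
    by (simp add: fps_mult_nth fps_dilate_nth sum_distrib_left)
qed

lemma fps_dilate_dilate: "fps_dilate a (fps_dilate b F) = fps_dilate (a * b) F"
  by (rule fps_ext) (simp add: fps_dilate_nth power_mult_distrib mult.assoc)

text \<open>Iterating \<open>C(q t) = C(t) Z(t)\<close>: every further dilation contributes one more
  factor.\<close>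

lemma fps_dilate_prod:
  assumes "fps_dilate q C = C * Z"
  shows "fps_dilate (q ^ m) C = C * (\<Prod>i<m. fps_dilate (q ^ i) Z)"
proof (induction m)
  case 0
  show ?case by (rule fps_ext) (simp add: fps_dilate_nth)
next
  case (Suc m)
  have "fps_dilate (q ^ Suc m) C = fps_dilate (q ^ m) (fps_dilate q C)"
    by (simp add: fps_dilate_dilate mult.commute)
  also have "\<dots> = C * (\<Prod>i<m. fps_dilate (q ^ i) Z) * fps_dilate (q ^ m) Z"
    unfolding assms fps_dilate_mult Suc ..
  finally show ?case by (simp add: mult.assoc)
qed

section \<open>The auxiliary series and the functional equations\<close>

definition inv_GL :: "nat \<Rightarrow> 'k::alg_closed_field K0_St_sqrt" where
  "inv_GL n = inverse (of_St (GL_class n))"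

lemma inv_GL: "of_St (GL_class n) * inv_GL n = (1 :: 'k::alg_closed_field K0_St_sqrt)"
  unfolding inv_GL_def by (rule inverse_K0_St_sqrt[OF is_unit_of_St[OF is_unit_GL_class]])

lemma inv_GL_Suc: "inv_GL (Suc n) * (upow (2 * int n) * (of_St Lef ^ Suc n - 1)) = (inv_GL n :: 'k::alg_closed_field K0_St_sqrt)"
proof -
  let ?u = "upow (2 * int n) * (of_St Lef ^ Suc n - 1) :: 'k K0_St_sqrt"
  have "of_St (GL_class (Suc n)) = of_St (GL_class n) * ?u"
    unfolding GL_class_Suc of_St_mult of_St_diff of_St_power of_St_1 upow_Lef by (simp only: mult.assoc)
  then have "inv_GL (Suc n) * ?u = (of_St (GL_class n) * inv_GL n) * (inv_GL (Suc n) * ?u)"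
    by (simp add: inv_GL)
  also have "\<dots> = (of_St (GL_class n) * ?u * inv_GL (Suc n)) * inv_GL n" by (simp only: ac_simps)
  also have "\<dots> = inv_GL n" unfolding \<open>_ = of_St (GL_class n) * ?u\<close>[symmetric] inv_GL by simp
  finally show ?thesis .
qed

text \<open>The factor \<open>[GL k] [G(k, k + m)]\<close> of the recursion turns the inverse of
  \<open>[GL (k + m)]\<close> into that of \<open>[GL m]\<close>, up to a power of \<open>L\<close>.
  This is what makes the recursion a Cauchy product.\<close>

lemma inv_GL_grassmannian:
  "inv_GL (k + m) * (of_St (GL_class k) * of_St (Gr_class k (k + m))) =
    (inv_GL m * upow (- 2 * int (k * m)) :: 'k::alg_closed_field K0_St_sqrt)"
proof -
  let ?g = "of_St (GL_class k) * of_St (Gr_class k (k + m)) :: 'k K0_St_sqrt"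
  have x: "of_St (GL_class (k + m)) = of_St (GL_class m) * upow (2 * int (k * m)) * ?g"
    using arg_cong[OF GL_class_grassmannian[of k m, where 'k = 'k], of of_St]
    unfolding of_St_mult of_St_power upow_Lef .
  have p: "upow (2 * int (k * m)) * upow (- 2 * int (k * m)) = (1 :: 'k K0_St_sqrt)"
    unfolding upow_add[symmetric] by simp
  have "inv_GL (k + m) * ?g = inv_GL (k + m) * ?g * (of_St (GL_class m) * inv_GL m) * (upow (2 * int (k * m)) * upow (- 2 * int (k * m)))"
    unfolding p inv_GL by simp
  also have "\<dots> = (of_St (GL_class (k + m)) * inv_GL (k + m)) * (inv_GL m * upow (- 2 * int (k * m)))"
    unfolding x by (simp only: ac_simps)
  finally show ?thesis by (simp only: inv_GL mult.left_neutral)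
qed

text \<open>Up to the substitution of \<open>L^(-1/2) t\<close> for \<open>t\<close>, this is the
  generating series of the stacks of \<open>n\<close>-dimensional representations of the free
  algebra: the class \<open>L^(d n^2) / [GL n]\<close> is normalised by \<open>L^(-D/2)\<close> with
  \<open>D = (d - 1) n^2\<close>. The exponent of \<open>upow\<close> counts half powers.\<close>

definition C_series :: "nat \<Rightarrow> 'k::alg_closed_field K0_St_sqrt fps" where
  "C_series d = Abs_fps (\<lambda>n. upow (int d * int n ^ 2 + int n ^ 2 - int n) * inv_GL n)"

lemma C_series_0: "fps_nth (C_series d) 0 = 1"
  using inv_GL[of 0] by (simp add: C_series_def GL_class_0 of_St_1)

text \<open>From \<open>n\<close> to \<open>n + 1\<close> the exponent grows by
  \<open>d + 2 d n + 2 n\<close> half powers, while \<open>[GL]\<close> grows by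
  \<open>L^n (L^(n + 1) - 1)\<close>. The part \<open>2 n\<close> absorbs \<open>L^n\<close>, and
  \<open>d + 2 d n\<close> is the factor on the right.\<close>

lemma C_series_Suc:
  "of_St Lef ^ Suc n * fps_nth (C_series d) (Suc n) =
   fps_nth (C_series d) (Suc n) + Lef_sqrt ^ d * ((of_St Lef ^ d) ^ n * fps_nth (C_series d) n :: 'k::alg_closed_field K0_St_sqrt)"
proof -
  let ?e = "int d * int (Suc n) ^ 2 + int (Suc n) ^ 2 - int (Suc n)"
  let ?a = "of_St Lef ^ Suc n - 1 :: 'k K0_St_sqrt"
  have e: "?e = int d + 2 * int (d * n) + (int d * int n ^ 2 + int n ^ 2 - int n) + 2 * int n"
    by (simp add: power2_eq_square algebra_simps)
  have p: "(of_St Lef ^ d) ^ n = (upow (2 * int (d * n)) :: 'k K0_St_sqrt)"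
    unfolding power_mult[symmetric] by (rule upow_Lef)
  have "?a * fps_nth (C_series d) (Suc n) = upow ?e * inv_GL (Suc n) * ?a"
    unfolding C_series_def fps_nth_Abs_fps by (simp only: ac_simps)
  also have "\<dots> = Lef_sqrt ^ d * ((of_St Lef ^ d) ^ n * (upow (int d * int n ^ 2 + int n ^ 2 - int n) * (inv_GL (Suc n) * (upow (2 * int n) * ?a))))"
    unfolding e upow_add upow_nat[symmetric] p by (simp only: ac_simps)
  also have "\<dots> = Lef_sqrt ^ d * ((of_St Lef ^ d) ^ n * fps_nth (C_series d) n)"
    unfolding inv_GL_Suc C_series_def fps_nth_Abs_fps ..
  finally show ?thesis by (simp add: left_diff_distrib diff_eq_eq add.commute)
qed

lemma C_series_dilate:
  "fps_dilate (of_St Lef) (C_series d) = C_series d + fps_const (Lef_sqrt ^ d) * fps_X * fps_dilate (of_St Lef ^ d) (C_series d :: 'k::alg_closed_field K0_St_sqrt fps)"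
proof (rule fps_ext)
  fix n
  show "fps_nth (fps_dilate (of_St Lef) (C_series d)) n =
    fps_nth (C_series d + fps_const (Lef_sqrt ^ d) * fps_X * fps_dilate (of_St Lef ^ d) (C_series d :: 'k K0_St_sqrt fps)) n"
  proof (cases n)
    case (Suc m)
    then show ?thesis using C_series_Suc[of m d, where 'k = 'k] by (simp add: fps_dilate_nth mult.assoc fps_X_mult_nth)
  qed (simp add: fps_dilate_nth mult.assoc fps_X_mult_nth)
qed

text \<open>The scaling of \<open>t\<close> by \<open>L^((r - 1) / 2)\<close> is made to remove
  \<open>r\<close> from the exponent: \<open>-N + (r - 1) k = k^2 - d k^2 - k\<close> in half
  powers. The hypothesis \<open>r > 0\<close> makes the natural difference \<open>r - 1\<close> the
  true one.\<close>

lemma Z_series_nth: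
  assumes "r > 0"
  shows "fps_nth (Z_series r d) k = upow (int k ^ 2 - int d * int k ^ 2 - int k) * of_St (Quot_class k r d)"
proof -
  have "(Lef_sqrt ^ (r - 1)) ^ k = (upow (int ((r - 1) * k)) :: complex K0_St_sqrt)"
    unfolding upow_nat by (rule power_mult[symmetric])
  moreover have "int k ^ 2 - int d * int k ^ 2 - int k = - ncQuot_dim k r d + int ((r - 1) * k)"
    using assms by (simp add: ncQuot_dim_def of_nat_diff algebra_simps)
  ultimately show ?thesis by (simp only: Z_series_def fps_nth_Abs_fps upow_add ac_simps)
qed

lemma quot_recursion_inv:
  "inv_GL n * upow (2 * int (d * n\<^sup>2 + r * n)) =
   (\<Sum>k\<le>n. of_St (Quot_class k r d) * (inv_GL (n - k) * upow (2 * int (d * (n * (n - k))) - 2 * int (k * (n - k))))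
     :: 'k::alg_closed_field K0_St_sqrt)"
proof -
  have "inv_GL n * upow (2 * int (d * n\<^sup>2 + r * n)) = (\<Sum>k\<le>n. inv_GL n *
     (of_St (Quot_class k r d) * of_St (GL_class k) * of_St (Gr_class k n) * upow (2 * int (d * (n * (n - k))))) :: 'k K0_St_sqrt)"
    using arg_cong[OF quot_recursion[of d n r, where 'k = 'k], of of_St]
    unfolding of_St_sum of_St_mult of_St_power upow_Lef by (simp only: sum_distrib_left)
  also have "\<dots> = (\<Sum>k\<le>n. of_St (Quot_class k r d) * (inv_GL (n - k) * upow (2 * int (d * (n * (n - k))) - 2 * int (k * (n - k)))))"
  proof (rule sum.cong[OF refl])
    fix k assume "k \<in> {..n}"
    then have g: "inv_GL n * (of_St (GL_class k) * of_St (Gr_class k n)) = (inv_GL (n - k) * upow (- 2 * int (k * (n - k))) :: 'k K0_St_sqrt)"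
      using inv_GL_grassmannian[of k "n - k", where 'k = 'k] by simp
    have u: "upow (2 * int (d * (n * (n - k))) - 2 * int (k * (n - k))) =
        (upow (2 * int (d * (n * (n - k)))) * upow (- 2 * int (k * (n - k))) :: 'k K0_St_sqrt)"
      unfolding upow_add[symmetric] by simp
    have "inv_GL n * (of_St (Quot_class k r d) * of_St (GL_class k) * of_St (Gr_class k n) * upow (2 * int (d * (n * (n - k))))) =
      of_St (Quot_class k r d) * (inv_GL n * (of_St (GL_class k) * of_St (Gr_class k n)) * (upow (2 * int (d * (n * (n - k)))) :: 'k K0_St_sqrt))"
      by (simp only: ac_simps)
    then show "inv_GL n * (of_St (Quot_class k r d) * of_St (GL_class k) * of_St (Gr_class k n) * upow (2 * int (d * (n * (n - k))))) =
      of_St (Quot_class k r d) * (inv_GL (n - k) * (upow (2 * int (d * (n * (n - k))) - 2 * int (k * (n - k))) :: 'k K0_St_sqrt))"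
      unfolding g u by (simp only: ac_simps)
  qed
  finally show ?thesis .
qed

text \<open>Divided by \<open>[GL n]\<close>, the recursion is a convolution over \<open>k\<close>
  and \<open>n - k\<close> up to powers of \<open>L\<close>, and the exponents of \<open>Z\<close>
  and \<open>C\<close> are such that these powers split. On the left \<open>r\<close> enters only
  through \<open>L^(r n)\<close>, which is the substitution of \<open>L^r t\<close>.\<close>

lemma C_series_Z_series:
  assumes "r > 0"
  shows "fps_dilate (of_St Lef ^ r) (C_series d) = C_series d * Z_series r d"
proof (rule fps_ext)
  fix n
  let ?f = "int n ^ 2 - int d * int n ^ 2 - int n"
  let ?e = "int d * int n ^ 2 + int n ^ 2 - int n"
  have "2 * int (r * n) + ?e = ?f + 2 * int (d * n\<^sup>2 + r * n)" by (simp add: algebra_simps)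
  then have u: "upow (2 * int (r * n)) * upow ?e = (upow ?f * upow (2 * int (d * n\<^sup>2 + r * n)) :: complex K0_St_sqrt)"
    by (simp only: upow_add[symmetric])
  have "fps_nth (fps_dilate (of_St Lef ^ r) (C_series d)) n = upow (2 * int (r * n)) * (upow ?e * inv_GL n :: complex K0_St_sqrt)"
    unfolding fps_dilate_nth C_series_def fps_nth_Abs_fps upow_Lef[symmetric] power_mult ..
  also have "\<dots> = upow ?f * (inv_GL n * upow (2 * int (d * n\<^sup>2 + r * n)))"
    unfolding mult.assoc[symmetric] u by (simp only: ac_simps)
  also have "\<dots> = (\<Sum>k\<le>n. upow ?f * (of_St (Quot_class k r d) * (inv_GL (n - k) * upow (2 * int (d * (n * (n - k))) - 2 * int (k * (n - k))))))"
    unfolding quot_recursion_inv sum_distrib_left ..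
  also have "\<dots> = (\<Sum>k\<le>n. fps_nth (Z_series r d) k * fps_nth (C_series d) (n - k))"
  proof (rule sum.cong[OF refl])
    fix k assume "k \<in> {..n}"
    then obtain m where m: "n = k + m" using le_Suc_ex by auto
    let ?h = "2 * int (d * (n * (n - k))) - 2 * int (k * (n - k))"
    let ?a = "int k ^ 2 - int d * int k ^ 2 - int k" and ?b = "int d * int m ^ 2 + int m ^ 2 - int m"
    \<comment> \<open>The mixed terms in \<open>k\<close> and \<open>m\<close> cancel, which leaves
      one exponent for \<open>Z\<close> and one for \<open>C\<close>.\<close>
    have "?f + ?h = ?a + ?b" by (simp add: m power2_eq_square algebra_simps)
    then have u: "upow ?f * upow ?h = (upow ?a * upow ?b :: complex K0_St_sqrt)" by (simp only: upow_add[symmetric])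
    have "upow ?f * (of_St (Quot_class k r d) * (inv_GL (n - k) * upow ?h)) =
      upow ?f * upow ?h * (of_St (Quot_class k r d) * (inv_GL (n - k) :: complex K0_St_sqrt))" by (simp only: ac_simps)
    also have "\<dots> = fps_nth (Z_series r d) k * fps_nth (C_series d) (n - k)"
      unfolding u Z_series_nth[OF assms] C_series_def fps_nth_Abs_fps by (simp add: m ac_simps)
    finally show "upow ?f * (of_St (Quot_class k r d) * (inv_GL (n - k) * upow ?h)) = fps_nth (Z_series r d) k * fps_nth (C_series d) (n - k)" .
  qed
  also have "\<dots> = fps_nth (C_series d * Z_series r d) n"
    unfolding mult.commute[of "C_series d"] fps_mult_nth by (simp add: atMost_atLeast0)
  finally show "fps_nth (fps_dilate (of_St Lef ^ r) (C_series d)) n = fps_nth (C_series d * Z_series r d) n" .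
qed

text \<open>Both sides times \<open>C\<close> equal \<open>C(L^r t)\<close>: the left one directly,
  the right one by iterating the case \<open>r = 1\<close>. The constant term of \<open>C\<close> is
  \<open>1\<close>, so \<open>C\<close> can be cancelled.\<close>

lemma Z_series_prod:
  assumes "r > 0"
  shows "Z_series r d = (\<Prod>i<r. fps_dilate (of_St Lef ^ i) (Z_series 1 d))"
proof (rule fps_cancel[OF C_series_0[of d]])
  have "fps_dilate (of_St Lef) (C_series d) = C_series d * Z_series 1 d"
    using C_series_Z_series[of 1 d] by simp
  from fps_dilate_prod[OF this, of r]
  show "C_series d * Z_series r d = C_series d * (\<Prod>i<r. fps_dilate (of_St Lef ^ i) (Z_series 1 d))"
    unfolding C_series_Z_series[OF assms] .
qed

text \<open>By the product formula with \<open>r = d\<close>, the product on the right is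
  \<open>Z_series d d\<close>, and \<open>C\<close> times it is \<open>C(L^d t)\<close>. After
  multiplication by \<open>C\<close> the claim is \<open>C_series_dilate\<close>; taking
  \<open>r = d\<close> is where \<open>d > 0\<close> enters.\<close>

lemma Z_series_1:
  assumes "d > 0"
  shows "Z_series 1 d = 1 + fps_const (Lef_sqrt ^ d) * fps_X * (\<Prod>i<d. fps_dilate (of_St Lef ^ i) (Z_series 1 d))"
  unfolding Z_series_prod[OF assms, symmetric]
proof (rule fps_cancel[OF C_series_0[of d]])
  have "C_series d * Z_series 1 d = C_series d + fps_const (Lef_sqrt ^ d) * fps_X * (C_series d * Z_series d d)"
    using C_series_dilate[of d, where 'k = complex] C_series_Z_series[of 1 d] C_series_Z_series[OF assms, of d] by simp
  then show "C_series d * Z_series 1 d = C_series d * (1 + fps_const (Lef_sqrt ^ d) * fps_X * Z_series d d)"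
    unfolding distrib_left mult.left_commute[of "C_series d"] mult.right_neutral .
qed

theorem theorem1p1:
  fixes r d n :: nat
  assumes "r > 0" and "d > 0"
  shows "St_class (ncQuot n r d :: ('k::alg_closed_field, _) space) =
        Lef ^ (d * n^2) / St_class (GL_space n :: ('k, _) space) *
        (Lef ^ (r * n) -
          (\<Sum>k<n. St_class (ncQuot k r d :: ('k, _) space) * St_class (GL_space k :: ('k, _) space) *
                 St_class (grassmannian k n :: ('k, _) space) * Lef powi (- int (d * n * k))))
    \<and> Z_series 1 d = 1 + fps_const (Lef_sqrt ^ d) * fps_X * (\<Prod>i<d. fps_dilate (of_St Lef ^ i) (Z_series 1 d))
    \<and> Z_series r d = (\<Prod>i<r. fps_dilate (of_St Lef ^ i) (Z_series 1 d))"
  using Quot_class_formula Z_series_1[OF assms(2)] Z_series_prod[OF assms(1)] by blast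

end
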